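(* Let $\hat\ell\ge 0$ and $\bar k\ge 1$ be integers, and let $\underline t$ be flat coordinates for the Dubrovin--Zhang Frobenius manifold of the extended affine Weyl group $\widetilde W^{(\bar k)}(A_{\hat\ell+\bar k})$. Fix an integer $p\ge 0$, let $\pi=(m_1,\dots,m_{\ell(\pi)})$ be a partition of $p$, put $\ell:=\hat\ell+\bar k+p$, and consider the associated Landau--Ginzburg model $$\lambda(\mu)=\frac{w_0\,Q_\ell(\mu;w_1,\dots,w_\ell)}{\mu^{\bar k}\prod_{\alpha=1}^{\ell(\pi)}(\mu-w_{-\alpha})^{m_\alpha}},\qquad\phi=\mathrm d\log\mu .$$ One can find coordinates of the form $(\underline t,\underline\beta,\underline c)$, called collision coordinates, on the associated Frobenius manifold such that: (1) $\underline\beta=(\beta_1,\dots,\beta_{\ell(\pi)})\in\mathbb C^{\ell(\pi)}$ are flat coordinates logarithmic in the movable poles ($e^{\beta_\alpha}$ is the position of the $\alpha$-th movable pole); (2) $\underline c=(\underline c_1,\dots,\underline c_{\ell(\pi)})\in\mathbb C^{m_1}\times\dots\times\mathbb C^{m_{\ell(\pi)}}$, with $\underline c_\alpha=(c_{1,\alpha},\dots,c_{m_\alpha,\alpha})$, are (in general curved, i.e. non-flat) natural collision quantities, defined in the context, that are well behaved in the collision limit (in the sense made precise in the context). In each collision cluster they are related to flat coordinates in a controllable, block-diagonal, universal way that only depends on the size of the cluster. Namely, for a cluster of size $m$ with collision coordinates $\beta,c_1,\dots,c_m$, flat coordinates in the cluster are of the form $$s=\beta,\qquad t_{-1}=c_1,\qquad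 t_{-k}\in c_m^{k/m}\,\mathbb C\Big[\tfrac{c_1}{c_m},\dots,\tfrac{c_{m-1}}{c_m}\Big]\quad(k=2,\dots,m-1),\qquad t_{-m}=c_m^{1/m},$$ and the Jacobian matrix of $(c_2,\dots,c_{m-1})\mapsto(t_{-2},\dots,t_{-(m-1)})$ is upper-triangular.
   Context: Here $Q_\ell(\mu;w_1,\dots,w_\ell)=1+(-1)^{\ell+1}\mu^{\ell+1}+\sum_{i=1}^\ell(-1)^iw_i\mu^i$. The poles $w_{-\alpha}\in\mathbb C^\ast$, pairwise distinct, are called movable poles; $\lambda$ has poles of order $\hat\ell+1$ at $\infty$, $\bar k$ at $0$ and $m_\alpha$ at the $\alpha$-th movable pole. The Frobenius manifold of a Landau--Ginzburg model $(\lambda,\phi)$ has flat metric given, up to an overall sign, by $\eta(X,Y)=\sum_{q:\,\mathrm d\lambda(q)=0}\operatorname{Res}_q X(\lambda)Y(\lambda)\,\phi^2/\mathrm d\lambda$ (derivatives of $\lambda$ taken at fixed $\mu$); flat coordinates are coordinates in which $\eta$ is constant. By partial fractions $\lambda$ is the sum of a function $h$, with poles only at $\infty$ (order $\hat\ell+1$) and $0$ (order $\bar k$), and of the principal parts (in $\mu$) at the movable poles. The coordinate $\mu$, which may be rescaled without changing $\mathrm d\log\mu$, is normalised so that $h$ has leading coefficient $1$ at $\infty$. Then $(h,\mathrm d\log\mu)$ is a Landau--Ginzburg model of the Dubrovin--Zhang Frobenius manifold of $\widetilde W^{(\bar k)}(A_{\hat\ell+\bar k})$, and $\underline t$ are flat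 coordinates for the latter. Collision quantities. A movable pole of order $m$ is regarded as the collision of a cluster of $m$ simple poles. When all movable poles are simple, write the contribution of a cluster to $\lambda$ as $\sum_{j=1}^m\frac{r_j}{\mu-p_j}$, with $p_j=e^{\beta_j}$ and $r_j=\alpha_je^{\beta_j}$, and set $$\beta:=\tfrac1m(\beta_1+\dots+\beta_m),\qquad \Delta_j:=\beta_j-\beta,\qquad c_i:=\sum_{j=1}^m\alpha_j\,\Delta_j^{\,i-1}\quad(i=1,\dots,m).$$ For a pole of order $m$ at $e^{\beta}$, $c_1,\dots,c_m$ denote the principal Laurent coefficients of $z\mapsto\lambda(e^z)$ at $z=\beta$ ($c_i$ being the coefficient of $(z-\beta)^{-i}$). Well-behavedness in the limit means the following. Let $\lambda_n$ be a sequence of functions in which the cluster consists of $m$ simple poles, all converging to the same point $e^{\beta}$ as $n\to\infty$, the remaining part of $\lambda_n$ being kept fixed. If $\lambda_n$ converges to a function $\lambda$ uniformly on compact sets containing neither $e^{\beta}$ nor poles of the fixed part, then $\lambda$ is meromorphic with a pole of order at most $m$ at $e^\beta$, and $c_i=\lim_{n\to\infty}c_i(n)$ for $i=1,\dots,m$. Conversely, if $c_1(n),\dots,c_m(n)$ have finite limits $c_1,\dots,c_m$ with $c_m\ne 0$, then $\lambda_n$ converges, uniformly on such compact sets, to the function with the same fixed part and with principal Laurent coefficients $c_1,\dots,c_m$.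
   Formalization: The Jacobian is proved upper-triangular with the flat coordinates taken in reversed order (t_{-(m-1)},…,t_{-2}); in the listed order the claim fails for m=4, where t_{-2} depends only on c_3 (and c_4) while t_{-3} depends on c_2. *)

theory Defs
  imports "HOL-Complex_Analysis.Complex_Analysis"
begin

section \<open>Local coordinates on complex manifolds\<close>

text \<open>
  For a finite index set \<open>I\<close>, the space \<open>\<complex>\<^sup>I\<close> consists of the functions that are
  \<open>undefined\<close> outside \<open>I\<close> (\<open>extensional I\<close>), with the product topology.
\<close>

abbreviation cspace :: "'i set \<Rightarrow> ('i \<Rightarrow> complex) topology" where
  "cspace I \<equiv> product_topology (\<lambda>_. euclidean) I"

text \<open>Holomorphic in several variables: continuous, and holomorphic in each variable.\<close>

definition holomorphic_fun ::
    "'i set \<Rightarrow> ('i \<Rightarrow> complex) set \<Rightarrow> (('i \<Rightarrow> complex) \<Rightarrow> complex) \<Rightarrow> bool" where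
  "holomorphic_fun I U f \<longleftrightarrow>
     continuous_map (subtopology (cspace I) U) euclidean f \<and>
     (\<forall>w\<in>U. \<forall>i\<in>I. (\<lambda>x. f (w(i := x))) field_differentiable at (w i))"

definition pderiv_at :: "'i \<Rightarrow> (('i \<Rightarrow> complex) \<Rightarrow> complex) \<Rightarrow> ('i \<Rightarrow> complex) \<Rightarrow> complex" where
  "pderiv_at i f w = deriv (\<lambda>x. f (w(i := x))) (w i)"

definition chart_map ::
    "'j set \<Rightarrow> ('j \<Rightarrow> ('i \<Rightarrow> complex) \<Rightarrow> complex) \<Rightarrow> ('i \<Rightarrow> complex) \<Rightarrow> 'j \<Rightarrow> complex" where
  "chart_map J y w = (\<lambda>j\<in>J. y j w)"

text \<open>The functions \<open>y j\<close> (\<open>j \<in> J\<close>) map the open set \<open>U\<close> biholomorphically onto an open set.\<close>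

definition coordinate_system ::
    "'i set \<Rightarrow> ('i \<Rightarrow> complex) set \<Rightarrow> 'j set \<Rightarrow> ('j \<Rightarrow> ('i \<Rightarrow> complex) \<Rightarrow> complex) \<Rightarrow> bool" where
  "coordinate_system I U J y \<longleftrightarrow>
     openin (cspace I) U \<and>
     (\<forall>j\<in>J. holomorphic_fun I U (y j)) \<and>
     inj_on (chart_map J y) U \<and>
     openin (cspace J) (chart_map J y ` U) \<and>
     (\<forall>i\<in>I. holomorphic_fun J (chart_map J y ` U) (\<lambda>v. inv_into U (chart_map J y) v i))"

text \<open>
  A metric \<open>g\<close> is given by its components \<open>g w a b\<close> in the ambient coordinates \<open>w a\<close>.
  The coordinates \<open>y\<close> are flat if \<open>g = (\<Sum>i j. G i j dy\<^sub>i dy\<^sub>j)\<close> with constants \<open>G i j\<close>.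
\<close>

definition flat_coordinates ::
    "'i set \<Rightarrow> (('i \<Rightarrow> complex) \<Rightarrow> 'i \<Rightarrow> 'i \<Rightarrow> complex) \<Rightarrow>
     ('i \<Rightarrow> complex) set \<Rightarrow> 'j set \<Rightarrow> ('j \<Rightarrow> ('i \<Rightarrow> complex) \<Rightarrow> complex) \<Rightarrow> bool" where
  "flat_coordinates I g U J y \<longleftrightarrow>
     coordinate_system I U J y \<and>
     (\<exists>G. \<forall>w\<in>U. \<forall>a\<in>I. \<forall>b\<in>I.
        g w a b = (\<Sum>i\<in>J. \<Sum>j\<in>J. G i j * pderiv_at a (y i) w * pderiv_at b (y j) w))"

section \<open>Landau--Ginzburg models\<close>

text \<open>
  Metric of the model \<open>(lam, \<phi> d\<mu>)\<close>, where \<open>lam w \<mu>\<close> depends on the parameters \<open>w\<close>: the components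
  are obtained from \<open>X = \<partial>/\<partial>w\<^sub>a\<close>, \<open>Y = \<partial>/\<partial>w\<^sub>b\<close>, and the derivatives are taken at fixed \<open>\<mu>\<close>.
  Poles of \<open>lam w\<close> are not critical points, hence the condition of analyticity
  (\<open>deriv\<close> is total).
\<close>

definition critical_points :: "(complex \<Rightarrow> complex) \<Rightarrow> complex set" where
  "critical_points f = {q. f analytic_on {q} \<and> deriv f q = 0}"

definition lg_metric ::
    "(('i \<Rightarrow> complex) \<Rightarrow> complex \<Rightarrow> complex) \<Rightarrow> (complex \<Rightarrow> complex) \<Rightarrow>
     ('i \<Rightarrow> complex) \<Rightarrow> 'i \<Rightarrow> 'i \<Rightarrow> complex" where
  "lg_metric lam \<phi> w a b =
     (\<Sum>q\<in>critical_points (lam w).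
        residue (\<lambda>\<mu>. pderiv_at a (\<lambda>w. lam w \<mu>) w * pderiv_at b (\<lambda>w. lam w \<mu>) w
                       * (\<phi> \<mu>)\<^sup>2 / deriv (lam w) \<mu>) q)"

text \<open>The coefficient \<open>\<phi>\<close> of \<open>d log \<mu> = \<phi> d\<mu>\<close>.\<close>

definition dlog :: "complex \<Rightarrow> complex" where
  "dlog \<mu> = 1 / \<mu>"

subsection \<open>The Dubrovin--Zhang manifold of the extended affine Weyl group of type \<open>A\<close>\<close>

text \<open>
  It is taken in its Landau--Ginzburg form: the superpotentials are the Laurent polynomials
  \<open>h = \<mu>^(lhat+1) + (\<Sum>i = -kbar..lhat. A\<^sub>i \<mu>\<^sup>i)\<close> with a pole of order exactly \<open>kbar\<close> at \<open>0\<close>.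
\<close>

definition dz_index :: "nat \<Rightarrow> nat \<Rightarrow> int set" where
  "dz_index lhat kbar = {- int kbar..int lhat}"

definition dz_superpotential :: "nat \<Rightarrow> nat \<Rightarrow> (int \<Rightarrow> complex) \<Rightarrow> complex \<Rightarrow> complex" where
  "dz_superpotential lhat kbar A \<mu> =
     \<mu> ^ (lhat + 1) + (\<Sum>i\<in>dz_index lhat kbar. A i * \<mu> powi i)"

definition dz_parameters :: "nat \<Rightarrow> nat \<Rightarrow> (int \<Rightarrow> complex) set" where
  "dz_parameters lhat kbar = {A \<in> extensional (dz_index lhat kbar). A (- int kbar) \<noteq> 0}"

definition dz_flat_coordinates ::
    "nat \<Rightarrow> nat \<Rightarrow> (int \<Rightarrow> complex) set \<Rightarrow> (nat \<Rightarrow> (int \<Rightarrow> complex) \<Rightarrow> complex) \<Rightarrow> bool" where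
  "dz_flat_coordinates lhat kbar V t \<longleftrightarrow>
     V \<subseteq> dz_parameters lhat kbar \<and>
     flat_coordinates (dz_index lhat kbar) (lg_metric (dz_superpotential lhat kbar) dlog)
       V {1..lhat + kbar + 1} t"

subsection \<open>Superpotentials with movable poles\<close>

definition partition_of :: "nat \<Rightarrow> nat list \<Rightarrow> bool" where
  "partition_of p ms \<longleftrightarrow> sorted_wrt (\<ge>) ms \<and> (\<forall>m\<in>set ms. 0 < m) \<and> sum_list ms = p"

text \<open>Movable poles are numbered from \<open>1\<close>; list positions start at \<open>0\<close>.\<close>

definition pole_order :: "nat list \<Rightarrow> nat \<Rightarrow> nat" where
  "pole_order ms \<alpha> = ms ! (\<alpha> - 1)"

definition Q_poly :: "nat \<Rightarrow> (int \<Rightarrow> complex) \<Rightarrow> complex \<Rightarrow> complex" where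
  "Q_poly l w \<mu> =
     1 + (-1) ^ (l + 1) * \<mu> ^ (l + 1) + (\<Sum>i=1..l. (-1) ^ i * w (int i) * \<mu> ^ i)"

definition total_degree :: "nat \<Rightarrow> nat \<Rightarrow> nat list \<Rightarrow> nat" where
  "total_degree lhat kbar ms = lhat + kbar + sum_list ms"

definition superpotential ::
    "nat \<Rightarrow> nat \<Rightarrow> nat list \<Rightarrow> (int \<Rightarrow> complex) \<Rightarrow> complex \<Rightarrow> complex" where
  "superpotential lhat kbar ms w \<mu> =
     w 0 * Q_poly (total_degree lhat kbar ms) w \<mu> /
     (\<mu> ^ kbar * (\<Prod>\<alpha>=1..length ms. (\<mu> - w (- int \<alpha>)) ^ pole_order ms \<alpha>))"

definition parameter_index :: "nat \<Rightarrow> nat \<Rightarrow> nat list \<Rightarrow> int set" where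
  "parameter_index lhat kbar ms = {- int (length ms)..int (total_degree lhat kbar ms)}"

text \<open>
  The movable poles are distinct, nonzero and not cancelled by the numerator, so that the pole orders
  are exactly \<open>lhat + 1\<close>, \<open>kbar\<close> and \<open>m\<^sub>\<alpha>\<close>.
\<close>

definition parameters :: "nat \<Rightarrow> nat \<Rightarrow> nat list \<Rightarrow> (int \<Rightarrow> complex) set" where
  "parameters lhat kbar ms =
     {w \<in> extensional (parameter_index lhat kbar ms).
        w 0 \<noteq> 0 \<and>
        inj_on (\<lambda>\<alpha>. w (- int \<alpha>)) {1..length ms} \<and>
        (\<forall>\<alpha>\<in>{1..length ms}. w (- int \<alpha>) \<noteq> 0 \<and>
           Q_poly (total_degree lhat kbar ms) w (w (- int \<alpha>)) \<noteq> 0)}"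

text \<open>
  Normalisation of \<open>\<mu>\<close>: in the coordinate \<open>a * \<mu>\<close>, the superpotential has leading coefficient \<open>1\<close>
  at infinity iff \<open>a\<close> is an \<open>(lhat + 1)\<close>-st root of the leading coefficient below.
\<close>

definition leading_coeff :: "nat \<Rightarrow> nat \<Rightarrow> nat list \<Rightarrow> (int \<Rightarrow> complex) \<Rightarrow> complex" where
  "leading_coeff lhat kbar ms w = (-1) ^ (total_degree lhat kbar ms + 1) * w 0"

definition normalised_superpotential ::
    "nat \<Rightarrow> nat \<Rightarrow> nat list \<Rightarrow> (int \<Rightarrow> complex) \<Rightarrow> complex \<Rightarrow> complex \<Rightarrow> complex" where
  "normalised_superpotential lhat kbar ms w a \<mu> = superpotential lhat kbar ms w (\<mu> / a)"

definition movable_pole :: "(int \<Rightarrow> complex) \<Rightarrow> complex \<Rightarrow> nat \<Rightarrow> complex" where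
  "movable_pole w a \<alpha> = a * w (- int \<alpha>)"

definition principal_part :: "(complex \<Rightarrow> complex) \<Rightarrow> complex \<Rightarrow> nat \<Rightarrow> complex \<Rightarrow> complex" where
  "principal_part f b m \<mu> =
     (\<Sum>i=1..m. fls_nth (laurent_expansion f b) (- int i) / (\<mu> - b) ^ i)"

text \<open>The summand \<open>h\<close> with poles only at infinity and \<open>0\<close>, as a point of the Dubrovin--Zhang manifold.\<close>

definition h_part ::
    "nat \<Rightarrow> nat \<Rightarrow> nat list \<Rightarrow> (int \<Rightarrow> complex) \<Rightarrow> complex \<Rightarrow> complex \<Rightarrow> complex" where
  "h_part lhat kbar ms w a \<mu> =
     normalised_superpotential lhat kbar ms w a \<mu> -
     (\<Sum>\<alpha>=1..length ms.
        principal_part (normalised_superpotential lhat kbar ms w a)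
          (movable_pole w a \<alpha>) (pole_order ms \<alpha>) \<mu>)"

definition h_coeffs ::
    "nat \<Rightarrow> nat \<Rightarrow> nat list \<Rightarrow> (int \<Rightarrow> complex) \<Rightarrow> complex \<Rightarrow> int \<Rightarrow> complex" where
  "h_coeffs lhat kbar ms w a =
     (\<lambda>i\<in>dz_index lhat kbar. fls_nth (laurent_expansion (h_part lhat kbar ms w a) 0) i)"

section \<open>Collision quantities\<close>

text \<open>The coefficient of \<open>(z - \<beta>)\<close> to the power \<open>-i\<close> in the Laurent expansion of \<open>lam (exp z)\<close>.\<close>

definition collision_coeff :: "(complex \<Rightarrow> complex) \<Rightarrow> complex \<Rightarrow> nat \<Rightarrow> complex" where
  "collision_coeff lam \<beta> i = fls_nth (laurent_expansion (\<lambda>z. lam (exp z)) \<beta>) (- int i)"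

text \<open>
  The same quantity for a cluster of \<open>m\<close> simple poles at \<open>exp (be j)\<close> with residues
  \<open>al j * exp (be j)\<close>, \<open>j = 1..m\<close>.
\<close>

definition cluster_mean :: "nat \<Rightarrow> (nat \<Rightarrow> complex) \<Rightarrow> complex" where
  "cluster_mean m be = (\<Sum>j=1..m. be j) / of_nat m"

definition cluster_coeff ::
    "nat \<Rightarrow> (nat \<Rightarrow> complex) \<Rightarrow> (nat \<Rightarrow> complex) \<Rightarrow> nat \<Rightarrow> complex" where
  "cluster_coeff m al be i = (\<Sum>j=1..m. al j * (be j - cluster_mean m be) ^ (i - 1))"

definition cluster_function ::
    "nat \<Rightarrow> (nat \<Rightarrow> complex) \<Rightarrow> (nat \<Rightarrow> complex) \<Rightarrow> complex \<Rightarrow> complex" where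
  "cluster_function m al be \<mu> = (\<Sum>j=1..m. al j * exp (be j) / (\<mu> - exp (be j)))"

text \<open>
  The part of a superpotential that is kept fixed when the poles of the \<open>\<alpha>\<close>-th cluster collide:
  \<open>h\<close> has coefficients \<open>A\<close>, and \<open>d \<gamma> i\<close> are the coefficients of the principal part at the
  remaining movable pole \<open>b \<gamma>\<close>.
\<close>

definition other_poles :: "nat list \<Rightarrow> nat \<Rightarrow> nat set" where
  "other_poles ms \<alpha> = {1..length ms} - {\<alpha>}"

definition fixed_part ::
    "nat \<Rightarrow> nat \<Rightarrow> nat list \<Rightarrow> nat \<Rightarrow> (int \<Rightarrow> complex) \<Rightarrow> (nat \<Rightarrow> complex) \<Rightarrow>
     (nat \<Rightarrow> nat \<Rightarrow> complex) \<Rightarrow> complex \<Rightarrow> complex" where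
  "fixed_part lhat kbar ms \<alpha> A b d \<mu> =
     dz_superpotential lhat kbar A \<mu> +
     (\<Sum>\<gamma>\<in>other_poles ms \<alpha>. \<Sum>i=1..pole_order ms \<gamma>. d \<gamma> i / (\<mu> - b \<gamma>) ^ i)"

definition valid_fixed_part ::
    "nat \<Rightarrow> nat \<Rightarrow> nat list \<Rightarrow> nat \<Rightarrow> (int \<Rightarrow> complex) \<Rightarrow> (nat \<Rightarrow> complex) \<Rightarrow>
     (nat \<Rightarrow> nat \<Rightarrow> complex) \<Rightarrow> complex \<Rightarrow> bool" where
  "valid_fixed_part lhat kbar ms \<alpha> A b d \<beta> \<longleftrightarrow>
     A \<in> dz_parameters lhat kbar \<and>
     inj_on b (other_poles ms \<alpha>) \<and>
     (\<forall>\<gamma>\<in>other_poles ms \<alpha>. b \<gamma> \<noteq> 0 \<and> b \<gamma> \<noteq> exp \<beta> \<and> d \<gamma> (pole_order ms \<gamma>) \<noteq> 0)"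

text \<open>
  Sequences of clusters of \<open>m\<close> distinct simple poles, away from the other movable poles, which
  collide at \<open>exp \<beta>\<close>. The logarithms of the poles are those that converge to \<open>\<beta>\<close>.
\<close>

definition colliding ::
    "nat \<Rightarrow> complex set \<Rightarrow> (nat \<Rightarrow> nat \<Rightarrow> complex) \<Rightarrow> (nat \<Rightarrow> nat \<Rightarrow> complex) \<Rightarrow> complex \<Rightarrow> bool" where
  "colliding m others al be \<beta> \<longleftrightarrow>
     (\<forall>n. inj_on (\<lambda>j. exp (be n j)) {1..m} \<and>
          (\<forall>j\<in>{1..m}. al n j \<noteq> 0 \<and> exp (be n j) \<notin> others)) \<and>
     (\<forall>j\<in>{1..m}. (\<lambda>n. be n j) \<longlonglongrightarrow> \<beta>)"

definition compactly_convergent_off ::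
    "complex set \<Rightarrow> (nat \<Rightarrow> complex \<Rightarrow> complex) \<Rightarrow> (complex \<Rightarrow> complex) \<Rightarrow> bool" where
  "compactly_convergent_off S f g \<longleftrightarrow>
     (\<forall>K. compact K \<and> K \<inter> S = {} \<longrightarrow> uniform_limit K f g sequentially)"

definition well_behaved_collision :: "nat \<Rightarrow> nat \<Rightarrow> nat list \<Rightarrow> nat \<Rightarrow> bool" where
  "well_behaved_collision lhat kbar ms \<alpha> \<longleftrightarrow>
     (\<forall>A b d \<beta> al be.
        let m = pole_order ms \<alpha>;
            f = fixed_part lhat kbar ms \<alpha> A b d;
            others = b ` other_poles ms \<alpha>;
            S = {0, exp \<beta>} \<union> others;
            lam_n = (\<lambda>n \<mu>. f \<mu> + cluster_function m (al n) (be n) \<mu>)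
        in valid_fixed_part lhat kbar ms \<alpha> A b d \<beta> \<and> colliding m others al be \<beta> \<longrightarrow>
           (\<forall>lam. compactly_convergent_off S lam_n lam \<longrightarrow>
              lam meromorphic_on UNIV \<and> - int m \<le> zorder lam (exp \<beta>) \<and>
              (\<forall>i\<in>{1..m}. (\<lambda>n. cluster_coeff m (al n) (be n) i)
                              \<longlonglongrightarrow> collision_coeff lam \<beta> i)) \<and>
           (\<forall>c. (\<forall>i\<in>{1..m}. (\<lambda>n. cluster_coeff m (al n) (be n) i) \<longlonglongrightarrow> c i) \<and> c m \<noteq> 0 \<longrightarrow>
              (\<exists>e. let lam = (\<lambda>\<mu>. f \<mu> + (\<Sum>i=1..m. e i / (\<mu> - exp \<beta>) ^ i))
                   in (\<forall>i\<in>{1..m}. collision_coeff lam \<beta> i = c i) \<and>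
                      compactly_convergent_off S lam_n lam)))"

section \<open>Collision coordinates\<close>

text \<open>
  Labels of the coordinates: \<open>Tc i\<close> for the coordinates \<open>t\<close>, \<open>Bc \<alpha>\<close> for \<open>\<beta>\<^sub>\<alpha>\<close>, and \<open>Cc \<alpha> i\<close> for the
  \<open>i\<close>-th remaining coordinate of the \<open>\<alpha>\<close>-th cluster (\<open>c\<^sub>i\<close>, or the flat coordinate \<open>t\<close> with index \<open>-i\<close>).
\<close>

datatype coord_label = Tc nat | Bc nat | Cc nat nat

definition coord_labels :: "nat \<Rightarrow> nat \<Rightarrow> nat list \<Rightarrow> coord_label set" where
  "coord_labels lhat kbar ms =
     Tc ` {1..lhat + kbar + 1} \<union> Bc ` {1..length ms} \<union>
     {Cc \<alpha> i | \<alpha> i. \<alpha> \<in> {1..length ms} \<and> i \<in> {1..pole_order ms \<alpha>}}"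

primrec joint_coords ::
    "(nat \<Rightarrow> 'p \<Rightarrow> complex) \<Rightarrow> (nat \<Rightarrow> 'p \<Rightarrow> complex) \<Rightarrow> (nat \<Rightarrow> nat \<Rightarrow> 'p \<Rightarrow> complex) \<Rightarrow>
     coord_label \<Rightarrow> 'p \<Rightarrow> complex" where
  "joint_coords t \<beta> c (Tc i) = t i"
| "joint_coords t \<beta> c (Bc \<alpha>) = \<beta> \<alpha>"
| "joint_coords t \<beta> c (Cc \<alpha> i) = c \<alpha> i"

definition lift_t ::
    "nat \<Rightarrow> nat \<Rightarrow> nat list \<Rightarrow> (nat \<Rightarrow> (int \<Rightarrow> complex) \<Rightarrow> complex) \<Rightarrow>
     ((int \<Rightarrow> complex) \<Rightarrow> complex) \<Rightarrow> nat \<Rightarrow> (int \<Rightarrow> complex) \<Rightarrow> complex" where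
  "lift_t lhat kbar ms t a i w = t i (h_coeffs lhat kbar ms w (a w))"

definition c_coord ::
    "nat \<Rightarrow> nat \<Rightarrow> nat list \<Rightarrow> ((int \<Rightarrow> complex) \<Rightarrow> complex) \<Rightarrow>
     (nat \<Rightarrow> (int \<Rightarrow> complex) \<Rightarrow> complex) \<Rightarrow> nat \<Rightarrow> nat \<Rightarrow> (int \<Rightarrow> complex) \<Rightarrow> complex" where
  "c_coord lhat kbar ms a \<beta> \<alpha> i w =
     collision_coeff (normalised_superpotential lhat kbar ms w (a w)) (\<beta> \<alpha> w) i"

definition model_flat_coordinates ::
    "nat \<Rightarrow> nat \<Rightarrow> nat list \<Rightarrow> (int \<Rightarrow> complex) set \<Rightarrow>
     (coord_label \<Rightarrow> (int \<Rightarrow> complex) \<Rightarrow> complex) \<Rightarrow> bool" where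
  "model_flat_coordinates lhat kbar ms U y \<longleftrightarrow>
     flat_coordinates (parameter_index lhat kbar ms) (lg_metric (superpotential lhat kbar ms) dlog)
       U (coord_labels lhat kbar ms) y"

text \<open>
  \<open>(t, \<beta>, c)\<close> is a system of collision coordinates on \<open>U\<close>, where \<open>a\<close> is a holomorphic branch of the
  rescaling of \<open>\<mu>\<close>.
\<close>

definition collision_coordinates ::
    "nat \<Rightarrow> nat \<Rightarrow> nat list \<Rightarrow> (int \<Rightarrow> complex) set \<Rightarrow> (nat \<Rightarrow> (int \<Rightarrow> complex) \<Rightarrow> complex) \<Rightarrow>
     (int \<Rightarrow> complex) set \<Rightarrow> ((int \<Rightarrow> complex) \<Rightarrow> complex) \<Rightarrow>
     (nat \<Rightarrow> (int \<Rightarrow> complex) \<Rightarrow> complex) \<Rightarrow> bool" where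
  "collision_coordinates lhat kbar ms V t U a \<beta> \<longleftrightarrow>
     U \<subseteq> parameters lhat kbar ms \<and>
     holomorphic_fun (parameter_index lhat kbar ms) U a \<and>
     (\<forall>w\<in>U. a w ^ (lhat + 1) = leading_coeff lhat kbar ms w \<and>
            h_coeffs lhat kbar ms w (a w) \<in> V \<and>
            (\<forall>\<alpha>\<in>{1..length ms}. exp (\<beta> \<alpha> w) = movable_pole w (a w) \<alpha>)) \<and>
     coordinate_system (parameter_index lhat kbar ms) U (coord_labels lhat kbar ms)
       (joint_coords (lift_t lhat kbar ms t a) \<beta> (c_coord lhat kbar ms a \<beta>))"

section \<open>Flat coordinates of a cluster\<close>

definition polynomial_in :: "nat \<Rightarrow> ((nat \<Rightarrow> complex) \<Rightarrow> complex) \<Rightarrow> bool" where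
  "polynomial_in n P \<longleftrightarrow>
     (\<exists>(E :: (nat \<Rightarrow> nat) set) coef. finite E \<and>
        (\<forall>x. P x = (\<Sum>e\<in>E. coef e * (\<Prod>i=1..n. x i ^ e i))))"

text \<open>
  The element of \<open>c\<^sub>m^(k/m) \<complex>[c\<^sub>1/c\<^sub>m, \<dots>, c\<^sub>m\<^sub>-\<^sub>1/c\<^sub>m]\<close> with polynomial \<open>P\<close>, where \<open>s\<close> is the chosen
  \<open>m\<close>-th root of \<open>c\<^sub>m\<close>.
\<close>

definition cluster_flat ::
    "((nat \<Rightarrow> complex) \<Rightarrow> complex) \<Rightarrow> nat \<Rightarrow> nat \<Rightarrow> complex \<Rightarrow> (nat \<Rightarrow> complex) \<Rightarrow> complex" where
  "cluster_flat P m k s c = s ^ k * P (\<lambda>i. c i / c m)"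

text \<open>
  The Jacobian matrix with respect to \<open>c\<^sub>2, \<dots>, c\<^sub>m\<^sub>-\<^sub>1\<close>, with the flat coordinates listed by
  increasing index \<open>-(m-1), \<dots>, -2\<close>: the rows and columns are numbered by \<open>2, \<dots>, m-1\<close>, and row \<open>r\<close>
  belongs to the flat coordinate with index \<open>-(m+1-r)\<close>. For \<open>m \<ge> 4\<close> this is the order that is
  compatible with the exponents \<open>k/m\<close>: by homogeneity, the coordinate with exponent \<open>k/m\<close> is a
  multiple of \<open>Res (lam (exp z) powr (k/m)) dz\<close>, which depends on \<open>c\<^sub>j\<close> for \<open>2 \<le> j < m\<close> exactly if \<open>j \<ge> m+1-k\<close>.
\<close>

definition cluster_jacobian ::
    "(nat \<Rightarrow> nat \<Rightarrow> (nat \<Rightarrow> complex) \<Rightarrow> complex) \<Rightarrow> nat \<Rightarrow> complex \<Rightarrow> (nat \<Rightarrow> complex) \<Rightarrow>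
     nat \<Rightarrow> nat \<Rightarrow> complex" where
  "cluster_jacobian P m s c r j =
     (let k = m + 1 - r in pderiv_at j (cluster_flat (P m k) m k s) c)"

definition cluster_relation ::
    "(nat \<Rightarrow> nat \<Rightarrow> (nat \<Rightarrow> complex) \<Rightarrow> complex) \<Rightarrow> nat \<Rightarrow> (nat \<Rightarrow> complex) \<Rightarrow> (nat \<Rightarrow> complex) \<Rightarrow> bool"
where
  "cluster_relation P m c \<tau> \<longleftrightarrow>
     \<tau> 1 = c 1 \<and> \<tau> m ^ m = c m \<and>
     (\<forall>k\<in>{2..<m}. \<tau> k = cluster_flat (P m k) m k (\<tau> m) c)"

end

theory Submission
  imports Defs
begin

text \<open>
  Write the superpotential, in the normalised coordinate, as a Laurent polynomial \<open>h\<close> plus principal parts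
  at the movable poles, the latter expanded in powers of \<open>1 / (\<mu>/b - 1)\<close>; then the collision quantities are
  constant linear combinations of the coefficients. The residues at the critical points are
  traded for residues at \<open>0\<close> and at the movable poles. The resulting formula for the metric is
  \<open>\<eta> = \<eta>\<^sub>h + (terms d log A\<^sub>-\<^sub>k dc\<^sub>1) + \<Sum> (2 d\<beta> dc\<^sub>1 + m \<Sum>\<^sub>i ds\<^sub>i ds\<^sub>m\<^sub>-\<^sub>i)\<close>, where \<open>A\<^sub>-\<^sub>k\<close> is the lowest coefficient of \<open>h\<close> and
  \<open>s\<^sub>i\<close> is the residue of the power \<open>i/m\<close> of the principal part, divided by \<open>i\<close>; the last sum is an instance of Lagrange
  inversion. Since \<open>d log A\<^sub>-\<^sub>k\<close> is dual to the field \<open>\<partial>/\<partial>A\<^sub>0\<close>, which preserves the metric of the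
  Dubrovin--Zhang manifold, it has constant coefficients in flat coordinates, so \<open>(t, \<beta>, s)\<close> is flat.
\<close>

text \<open>No residue at infinity is ever computed: the integrand of the model is compared with the
  integrand of its summand \<open>h\<close> alone. The difference decays fast enough at infinity and
  has at most a simple pole at 0, and the part from \<open>h\<close> is the Dubrovin--Zhang metric,
  whatever flat coordinates \<open>t\<close> are given. The rescaling \<open>a\<close> depends on
  the parameters, but it changes a variation of the superpotential only by a multiple of its
  derivative, which contributes no residue at a critical point. Coordinates are biholomorphisms, so
  inverses have to be explicit. The numerator is rebuilt from \<open>h\<close>, the poles and the
  principal parts; its constant term determines \<open>a\<close> up to an \<open>(l+1)\<close>-st
  root, whereas the forward direction takes an \<open>(lhat+1)\<close>-st root of the leading
  coefficient. The domains are cut so that both branches agree. The constants of the closed Killing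
  form are obtained on a polydisc only, hence all charts live near the given \<open>w0\<close>. In
  the collision limit, one direction integrates against powers of \<open>z - mean\<close> over a
  fixed circle; the converse uses the Newton form of the cluster, whose coefficients converge
  although single residues may blow up.\<close>

abbreviation (input) "hol \<equiv> holomorphic_fun"
abbreviation (input) "pd \<equiv> pderiv_at"
abbreviation (input) "cmap \<equiv> chart_map"
abbreviation (input) "csys \<equiv> coordinate_system"
abbreviation (input) "dzs \<equiv> dz_superpotential"
abbreviation (input) "nsp \<equiv> normalised_superpotential"
abbreviation (input) "mpole \<equiv> movable_pole"
abbreviation (input) "spot \<equiv> superpotential"
abbreviation (input) "lcoef \<equiv> leading_coeff"
abbreviation (input) "dz_par \<equiv> dz_parameters"
abbreviation (input) "par_ix \<equiv> parameter_index"
abbreviation (input) "dz_ix \<equiv> dz_index"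
abbreviation (input) "cmean \<equiv> cluster_mean"
abbreviation (input) "ccoef \<equiv> cluster_coeff"
abbreviation (input) "cconv \<equiv> compactly_convergent_off"

section \<open>Holomorphic functions of several variables\<close>

definition polydisc :: "'i set => ('i => complex) => real => ('i => complex) set" where
 "polydisc I w d = {v : extensional I. ALL i:I. dist (v i) (w i) < d}"

text \<open>All points of \<open>extensional I\<close> agree outside \<open>I\<close>, so a basic
  box over \<open>I\<close> and a basic box over all indices cut out the same sets. This makes the
  type-class topology of function spaces, and with it \<open>continuous_on\<close>, available for
  \<open>cspace\<close>.\<close>

lemma cspace_eq: "cspace I = top_of_set (extensional I)"
 unfolding topology_eq
proof (intro allI iffI)
 fix S :: "('a => complex) set" assume "openin (cspace I) S"
 hence S: "!!x. x : S ==> EX U. finite {i : I. U i ~= UNIV} & (ALL i:I. open (U i)) & x : Pi\<^sub>E I U & Pi\<^sub>E I U <= S"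
  by (auto simp: openin_product_topology_alt)
 show "openin (top_of_set (extensional I)) S"
 proof (subst openin_subopen, intro ballI)
  fix x assume "x : S"
  then obtain U where U: "finite {i : I. U i ~= UNIV}" "ALL i:I. open (U i)" "x : Pi\<^sub>E I U" "Pi\<^sub>E I U <= S"
   using S by metis
  let ?T = "Pi\<^sub>E UNIV (%i. if i : I then U i else UNIV)"
  have "open ?T"
  proof (rule open_PiE)
   show "!!i. open (if i : I then U i else UNIV)" using U by auto
   show "finite {i. (if i : I then U i else UNIV) ~= UNIV}"
    by (rule finite_subset[OF _ U(1)]) auto
  qed
  moreover have "extensional I \<inter> ?T = Pi\<^sub>E I U"
   by (auto simp: PiE_def Pi_def extensional_def split: if_splits)
  ultimately have "openin (top_of_set (extensional I)) (Pi\<^sub>E I U)"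
   by (metis openin_open)
  with U show "EX T. openin (top_of_set (extensional I)) T & x : T & T <= S" by blast
 qed
next
 fix S :: "('a => complex) set" assume "openin (top_of_set (extensional I)) S"
 then obtain T where T: "open T" "S = extensional I \<inter> T" by (auto simp: openin_open)
 show "openin (cspace I) S"
  unfolding openin_product_topology_alt
 proof
  fix x assume x: "x : S"
  have "openin (product_topology (%i. euclidean) UNIV) T"
   using T by (simp add: euclidean_product_topology)
  then obtain U where U: "finite {i. U i ~= (UNIV :: complex set)}" "ALL i. open (U i)" "x : Pi\<^sub>E UNIV U" "Pi\<^sub>E UNIV U <= T"
   using x T unfolding openin_product_topology_alt by force
  let ?U = "%i. U i"
  have "Pi\<^sub>E I U <= S"
  proof
   fix y assume y: "y : Pi\<^sub>E I U"
   have "y i : U i" for i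
   proof (cases "i : I")
    case False
    hence "y i = x i" using x y T by (auto simp: PiE_def extensional_def)
    thus ?thesis using U by auto
   qed (use y in auto)
   thus "y : S" using U y T by (auto simp: PiE_def)
  qed
  moreover have "x : Pi\<^sub>E I U" using U x T by (auto simp: PiE_def)
  moreover have "finite {i : I. U i ~= topspace euclidean}" using U(1) by (rule rev_finite_subset) auto
  ultimately show "EX U. finite {i : I. U i ~= topspace (euclidean::complex topology)} &
       (ALL i:I. openin euclidean (U i)) & x : Pi\<^sub>E I U & Pi\<^sub>E I U <= S"
   using U by auto
 qed
qed

lemma polydisc_mono: "d <= d' ==> polydisc I w d <= polydisc I w d'"
 by (force simp: polydisc_def)

lemma polydisc_center: "w : extensional I ==> 0 < d ==> w : polydisc I w d"
 by (auto simp: polydisc_def)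

lemma openin_polydisc:
 assumes "finite I" shows "openin (cspace I) (polydisc I w d)"
proof -
 have "polydisc I w d = Pi\<^sub>E I (%i. ball (w i) d)"
  by (auto simp: polydisc_def PiE_def Pi_def dist_commute)
 thus ?thesis using assms by (simp add: openin_PiE)
qed

lemma openin_cspace_iff:
 assumes "finite I"
 shows "openin (cspace I) U \<longleftrightarrow> U <= extensional I & (ALL w:U. EX d>0. polydisc I w d <= U)"
proof
 assume U: "openin (cspace I) U"
 have sub: "U <= extensional I" using openin_subset[OF U] by (auto simp: PiE_def)
 moreover have "EX d>0. polydisc I w d <= U" if w: "w : U" for w
 proof -
  obtain V where V: "ALL i:I. open (V i)" "w : Pi\<^sub>E I V" "Pi\<^sub>E I V <= U"
   using U w by (auto simp: openin_product_topology_alt)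
  have "ALL i:I. EX d>0. ball (w i) d <= V i" using V open_contains_ball by (metis PiE_mem)
  then obtain d where d: "!!i. i : I ==> d i > 0 & ball (w i) (d i) <= V i" by metis
  let ?d = "Min (insert 1 (d ` I))"
  have "?d > 0" using assms d by (subst Min_gr_iff) auto
  moreover have "polydisc I w ?d <= Pi\<^sub>E I V"
  proof
   fix v assume v: "v : polydisc I w ?d"
   have "v i : V i" if i: "i : I" for i
   proof -
    have "?d <= d i" using i assms by (intro Min_le) auto
    hence "v i : ball (w i) (d i)" using v i by (auto simp: polydisc_def dist_commute)
    thus ?thesis using d[OF i] by blast
   qed
   thus "v : Pi\<^sub>E I V" using v by (auto simp: polydisc_def PiE_def)
  qed
  ultimately show ?thesis using V by blast
 qed
 ultimately show "U <= extensional I & (ALL w:U. EX d>0. polydisc I w d <= U)" by blast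
next
 assume *: "U <= extensional I & (ALL w:U. EX d>0. polydisc I w d <= U)"
 show "openin (cspace I) U"
 proof (subst openin_subopen, intro ballI)
  fix x assume "x : U"
  with * obtain d where "d > 0" "polydisc I x d <= U" "x : extensional I" by blast
  thus "EX T. openin (cspace I) T & x : T & T <= U"
   by (intro exI[of _ "polydisc I x d"] conjI openin_polydisc[OF assms] polydisc_center)
 qed
qed

lemma openin_cspace_subset: "openin (cspace I) U ==> U <= extensional I"
 using openin_subset[of "cspace I" U] by (auto simp: PiE_def)

lemma holomorphic_fun_iff:
 assumes "openin (cspace I) U"
 shows "hol I U f \<longleftrightarrow> continuous_on U f &
  (ALL w:U. ALL i:I. (%x. f (w(i := x))) field_differentiable at (w i))"
proof -
 have "subtopology (cspace I) U = top_of_set U"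
  using openin_cspace_subset[OF assms] by (simp add: cspace_eq subtopology_subtopology inf.absorb2)
 thus ?thesis unfolding holomorphic_fun_def by simp
qed

lemma holomorphic_fun_subset: "hol I U f ==> V <= U ==> hol I V f"
 unfolding holomorphic_fun_def using continuous_map_from_subtopology_mono by blast

lemma openin_cspace_vimage:
 assumes "openin (cspace I) U" "continuous_on U f" "open S"
 shows "openin (cspace I) {w : U. f w : S}"
proof -
 have "openin (top_of_set U) (U \<inter> f -` S)"
  using assms by (intro continuous_openin_preimage_gen) auto
 hence "openin (cspace I) (U \<inter> f -` S)"
  using assms(1) unfolding cspace_eq by (metis openin_trans)
 moreover have "U \<inter> f -` S = {w : U. f w : S}" by auto
 ultimately show ?thesis by simp
qed

lemma continuous_polydisc:
 assumes "finite I" "openin (cspace I) U" "continuous_on U f" "w : U" "e > (0::real)"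
 shows "EX d>0. ALL v:polydisc I w d. v : U & dist (f v :: complex) (f w) < e"
proof -
 have "openin (cspace I) {v : U. f v : ball (f w) e}"
  using assms by (intro openin_cspace_vimage) auto
 moreover have "w : {v : U. f v : ball (f w) e}" using assms by auto
 ultimately obtain d where "d > 0" "polydisc I w d <= {v : U. f v : ball (f w) e}"
  unfolding openin_cspace_iff[OF assms(1)] by blast
 thus ?thesis by (intro exI[of _ d]) (auto simp: dist_commute)
qed

lemma slice_open:
 assumes "finite I" "openin (cspace I) U" "i : I" shows "open {x. w(i := x) : U}"
 unfolding open_contains_ball
proof
 fix x assume "x : {x. w(i := x) : U}"
 then obtain d where d: "d > 0" "polydisc I (w(i:=x)) d <= U" and ext: "w(i:=x) : extensional I"
  using assms unfolding openin_cspace_iff[OF assms(1)] by blast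
 have "w(i:=y) : polydisc I (w(i:=x)) d" if "y : ball x d" for y
  using that ext d assms(3) by (auto simp: polydisc_def dist_commute extensional_def)
 thus "EX e>0. ball x e <= {x. w(i := x) : U}" using d by blast
qed

lemma slice_eventually:
 assumes "finite I" "openin (cspace I) U" "i : I" "w : U"
 shows "\<forall>\<^sub>F x in nhds (w i). w(i := x) : U"
 using eventually_nhds_in_open[OF slice_open[OF assms(1-3), of w], of "w i"] assms(4) by simp

lemma holomorphic_fun_slice:
 assumes "hol I U f" "i : I"
 shows "(%x. f (w(i := x))) holomorphic_on {x. w(i := x) : U}"
proof -
 have "(%x. f (w(i := x))) field_differentiable at y" if "w(i := y) : U" for y
 proof -
  have "(%x. f ((w(i := y))(i := x))) field_differentiable at ((w(i := y)) i)"
   using assms that unfolding holomorphic_fun_def by blast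
  thus ?thesis by simp
 qed
 thus ?thesis
  by (auto simp: holomorphic_on_def intro: field_differentiable_at_within)
qed

lemma hol_has_pd:
 assumes "hol I U f" "i : I" "w : U"
 shows "DERIV (%x. f (w(i := x))) ((w i)) :> pd i f w"
 using assms unfolding holomorphic_fun_def pderiv_at_def
 by (simp add: field_differentiable_derivI)

lemma pderiv_at_upd: "pd i f (w(i := x)) = deriv (%x. f (w(i := x))) x"
 by (simp add: pderiv_at_def)

lemma pderiv_at_cong:
 assumes "finite I" "openin (cspace I) U" "i : I" "w : U" "!!v. v : U ==> f v = g v"
 shows "pd i f w = pd i g w"
 unfolding pderiv_at_def
 by (intro deriv_cong_ev refl eventually_mono[OF slice_eventually[OF assms(1-4)]] assms(5))

lemma holomorphic_fun_cong:
 assumes "finite I" "openin (cspace I) U" "!!v. v : U ==> f v = g v"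
 shows "hol I U f \<longleftrightarrow> hol I U g"
proof -
 have *: "hol I U g" if f: "hol I U f" and eq: "!!v. v : U ==> f v = g v" for f g :: "_ => complex"
  unfolding holomorphic_fun_iff[OF assms(2)]
 proof (intro conjI ballI)
  show "continuous_on U g" using f eq continuous_on_cong[of U U f g] unfolding holomorphic_fun_iff[OF assms(2)]
   by simp
  fix w i assume w: "w : U" "i : I"
  have "\<forall>\<^sub>F x in nhds (w i). g (w(i:=x)) = f (w(i:=x))"
   using eventually_mono[OF slice_eventually[OF assms(1,2) w(2,1)]] eq by fastforce
  moreover have "(%x. f (w(i := x))) field_differentiable at (w i)"
   using f w unfolding holomorphic_fun_iff[OF assms(2)] by auto
  ultimately show "(%x. g (w(i := x))) field_differentiable at (w i)"
   unfolding field_differentiable_def using DERIV_cong_ev[OF refl _ refl, of "%x. g (w(i:=x))" "%x. f (w(i:=x))" "w i"] by blast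
 qed
 show ?thesis using *[of f g] *[of g f] assms(3) by auto
qed

section \<open>Closure properties of holomorphic functions of several variables\<close>

context
 fixes I :: "'i set" and U :: "('i => complex) set"
 assumes U: "openin (cspace I) U"
begin

lemma hol_const: "hol I U (%_. c)"
 by (auto simp: holomorphic_fun_iff[OF U])

lemma hol_coord: "hol I U (%w. w j)"
proof -
 have "(%x. (w(i := x)) j) field_differentiable at y" for w :: "'i => complex" and i y
  by (cases "i = j") auto
 moreover have "continuous_on U (%w. w j)"
  by (rule continuous_on_subset[OF continuous_on_product_coordinates]) simp
 ultimately show ?thesis unfolding holomorphic_fun_iff[OF U] by blast
qed

lemma hol_add: "hol I U f ==> hol I U g ==> hol I U (%w. f w + g w)"
 by (auto simp: holomorphic_fun_iff[OF U] intro: continuous_on_add field_differentiable_add)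

lemma hol_mult: "hol I U f ==> hol I U g ==> hol I U (%w. f w * g w)"
 by (auto simp: holomorphic_fun_iff[OF U] intro: continuous_on_mult field_differentiable_mult)

lemma hol_compose1:
 assumes "hol I U f" "g holomorphic_on S" "open S" "f ` U <= S"
 shows "hol I U (%w. g (f w))"
 unfolding holomorphic_fun_iff[OF U]
proof (intro conjI ballI)
 show "continuous_on U (%w. g (f w))"
  using assms by (auto simp: holomorphic_fun_iff[OF U] intro: continuous_on_compose2 holomorphic_on_imp_continuous_on)
 fix w i assume w: "w : U" "i : I"
 have "g field_differentiable at (f (w(i := w i)))"
  using assms w by (auto simp: holomorphic_on_open field_differentiable_def)
 moreover have "(%x. f (w(i := x))) field_differentiable at (w i)"
  using assms w by (auto simp: holomorphic_fun_iff[OF U])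
 ultimately show "(%x. g (f (w(i := x)))) field_differentiable at (w i)"
  using field_differentiable_compose[of "%x. f (w(i := x))" "w i" g] by (simp add: o_def)
qed

lemma hol_inverse: "hol I U f ==> (!!w. w : U ==> f w ~= 0) ==> hol I U (%w. inverse (f w))"
 by (rule hol_compose1[where S = "-{0}"]) (auto intro!: holomorphic_intros)

lemma hol_exp: "hol I U f ==> hol I U (%w. exp (f w))"
 by (rule hol_compose1[where S = UNIV]) (auto intro!: holomorphic_intros)

lemma hol_Ln: "hol I U f ==> (!!w. w : U ==> f w ~: nonpos_Reals) ==> hol I U (%w. Ln (f w))"
 by (rule hol_compose1[where S = "-nonpos_Reals"]) (auto intro!: holomorphic_intros simp: open_Compl)

lemma hol_cmult: "hol I U f ==> hol I U (%w. c * f w)"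
 by (rule hol_mult[OF hol_const])

lemma hol_minus: "hol I U f ==> hol I U (%w. - f w)"
 using hol_cmult[of f "-1"] by simp

lemma hol_diff: "hol I U f ==> hol I U g ==> hol I U (%w. f w - g w)"
 using hol_add[of f "%w. - g w"] hol_minus by simp

lemma hol_divide: "hol I U f ==> hol I U g ==> (!!w. w : U ==> g w ~= 0) ==> hol I U (%w. f w / g w)"
 using hol_mult[of f "%w. inverse (g w)"] hol_inverse by (simp add: divide_inverse)

lemma hol_sum: "(!!a. a : A ==> hol I U (f a)) ==> hol I U (%w. SUM a:A. f a w)"
 by (induction A rule: infinite_finite_induct) (auto intro: hol_const hol_add)

lemma hol_prod: "(!!a. a : A ==> hol I U (f a)) ==> hol I U (%w. PROD a:A. f a w)"
 by (induction A rule: infinite_finite_induct) (auto intro: hol_const hol_mult)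

lemma hol_power: "hol I U f ==> hol I U (%w. f w ^ n)"
 by (induction n) (auto intro: hol_const hol_mult)

lemma hol_continuous: "hol I U f ==> continuous_on U f"
 by (auto simp: holomorphic_fun_iff[OF U])

end

lemma hol_power_int:
 assumes "openin (cspace I) U" "hol I U f" "!!w. w : U ==> f w ~= 0"
 shows "hol I U (%w. f w powi n)"
 by (cases "n \<ge> 0") (auto simp: power_int_def intro!: hol_power hol_inverse assms)

lemmas hol_intros = hol_const hol_coord hol_add hol_mult hol_inverse hol_exp hol_Ln hol_minus hol_diff hol_divide
 hol_sum hol_prod hol_power hol_power_int

text \<open>Each point of the compact slice has a polydisc on which \<open>f\<close> varies by less
  than \<open>e/2\<close>; a finite subcover gives one radius for the whole slice. Both
  \<open>v(k := x)\<close> and \<open>w(k := x)\<close> lie in the polydisc of the same centre,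
  which costs twice \<open>e/2\<close>.\<close>

lemma tube_lemma:
 assumes I: "finite I" and U: "openin (cspace I) U" and f: "continuous_on U f" and k: "k : I"
  and K: "compact K" "!!x. x : K ==> w(k := x) : U" and e: "e > (0::real)"
 obtains d where "d > 0"
  "!!v x. v : polydisc I w d ==> x : K ==> v(k := x) : U & dist (f (v(k := x)) :: complex) (f (w(k := x))) < e"
proof -
 have "EX d>0. ALL u:polydisc I (w(k:=x)) d. u : U & dist (f u) (f (w(k:=x))) < e/2" if x: "x : K" for x
 proof -
  have "e/2 > 0" using e by simp
  thus ?thesis by (rule continuous_polydisc[OF I U f K(2)[OF x]])
 qed
 hence "EX d. ALL x:K. d x > 0 & (ALL u:polydisc I (w(k:=x)) (d x). u : U & dist (f u) (f (w(k:=x))) < e/2)"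
  by (intro bchoice) blast
 then obtain d where d: "!!x. x : K ==> d x > 0"
  "!!x u. x : K ==> u : polydisc I (w(k:=x)) (d x) ==> u : U & dist (f u) (f (w(k:=x))) < e/2" by blast
 obtain C where C: "C <= K" "finite C" "K <= (\<Union>c\<in>C. ball c (d c))"
 proof (rule compactE_image[OF K(1), of K "%x. ball x (d x)"])
  show "K <= (\<Union>c\<in>K. ball c (d c))" using d(1) by force
 qed auto
 let ?d = "Min (insert 1 (d ` C))"
 have dpos: "?d > 0" using C d by (subst Min_gr_iff) auto
 show ?thesis
 proof (rule that[OF dpos])
  fix v x assume v: "v : polydisc I w ?d" and x: "x : K"
  obtain c where c: "c : C" "x : ball c (d c)" using C x by auto
  have le: "?d <= d c" using c C by (intro Min_le) auto
  have 1: "w(k:=x) : extensional I" using openin_cspace_subset[OF U] K(2)[OF x] by auto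
  have "v(k:=x) : polydisc I (w(k:=c)) (d c)"
   using v c le k by (force simp: polydisc_def extensional_def dist_commute)
  moreover have "w(k:=x) : polydisc I (w(k:=c)) (d c)"
   using 1 c k d(1)[of c] C by (auto simp: polydisc_def dist_commute)
  ultimately have "v(k:=x) : U" "dist (f (v(k:=x))) (f (w(k:=c))) < e/2" "dist (f (w(k:=x))) (f (w(k:=c))) < e/2"
   using d(2)[OF subsetD[OF C(1) c(1)]] by auto
  thus "v(k := x) : U & dist (f (v(k := x))) (f (w(k := x))) < e"
   using dist_triangle_half_l by blast
 qed
qed

text \<open>The partial derivatives at \<open>v\<close> and \<open>w\<close> belong to two functions
  of one variable, which are uniformly close on a disc by \<open>tube_lemma\<close>. Cauchy's
  inequality makes their derivatives close, and continuity of the derivative of the fixed slice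
  through \<open>w\<close> accounts for the change of the base point.\<close>

lemma pderiv_continuous:
 assumes I: "finite I" and U: "openin (cspace I) U" and f: "hol I U f" and k: "k : I"
 shows "continuous_on U (pd k f)"
proof -
 have "EX d>0. ALL v:polydisc I w d. dist (pd k f v) (pd k f w) < e" if w: "w : U" and e: "e > 0" for w e
 proof -
  let ?S = "{x. w(k := x) : U}"
  have S: "open ?S" using slice_open[OF I U k] .
  have wS: "w k : ?S" using w by simp
  obtain r0 where r0: "r0 > 0" "cball (w k) r0 <= ?S" using S wS open_contains_cball by blast
  define r where "r = r0/2"
  have r: "r > 0" "cball (w k) (2*r) <= ?S" using r0 by (auto simp: r_def)
  have hs: "(%x. f (w(k:=x))) holomorphic_on ?S" by (rule holomorphic_fun_slice[OF f k])
  have "isCont (deriv (%x. f (w(k:=x)))) (w k)"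
   using holomorphic_on_imp_continuous_on[OF holomorphic_deriv[OF hs S]] S wS
   by (simp add: continuous_on_eq_continuous_at)
  then obtain d1 where d1: "d1 > 0" "!!y. dist y (w k) < d1 ==> dist (deriv (%x. f (w(k:=x))) y) (pd k f w) < e/2"
   using e unfolding continuous_at_eps_delta pderiv_at_def by (meson half_gt_zero)
  \<comment> \<open>Cauchy's inequality divides by \<open>r\<close> and leaves \<open>e/4\<close>;
    the fixed slice contributes less than \<open>e/2\<close>. The disc of radius \<open>r\<close>
    about \<open>v k\<close> stays inside the disc of radius \<open>2*r\<close> about
    \<open>w k\<close>, where the slices are compared.\<close>
  have ep: "e * r / 4 > 0" using e r by auto
  obtain d2 where d2: "d2 > 0" "!!v x. v : polydisc I w d2 ==> x : cball (w k) (2*r) ==>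
    v(k := x) : U & dist (f (v(k := x))) (f (w(k := x))) < e*r/4"
   by (rule tube_lemma[OF I U hol_continuous[OF U f] k compact_cball[of "w k" "2*r"] _ ep])
    (use r in auto)
  let ?d = "min d1 (min d2 r)"
  show ?thesis
  proof (intro exI[of _ ?d] conjI ballI)
   show "?d > 0" using d1 d2 r by auto
   fix v assume v: "v : polydisc I w ?d"
   have vk: "dist (v k) (w k) < d1" "dist (v k) (w k) < r" using v k by (auto simp: polydisc_def)
   have v2: "v : polydisc I w d2" using v by (auto simp: polydisc_def)
   have sub: "cball (v k) r <= cball (w k) (2*r)"
   proof
    fix x assume "x : cball (v k) r"
    hence "dist (v k) x <= r" by auto
    thus "x : cball (w k) (2*r)" using vk(2) dist_triangle[of "w k" x "v k"] by (auto simp: dist_commute)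
   qed
   let ?g = "%x. f (v(k:=x)) - f (w(k:=x))"
   have h1: "(%x. f (v(k:=x))) holomorphic_on {x. v(k := x) : U}" by (rule holomorphic_fun_slice[OF f k])
   have s1: "cball (v k) r <= {x. v(k := x) : U}" using sub d2(2)[OF v2] by auto
   have s2: "cball (v k) r <= ?S" using sub r by auto
   have hol: "?g holomorphic_on cball (v k) r"
    by (intro holomorphic_intros holomorphic_on_subset[OF h1 s1] holomorphic_on_subset[OF hs s2])
   have "norm ((deriv ^^ 1) ?g (v k)) <= fact 1 * (e*r/4) / r^1"
   proof (rule Cauchy_inequality)
    show "?g holomorphic_on ball (v k) r" using hol by (rule holomorphic_on_subset) auto
    show "continuous_on (cball (v k) r) ?g" using hol by (rule holomorphic_on_imp_continuous_on)
    show "norm (?g x) <= e*r/4" if "norm (v k - x) = r" for x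
    proof -
     have "x : cball (w k) (2*r)" using that sub by (auto simp: dist_norm)
     thus ?thesis using d2(2)[OF v2, of x] by (auto simp: dist_norm)
    qed
   qed (use r in auto)
   hence n1: "norm (deriv ?g (v k)) <= e/4" using r by simp
   have vin: "v k : cball (v k) r" using r by simp
   have "deriv ?g (v k) = deriv (%x. f (v(k:=x))) (v k) - deriv (%x. f (w(k:=x))) (v k)"
   proof (rule deriv_diff)
    show "(%x. f (v(k := x))) field_differentiable at (v k)"
     using h1 s1 vin slice_open[OF I U k] by (meson holomorphic_on_imp_differentiable_at subsetD)
    show "(%x. f (w(k := x))) field_differentiable at (v k)"
     using hs s2 vin S by (meson holomorphic_on_imp_differentiable_at subsetD)
   qed
   hence "dist (pd k f v) (deriv (%x. f (w(k:=x))) (v k)) <= e/4"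
    using n1 by (simp add: pderiv_at_def dist_norm)
   thus "dist (pd k f v) (pd k f w) < e"
    using d1(2)[OF vk(1)] dist_triangle[of "pd k f v" "pd k f w" "deriv (%x. f (w(k:=x))) (v k)"] e by linarith
  qed
 qed
 note * = this
 show ?thesis
  unfolding continuous_on_open_invariant
 proof (intro allI impI)
  fix B :: "complex set" assume B: "open B"
  let ?A = "pd k f -` B \<inter> U"
  have "openin (cspace I) ?A"
   unfolding openin_cspace_iff[OF I]
  proof (intro conjI ballI)
   show "?A <= extensional I" using openin_cspace_subset[OF U] by auto
   fix w assume w: "w : ?A"
   then obtain e where e: "e > 0" "ball (pd k f w) e <= B" using B open_contains_ball by (metis IntD1 vimageD)
   obtain d1 where "d1>0" "ALL v:polydisc I w d1. dist (pd k f v) (pd k f w) < e" using * w e by blast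
   moreover obtain d2 where "d2>0" "polydisc I w d2 <= U" using U w openin_cspace_iff[OF I] by blast
   ultimately have "polydisc I w (min d1 d2) <= ?A" "min d1 d2 > 0"
    using e polydisc_mono[of "min d1 d2" d1 I w] polydisc_mono[of "min d1 d2" d2 I w] by (auto simp: dist_commute subset_iff)
   thus "EX d>0. polydisc I w d <= ?A" by blast
  qed
  then obtain T where "open T" "?A = extensional I \<inter> T" by (auto simp: cspace_eq openin_open)
  thus "EX A. open A & A \<inter> U = pd k f -` B \<inter> U" using openin_cspace_subset[OF U] by (intro exI[of _ T]) auto
 qed
qed

text \<open>The coordinates are moved from \<open>w\<close> to \<open>v\<close> one at a time, so
  the induction runs over the set \<open>K\<close> of coordinates that may differ. Each single move
  is a mean value estimate whose derivative is close to the one at \<open>w\<close> because partial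
  derivatives are continuous.\<close>

lemma frechet_estimate:
 assumes I: "finite I" and U: "openin (cspace I) U" and f: "hol I U f"
  and w: "w : U" and e: "e > (0::real)" and K: "K <= I"
 shows "EX d>0. ALL v:polydisc I w d. (ALL i:I-K. v i = w i) -->
   norm (f v - f w - (SUM i:K. pd i f w * (v i - w i))) <= e * (SUM i:K. norm (v i - w i))"
 using finite_subset[OF K I] K
proof (induction K rule: finite_induct)
 case empty
 have "v = w" if "v : polydisc I w 1" "ALL i:I. v i = w i" for v
  using that openin_cspace_subset[OF U] w by (intro extensionalityI[of v I w]) (auto simp: polydisc_def)
 thus ?case by (intro exI[of _ 1]) auto
next
 case (insert k K)
 then obtain d1 where d1: "d1 > 0" "!!v. v : polydisc I w d1 ==> (ALL i:I-K. v i = w i) ==>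
   norm (f v - f w - (SUM i:K. pd i f w * (v i - w i))) <= e * (SUM i:K. norm (v i - w i))" by auto
 have k: "k : I" using insert by auto
 obtain d2 where d2: "d2 > 0" "!!v. v : polydisc I w d2 ==> v : U & dist (pd k f v) (pd k f w) < e"
  using continuous_polydisc[OF I U pderiv_continuous[OF I U f k] w e] by blast
 show ?case
 proof (intro exI[of _ "min d1 d2"] conjI ballI impI)
  show "min d1 d2 > 0" using d1 d2 by auto
  fix v assume v: "v : polydisc I w (min d1 d2)" and eq: "ALL i:I - insert k K. v i = w i"
  let ?v = "v(k := w k)"
  have ext: "v : extensional I" using v by (auto simp: polydisc_def)
  have v': "?v : polydisc I w d1" using v d1 ext k by (auto simp: polydisc_def extensional_def)
  have eq': "ALL i:I-K. ?v i = w i" using eq by auto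
  let ?g = "%x. f (v(k := x)) - pd k f w * x"
  have b: "v(k := x) : polydisc I w d2" if "x : ball (w k) d2" for x
   using that v ext k by (auto simp: polydisc_def extensional_def dist_commute)
  have "norm (?g (v k) - ?g (w k)) <= e * norm (v k - w k)"
  proof (rule field_differentiable_bound[where S = "ball (w k) d2" and f' = "%x. pd k f (v(k:=x)) - pd k f w"])
   fix x assume x: "x : ball (w k) d2"
   have "DERIV (%y. f ((v(k:=x))(k := y))) (((v(k:=x)) k)) :> pd k f (v(k:=x))"
    by (rule hol_has_pd[OF f k]) (use d2(2)[OF b[OF x]] in auto)
   thus "(?g has_field_derivative pd k f (v(k:=x)) - pd k f w) (at x within ball (w k) d2)"
    by (intro derivative_eq_intros) (auto intro: has_field_derivative_at_within)
   show "norm (pd k f (v(k:=x)) - pd k f w) <= e"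
    using d2(2)[OF b[OF x]] by (simp add: dist_norm)
  qed (insert d2 v k, auto simp: polydisc_def dist_commute)
  hence A: "norm (f v - f ?v - pd k f w * (v k - w k)) <= e * norm (v k - w k)"
   by (simp add: algebra_simps)
  have S: "(SUM i:K. pd i f w * (?v i - w i)) = (SUM i:K. pd i f w * (v i - w i))"
   "(SUM i:K. norm (?v i - w i)) = (SUM i:K. norm (v i - w i))"
   using insert.hyps by (auto intro!: sum.cong)
  have B: "norm (f ?v - f w - (SUM i:K. pd i f w * (v i - w i))) <= e * (SUM i:K. norm (v i - w i))"
   using d1(2)[OF v' eq'] unfolding S .
  have "f v - f w - (SUM i:insert k K. pd i f w * (v i - w i)) =
    (f v - f ?v - pd k f w * (v k - w k)) + (f ?v - f w - (SUM i:K. pd i f w * (v i - w i)))"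
   using insert.hyps by simp
  thus "norm (f v - f w - (SUM i:insert k K. pd i f w * (v i - w i))) <= e * (SUM i:insert k K. norm (v i - w i))"
   using norm_triangle_mono[OF A B] insert.hyps by (simp add: algebra_simps)
 qed
qed

lemma chain_rule_curve:
 assumes I: "finite I" and U: "openin (cspace I) U" and f: "hol I U f"
  and g: "\<forall>\<^sub>F x in at x0. g x : extensional I" "g x0 : U"
  and g': "!!i. i : I ==> DERIV (%x. g x i) x0 :> g' i"
 shows "DERIV (%x. f (g x)) x0 :> (SUM i:I. pd i f (g x0) * g' i)"
proof -
 let ?D = "%x. SUM i:I. pd i f (g x0) * ((g x i - g x0 i) / (x - x0))"
 let ?N = "%x. SUM i:I. norm ((g x i - g x0 i) / (x - x0))"
 have q: "((%x. (g x i - g x0 i) / (x - x0)) \<longlongrightarrow> g' i) (at x0)" if "i : I" for i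
  using g'[OF that] by (simp add: has_field_derivative_iff)
 have D: "(?D \<longlongrightarrow> (SUM i:I. pd i f (g x0) * g' i)) (at x0)"
  by (intro tendsto_intros q)
 have N: "(?N \<longlongrightarrow> (SUM i:I. norm (g' i))) (at x0)"
  by (intro tendsto_intros q)
 \<comment> \<open>\<open>?M\<close> exceeds the sum of the difference quotients of the curve near
   \<open>x0\<close>, so an error of \<open>e / ?M\<close> per unit of displacement becomes less
   than \<open>e\<close> after division by \<open>x - x0\<close>. The summand 1 keeps
   \<open>?M\<close> positive.\<close>
 let ?M = "(SUM i:I. norm (g' i)) + 1"
 have M: "?M > 0" by (simp add: add_nonneg_pos sum_nonneg)
 have EN: "\<forall>\<^sub>F x in at x0. ?N x < ?M" using N by (rule order_tendstoD) simp
 have "((%x. (f (g x) - f (g x0)) / (x - x0) - ?D x) \<longlongrightarrow> 0) (at x0)"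
 proof (rule tendstoI)
  fix e :: real assume e: "e > 0"
  hence "e / ?M > 0" using M by auto
  then obtain d where d: "d > 0" "!!v. v : polydisc I (g x0) d ==>
    norm (f v - f (g x0) - (SUM i:I. pd i f (g x0) * (v i - g x0 i))) <= e / ?M * (SUM i:I. norm (v i - g x0 i))"
   using frechet_estimate[OF I U f g(2), of "e / ?M" I] by auto
  have "\<forall>\<^sub>F x in at x0. ALL i:I. dist (g x i) (g x0 i) < d"
  proof (intro eventually_ball_finite[OF I] ballI)
   fix i assume "i : I"
   hence "((%x. g x i) \<longlongrightarrow> g x0 i) (at x0)"
    using DERIV_isCont[OF g'] by (simp add: isCont_def)
   thus "\<forall>\<^sub>F x in at x0. dist (g x i) (g x0 i) < d" using d(1) by (rule tendstoD)
  qed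
  hence "\<forall>\<^sub>F x in at x0. g x : polydisc I (g x0) d"
   using g(1) by eventually_elim (auto simp: polydisc_def)
  moreover have "\<forall>\<^sub>F x in at x0. x ~= x0" by (simp add: eventually_at_filter)
  ultimately show "\<forall>\<^sub>F x in at x0. dist ((f (g x) - f (g x0)) / (x - x0) - ?D x) 0 < e"
   using EN
  proof eventually_elim
   case (elim x)
   have eq: "(f (g x) - f (g x0)) / (x - x0) - ?D x =
     (f (g x) - f (g x0) - (SUM i:I. pd i f (g x0) * (g x i - g x0 i))) / (x - x0)"
    by (simp only: diff_divide_distrib[of "f (g x) - f (g x0)"] sum_divide_distrib times_divide_eq_right)
   have eqN: "(SUM i:I. norm (g x i - g x0 i)) / norm (x - x0) = ?N x"
    by (simp add: sum_divide_distrib norm_divide)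
   have "norm ((f (g x) - f (g x0)) / (x - x0) - ?D x) <= (e / ?M * (SUM i:I. norm (g x i - g x0 i))) / norm (x - x0)"
    unfolding eq norm_divide by (rule divide_right_mono[OF d(2)[OF elim(1)]]) simp
   also have "... = e / ?M * ?N x" unfolding eqN[symmetric] by (rule times_divide_eq_right[symmetric])
   also have "... < e / ?M * ?M" using elim(3) e M by (intro mult_strict_left_mono) auto
   also have "... = e" using M by auto
   finally show ?case by simp
  qed
 qed
 from tendsto_add[OF this D] show ?thesis by (simp add: has_field_derivative_iff)
qed

section \<open>Chart maps and the chain rule for them\<close>

lemma chart_map_extensional: "cmap J y w : extensional J"
 by (auto simp: chart_map_def)

lemma chart_map_apply: "j : J ==> cmap J y w j = y j w"
 by (auto simp: chart_map_def)

lemma chart_map_continuous: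
 assumes "openin (cspace I) U" "!!j. j : J ==> hol I U (y j)"
 shows "continuous_on U (cmap J y)"
proof (rule continuous_on_coordinatewise_then_product)
 fix j show "continuous_on U (%w. cmap J y w j)"
  by (cases "j : J") (auto simp: chart_map_def hol_continuous[OF assms])
qed

lemma chart_map_vimage_open:
 assumes "openin (cspace I) U" "!!j. j : J ==> hol I U (y j)" "openin (cspace J) V"
 shows "openin (cspace I) {w : U. cmap J y w : V}"
proof -
 obtain T where T: "open T" "V = extensional J \<inter> T" using assms(3) by (auto simp: cspace_eq openin_open)
 have "openin (cspace I) {w : U. cmap J y w : T}"
  by (rule openin_cspace_vimage[OF assms(1) chart_map_continuous[OF assms(1,2)] T(1)])
 thus ?thesis using T chart_map_extensional by (metis (mono_tags, lifting) Collect_cong IntD2 IntI)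
qed

lemma chain_rule:
 assumes I: "finite I" and J: "finite J" and U: "openin (cspace I) U" and V: "openin (cspace J) V"
  and y: "!!j. j : J ==> hol I U (y j)" and f: "hol J V f"
  and w: "w : U" "cmap J y w : V" and i: "i : I"
 shows "DERIV (%x. f (cmap J y (w(i := x)))) ((w i)) :> (SUM j:J. pd j f (cmap J y w) * pd i (y j) w)"
proof -
 have "DERIV (%x. f (cmap J y (w(i := x)))) ((w i)) :> (SUM j:J. pd j f (cmap J y (w(i := w i))) * pd i (y j) w)"
  by (rule chain_rule_curve[OF J V f])
   (insert w hol_has_pd[OF y i w(1)], auto simp: chart_map_extensional chart_map_apply)
 thus ?thesis by simp
qed

lemma hol_compose:
 assumes I: "finite I" and J: "finite J" and U: "openin (cspace I) U" and V: "openin (cspace J) V"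
  and y: "!!j. j : J ==> hol I U (y j)" and f: "hol J V f"
  and w: "!!w. w : U ==> cmap J y w : V"
 shows "hol I U (%w. f (cmap J y w))"
 unfolding holomorphic_fun_iff[OF U]
proof (intro conjI ballI)
 show "continuous_on U (%w. f (cmap J y w))"
  by (rule continuous_on_compose2[OF hol_continuous[OF V f] chart_map_continuous[OF U y]]) (use w in auto)
 fix v i assume v: "v : U" "i : I"
 thus "(%x. f (cmap J y (v(i := x)))) field_differentiable at (v i)"
  using chain_rule[OF I J U V y f v(1) w[OF v(1)] v(2)] field_differentiable_def by blast
qed

lemma pderiv_compose:
 assumes I: "finite I" and J: "finite J" and U: "openin (cspace I) U" and V: "openin (cspace J) V"
  and y: "!!j. j : J ==> hol I U (y j)" and f: "hol J V f"
  and w: "w : U" "cmap J y w : V" and i: "i : I"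
 shows "pd i (%w. f (cmap J y w)) w =
  (SUM j:J. pd j f (cmap J y w) * pd i (y j) w)"
 using DERIV_imp_deriv[OF chain_rule[OF assms]] by (simp add: pderiv_at_def)

text \<open>The difference quotients of \<open>f\<close> in direction \<open>k\<close> converge
  uniformly, as functions of the \<open>j\<close>-th variable, because the partial derivative is
  uniformly continuous on a compact bidisc. Weierstrass' theorem then makes the limit holomorphic
  and lets the derivatives converge too. One argument thus yields differentiability of
  \<open>pd k f\<close> and, through the explicit sequence, the symmetry of second
  derivatives.\<close>

lemma pderiv_differentiable_commute:
 assumes I: "finite I" and U: "openin (cspace I) U" and f: "hol I U f"
  and j: "j : I" and k: "k : I" and jk: "j ~= k" and w: "w : U"
 shows "EX D. DERIV (%x. pd k f (w(j := x))) ((w j)) :> D &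
   (%n. (pd j f (w(k := w k + 1 / of_nat (Suc n))) - pd j f w) * of_nat (Suc n)) \<longlonglongrightarrow> D"
proof -
 obtain d where d: "d > 0" "polydisc I w d <= U" and ext: "w : extensional I"
  using U w unfolding openin_cspace_iff[OF I] by blast
 define r where "r = d/2"
 have r: "r > 0" "r < d" using d by (auto simp: r_def)
 let ?p = "%z. w(j := fst z, k := snd z)"
 let ?W = "cball (w j) r \<times> cball (w k) r"
 have p: "?p z : U" if "z : ?W" for z
  using d that r ext j k by (intro subsetD[OF d(2)]) (auto simp: polydisc_def extensional_def dist_commute)
 have upd: "(w(j := x))(k := y) = ?p (x,y)" "(w(k := y))(j := x) = ?p (x,y)" for x y
  using jk by (auto simp: fun_upd_twist)
 have c: "continuous_on ?W (%z. pd k f (?p z))"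
 proof (rule continuous_on_compose2[OF pderiv_continuous[OF I U f k]])
  show "continuous_on ?W ?p"
  proof (rule continuous_on_coordinatewise_then_product)
   fix i show "continuous_on ?W (%z. ?p z i)"
    by (cases "i = k"; cases "i = j") (auto intro!: continuous_intros)
  qed
 qed (use p in auto)
 have uc: "uniformly_continuous_on ?W (%z. pd k f (?p z))"
  by (rule compact_uniformly_continuous[OF c compact_Times[OF compact_cball compact_cball]])
 \<comment> \<open>Dropping the first \<open>N\<close> terms makes every step size
   \<open>1 / Suc (n + N)\<close> at most \<open>r\<close>; \<open>LIMSEQ_offset\<close> removes the
   shift in the end.\<close>
 define N where "N = nat \<lceil>1/r\<rceil>"
 have small: "norm (1 / of_nat (Suc (n + N)) :: complex) <= r" for n
 proof -
  have "1/r <= real (Suc (n + N))" unfolding N_def by linarith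
  thus ?thesis using r by (simp add: norm_divide field_simps del: of_nat_Suc of_nat_add)
 qed
 define h where "h n = 1 / complex_of_nat (Suc (n + N))" for n
 have h: "norm (h n) <= r" "h n ~= 0" for n using small[of n] by (auto simp: h_def of_nat_neq_0 simp del: of_nat_add of_nat_Suc)
 have hlim: "(%n. h n) \<longlonglongrightarrow> 0" unfolding h_def
  using LIMSEQ_ignore_initial_segment[OF lim_1_over_n[where 'a=complex], of "Suc N"] by (simp add: ac_simps)
 define F where "F n x = (f (?p (x, w k + h n)) - f (?p (x, w k))) / h n" for n x
 define F' where "F' n x = (pd j f (?p (x, w k + h n)) - pd j f (?p (x, w k))) / h n" for n x
 define G where "G x = pd k f (?p (x, w k))" for x
 have kin: "w k + h n : cball (w k) r" for n using h by (auto simp: dist_norm)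
 have dj: "DERIV (%x. f (?p (x,y))) x :> pd j f (?p (x,y))" if "x : ball (w j) r" "y : cball (w k) r" for x y
 proof -
  have "DERIV (%z. f ((?p (x,y))(j := z))) (((?p (x,y)) j)) :> pd j f (?p (x,y))"
   by (rule hol_has_pd[OF f j p]) (use that in auto)
  thus ?thesis using jk by (simp add: fun_upd_twist)
 qed
 have dk: "DERIV (%y. f (?p (x,y))) y :> pd k f (?p (x,y))" if "x : cball (w j) r" "y : cball (w k) r" for x y
 proof -
  have "DERIV (%z. f ((?p (x,y))(k := z))) (((?p (x,y)) k)) :> pd k f (?p (x,y))"
   by (rule hol_has_pd[OF f k p]) (use that in auto)
  thus ?thesis by simp
 qed
 have ul: "uniform_limit (cball (w j) r) F G sequentially"
 proof (rule uniform_limitI)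
  fix e :: real assume e: "e > 0"
  then obtain s where s: "s > 0" "!!z z'. z : ?W ==> z' : ?W ==> dist z' z < s ==> dist (pd k f (?p z')) (pd k f (?p z)) < e/2"
   using uc unfolding uniformly_continuous_on_def by (metis half_gt_zero)
  have "\<forall>\<^sub>F n in sequentially. dist (h n) 0 < s" using hlim s(1) by (rule tendstoD)
  thus "\<forall>\<^sub>F n in sequentially. ALL x:cball (w j) r. dist (F n x) (G x) < e"
  proof eventually_elim
   case (elim n)
   show ?case
   proof
    fix x assume x: "x : cball (w j) r"
    let ?S = "cball (w k) r \<inter> cball (w k) (norm (h n))"
    let ?g = "%y. f (?p (x,y)) - G x * y"
    have "norm (?g (w k + h n) - ?g (w k)) <= (e/2) * norm ((w k + h n) - w k)"
    proof (rule field_differentiable_bound[where S = ?S and f' = "%y. pd k f (?p (x,y)) - G x"])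
     show "convex ?S" by (intro convex_Int convex_cball)
     fix y assume y: "y : ?S"
     show "(?g has_field_derivative pd k f (?p (x,y)) - G x) (at y within ?S)"
      by (rule derivative_eq_intros has_field_derivative_at_within[OF dk] | use x y in simp)+
     have "dist (x,y) (x, w k) < s" using y elim by (auto simp: dist_Pair_Pair dist_commute)
     thus "norm (pd k f (?p (x,y)) - G x) <= e/2"
      using s(2)[of "(x, w k)" "(x,y)"] x y r by (auto simp: G_def dist_norm)
    qed (insert h r, auto simp: dist_norm)
    moreover have "(F n x - G x) * h n = ?g (w k + h n) - ?g (w k)"
     using h(2)[of n] by (simp add: F_def field_simps)
    ultimately have "norm ((F n x - G x) * h n) <= e/2 * norm (h n)"
     by simp
    hence "norm (F n x - G x) <= e/2" using h(2)[of n] by (simp add: norm_mult)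
    thus "dist (F n x) (G x) < e" using e by (simp add: dist_norm)
   qed
  qed
 qed
 have "EX g'. ALL x:ball (w j) r. DERIV G x :> g' x & (%n. F' n x) \<longlonglongrightarrow> g' x"
 proof (rule has_complex_derivative_uniform_sequence)
  fix n x assume x: "x : ball (w j) r"
  show "DERIV (F n) x :> F' n x"
   unfolding F_def[abs_def] F'_def
   by (intro DERIV_cdivide DERIV_diff dj[OF x] kin) (use r in auto)
 next
  fix x assume x: "x : ball (w j) r"
  then obtain e where "e > 0" "cball x e <= ball (w j) r" using open_contains_cball open_ball by metis
  thus "EX d>0. cball x d <= ball (w j) r & uniform_limit (cball x d) F G sequentially"
   using uniform_limit_on_subset[OF ul] ball_subset_cball by (metis subset_trans)
 qed auto
 then obtain D where D: "DERIV G ((w j)) :> D" "(%n. F' n (w j)) \<longlonglongrightarrow> D"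
  using r by (metis centre_in_ball)
 have 1: "?p (x, w k) = w(j := x)" for x using jk by auto
 have 2: "?p (w j, y) = w(k := y)" for y by auto
 have "(%n. (pd j f (w(k := w k + 1 / of_nat (Suc n))) - pd j f w) * of_nat (Suc n)) \<longlonglongrightarrow> D"
  by (rule LIMSEQ_offset[of _ N]) (insert D(2), simp add: F'_def 2 h_def del: of_nat_Suc of_nat_add)
 moreover have "DERIV (%x. pd k f (w(j := x))) ((w j)) :> D"
  using D(1) unfolding G_def[abs_def] 1 .
 ultimately show ?thesis by blast
qed

lemma hol_pderiv:
 assumes I: "finite I" and U: "openin (cspace I) U" and f: "hol I U f" and k: "k : I"
 shows "hol I U (pd k f)"
 unfolding holomorphic_fun_iff[OF U]
proof (intro conjI ballI)
 show "continuous_on U (pd k f)" by (rule pderiv_continuous[OF assms])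
 fix w i assume w: "w : U" "i : I"
 show "(%x. pd k f (w(i := x))) field_differentiable at (w i)"
 proof (cases "i = k")
  case True
  have "deriv (%x. f (w(k := x))) holomorphic_on {x. w(k := x) : U}"
   by (intro holomorphic_deriv holomorphic_fun_slice[OF f k] slice_open[OF I U k])
  thus ?thesis
   unfolding pderiv_at_upd True
   by (rule holomorphic_on_imp_differentiable_at) (use w slice_open[OF I U k] in auto)
 next
  case False
  thus ?thesis using pderiv_differentiable_commute[OF I U f w(2) k False w(1)] by (auto simp: field_differentiable_def)
 qed
qed

text \<open>The sequence of \<open>pderiv_differentiable_commute\<close> consists of difference
  quotients of \<open>pd j f\<close> in direction \<open>k\<close>; hence its limit is also the
  other mixed derivative.\<close>

lemma pderiv_commute:
 assumes I: "finite I" and U: "openin (cspace I) U" and f: "hol I U f"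
  and j: "j : I" and k: "k : I" and w: "w : U"
 shows "pd j (pd k f) w = pd k (pd j f) w"
proof (cases "j = k")
 case False
 obtain D where D: "DERIV (%x. pd k f (w(j := x))) ((w j)) :> D"
  "(%n. (pd j f (w(k := w k + 1 / of_nat (Suc n))) - pd j f w) * of_nat (Suc n)) \<longlonglongrightarrow> D"
  using pderiv_differentiable_commute[OF I U f j k False w] by blast
 have "DERIV (%x. pd j f (w(k := x))) ((w k)) :> pd k (pd j f) w"
  by (rule hol_has_pd[OF hol_pderiv[OF I U f j] k w])
 hence "((%h. (pd j f (w(k := w k + h)) - pd j f w) / h) \<longlongrightarrow> pd k (pd j f) w) (at 0)"
  by (simp add: DERIV_def)
 moreover have "filterlim (%n. 1 / complex_of_nat (Suc n)) (at 0) sequentially"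
  unfolding filterlim_at using LIMSEQ_Suc[OF lim_1_over_n[where 'a=complex]] by (auto simp del: of_nat_Suc)
 ultimately have "(%n. (pd j f (w(k := w k + 1 / of_nat (Suc n))) - pd j f w) / (1 / of_nat (Suc n))) \<longlonglongrightarrow> pd k (pd j f) w"
  by (rule filterlim_compose)
 hence "D = pd k (pd j f) w"
  using D(2) LIMSEQ_unique by (simp del: of_nat_Suc) 
 thus ?thesis using DERIV_imp_deriv[OF D(1)] by (simp add: pderiv_at_def[of j])
qed simp

section \<open>Coordinate systems\<close>

text \<open>An explicit holomorphic inverse \<open>g\<close> takes the place of
  \<open>inv_into\<close> and of an inverse function theorem. New charts are verified in this way
  throughout.\<close>

lemma coordinate_systemI:
 assumes U: "openin (cspace I) U" and J: "finite J" and V: "openin (cspace J) V"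
  and y: "!!j. j : J ==> hol I U (y j)"
  and g: "!!i. i : I ==> hol J V (g i)"
  and yV: "!!w. w : U ==> cmap J y w : V" and gU: "!!v. v : V ==> cmap I g v : U"
  and gy: "!!w. w : U ==> cmap I g (cmap J y w) = w"
  and yg: "!!v. v : V ==> cmap J y (cmap I g v) = v"
 shows "csys I U J y" "cmap J y ` U = V"
proof -
 show im: "cmap J y ` U = V"
  using yV gU yg by (auto simp: image_iff) metis
 have inj: "inj_on (cmap J y) U" using gy by (intro inj_on_inverseI[where g = "cmap I g"])
 have "hol J V (%v. inv_into U (cmap J y) v i)" if i: "i : I" for i
 proof -
  have "inv_into U (cmap J y) v i = g i v" if v: "v : V" for v
  proof -
   have "inv_into U (cmap J y) v = cmap I g v"
    using inv_into_f_f[OF inj gU[OF v]] yg[OF v] by simp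
   thus ?thesis using i by (simp add: chart_map_apply)
  qed
  thus ?thesis using holomorphic_fun_cong[OF J V] g[OF i] by metis
 qed
 thus "csys I U J y"
  unfolding coordinate_system_def im using U y inj V by blast
qed

lemma chart_inverse:
 assumes I: "finite I" and c: "csys I U J y"
 defines "V \<equiv> cmap J y ` U" and "g \<equiv> %i v. inv_into U (cmap J y) v i"
 shows "openin (cspace I) U" "openin (cspace J) V"
  "!!j. j : J ==> hol I U (y j)" "!!i. i : I ==> hol J V (g i)"
  "!!w. w : U ==> cmap J y w : V" "!!v. v : V ==> cmap I g v : U"
  "!!w. w : U ==> cmap I g (cmap J y w) = w"
  "!!v. v : V ==> cmap J y (cmap I g v) = v"
proof -
 show U: "openin (cspace I) U" and "openin (cspace J) V"
  and "!!j. j : J ==> hol I U (y j)" and "!!i. i : I ==> hol J V (g i)"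
  and "!!w. w : U ==> cmap J y w : V"
  using c by (auto simp: coordinate_system_def V_def g_def)
 have *: "cmap I g v = inv_into U (cmap J y) v" if v: "v : V" for v
 proof -
  have "inv_into U (cmap J y) v : extensional I"
   using v inv_into_into[of v "cmap J y" U] openin_cspace_subset[OF U] by (auto simp: V_def)
  thus ?thesis by (auto simp: chart_map_def g_def extensional_restrict)
 qed
 have inj: "inj_on (cmap J y) U" using c by (simp add: coordinate_system_def)
 show "cmap I g v : U" if "v : V" for v
  unfolding *[OF that] using that inv_into_into by (metis V_def)
 show "cmap J y (cmap I g v) = v" if "v : V" for v
  unfolding *[OF that] using that f_inv_into_f by (metis V_def)
 show "cmap I g (cmap J y w) = w" if "w : U" for w
 proof -
  have "cmap J y w : V" using that by (auto simp: V_def)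
  thus ?thesis using * inv_into_f_f[OF inj that] by simp
 qed
qed

text \<open>For maps that are mutually inverse only where both compositions make sense, the
  preimages of the two domains under the two maps are exchanged bijectively. Branch conditions can
  therefore be imposed on each side separately.\<close>

lemma coordinate_system_local:
 assumes I: "finite I" and J: "finite J" and W: "openin (cspace I) W" and W': "openin (cspace J) W'"
  and y: "!!j. j : J ==> hol I W (y j)"
  and g: "!!i. i : I ==> hol J W' (g i)"
  and gy: "!!w. w : W ==> cmap J y w : W' ==> cmap I g (cmap J y w) = w"
  and yg: "!!v. v : W' ==> cmap I g v : W ==> cmap J y (cmap I g v) = v"
 shows "csys I {w : W. cmap J y w : W'} J y"
  and "cmap J y ` {w : W. cmap J y w : W'} = {v : W'. cmap I g v : W}"
proof -
 let ?U = "{w : W. cmap J y w : W'}" and ?V = "{v : W'. cmap I g v : W}"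
 have U: "openin (cspace I) ?U" by (rule chart_map_vimage_open[OF W y W'])
 have V: "openin (cspace J) ?V" by (rule chart_map_vimage_open[OF W' g W])
 note * = coordinate_systemI[OF U J V, of y g]
 have 1: "hol I ?U (y j)" if "j : J" for j by (rule holomorphic_fun_subset[OF y[OF that]]) auto
 have 2: "hol J ?V (g i)" if "i : I" for i by (rule holomorphic_fun_subset[OF g[OF that]]) auto
 show "csys I ?U J y" "cmap J y ` ?U = ?V"
  using *[OF 1 2] gy yg by auto
qed

lemma coordinate_system_restrict:
 assumes I: "finite I" and J: "finite J" and c: "csys I U J y"
  and U': "openin (cspace I) U'" "U' <= U"
 shows "csys I U' J y"
proof -
 note * = chart_inverse[OF I c]
 let ?V = "cmap J y ` U" and ?g = "%i v. inv_into U (cmap J y) v i"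
 have "csys I {w : U'. cmap J y w : ?V} J y"
 proof (rule coordinate_system_local[OF I J U'(1) *(2), of y ?g])
  show "hol I U' (y j)" if "j : J" for j by (rule holomorphic_fun_subset[OF *(3)[OF that] U'(2)])
  show "hol J ?V (?g i)" if "i : I" for i by (rule *(4)[OF that])
  show "cmap I ?g (cmap J y w) = w" if "w : U'" for w using that U' by (intro *(7)) auto
  show "cmap J y (cmap I ?g v) = v" if "v : ?V" for v by (rule *(8)[OF that])
 qed
 moreover have "{w : U'. cmap J y w : ?V} = U'" using U' by auto
 ultimately show ?thesis by simp
qed

lemma coordinate_system_compose:
 assumes I: "finite I" and J: "finite J" and K: "finite K" and c: "csys I U J y"
  and d: "csys J V K z" and sub: "cmap J y ` U <= V"
 shows "csys I U K (%k w. z k (cmap J y w))"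
proof -
 let ?V = "cmap J y ` U" and ?g = "%i v. inv_into U (cmap J y) v i"
 note c' = chart_inverse[OF I c]
 have d0: "csys J ?V K z" by (rule coordinate_system_restrict[OF J K d c'(2) sub])
 let ?X = "cmap K z ` ?V" and ?h = "%i v. inv_into ?V (cmap K z) v i"
 note d' = chart_inverse[OF J d0]
 let ?y = "%k w. z k (cmap J y w)" and ?f = "%i v. ?g i (cmap J ?h v)"
 have eq: "cmap K ?y w = cmap K z (cmap J y w)" for w by (simp add: chart_map_def)
 have eq': "cmap I ?f v = cmap I ?g (cmap J ?h v)" for v by (simp add: chart_map_def)
 show ?thesis
 proof (rule coordinate_systemI(1)[OF c'(1) K d'(2), where g = ?f])
  show "hol I U (?y k)" if "k : K" for k
   by (rule hol_compose[OF I J c'(1,2) c'(3) d'(3)[OF that]]) auto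
  show "hol K ?X (?f i)" if "i : I" for i
   by (rule hol_compose[OF K J d'(2) c'(2) d'(4) c'(4)[OF that]]) (use d'(6) in auto)
  show "cmap K ?y w : ?X" if "w : U" for w unfolding eq using that by auto
  show "cmap I ?f v : U" if "v : ?X" for v unfolding eq' using that by (intro c'(6) d'(6))
  show "cmap I ?f (cmap K ?y w) = w" if "w : U" for w
   unfolding eq eq' using that d'(7)[of "cmap J y w"] c'(7) by simp
  show "cmap K ?y (cmap I ?f v) = v" if "v : ?X" for v
   unfolding eq eq' using that c'(8)[OF d'(6)] d'(8) by simp
 qed
qed

text \<open>Multiplication by the derivative of the inverse chart, through the chain rule, isolates
  the coefficient \<open>X k\<close>. This is the form in which invertibility of the Jacobian is
  used: coefficients with respect to the differentials of coordinates are unique.\<close>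

lemma coordinate_system_jacobian:
 assumes I: "finite I" and J: "finite J" and c: "csys I U J y" and w: "w : U"
  and X: "!!b. b : I ==> (SUM j:J. X j * pd b (y j) w) = 0" and k: "k : J"
 shows "X k = 0"
proof -
 note c' = chart_inverse[OF I c]
 let ?V = "cmap J y ` U" and ?g = "%i v. inv_into U (cmap J y) v i"
 let ?v = "cmap J y w"
 have v: "?v : ?V" using w by auto
 have gv: "cmap I ?g ?v = w" by (rule c'(7)[OF w])
 have *: "(SUM b:I. pd b (y j) w * pd k (?g b) ?v) = (if j = k then 1 else 0)" if j: "j : J" for j
 proof -
  have "pd k (%v. y j (cmap I ?g v)) ?v = (SUM b:I. pd b (y j) w * pd k (?g b) ?v)"
   using pderiv_compose[OF J I c'(2,1) c'(4) c'(3)[OF j] v _ k] gv w by simp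
  moreover have "pd k (%v. y j (cmap I ?g v)) ?v = pd k (%v. v j) ?v"
  proof (rule pderiv_at_cong[OF J c'(2) k v])
   fix u assume "u : ?V"
   hence "cmap J y (cmap I ?g u) = u" by (rule c'(8))
   thus "y j (cmap I ?g u) = u j" using chart_map_apply[OF j] by metis
  qed
  moreover have "pd k (%v. v j) ?v = (if j = k then 1 else 0)"
   by (cases "j = k") (auto simp: pderiv_at_def)
  ultimately show ?thesis by simp
 qed
 have "0 = (SUM b:I. (SUM j:J. X j * pd b (y j) w) * pd k (?g b) ?v)"
  using X by simp
 also have "... = (SUM j:J. X j * (SUM b:I. pd b (y j) w * pd k (?g b) ?v))"
  by (simp add: sum_distrib_left sum_distrib_right mult.assoc sum.swap[of _ J I])
 also have "... = (SUM j:J. X j * (if j = k then 1 else 0))"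
  by (intro sum.cong refl) (simp add: *)
 also have "... = X k" using J k by (simp add: sum.delta' mult_delta_right)
 finally show ?thesis by simp
qed

text \<open>The straight segment from \<open>w\<close> to \<open>v\<close> stays in the polydisc,
  and along it the chain rule gives derivative zero.\<close>

lemma pderiv_zero_constant:
 assumes I: "finite I" and w: "w : extensional I" and f: "hol I (polydisc I w d) f"
  and z: "!!v i. v : polydisc I w d ==> i : I ==> pd i f v = 0"
  and v: "v : polydisc I w d"
 shows "f v = f w"
proof -
 let ?g = "%x::complex. \<lambda>i\<in>I. w i + x * (v i - w i)"
 have "EX c. ALL x:closed_segment 0 (1::complex). f (?g x) = c"
 proof (rule has_field_derivative_zero_constant)
  fix x :: complex assume x: "x : closed_segment 0 1"
  hence nx: "norm x <= 1" using segment_bound(1)[of x 0 1] by simp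
  have gx: "?g x : polydisc I w d"
  proof -
   have "dist (w i + x * (v i - w i)) (w i) < d" if "i : I" for i
   proof -
    have "norm (x * (v i - w i)) <= 1 * norm (v i - w i)"
     unfolding norm_mult by (rule mult_right_mono[OF nx]) simp
    also have "... < d" using v that by (auto simp: polydisc_def dist_norm)
    finally show ?thesis by (simp add: dist_norm)
   qed
   thus ?thesis by (auto simp: polydisc_def)
  qed
  have "DERIV (%x. f (?g x)) x :> (SUM i:I. pd i f (?g x) * (v i - w i))"
  proof (rule chain_rule_curve[OF I openin_polydisc[OF I] f])
   show "DERIV (%x. ?g x i) x :> v i - w i" if "i : I" for i
    using that by (auto intro!: derivative_eq_intros)
  qed (use gx in auto)
  thus "((%x. f (?g x)) has_field_derivative 0) (at x within closed_segment 0 1)"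
   using z[OF gx] by (simp add: has_field_derivative_at_within)
 qed auto
 then obtain c where "ALL x:closed_segment 0 (1::complex). f (?g x) = c" ..
 hence "f (?g 0) = c" "f (?g 1) = c" by (simp_all only: ends_in_segment)
 hence "f (?g 0) = f (?g 1)" by simp
 moreover have "?g 0 = w" using w by (simp add: extensional_restrict)
 moreover have "?g 1 = v" using v by (simp add: extensional_restrict polydisc_def)
 ultimately show ?thesis by simp
qed

text \<open>
  A vector field \<open>\<partial>\<^sub>e\<close> that preserves a flat metric is a Killing field; if moreover the dual one-form
  \<open>g(\<partial>\<^sub>e, -)\<close> is closed, then the covariant derivative of this form is both symmetric and
  antisymmetric, so the form has constant coefficients in flat coordinates.
\<close>

lemma flat_one_form:
 assumes I: "finite I" and J: "finite J" and c: "csys I V J t" and e: "e : I"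
  and g: "!!w a b. w : V ==> a : I ==> b : I ==>
    g w a b = (SUM i:J. SUM j:J. G i j * pd a (t i) w * pd b (t j) w)"
  and sym: "!!w a b. w : V ==> a : I ==> b : I ==> g w a b = g w b a"
  and inv: "!!w x a b. w : V ==> w(e := x) : V ==> a : I ==> b : I ==> g (w(e := x)) a b = g w a b"
  and curl: "!!w a b. w : V ==> a : I ==> b : I ==>
    pd a (%w. g w e b) w = pd b (%w. g w e a) w"
  and w0: "w0 : V"
 obtains d E where "d > 0" "polydisc I w0 d <= V"
  "!!w b. w : polydisc I w0 d ==> b : I ==> g w e b = (SUM j:J. E j * pd b (t j) w)"
proof -
 have V: "openin (cspace I) V" and t: "!!j. j : J ==> hol I V (t j)"
  using chart_inverse[OF I c] by auto
 \<comment> \<open>The constant matrix of a flat coordinate system may be asymmetric; since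
   \<open>g\<close> is symmetric, it can be symmetrised.\<close>
 define H where "H i j = (G i j + G j i) / 2" for i j
 have Hsym: "H i j = H j i" for i j by (simp add: H_def)
 have gH: "g w a b = (SUM i:J. SUM j:J. H i j * pd a (t i) w * pd b (t j) w)"
  if w: "w : V" "a : I" "b : I" for w a b
 proof -
  have "2 * g w a b = g w a b + g w b a" using sym[OF w] by simp
  also have "... = (SUM i:J. SUM j:J. G i j * pd a (t i) w * pd b (t j) w)
    + (SUM j:J. SUM i:J. G i j * pd b (t i) w * pd a (t j) w)"
   unfolding g[OF w] g[OF w(1,3,2)] by (subst (4) sum.swap) simp
  also have "... = 2 * (SUM i:J. SUM j:J. H i j * pd a (t i) w * pd b (t j) w)"
   unfolding sum.distrib[symmetric] sum_distrib_left H_def by (intro sum.cong refl) (simp add: algebra_simps)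
  finally show ?thesis by simp
 qed
 define D2 where "D2 a b i w = pd a (pd b (t i)) w" for a b i w
 have D2: "DERIV (%x. pd b (t i) (w(a := x))) ((w a)) :> D2 a b i w"
  if "w : V" "a : I" "b : I" "i : J" for a b i w
  unfolding D2_def using that by (intro hol_has_pd[of I V] hol_pderiv I V t)
 have D2c: "D2 a b i w = D2 b a i w" if "w : V" "a : I" "b : I" "i : J" for a b i w
  unfolding D2_def using that by (intro pderiv_commute[of I V] I V t)
 \<comment> \<open>These are the components of the one-form \<open>g(\<partial>\<^sub>e, -)\<close>
   in the flat coordinates.\<close>
 define E where "E j w = (SUM i:J. H i j * pd e (t i) w)" for j w
 have hE: "hol I V (E j)" for j
  unfolding E_def by (intro hol_sum[OF V] hol_cmult[OF V] hol_pderiv I V t e)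
 have gE: "g w e b = (SUM j:J. E j w * pd b (t j) w)" if "w : V" "b : I" for w b
  unfolding gH[OF that(1) e that(2)] E_def sum_distrib_right by (rule sum.swap)
 have dE: "DERIV (%x. E j (w(a := x))) ((w a)) :> pd a (E j) w" if "w : V" "a : I" for j w a
  by (rule hol_has_pd[OF hE that(2,1)])
 have dE': "pd a (E j) w = (SUM i:J. H i j * D2 a e i w)" if w: "w : V" "a : I" for j w a
 proof -
  have "DERIV (%x. E j (w(a := x))) ((w a)) :> (SUM i:J. H i j * D2 a e i w)"
   unfolding E_def by (intro DERIV_sum DERIV_cmult D2 w e)
  thus ?thesis using DERIV_unique dE[OF w] by blast
 qed
 \<comment> \<open>In flat coordinates the covariant derivative is the ordinary derivative of the
   components; \<open>M\<close> is this tensor written in the ambient coordinates.\<close>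
 define M where "M a b w = (SUM j:J. pd a (E j) w * pd b (t j) w)" for a b w
 \<comment> \<open>This is the Killing equation: the derivative of the locally constant function
   \<open>x \<mapsto> g (w(e := x)) a b\<close>, with second derivatives of \<open>t\<close>
   interchanged.\<close>
 have anti: "M a b w + M b a w = 0" if w: "w : V" "a : I" "b : I" for a b w
 proof -
  have "DERIV (%x. SUM i:J. SUM j:J. H i j * (pd a (t i) (w(e := x)) * pd b (t j) (w(e := x)))) ((w e)) :> (SUM i:J. SUM j:J. H i j * (D2 e a i w * pd b (t j) (w(e := w e)) + D2 e b j w * pd a (t i) (w(e := w e))))"
   by (intro DERIV_sum DERIV_cmult DERIV_mult D2 w e)
  moreover have "DERIV (%x. SUM i:J. SUM j:J. H i j * (pd a (t i) (w(e := x)) * pd b (t j) (w(e := x)))) ((w e)) :> 0"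
  proof -
   have "\<forall>\<^sub>F x in nhds (w e). (SUM i:J. SUM j:J. H i j * (pd a (t i) (w(e := x)) * pd b (t j) (w(e := x)))) = g w a b"
    using slice_eventually[OF I V e w(1)]
   proof eventually_elim
    case (elim x)
    have "g w a b = g (w(e := x)) a b" using inv[OF w(1) elim w(2,3)] by simp
    thus ?case using gH[OF elim w(2,3)] by (simp add: mult.assoc)
   qed
   thus ?thesis by (rule DERIV_cong_ev[OF refl _ refl, THEN iffD2]) (rule DERIV_const)
  qed
  ultimately have "0 = (SUM i:J. SUM j:J. H i j * (D2 e a i w * pd b (t j) w + D2 e b j w * pd a (t i) w))"
   using DERIV_unique by fastforce
  also have "... = (SUM i:J. SUM j:J. H i j * D2 e a i w * pd b (t j) w) + (SUM i:J. SUM j:J. H i j * D2 e b j w * pd a (t i) w)"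
   by (simp add: algebra_simps sum.distrib)
  also have "(SUM i:J. SUM j:J. H i j * D2 e a i w * pd b (t j) w) = M a b w"
   unfolding M_def dE'[OF w(1,2)] sum_distrib_right
   by (subst sum.swap) (intro sum.cong refl, simp add: D2c w e)
  also have "(SUM i:J. SUM j:J. H i j * D2 e b j w * pd a (t i) w) = M b a w"
   unfolding M_def dE'[OF w(1,3)] sum_distrib_right
   by (intro sum.cong refl) (simp add: D2c w e Hsym)
  finally show ?thesis by simp
 qed
 have sm: "M a b w = M b a w" if w: "w : V" "a : I" "b : I" for a b w
 proof -
  have *: "pd a (%w. g w e b) w = M a b w + (SUM j:J. E j w * D2 a b j w)" if w: "w : V" "a : I" "b : I" for a b
  proof -
   have "pd a (%w. g w e b) w = pd a (%w. SUM j:J. E j w * pd b (t j) w) w"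
    by (rule pderiv_at_cong[OF I V w(2,1)]) (simp add: gE w)
   also have "DERIV (%x. SUM j:J. E j (w(a := x)) * pd b (t j) (w(a := x))) ((w a)) :> (SUM j:J. pd a (E j) w * pd b (t j) (w(a := w a)) + D2 a b j w * E j (w(a := w a)))"
    by (intro DERIV_sum DERIV_mult dE D2 w)
   hence "pd a (%w. SUM j:J. E j w * pd b (t j) w) w = (SUM j:J. pd a (E j) w * pd b (t j) w + D2 a b j w * E j w)"
    unfolding pderiv_at_def[of a "%w. SUM j:J. E j w * pd b (t j) w"] using DERIV_imp_deriv by fastforce
   finally show ?thesis by (simp add: M_def sum.distrib mult.commute)
  qed
  show ?thesis using *[OF w] *[OF w(1,3,2)] curl[OF w] D2c[OF w] by simp
 qed
 have M0: "M a b w = 0" if "w : V" "a : I" "b : I" for a b w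
  using anti[OF that] sm[OF that] by simp
 have E0: "pd a (E j) w = 0" if w: "w : V" "a : I" "j : J" for a j w
  by (rule coordinate_system_jacobian[OF I J c w(1), of "%j. pd a (E j) w"])
   (insert M0 w, auto simp: M_def)
 obtain d where d: "d > 0" "polydisc I w0 d <= V" using V w0 unfolding openin_cspace_iff[OF I] by blast
 have "w0 : extensional I" using w0 openin_cspace_subset[OF V] by auto
 hence cE: "E j w = E j w0" if "w : polydisc I w0 d" "j : J" for w j
  using that d by (intro pderiv_zero_constant[OF I _ holomorphic_fun_subset[OF hE d(2)]] E0) auto
 show ?thesis
 proof (rule that[OF d, of "%j. E j w0"])
  fix w b assume w: "w : polydisc I w0 d" "b : I"
  hence "w : V" using d by auto
  thus "g w e b = (SUM j:J. E j w0 * pd b (t j) w)"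
   using gE w by (auto intro!: sum.cong simp: cE)
 qed
qed

section \<open>Polynomial functions\<close>

text \<open>Different indices \<open>k\<close> may carry the same exponent vector, and their
  coefficients are collected. Sums and products of polynomials can thus keep their natural index
  sets.\<close>

lemma polynomial_inI:
 fixes c :: "'k => complex" and h :: "'k => nat => nat"
 assumes "finite K" "!!x. P x = (SUM k:K. c k * (PROD i=1..n. x i ^ h k i))"
 shows "polynomial_in n P"
 unfolding polynomial_in_def
proof (intro exI conjI allI)
 show "finite (h ` K)" using assms(1) by simp
 fix x
 show "P x = (SUM e:h ` K. (SUM k:{k\<in>K. h k = e}. c k) * (PROD i=1..n. x i ^ e i))"
  unfolding assms(2) sum.image_gen[OF assms(1), where g = h] sum_distrib_right
  by (intro sum.cong refl) auto
qed

lemma polynomial_in_const: "polynomial_in n (%_. c)"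
 by (rule polynomial_inI[where K = "{()}" and c = "%_. c" and h = "%_ _. 0"]) auto

lemma polynomial_in_var:
 assumes "i : {1..n}" shows "polynomial_in n (%x. x i)"
proof (rule polynomial_inI[where K = "{()}" and c = "%_. 1" and h = "%_ j. if j = i then 1 else 0"])
 fix x :: "nat => complex"
 have "(PROD j=1..n. x j ^ (if j = i then 1 else 0)) = (PROD j=1..n. if j = i then x j else 1)"
  by (intro prod.cong refl) auto
 thus "x i = (SUM k:{()}. 1 * (PROD j=1..n. x j ^ (if j = i then 1 else 0)))"
  using assms by (simp add: prod.delta)
qed auto

lemma polynomial_in_add:
 assumes "polynomial_in n P" "polynomial_in n Q" shows "polynomial_in n (%x. P x + Q x)"
proof -
 obtain E a where E: "finite E" "!!x. P x = (SUM e:E. a e * (PROD i=1..n. x i ^ e i))"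
  using assms(1) unfolding polynomial_in_def by blast
 obtain F b where F: "finite F" "!!x. Q x = (SUM e:F. b e * (PROD i=1..n. x i ^ e i))"
  using assms(2) unfolding polynomial_in_def by blast
 show ?thesis
  by (rule polynomial_inI[where K = "E <+> F" and c = "case_sum a b" and h = "case_sum id id"])
   (simp_all add: E F sum.Plus)
qed

lemma polynomial_in_mult:
 assumes "polynomial_in n P" "polynomial_in n Q" shows "polynomial_in n (%x. P x * Q x)"
proof -
 obtain E a where E: "finite E" "!!x. P x = (SUM e:E. a e * (PROD i=1..n. x i ^ e i))"
  using assms(1) unfolding polynomial_in_def by blast
 obtain F b where F: "finite F" "!!x. Q x = (SUM e:F. b e * (PROD i=1..n. x i ^ e i))"
  using assms(2) unfolding polynomial_in_def by blast
 show ?thesis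
 proof (rule polynomial_inI[where K = "E \<times> F" and c = "%(e, f). a e * b f" and h = "%(e, f) i. e i + f i"])
  fix x
  show "P x * Q x = (SUM k:E \<times> F. (case k of (e, f) => a e * b f) * (PROD i=1..n. x i ^ (case k of (e, f) => %i. e i + f i) i))"
   unfolding E(2) F(2) sum_product sum.cartesian_product
   by (intro sum.cong refl) (auto simp: power_add prod.distrib)
 qed (use E F in auto)
qed

lemma polynomial_in_sum:
 "(!!a. a : A ==> polynomial_in n (f a)) ==> polynomial_in n (%x. SUM a:A. f a x)"
 by (induction A rule: infinite_finite_induct) (auto intro: polynomial_in_const polynomial_in_add)

lemma hol_polynomial:
 assumes U: "openin (cspace I) U" and P: "polynomial_in n P"
  and y: "!!i. i : {1..n} ==> hol I U (y i)"
 shows "hol I U (%w. P (%i. y i w))"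
proof -
 obtain E a where E: "!!x. P x = (SUM e:E. a e * (PROD i=1..n. x i ^ e i))"
  using P unfolding polynomial_in_def by blast
 show ?thesis unfolding E
  by (intro hol_sum[OF U] hol_mult[OF U] hol_const[OF U] hol_prod[OF U] hol_power[OF U] y)
qed

section \<open>The universal polynomials\<close>

definition cluster_series :: "nat => (nat => complex) => complex fps" where
 "cluster_series m y = Abs_fps (%i. if 0 < i & i < m then y (m - i) else 0)"

text \<open>
  For \<open>c\<^sub>m z\<^sup>-\<^sup>m (1 + u(z)) = \<Sum>\<^sub>i c\<^sub>i z\<^sup>-\<^sup>i\<close> and \<open>s\<^sup>m = c\<^sub>m\<close>, the number \<open>s\<^sup>k\<close> \<open>cluster_poly m k\<close> is the residue of the
  \<open>(k/m)\<close>-th power of this Laurent polynomial, divided by \<open>k\<close>.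
\<close>

definition cluster_poly :: "nat => nat => (nat => complex) => complex" where
 "cluster_poly m k y = fps_nth (fps_binomial (of_nat k / of_nat m) oo cluster_series m y) (k - 1) / of_nat k"

lemma cluster_series_nth: "fps_nth (cluster_series m y) i = (if 0 < i & i < m then y (m - i) else 0)"
 by (simp add: cluster_series_def)

lemma cluster_poly_alt:
 "cluster_poly m k y = (SUM i=0..k-1. (of_nat k / of_nat m gchoose i) * fps_nth (cluster_series m y ^ i) (k - 1)) / of_nat k"
 by (simp add: cluster_poly_def fps_compose_nth)

lemma polynomial_in_cluster_power:
 "polynomial_in (m - 1) (%y. fps_nth (cluster_series m y ^ n) j)"
proof (induction n arbitrary: j)
 case 0
 thus ?case by (simp add: polynomial_in_const)
next
 case (Suc n)
 have "polynomial_in (m - 1) (%y. fps_nth (cluster_series m y) i)" for i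
 proof (cases "0 < i & i < m")
  case True
  hence "m - i : {1..m-1}" by auto
  thus ?thesis using True by (simp add: cluster_series_nth polynomial_in_var)
 next
  case False
  show ?thesis unfolding cluster_series_nth if_not_P[OF False] by (rule polynomial_in_const)
 qed
 thus ?case unfolding power_Suc fps_mult_nth
  by (intro polynomial_in_sum polynomial_in_mult Suc)
qed

lemma polynomial_in_cluster_poly: "polynomial_in (m - 1) (cluster_poly m k)"
proof -
 have "polynomial_in (m - 1) (%y. (1 / of_nat k) * (SUM i=0..k-1. (of_nat k / of_nat m gchoose i) * fps_nth (cluster_series m y ^ i) (k - 1)))"
  by (intro polynomial_in_mult polynomial_in_const polynomial_in_sum polynomial_in_cluster_power)
 thus ?thesis by (simp add: cluster_poly_alt[abs_def])
qed

lemma fps_power_nth_cong: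
 fixes a b :: "'a::comm_ring_1 fps"
 assumes "!!j. j <= n ==> fps_nth a j = fps_nth b j" "j <= n"
 shows "fps_nth (a ^ i) j = fps_nth (b ^ i) j"
 using assms(2)
proof (induction i arbitrary: j)
 case (Suc i)
 thus ?case using assms(1) by (auto simp: fps_mult_nth intro!: sum.cong)
qed auto

text \<open>The coefficient of order \<open>k - 1\<close> involves the series only up to that order,
  and its coefficient of order \<open>j\<close> is \<open>y (m - j)\<close>; so only indices above
  \<open>m - k\<close> matter. Triangularity of the Jacobian and solvability one unknown at a time
  both rest on this.\<close>

lemma cluster_poly_cong:
 assumes "k <= m" "0 < k" "!!i. m - k < i ==> i < m ==> y i = y' i"
 shows "cluster_poly m k y = cluster_poly m k y'"
proof -
 have "fps_nth (cluster_series m y ^ i) (k - 1) = fps_nth (cluster_series m y' ^ i) (k - 1)" for i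
  using assms by (intro fps_power_nth_cong[where n = "k - 1"]) (auto simp: cluster_series_nth)
 thus ?thesis by (simp add: cluster_poly_alt)
qed

text \<open>Without constant terms, the coefficient of order \<open>n\<close> of one factor could
  only meet the constant term of the other factors, so it drops out of every power with exponent at
  least 2.\<close>

lemma fps_power_nth_cong_top:
 fixes a b :: "'a::comm_ring_1 fps"
 assumes "fps_nth a 0 = 0" "fps_nth b 0 = 0" "!!j. j < n ==> fps_nth a j = fps_nth b j" "i \<ge> 2"
 shows "fps_nth (a ^ i) n = fps_nth (b ^ i) n"
proof -
 obtain k where k: "i = Suc k" "k \<ge> 1" using assms(4) by (cases i) auto
 have z: "fps_nth (a ^ k) 0 = 0" "fps_nth (b ^ k) 0 = 0" using assms k by (simp_all add: fps_nth_power_0 power_0_left)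
 have "fps_nth a j * fps_nth (a ^ k) (n - j) = fps_nth b j * fps_nth (b ^ k) (n - j)" if "j <= n" for j
 proof -
  consider "j = 0" | "j = n" | "0 < j" "j < n" using \<open>j <= n\<close> by linarith
  thus ?thesis
  proof cases
   case 3
   have "fps_nth (a ^ k) (n - j) = fps_nth (b ^ k) (n - j)"
    by (rule fps_power_nth_cong[where n = "n - j"]) (use assms 3 in auto)
   thus ?thesis using assms(3)[OF 3(2)] by simp
  qed (use assms z in auto)
 qed
 thus ?thesis by (simp add: k fps_mult_nth)
qed

text \<open>Only the first power of the series sees its coefficient of order \<open>k - 1\<close>,
  which is \<open>y (m + 1 - k)\<close>. It enters with the binomial coefficient \<open>k/m\<close>,
  and the division by \<open>k\<close> leaves \<open>1/m\<close>.\<close>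

lemma cluster_poly_linear:
 assumes "2 <= k" "k < m"
 shows "cluster_poly m k (y(m + 1 - k := v)) = cluster_poly m k (y(m + 1 - k := 0)) + v / of_nat m"
proof -
 let ?a = "cluster_series m (y(m + 1 - k := v))" and ?b = "cluster_series m (y(m + 1 - k := 0))"
 let ?c = "%i. complex_of_nat k / of_nat m gchoose i"
 have k: "{0..k-1} = insert 0 (insert 1 {2..k-1})" using assms by auto
 have "fps_nth (?a ^ i) (k-1) = fps_nth (?b ^ i) (k-1)" if "i : {2..k-1}" for i
  by (rule fps_power_nth_cong_top) (insert that assms, auto simp: cluster_series_nth)
 hence *: "(SUM i:{2..k-1}. ?c i * fps_nth (?a ^ i) (k-1)) = (SUM i:{2..k-1}. ?c i * fps_nth (?b ^ i) (k-1))"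
  by (intro sum.cong) auto
 have "fps_nth ?a (k-1) = v" "fps_nth ?b (k-1) = 0"
  using assms by (auto simp: cluster_series_nth)
 hence "(SUM i=0..k-1. ?c i * fps_nth (?a ^ i) (k-1)) = (SUM i=0..k-1. ?c i * fps_nth (?b ^ i) (k-1)) + of_nat k / of_nat m * v"
  unfolding k using * by simp
 thus ?thesis using assms unfolding cluster_poly_alt by (simp add: add_divide_distrib)
qed

lemma cluster_poly_1: "cluster_poly m 1 y = 1"
 by (simp add: cluster_poly_def)

text \<open>With \<open>k = m + 1 - r\<close>, \<open>cluster_poly_cong\<close> leaves only the
  ratios of index at least \<open>r\<close>. A change of \<open>c j\<close> with
  \<open>j < r\<close> affects none of these, and neither does it change the denominator
  \<open>c m\<close>, as \<open>j < m\<close>.\<close>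

lemma cluster_jacobian_triangular:
 assumes "r : {2..<m}" "j : {2..<m}" "j < r"
 shows "cluster_jacobian cluster_poly m s c r j = 0"
proof -
 have "cluster_poly m (m + 1 - r) (%i. (c(j := x)) i / (c(j := x)) m) = cluster_poly m (m + 1 - r) (%i. c i / c m)" for x
  by (rule cluster_poly_cong) (use assms in auto)
 hence "(%x. cluster_flat (cluster_poly m (m + 1 - r)) m (m + 1 - r) s (c(j := x))) =
  (%x. cluster_flat (cluster_poly m (m + 1 - r)) m (m + 1 - r) s c)"
  unfolding cluster_flat_def by simp
 thus ?thesis
  unfolding cluster_jacobian_def Let_def pderiv_at_def by simp
qed

text \<open>
  Solves \<open>cluster_poly m k y = T k\<close> (\<open>2 \<le> k < m\<close>) for \<open>y\<^sub>m\<^sub>-\<^sub>1, \<dots>, y\<^sub>2\<close>, one unknown at a time: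
  by \<open>cluster_poly_linear\<close> the equation with index \<open>k\<close> is linear in \<open>y\<^sub>m\<^sub>+\<^sub>1\<^sub>-\<^sub>k\<close> and does not contain the later unknowns.
\<close>

primrec cluster_solve :: "nat => (nat => complex) => nat => nat => complex" where
 "cluster_solve m T 0 = (%_. 0)"
| "cluster_solve m T (Suc n) = (let y = cluster_solve m T n in
   y(m - Suc n := of_nat m * (T (n + 2) - cluster_poly m (n + 2) y)))"

lemma cluster_solve_zero: "i < m - n ==> cluster_solve m T n i = 0"
 by (induction n) (auto simp: Let_def)

lemma cluster_solve_stable:
 "n <= n' ==> m - n <= i ==> i < m ==> n' < m ==> cluster_solve m T n' i = cluster_solve m T n i"
 by (induction n' rule: dec_induct) (auto simp: Let_def)

lemma cluster_solve_correct:
 assumes "2 <= k" "k < m"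
 shows "cluster_poly m k (cluster_solve m T (m - 2)) = T k"
proof -
 obtain n where n: "k = n + 2" using assms by (metis le_add_diff_inverse2)
 let ?y = "cluster_solve m T n"
 \<comment> \<open>The unknown to be determined still has its initial value 0, so
   \<open>cluster_poly_linear\<close> applies to the vector as it is.\<close>
 have z: "?y(m - Suc n := 0) = ?y" using cluster_solve_zero[of "m - Suc n" m n T] assms n by (intro ext) auto
 have "cluster_poly m k (cluster_solve m T (m - 2)) = cluster_poly m k (cluster_solve m T (Suc n))"
  by (rule cluster_poly_cong) (use assms n cluster_solve_stable[of "Suc n" "m - 2" m] in auto)
 also have "... = cluster_poly m k (?y(m + 1 - k := of_nat m * (T k - cluster_poly m k ?y)))"
  by (simp add: n Let_def)
 also have "... = T k"
  using z cluster_poly_linear[OF assms, of ?y] assms by (simp add: n)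
 finally show ?thesis .
qed

lemma cluster_solve_unique:
 assumes "!!k. 2 <= k ==> k < m ==> cluster_poly m k y = T k" "2 <= i" "i < m"
 shows "cluster_solve m T (m - 2) i = y i"
proof -
 have "ALL i. m - n <= i & i < m --> cluster_solve m T n i = y i" if "n <= m - 2" for n
  using that
 proof (induction n)
  case (Suc n)
  let ?y = "cluster_solve m T n" and ?k = "n + 2"
  have k: "2 <= ?k" "?k < m" using Suc.prems by auto
  have IH: "!!i. m - n <= i ==> i < m ==> ?y i = y i" using Suc by auto
  have z: "?y (m - Suc n) = 0" using cluster_solve_zero[of "m - Suc n" m n T] k by auto
  have mk: "m + 1 - ?k = m - Suc n" by simp
  have "cluster_poly m ?k ?y = cluster_poly m ?k (y(m - Suc n := 0))"
  proof (rule cluster_poly_cong)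
   fix i assume "m - ?k < i" "i < m"
   thus "?y i = (y(m - Suc n := 0)) i" using IH[of i] z by (cases "i = m - Suc n") auto
  qed (use k in auto)
  moreover have "T ?k = cluster_poly m ?k (y(m - Suc n := 0)) + y (m - Suc n) / of_nat m"
   using cluster_poly_linear[OF k, of y "y (m - Suc n)"] assms(1)[OF k] unfolding mk by simp
  ultimately have "of_nat m * (T ?k - cluster_poly m ?k ?y) = y (m - Suc n)" using k by simp
  thus ?case using IH by (auto simp: Let_def)
 qed auto
 from this[of "m - 2"] show ?thesis using assms by auto
qed

lemma hol_cluster_solve:
 assumes U: "openin (cspace I) U" and T: "!!k. 2 <= k ==> k < m ==> hol I U (T k)"
 shows "n <= m - 2 ==> hol I U (%w. cluster_solve m (%k. T k w) n i)"
proof (induction n arbitrary: i)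
 case (Suc n)
 have IH: "hol I U (%w. cluster_solve m (%k. T k w) n j)" for j using Suc by simp
 have "hol I U (%w. of_nat m * (T (n + 2) w - cluster_poly m (n + 2) (cluster_solve m (%k. T k w) n)))"
  by (intro hol_cmult[OF U] hol_diff[OF U] T hol_polynomial[OF U polynomial_in_cluster_poly, of m "%i w. cluster_solve m (%k. T k w) n i"] IH)
   (use Suc.prems in auto)
 thus ?case using IH by (cases "i = m - Suc n") (auto simp: Let_def)
qed (simp add: hol_const[OF U])

section \<open>Lagrange inversion\<close>

text \<open>With \<open>\<xi> = x / g\<close> one has \<open>d\<xi> = (N / g) dx\<close>. The
  identity is the invariance of the residue of \<open>K(\<xi>) d\<xi> / \<xi>^(n+1)\<close> under
  this substitution, in a form that needs only power series.\<close>

lemma lagrange_coefficient: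
 fixes g K :: "complex fps"
 assumes g: "fps_nth g 0 ~= 0"
 defines "N \<equiv> 1 - fps_X * fps_deriv g * inverse g"
 shows "fps_nth ((K oo (fps_X * inverse g)) * N * g ^ n) n = fps_nth K n"
proof -
 let ?\<xi> = "fps_X * inverse g"
 have gi: "g * inverse g = 1" using g by (simp add: inverse_mult_eq_1')
 have x0: "fps_nth ?\<xi> 0 = 0" by simp
 \<comment> \<open>By linearity \<open>K\<close> may be a monomial. For \<open>k < n\<close> put
   \<open>d = n - k\<close> and \<open>h = g^d\<close>: the coefficient of order \<open>d\<close> of
   \<open>h - x h' / d\<close> is wanted, and it cancels.\<close>
 have main: "fps_nth (?\<xi> ^ k * N * g ^ n) n = (if k = n then 1 else 0)" if k: "k <= n" for k
 proof -
  have "?\<xi> ^ k * g ^ n = fps_X ^ k * g ^ (n - k)"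
  proof -
   have "g ^ n = g ^ k * g ^ (n - k)" using k by (simp flip: power_add)
   hence "?\<xi> ^ k * g ^ n = fps_X ^ k * (g * inverse g) ^ k * g ^ (n - k)" by (simp add: power_mult_distrib algebra_simps)
   thus ?thesis using gi by simp
  qed
  hence eq: "?\<xi> ^ k * N * g ^ n = fps_X ^ k * (g ^ (n - k) * N)" by (simp add: algebra_simps)
  show ?thesis
  proof (cases "k = n")
   case True
   thus ?thesis unfolding eq by (simp add: N_def fps_X_power_mult_nth)
  next
   case False
   then obtain r where r: "n - k = Suc r" using k by (metis Suc_diff_Suc le_neq_implies_less)
   have "g ^ Suc r * N = g ^ Suc r - fps_X * (g ^ r * fps_deriv g) * (g * inverse g)"
    by (simp add: N_def algebra_simps)
   hence 1: "g ^ Suc r * N = g ^ Suc r - fps_X * (g ^ r * fps_deriv g)" using gi by simp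
   have "fps_deriv (g ^ Suc r) = fps_const (of_nat (Suc r)) * (g ^ r * fps_deriv g)"
    unfolding fps_deriv_power by (simp add: algebra_simps del: power_Suc of_nat_Suc)
   hence "fps_nth (fps_deriv (g ^ Suc r)) r = of_nat (Suc r) * fps_nth (g ^ r * fps_deriv g) r" by simp
   hence "fps_nth (g ^ Suc r) (Suc r) = fps_nth (g ^ r * fps_deriv g) r"
    by (simp only: fps_deriv_nth) (simp del: power_Suc of_nat_Suc)
   hence "fps_nth (g ^ Suc r * N) (Suc r) = 0" unfolding 1 by (simp del: power_Suc)
   thus ?thesis using False k unfolding eq by (simp add: fps_X_power_mult_nth r del: power_Suc)
  qed
 qed
 have low: "fps_nth (K oo ?\<xi>) j = (SUM k=0..n. fps_nth K k * fps_nth (?\<xi> ^ k) j)" if "j <= n" for j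
  unfolding fps_compose_nth
  by (rule sum.mono_neutral_left) (use that startsby_zero_power_prefix[OF x0] in auto)
 have "fps_nth ((K oo ?\<xi>) * (N * g ^ n)) n = (SUM j=0..n. (SUM k=0..n. fps_nth K k * fps_nth (?\<xi> ^ k) j) * fps_nth (N * g ^ n) (n - j))"
  unfolding fps_mult_nth[of "K oo ?\<xi>"] by (intro sum.cong refl) (simp add: low)
 also have "... = (SUM k=0..n. fps_nth K k * fps_nth (?\<xi> ^ k * (N * g ^ n)) n)"
  unfolding fps_mult_nth[of "?\<xi> ^ _"] sum_distrib_left sum_distrib_right by (subst sum.swap) (simp add: mult.assoc)
 also have "... = (SUM k=0..n. fps_nth K k * (if k = n then 1 else 0))"
  by (intro sum.cong refl) (simp add: main mult.assoc[symmetric])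
 also have "... = fps_nth K n" by (simp add: mult_delta_right)
 finally show ?thesis by (simp add: mult.assoc)
qed

text \<open>The series \<open>a / N\<close> and \<open>b / N\<close> are written as
  \<open>A(\<xi>)\<close> and \<open>B(\<xi>)\<close>. By \<open>lagrange_coefficient\<close> both
  sides are then coefficients in \<open>\<xi>\<close>: the left one of \<open>A * B\<close>, the
  right one its Cauchy product.\<close>

lemma lagrange_convolution:
 fixes g a b :: "complex fps"
 assumes g: "fps_nth g 0 ~= 0"
 defines "N \<equiv> 1 - fps_X * fps_deriv g * inverse g"
 shows "fps_nth (a * b * g ^ n * inverse N) n = (SUM p=0..n. fps_nth (a * g ^ p) p * fps_nth (b * g ^ (n - p)) (n - p))"
proof -
 let ?\<xi> = "fps_X * inverse g"
 have x: "fps_nth ?\<xi> 0 = 0" "fps_nth ?\<xi> 1 ~= 0" using g by auto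
 have N0: "fps_nth N 0 ~= 0" by (simp add: N_def)
 have iN: "inverse N * N = 1" using N0 by (rule inverse_mult_eq_1)
 \<comment> \<open>\<open>\<xi>\<close> has order exactly 1, hence a compositional inverse.\<close>
 have ex: "EX K. K oo ?\<xi> = H" for H
  using fps_compose_assoc[OF x(1), of "fps_inv ?\<xi>" H] fps_inv[OF x] by (intro exI[of _ "H oo fps_inv ?\<xi>"]) (simp add: fps_inv_def)
 obtain A where A: "A oo ?\<xi> = a * inverse N" using ex by blast
 obtain B where B: "B oo ?\<xi> = b * inverse N" using ex by blast
 have a: "fps_nth (a * g ^ p) p = fps_nth A p" for p
 proof -
  have "a * g ^ p = (A oo ?\<xi>) * N * g ^ p" unfolding A using iN by (simp add: mult.assoc)
  hence "fps_nth (a * g ^ p) p = fps_nth ((A oo ?\<xi>) * N * g ^ p) p" by (rule arg_cong)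
  also have "... = fps_nth A p" unfolding N_def by (rule lagrange_coefficient[OF g])
  finally show ?thesis .
 qed
 have b: "fps_nth (b * g ^ p) p = fps_nth B p" for p
 proof -
  have "b * g ^ p = (B oo ?\<xi>) * N * g ^ p" unfolding B using iN by (simp add: mult.assoc)
  hence "fps_nth (b * g ^ p) p = fps_nth ((B oo ?\<xi>) * N * g ^ p) p" by (rule arg_cong)
  also have "... = fps_nth B p" unfolding N_def by (rule lagrange_coefficient[OF g])
  finally show ?thesis .
 qed
 have "a * b * g ^ n * inverse N = (a * inverse N) * (b * inverse N) * N * g ^ n" using iN by (simp add: algebra_simps)
 also have "... = ((A * B) oo ?\<xi>) * N * g ^ n" unfolding A[symmetric] B[symmetric] fps_compose_mult_distrib[OF x(1)] ..
 finally have "fps_nth (a * b * g ^ n * inverse N) n = fps_nth (((A * B) oo ?\<xi>) * N * g ^ n) n" by (rule arg_cong)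
 also have "... = fps_nth (A * B) n" unfolding N_def by (rule lagrange_coefficient[OF g])
 also have "... = (SUM p=0..n. fps_nth (a * g ^ p) p * fps_nth (b * g ^ (n - p)) (n - p))"
  unfolding a b by (rule fps_mult_nth)
 finally show ?thesis .
qed

section \<open>Derivatives of the cluster coordinates\<close>

text \<open>The derivative in a parameter \<open>x\<close> is taken coefficient by coefficient. Each
  coefficient of a product or of a composition is a finite expression, so no convergence in the
  formal variable is involved.\<close>

definition fps_has_deriv :: "(complex => complex fps) => complex fps => complex => bool" where
 "fps_has_deriv F F' x0 \<longleftrightarrow> (ALL n. DERIV (%x. fps_nth (F x) n) x0 :> fps_nth F' n)"

lemma fps_has_deriv_mult:
 assumes "fps_has_deriv F F' x0" "fps_has_deriv G G' x0"
 shows "fps_has_deriv (%x. F x * G x) (F' * G x0 + F x0 * G') x0"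
 unfolding fps_has_deriv_def
proof
 fix n
 have "DERIV (%x. SUM i=0..n. fps_nth (F x) i * fps_nth (G x) (n - i)) x0 :> (SUM i=0..n. fps_nth F' i * fps_nth (G x0) (n - i) + fps_nth G' (n - i) * fps_nth (F x0) i)"
  using assms unfolding fps_has_deriv_def by (intro DERIV_sum DERIV_mult) auto
 thus "DERIV (%x. fps_nth (F x * G x) n) x0 :> fps_nth (F' * G x0 + F x0 * G') n"
  by (simp add: fps_mult_nth sum.distrib mult.commute[of "fps_nth G' _"])
qed

lemma fps_has_deriv_power:
 assumes "fps_has_deriv F F' x0"
 shows "fps_has_deriv (%x. F x ^ i) (of_nat i * F x0 ^ (i - 1) * F') x0"
proof (induction i)
 case 0
 show ?case by (auto simp: fps_has_deriv_def)
next
 case (Suc i)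
 have "F' * F x0 ^ i + F x0 * (of_nat i * F x0 ^ (i - 1) * F') = of_nat (Suc i) * F x0 ^ (Suc i - 1) * F'"
  by (cases i) (simp_all add: algebra_simps)
 thus ?case using fps_has_deriv_mult[OF assms Suc] by simp
qed

lemma fps_compose_mult_nth:
 fixes B u v :: "complex fps"
 assumes "fps_nth u 0 = 0"
 shows "fps_nth ((B oo u) * v) n = (SUM i=0..n. fps_nth B i * fps_nth (u ^ i * v) n)"
proof -
 have low: "fps_nth (B oo u) j = (SUM k=0..n. fps_nth B k * fps_nth (u ^ k) j)" if "j <= n" for j
  unfolding fps_compose_nth
  by (rule sum.mono_neutral_left) (use that startsby_zero_power_prefix[OF assms] in auto)
 have "fps_nth ((B oo u) * v) n = (SUM j=0..n. (SUM k=0..n. fps_nth B k * fps_nth (u ^ k) j) * fps_nth v (n - j))"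
  unfolding fps_mult_nth[of "B oo u"] by (intro sum.cong refl) (simp add: low)
 also have "... = (SUM k=0..n. fps_nth B k * fps_nth (u ^ k * v) n)"
  unfolding fps_mult_nth[of "u ^ _"] sum_distrib_left sum_distrib_right by (subst sum.swap) (simp add: mult.assoc)
 finally show ?thesis .
qed

text \<open>This is the derivative of \<open>(1 + u)^a\<close>. The absorption identity for binomial
  coefficients turns the differentiated sum of powers into the series with exponent
  \<open>a - 1\<close>.\<close>

lemma fps_has_deriv_binomial:
 assumes u: "fps_has_deriv u u' x0" and 0: "fps_nth (u x0) 0 = 0" "fps_nth u' 0 = 0"
 shows "fps_has_deriv (%x. fps_binomial a oo u x) (fps_const a * ((fps_binomial (a - 1) oo u x0) * u')) x0"
 unfolding fps_has_deriv_def
proof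
 fix n
 \<comment> \<open>The index shift leaves the sum one term short; the missing term is this one, of
   order at least \<open>n + 1\<close>.\<close>
 have top: "fps_nth (u x0 ^ n * u') n = 0"
  unfolding fps_mult_nth using 0 startsby_zero_power_prefix[OF 0(1)]
  by (intro sum.neutral ballI) (auto simp: le_less)
 let ?f = "%i. (a gchoose i) * fps_nth (of_nat i * u x0 ^ (i - 1) * u') n"
 have f: "?f (Suc i) = a * ((a - 1 gchoose i) * fps_nth (u x0 ^ i * u') n)" for i
 proof -
  have "?f (Suc i) = (of_nat (Suc i) * (a gchoose Suc i)) * fps_nth (u x0 ^ i * u') n"
   by (simp add: fps_mult_of_nat_nth mult.assoc del: of_nat_Suc)
  thus ?thesis unfolding gbinomial_absorption by (simp add: mult.assoc)
 qed
 have "DERIV (%x. SUM i=0..n. (a gchoose i) * fps_nth (u x ^ i) n) x0 :> (SUM i=0..n. ?f i)"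
  using fps_has_deriv_power[OF u] unfolding fps_has_deriv_def by (intro DERIV_sum DERIV_cmult) blast
 moreover have "(SUM i=0..n. ?f i) = a * fps_nth ((fps_binomial (a - 1) oo u x0) * u') n"
 proof (cases n)
  case 0
  thus ?thesis using assms by simp
 next
  case (Suc k)
  have "(SUM i=0..n. ?f i) = (SUM i=0..k. ?f (Suc i))" unfolding Suc sum.atLeast0_atMost_Suc_shift by simp
  also have "... = a * (SUM i=0..k. (a - 1 gchoose i) * fps_nth (u x0 ^ i * u') n)"
   unfolding f sum_distrib_left ..
  also have "(SUM i=0..k. (a - 1 gchoose i) * fps_nth (u x0 ^ i * u') n) = (SUM i=0..n. (a - 1 gchoose i) * fps_nth (u x0 ^ i * u') n)"
   using top unfolding Suc by simp
  also have "... = fps_nth ((fps_binomial (a - 1) oo u x0) * u') n"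
   unfolding fps_compose_mult_nth[OF 0(1)] by simp
  finally show ?thesis .
 qed
 ultimately show "DERIV (%x. fps_nth (fps_binomial a oo u x) n) x0 :> fps_nth (fps_const a * ((fps_binomial (a - 1) oo u x0) * u')) n"
  by (simp add: fps_compose_nth)
qed

text \<open>This is \<open>z^m\<close> times the principal part with coefficients \<open>c i\<close>
  of \<open>z^(-i)\<close>, so that residue computations can be done on power series.\<close>

definition prin_series :: "nat => (nat => complex) => complex fps" where
 "prin_series m c = Abs_fps (%j. if j < m then c (m - j) else 0)"

lemma principal_series_nth: "fps_nth (prin_series m c) j = (if j < m then c (m - j) else 0)"
 by (simp add: prin_series_def)

text \<open>The power \<open>(1 + u)^a\<close> of the normalised principal part, for any complex
  \<open>a\<close>; fractional powers are then handled by additivity in the exponent.\<close>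

definition cluster_root :: "nat => (nat => complex) => complex => complex fps" where
 "cluster_root m c a = fps_binomial a oo cluster_series m (%i. c i / c m)"

lemma cluster_root_add: "cluster_root m c (a + b) = cluster_root m c a * cluster_root m c b"
 unfolding cluster_root_def fps_binomial_add_mult
 by (rule fps_compose_mult_distrib) (simp add: cluster_series_nth)

lemma cluster_root_0: "cluster_root m c 0 = 1"
 by (simp add: cluster_root_def)

lemma cluster_root_1: "cluster_root m c 1 = 1 + cluster_series m (%i. c i / c m)"
 by (simp add: cluster_root_def fps_binomial_1 fps_compose_add_distrib cluster_series_nth)

lemma cluster_root_power: "cluster_root m c a ^ n = cluster_root m c (of_nat n * a)"
 by (induction n) (simp_all add: cluster_root_0 cluster_root_add[symmetric] algebra_simps)

lemma cluster_root_nth_0: "fps_nth (cluster_root m c a) 0 = 1"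
 by (simp add: cluster_root_def)

lemma cluster_root_deriv:
 "fps_deriv (cluster_root m c a) = fps_const a * cluster_root m c (a - 1) * fps_deriv (cluster_series m (%i. c i / c m))"
proof -
 let ?u = "cluster_series m (%i. c i / c m)"
 have u0: "fps_nth ?u 0 = 0" by (simp add: cluster_series_nth)
 have "fps_binomial a = fps_binomial (a - 1) * (1 + fps_X)"
  using fps_binomial_add_mult[of "a - 1" 1] by (simp add: fps_binomial_1)
 hence "fps_deriv (fps_binomial a) = fps_const a * fps_binomial (a - 1)"
  unfolding fps_binomial_deriv[of a] by (simp add: mult.assoc[symmetric])
 thus ?thesis unfolding cluster_root_def fps_compose_deriv[OF u0]
  by (simp add: fps_compose_mult_distrib[OF u0] fps_const_compose)
qed

lemma principal_series_eq:
 assumes "c m ~= 0" "0 < m"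
 shows "prin_series m c = fps_const (c m) * cluster_root m c 1"
 using assms by (intro fps_ext) (auto simp: cluster_root_1 principal_series_nth cluster_series_nth)

text \<open>For the principal part \<open>L\<close> and its variation \<open>z^(-m) A\<close>, this
  is the residue of \<open>L^(k/m - 1) z^(-m) A\<close>, divided by \<open>m\<close>: the
  differential of the residue of \<open>L^(k/m)\<close> divided by \<open>k\<close>.\<close>

definition cluster_diff :: "nat => (nat => complex) => complex => nat => complex fps => complex" where
 "cluster_diff m c s k A = s ^ k / (of_nat m * c m) * fps_nth (A * cluster_root m c (of_nat k / of_nat m - 1)) (k - 1)"

lemma cluster_poly_deriv:
 assumes m: "0 < m" and k: "0 < k"
  and c: "!!i. i : {1..m} ==> DERIV (%x. c x i) x0 :> c' i"
  and s: "DERIV s x0 :> s'" and sm: "s x0 ^ m = c x0 m" "c x0 m ~= 0"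
  and s': "of_nat m * s x0 ^ (m - 1) * s' = c' m"
 shows "DERIV (%x. s x ^ k * cluster_poly m k (%i. c x i / c x m)) x0 :> cluster_diff m (c x0) (s x0) k (prin_series m c')"
proof -
 let ?u = "%x. cluster_series m (%i. c x i / c x m)" and ?a = "complex_of_nat k / of_nat m"
 let ?c = "c x0" and ?s = "s x0"
 define u' where "u' = Abs_fps (%i. if 0 < i & i < m then (c' (m - i) * ?c m - ?c (m - i) * c' m) / (?c m * ?c m) else 0)"
 have u: "fps_has_deriv ?u u' x0"
  unfolding fps_has_deriv_def cluster_series_nth u'_def
 proof
  fix n
  show "DERIV (%x. if 0 < n & n < m then c x (m - n) / c x m else 0) x0 :> fps_nth (Abs_fps (%i. if 0 < i & i < m then (c' (m - i) * ?c m - ?c (m - i) * c' m) / (?c m * ?c m) else 0)) n"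
   by (cases "0 < n & n < m") (auto intro!: DERIV_divide c sm)
 qed
 have z: "fps_nth (?u x0) 0 = 0" "fps_nth u' 0 = 0" by (simp_all add: cluster_series_nth u'_def)
 \<comment> \<open>The variation of \<open>c\<^sub>m (1 + u)\<close> splits into the change of the
   factor \<open>c\<^sub>m\<close>, which also moves \<open>s\<close>, and the change of
   \<open>u\<close>.\<close>
 have eqA: "prin_series m c' = fps_const (c' m) * cluster_root m ?c 1 + fps_const (?c m) * u'"
  using sm m by (intro fps_ext) (auto simp: cluster_root_1 principal_series_nth cluster_series_nth u'_def field_simps)
 have "DERIV (%x. fps_nth (fps_binomial ?a oo ?u x) (k - 1)) x0 :> ?a * fps_nth (cluster_root m ?c (?a - 1) * u') (k - 1)"
  using fps_has_deriv_binomial[OF u z, of ?a] unfolding fps_has_deriv_def cluster_root_def by simp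
 hence "DERIV (%x. cluster_poly m k (%i. c x i / c x m)) x0 :> ?a * fps_nth (cluster_root m ?c (?a - 1) * u') (k - 1) / of_nat k"
  unfolding cluster_poly_def by (rule DERIV_cdivide)
 from DERIV_mult[OF DERIV_power[OF s, of k] this]
 have "DERIV (%x. s x ^ k * cluster_poly m k (%i. c x i / c x m)) x0 :> of_nat k * (s' * ?s ^ (k - Suc 0)) * cluster_poly m k (%i. ?c i / ?c m) +
   ?a * fps_nth (cluster_root m ?c (?a - 1) * u') (k - 1) / of_nat k * ?s ^ k"
  by simp
 moreover have "of_nat k * (s' * ?s ^ (k - Suc 0)) * cluster_poly m k (%i. ?c i / ?c m) +
   ?a * fps_nth (cluster_root m ?c (?a - 1) * u') (k - 1) / of_nat k * ?s ^ k = cluster_diff m ?c ?s k (prin_series m c')"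
 proof -
  have s0: "?s ~= 0" using sm m by (auto simp: power_0_left)
  have "?s ^ m = ?s * ?s ^ (m - 1)" using m by (cases m) auto
  hence "of_nat m * ?s ^ m * s' = c' m * ?s" unfolding s'[symmetric] by (simp only: ac_simps)
  hence c'm: "c' m = of_nat m * ?c m * s' / ?s" using s0 sm by (simp add: field_simps)
  have "cluster_root m ?c 1 * cluster_root m ?c (?a - 1) = cluster_root m ?c ?a"
   using cluster_root_add[of m ?c 1 "?a - 1"] by simp
  hence "prin_series m c' * cluster_root m ?c (?a - 1) = fps_const (c' m) * cluster_root m ?c ?a + fps_const (?c m) * (cluster_root m ?c (?a - 1) * u')"
   unfolding eqA by (simp add: algebra_simps)
  hence D: "cluster_diff m ?c ?s k (prin_series m c') = ?s ^ k / (of_nat m * ?c m) *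
    (c' m * fps_nth (cluster_root m ?c ?a) (k - 1) + ?c m * fps_nth (cluster_root m ?c (?a - 1) * u') (k - 1))"
   by (simp add: cluster_diff_def)
  have P: "fps_nth (cluster_root m ?c ?a) (k - 1) = of_nat k * cluster_poly m k (%i. ?c i / ?c m)"
   using k by (simp add: cluster_poly_def cluster_root_def)
  have K: "?s ^ k = ?s * ?s ^ (k - Suc 0)" using k by (cases k) auto
  show ?thesis unfolding D P c'm K using s0 sm m k by (simp add: field_simps)
 qed
 ultimately show ?thesis by simp
qed

section \<open>Residues of a cluster\<close>

text \<open>For \<open>L = z^(-m) C\<close> with \<open>C = prin_series m c\<close>, the series
  \<open>W\<close> is \<open>z^(m+1) L'\<close>. With \<open>g = (1 + u)^(1/m)\<close> and
  \<open>\<xi> = z / g\<close> the principal part becomes \<open>c\<^sub>m \<xi>^(-m)\<close>, and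
  \<open>W = - m c\<^sub>m (1 + u) N\<close> with the \<open>N\<close> of
  \<open>lagrange_convolution\<close>. That lemma splits the residue into products of two
  differentials.\<close>

lemma cluster_convolution:
 fixes A B :: "complex fps"
 assumes m: "2 <= m" and c: "c m ~= 0" "s ^ m = c m"
 defines "W \<equiv> fps_X * fps_deriv (prin_series m c) - of_nat m * prin_series m c"
 shows "fps_nth (A * B * inverse W) (m - 2) = - of_nat m * (SUM i=1..m-1. cluster_diff m c s i A * cluster_diff m c s (m - i) B)"
proof -
 let ?E = "cluster_root m c" and ?u = "cluster_series m (%i. c i / c m)"
 let ?g = "?E (1 / of_nat m)"
 have m0: "complex_of_nat m ~= 0" using m by simp
 have g0: "fps_nth ?g 0 ~= 0" by (simp add: cluster_root_nth_0)
 have ig: "inverse ?g = ?E (- 1 / of_nat m)"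
  by (rule fps_inverse_unique) (simp add: cluster_root_add[symmetric] cluster_root_0)
 define N where "N = 1 - fps_X * fps_deriv ?g * inverse ?g"
 have N: "N = 1 - fps_const (1 / of_nat m) * fps_X * fps_deriv ?u * ?E (- 1)"
 proof -
  have "fps_deriv ?g * inverse ?g = fps_const (1 / of_nat m) * fps_deriv ?u * (?E (1 / of_nat m - 1) * ?E (- 1 / of_nat m))"
   unfolding cluster_root_deriv ig by (simp only: ac_simps)
  also have "?E (1 / of_nat m - 1) * ?E (- 1 / of_nat m) = ?E (- 1)"
   unfolding cluster_root_add[symmetric] by (rule arg_cong[of _ _ ?E]) (simp add: algebra_simps)
  finally show ?thesis by (simp add: N_def algebra_simps)
 qed
 have E1: "?E 1 * ?E (- 1) = 1" unfolding cluster_root_add[symmetric] by (simp add: cluster_root_0)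
 have ps: "prin_series m c = fps_const (c m) * ?E 1" using principal_series_eq[of c m] c m by simp
 have W: "W = fps_const (- of_nat m * c m) * (?E 1 * N)"
 proof -
  have "?E 1 * N = ?E 1 - fps_const (1 / of_nat m) * fps_X * fps_deriv ?u * (?E 1 * ?E (- 1))"
   unfolding N by (simp only: algebra_simps mult_1_left)
  hence EN: "?E 1 * N = ?E 1 - fps_const (1 / of_nat m) * fps_X * fps_deriv ?u" using E1 by simp
  have d: "fps_deriv (?E 1) = fps_deriv ?u" unfolding cluster_root_1 by simp
  have k: "fps_const (- of_nat m * c m) * fps_const (1 / of_nat m) = fps_const (- c m)" using m0 by simp
  have "fps_const (- of_nat m * c m) * (?E 1 * N) =
    fps_const (- of_nat m * c m) * ?E 1 - (fps_const (- of_nat m * c m) * fps_const (1 / of_nat m)) * fps_X * fps_deriv ?u"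
   unfolding EN by (simp only: algebra_simps)
  also have "... = W" unfolding k W_def ps
   by (simp add: d fps_of_nat[symmetric] algebra_simps flip: fps_const_neg fps_const_mult)
  finally show ?thesis ..
 qed
 have "fps_nth N 0 = 1" unfolding N by simp
 hence iW: "inverse W = fps_const (- 1 / (of_nat m * c m)) * (?E (- 1) * inverse N)"
 proof (intro fps_inverse_unique)
  assume "fps_nth N 0 = 1"
  hence NN: "N * inverse N = 1" by (simp add: inverse_mult_eq_1')
  have kk: "fps_const (- of_nat m * c m) * fps_const (- 1 / (of_nat m * c m)) = 1" using m0 c by simp
  have "W * (fps_const (- 1 / (of_nat m * c m)) * (?E (- 1) * inverse N)) =
   (fps_const (- of_nat m * c m) * fps_const (- 1 / (of_nat m * c m))) * (?E 1 * ?E (- 1)) * (N * inverse N)"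
   unfolding W by (simp only: ac_simps)
  thus "W * (fps_const (- 1 / (of_nat m * c m)) * (?E (- 1) * inverse N)) = 1" unfolding kk E1 NN by simp
 qed
 define a b where "a = A * ?E (1 / of_nat m - 1)" and "b = B * ?E (1 / of_nat m - 1)"
 have "A * B * inverse W = fps_const (- 1 / (of_nat m * c m)) * (a * b * ?g ^ (m - 2) * inverse N)"
 proof -
  have "?E (1 / of_nat m - 1) * ?E (1 / of_nat m - 1) * ?g ^ (m - 2) = ?E (- 1)"
   unfolding cluster_root_power cluster_root_add[symmetric]
   by (rule arg_cong[of _ _ ?E]) (insert m m0, simp add: of_nat_diff field_simps)
  moreover have "a * b * ?g ^ (m - 2) * inverse N = A * B * (?E (1 / of_nat m - 1) * ?E (1 / of_nat m - 1) * ?g ^ (m - 2)) * inverse N"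
   unfolding a_def b_def by (simp only: ac_simps)
  ultimately show ?thesis unfolding iW by (simp only: ac_simps)
 qed
 hence "fps_nth (A * B * inverse W) (m - 2) = (- 1 / (of_nat m * c m)) * fps_nth (a * b * ?g ^ (m - 2) * inverse N) (m - 2)"
  by simp
 also have "fps_nth (a * b * ?g ^ (m - 2) * inverse N) (m - 2) =
   (SUM p=0..m-2. fps_nth (a * ?g ^ p) p * fps_nth (b * ?g ^ (m - 2 - p)) (m - 2 - p))"
  unfolding N_def by (rule lagrange_convolution[OF g0])
 \<comment> \<open>A product of two such differentials carries
   \<open>s^(Suc p) s^(m - Suc p) = c m\<close> in the numerator and
   \<open>(of_nat m * c m)^2\<close> in the denominator; this quotient is compensated here.\<close>
 also have "... = (SUM p=0..m-2. (of_nat m * c m)^2 / c m * (cluster_diff m c s (Suc p) A * cluster_diff m c s (m - Suc p) B))"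
 proof (intro sum.cong refl)
  fix p assume p: "p : {0..m-2}"
  have *: "C * ?E (1 / of_nat m - 1) * ?g ^ q = C * ?E (of_nat (Suc q) / of_nat m - 1)" for C q
   unfolding cluster_root_power mult.assoc cluster_root_add[symmetric]
   by (rule arg_cong[of _ _ "%x. C * ?E x"]) (insert m0, simp add: field_simps)
  have q: "m - Suc p = Suc (m - 2 - p)" using p m by auto
  have ss: "s ^ Suc p * s ^ Suc (m - 2 - p) = c m" unfolding c(2)[symmetric] power_add[symmetric]
   by (rule arg_cong[of _ _ "%n. s ^ n"]) (use p m in auto)
  have "cluster_diff m c s (Suc p) A * cluster_diff m c s (m - Suc p) B =
    (s ^ Suc p * s ^ Suc (m - 2 - p)) / (of_nat m * c m)^2 * (fps_nth (a * ?g ^ p) p * fps_nth (b * ?g ^ (m - 2 - p)) (m - 2 - p))"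
   unfolding a_def b_def * q cluster_diff_def by (simp add: power2_eq_square)
  thus "fps_nth (a * ?g ^ p) p * fps_nth (b * ?g ^ (m - 2 - p)) (m - 2 - p) =
   (of_nat m * c m)^2 / c m * (cluster_diff m c s (Suc p) A * cluster_diff m c s (m - Suc p) B)"
   unfolding ss using m0 c by (simp add: field_simps)
 qed
 also have "... = (of_nat m * c m)^2 / c m * (SUM p=0..m-2. cluster_diff m c s (Suc p) A * cluster_diff m c s (m - Suc p) B)"
  by (rule sum_distrib_left[symmetric])
 also have "(SUM p=0..m-2. cluster_diff m c s (Suc p) A * cluster_diff m c s (m - Suc p) B) = (SUM i=1..m-1. cluster_diff m c s i A * cluster_diff m c s (m - i) B)"
  by (rule sum.reindex_bij_witness[of _ "%i. i - 1" Suc]) (use m in auto)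
 finally show ?thesis using m0 c by (simp add: power2_eq_square)
qed

lemma fps_inverse_nth_cong:
 fixes W W' :: "complex fps"
 assumes "fps_nth W 0 ~= 0" "!!j. j <= n ==> fps_nth W j = fps_nth W' j" "j <= n"
 shows "fps_nth (inverse W) j = fps_nth (inverse W') j"
proof -
 have W': "fps_nth W' 0 ~= 0" using assms(1) assms(2)[of 0] by auto
 have "inverse W - inverse W' = (W' - W) * (inverse W * inverse W')"
 proof -
  have "(W' - W) * (inverse W * inverse W') = (W' * inverse W') * inverse W - (W * inverse W) * inverse W'"
   by (simp add: algebra_simps)
  thus ?thesis using inverse_mult_eq_1'[OF assms(1)] inverse_mult_eq_1'[OF W'] by simp
 qed
 hence "fps_nth (inverse W - inverse W') j = (SUM i=0..j. fps_nth (W' - W) i * fps_nth (inverse W * inverse W') (j - i))"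
  by (simp add: fps_mult_nth)
 also have "... = 0" using assms by (intro sum.neutral) auto
 finally show ?thesis by simp
qed

lemma fps_mult_nth_cong:
 fixes a b a' b' :: "complex fps"
 assumes "!!j. j <= n ==> fps_nth a j = fps_nth a' j" "!!j. j <= n ==> fps_nth b j = fps_nth b' j" "j <= n"
 shows "fps_nth (a * b) j = fps_nth (a' * b') j"
 unfolding fps_mult_nth using assms by (intro sum.cong) auto

text \<open>\<open>F\<close> and \<open>G\<close> are variations in the logarithmic coordinate: a
  change of the coefficients, a displacement of the pole by \<open>x\<close> or \<open>y\<close>,
  and a regular part. Expanding \<open>F G / L'\<close>, the term with \<open>L'\<close> is exact
  and has no residue, the terms linear in \<open>x\<close> and \<open>y\<close> read off the
  residues of the two variations, and the rest is \<open>cluster_convolution\<close>.\<close>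

lemma cluster_residue:
 fixes A B r r1 r2 :: "complex fps" and x y :: complex
 assumes m: "0 < m" and c: "c m ~= 0" "s ^ m = c m"
 defines "L \<equiv> fls_shift (int m) (fps_to_fls (prin_series m c)) + fps_to_fls r"
 defines "F \<equiv> fls_shift (int m) (fps_to_fls A) - fls_const x * fls_deriv L + fps_to_fls r1"
 defines "G \<equiv> fls_shift (int m) (fps_to_fls B) - fls_const y * fls_deriv L + fps_to_fls r2"
 shows "fls_residue (F * G / fls_deriv L) = - x * fps_nth B (m - 1) - y * fps_nth A (m - 1)
  - of_nat m * (SUM i=1..m-1. cluster_diff m c s i A * cluster_diff m c s (m - i) B)"
proof -
 let ?C = "prin_series m c"
 \<comment> \<open>\<open>W0\<close> is \<open>z^(m+1)\<close> times the derivative of the principal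
   part; the regular part \<open>r\<close> adds only terms of order above \<open>m\<close>.\<close>
 define W0 where "W0 = fps_X * fps_deriv ?C - of_nat m * ?C"
 define W where "W = W0 + fps_X ^ Suc m * fps_deriv r"
 have W0: "fps_nth W0 0 ~= 0" using m c by (simp add: W0_def principal_series_nth fps_mult_of_nat_nth)
 have WW: "fps_nth W j = fps_nth W0 j" if "j <= m" for j
  using that by (simp add: W_def fps_X_power_mult_nth del: power_Suc)
 have W: "fps_nth W 0 ~= 0" using WW W0 by simp
 have X: "fps_to_fls (fps_X ^ n * f) = fls_shift (- int n) (fps_to_fls f)" for n and f :: "complex fps"
  by (simp add: fls_times_fps_to_fls fps_to_fls_power fls_X_power_times_conv_shift)
 have dL: "fls_deriv L = fls_shift (int m + 1) (fps_to_fls W)"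
 proof (rule fls_eqI)
  fix k
  show "fls_nth (fls_deriv L) k = fls_nth (fls_shift (int m + 1) (fps_to_fls W)) k"
  proof (cases "k + (int m + 1) \<ge> 0")
   case True
   define j where "j = nat (k + (int m + 1))"
   have k: "k = int j - int m - 1" using True by (simp add: j_def)
   have a: "fps_nth (fps_X * fps_deriv ?C) j = of_nat j * fps_nth ?C j" by (cases j) auto
   have "Suc (j - Suc m) = j - m" if "\<not> j < Suc m" using that by simp
   hence xr: "fps_nth (fps_X ^ Suc m * fps_deriv r) j = (if j < Suc m then 0 else of_nat (j - m) * fps_nth r (j - m))"
    by (auto simp: fps_X_power_mult_nth simp del: power_Suc)
   have "fps_nth W j = (of_nat j - of_nat m) * fps_nth ?C j + (if j < Suc m then 0 else of_nat (j - m) * fps_nth r (j - m))"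
    unfolding W_def W0_def by (simp add: a xr fps_mult_of_nat_nth left_diff_distrib del: power_Suc)
   moreover have "fls_nth (fls_deriv L) k = of_int (k + 1) * (fps_nth ?C j + (if j < m then 0 else fps_nth r (j - m)))"
    by (auto simp: L_def k nat_diff_distrib distrib_left)
   ultimately show ?thesis using True unfolding k by (auto simp: not_less of_nat_diff principal_series_nth)
  next
   case False
   thus ?thesis by (auto simp: L_def)
  qed
 qed
 have dL0: "fls_deriv L ~= 0"
 proof
  assume "fls_deriv L = 0"
  hence "fls_nth (fls_shift (int m + 1) (fps_to_fls W)) (- (int m + 1)) = 0" unfolding dL by simp
  thus False using W by simp
 qed
 have idL: "inverse (fls_deriv L) = fls_shift (- int m - 1) (fps_to_fls (inverse W))"
 proof (rule inverse_unique)
  have "fls_deriv L * fls_shift (- int m - 1) (fps_to_fls (inverse W)) = fps_to_fls (W * inverse W)"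
   unfolding dL fls_shifted_times_simps by (simp add: fls_times_fps_to_fls)
  thus "fls_deriv L * fls_shift (- int m - 1) (fps_to_fls (inverse W)) = 1"
   using inverse_mult_eq_1'[OF W] by simp
 qed
 define A1 B1 where "A1 = A + fps_X ^ m * r1" and "B1 = B + fps_X ^ m * r2"
 have low: "fps_nth A1 j = fps_nth A j" "fps_nth B1 j = fps_nth B j" if "j < m" for j
  using that by (simp_all add: A1_def B1_def fps_X_power_mult_nth)
 define P Q where "P = fls_shift (int m) (fps_to_fls A1)" and "Q = fls_shift (int m) (fps_to_fls B1)"
 have FG: "F = P - fls_const x * fls_deriv L" "G = Q - fls_const y * fls_deriv L"
  unfolding F_def G_def P_def Q_def A1_def B1_def by (simp_all add: X)
 have "F * G / fls_deriv L = P * Q * inverse (fls_deriv L) - fls_const y * P - fls_const x * Q + fls_const x * (fls_const y * fls_deriv L)"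
  unfolding FG using dL0 by (simp add: field_simps)
 hence "fls_residue (F * G / fls_deriv L) = fls_residue (P * Q * inverse (fls_deriv L)) - y * fls_residue P - x * fls_residue Q"
  by simp
 also have "fls_residue P = fps_nth A (m - 1)" using m low by (simp add: P_def nat_diff_distrib')
 also have "fls_residue Q = fps_nth B (m - 1)" using m low by (simp add: Q_def nat_diff_distrib')
 also have "P * Q * inverse (fls_deriv L) = fls_shift (int m - 1) (fps_to_fls (A1 * B1 * inverse W))"
  unfolding P_def Q_def idL fls_shifted_times_simps by (simp add: fls_times_fps_to_fls)
 \<comment> \<open>Only coefficients up to order \<open>m - 2\<close> enter, while regular parts are
   felt from order \<open>m\<close> on. For \<open>m = 1\<close> there is no pole and the sum is
   empty.\<close>
 also have "fls_residue ... = - of_nat m * (SUM i=1..m-1. cluster_diff m c s i A * cluster_diff m c s (m - i) B)"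
 proof (cases "m \<ge> 2")
  case True
  have "fls_residue (fls_shift (int m - 1) (fps_to_fls (A1 * B1 * inverse W))) = fps_nth (A1 * B1 * inverse W) (m - 2)"
   using True by (simp add: nat_diff_distrib')
  also have "... = fps_nth (A * B * inverse W0) (m - 2)"
   by (intro fps_mult_nth_cong[where n = "m - 2"] fps_inverse_nth_cong[where n = "m - 2"]) (use True low WW W in auto)
  finally show ?thesis using cluster_convolution[where m = m and c = c and s = s and A = A and B = B, OF True c] unfolding W0_def by simp
 next
  case False
  hence "m = 1" using m by simp
  thus ?thesis by simp
 qed
 finally show ?thesis by simp
qed

section \<open>Residue calculus\<close>

lemma fls_deriv_compose_fps:
 fixes F :: "complex fls" and G :: "complex fps"
 assumes G: "fps_nth G 0 = 0" "G ~= 0"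
 shows "fls_deriv (fls_compose_fps F G) = fls_compose_fps (fls_deriv F) G * fps_to_fls (fps_deriv G)"
proof -
 define n where "n = nat (- fls_subdegree F)"
 define P where "P = Abs_fps (%j. fls_nth F (int j - int n))"
 have F: "F = fls_shift (int n) (fps_to_fls P)"
 proof (rule fls_eqI)
  fix k
  show "fls_nth F k = fls_nth (fls_shift (int n) (fps_to_fls P)) k"
  proof (cases "k + int n \<ge> 0")
   case False
   hence "k < fls_subdegree F" by (cases "fls_subdegree F <= 0") (auto simp: n_def)
   thus ?thesis using False by simp
  qed (simp add: P_def)
 qed
 let ?g = "fps_to_fls G"
 let ?i = "inverse ?g"
 have gi: "?g * ?i = 1" using G by simp
 have di: "fls_deriv ?i = - (?i * ?i * fps_to_fls (fps_deriv G))"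
 proof -
  have "0 = fls_deriv (?g * ?i) * ?i" unfolding gi by simp
  also have "... = (?g * ?i) * fls_deriv ?i + ?i * ?i * fps_to_fls (fps_deriv G)"
   by (simp add: fls_deriv_fps_to_fls algebra_simps)
  finally show ?thesis unfolding gi by (simp add: eq_neg_iff_add_eq_0)
 qed
 have cF: "fls_compose_fps F G = fps_to_fls (P oo G) * ?i ^ n"
  unfolding F using G by (simp add: fls_compose_fps_shift power_int_minus power_inverse)
 have dF: "fls_deriv F = of_int (- int n) * fls_shift (int (Suc n)) (fps_to_fls P) + fls_shift (int n) (fps_to_fls (fps_deriv P))"
  unfolding F by (simp add: fls_deriv_shift fls_deriv_fps_to_fls add.commute)
 have "fls_compose_fps (of_int (- int n) * fls_shift (int (Suc n)) (fps_to_fls P)) G = - of_nat n * (fps_to_fls (P oo G) * ?i ^ Suc n)"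
  using G by (simp add: fls_compose_fps_mult fls_compose_fps_shift power_int_minus power_inverse del: power_Suc of_nat_Suc) 
 moreover have "fls_compose_fps (fls_shift (int n) (fps_to_fls (fps_deriv P))) G = fps_to_fls (fps_deriv P oo G) * ?i ^ n"
  using G by (simp add: fls_compose_fps_shift power_int_minus power_inverse)
 ultimately have cdF: "fls_compose_fps (fls_deriv F) G = - of_nat n * (fps_to_fls (P oo G) * ?i ^ Suc n) + fps_to_fls (fps_deriv P oo G) * ?i ^ n"
  unfolding dF fls_compose_fps_add[OF G(2,1)] by (simp only:)
 have "fls_deriv (?i ^ n) = - of_nat n * ?i ^ Suc n * fps_to_fls (fps_deriv G)"
 proof (cases n)
  case (Suc k)
  show ?thesis unfolding Suc fls_deriv_power di by (simp add: algebra_simps del: of_nat_Suc)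
 qed simp
 thus ?thesis unfolding cF cdF
  by (simp add: fls_deriv_fps_to_fls fps_compose_deriv[OF G(1)] fls_times_fps_to_fls algebra_simps)
qed

text \<open>Up to a multiple of \<open>1/z\<close>, a Laurent series is a derivative. A derivative
  stays one after substitution and has no residue, and \<open>1/z\<close> becomes a logarithmic
  derivative, whose residue is the order of \<open>G\<close>, namely 1.\<close>

lemma fls_residue_compose_fps:
 fixes F :: "complex fls" and G :: "complex fps"
 assumes G: "fps_nth G 0 = 0" "fps_nth G 1 ~= 0"
 shows "fls_residue (fls_compose_fps F G * fps_to_fls (fps_deriv G)) = fls_residue F"
proof -
 have G0: "G ~= 0" using G by auto
 define c where "c = fls_residue F"
 have "fls_residue (F - fls_const c * inverse fls_X) = 0"
  by (simp add: c_def fls_inverse_X)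
 then obtain H where H: "fls_deriv H = F - fls_const c * inverse fls_X"
  using fls_residue_nonzero_ex_antiderivative by blast
 hence F: "F = fls_deriv H + fls_const c * inverse fls_X" by simp
 have "fls_compose_fps F G * fps_to_fls (fps_deriv G) =
   fls_deriv (fls_compose_fps H G) + fls_const c * (inverse (fps_to_fls G) * fls_deriv (fps_to_fls G))"
  unfolding F using G G0
  by (simp add: fls_compose_fps_add fls_compose_fps_mult fls_compose_fps_inverse fls_deriv_compose_fps fls_deriv_fps_to_fls algebra_simps)
 moreover have "subdegree G = 1" using G by (intro subdegreeI) auto
 hence "fls_residue (inverse (fps_to_fls G) * fls_deriv (fps_to_fls G)) = 1"
  unfolding fls_residue_deriv_times_inverse_eq_subdegree by (simp add: fls_subdegree_fls_to_fps)
 ultimately show ?thesis by (simp add: c_def)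
qed

text \<open>It is applied to \<open>exp\<close>, for the logarithmic coordinate at a movable pole,
  and to \<open>\<mu> \<mapsto> a \<mu>\<close>, for the normalisation.\<close>

lemma residue_change_variable:
 assumes f: "f meromorphic_on {g z0}" and g: "g analytic_on {z0}" "deriv g z0 ~= 0"
 shows "residue f (g z0) = residue (%z. f (g z) * deriv g z) z0"
proof -
 obtain F where F: "(%w. f (g z0 + w)) has_laurent_expansion F"
  using f by (auto simp: meromorphic_on_def)
 define G where "G = fps_expansion (%z. g z - g z0) z0"
 have an: "(%z. g z - g z0) analytic_on {z0}" using g by (intro analytic_intros)
 have G: "(%x. g (z0 + x) - g z0) has_fps_expansion G"
  unfolding G_def by (rule analytic_at_imp_has_fps_expansion[OF an])
 have G0: "fps_nth G 0 = 0" "fps_nth G 1 = deriv g z0"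
 proof -
  show "fps_nth G 0 = 0" by (simp add: G_def fps_expansion_def)
  have "deriv (%z. g z - g z0) z0 = deriv g z0"
   using g(1) by (subst deriv_diff) (auto simp: analytic_at_imp_isCont intro: analytic_on_imp_differentiable_at)
  thus "fps_nth G 1 = deriv g z0" by (simp add: G_def fps_expansion_def)
 qed
 have GL: "(%x. g (z0 + x) - g z0) has_laurent_expansion fps_to_fls G"
  using G by (rule has_laurent_expansion_fps)
 have "((%w. f (g z0 + w)) \<circ> (%x. g (z0 + x) - g z0)) has_laurent_expansion fls_compose_fps F G"
  by (rule has_laurent_expansion_compose[OF F GL]) (use G0 g in auto)
 hence 1: "(%x. f (g (z0 + x))) has_laurent_expansion fls_compose_fps F G" by (simp add: o_def)
 have "deriv (%x. g (z0 + x) - g z0) has_laurent_expansion fls_deriv (fps_to_fls G)"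
  by (rule has_laurent_expansion_deriv[OF GL])
 moreover have ev: "\<forall>\<^sub>F x in at 0. deriv (%x. g (z0 + x) - g z0) x = deriv g (z0 + x)"
 proof -
  obtain S where S: "open S" "z0 : S" "g holomorphic_on S" using g(1) by (auto simp: analytic_at)
  have "\<forall>\<^sub>F x in nhds 0. x : (%x. z0 + x) -` S"
   using S by (intro eventually_nhds_in_open open_vimage continuous_intros) auto
  hence "\<forall>\<^sub>F x in at 0. x : (%x. z0 + x) -` S" by (simp add: eventually_at_filter eventually_mono)
  thus ?thesis
  proof eventually_elim
   case (elim x)
   have "DERIV g ((z0 + x)) :> deriv g (z0 + x)"
    using S elim by (intro holomorphic_derivI) auto
   hence "DERIV (%x. g (z0 + x) - g z0) x :> deriv g (z0 + x)"
    by (auto intro!: derivative_eq_intros DERIV_chain2[where f = g])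
   thus ?case by (rule DERIV_imp_deriv)
  qed
 qed
 ultimately have 2: "(%x. deriv g (z0 + x)) has_laurent_expansion fps_to_fls (fps_deriv G)"
  using has_laurent_expansion_cong[OF ev refl, of "fps_to_fls (fps_deriv G)"] by (simp add: fls_deriv_fps_to_fls)
 have "residue (%z. f (g z) * deriv g z) z0 = fls_residue (fls_compose_fps F G * fps_to_fls (fps_deriv G))"
  by (rule has_laurent_expansion_residue[OF has_laurent_expansion_mult[OF 1 2]])
 also have "... = fls_residue F" using G0 g by (intro fls_residue_compose_fps) auto
 also have "... = residue f (g z0)" by (rule has_laurent_expansion_residue[OF F, symmetric])
 finally show ?thesis ..
qed

text \<open>The integral over a large circle is \<open>2 \<pi> i\<close> times the sum of all
  residues, and the decay of \<open>z f(z)\<close> makes it arbitrarily small.\<close>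

lemma total_residue:
 assumes S: "finite S" and f: "f holomorphic_on - S" and lim: "((%z. z * f z) \<longlongrightarrow> 0) at_infinity"
 shows "(SUM p:S. residue f p) = 0"
proof -
 define T where "T = (SUM p:S. residue f p)"
 have "norm T <= e" if e: "e > 0" for e :: real
 proof -
  obtain B where B: "!!z. norm z \<ge> B ==> norm (z * f z) < e"
   using lim e unfolding tendsto_iff eventually_at_infinity by (auto simp: dist_norm)
  obtain M where M: "!!p. p : S ==> norm p <= M" using finite_imp_bounded[OF S] by (auto simp: bounded_iff)
  define r where "r = max (max B (M + 1)) 1"
  have r1: "r > 0" "B <= r" "M + 1 <= r" by (auto simp: r_def)
  have "norm p < r" if "p : S" for p using M[OF that] r1 by linarith
  note r = r1(1,2) this
  have sub: "path_image (circlepath 0 r) <= UNIV - S" using r by (auto dest: r(3))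
  have "contour_integral (circlepath 0 r) f = 2 * pi * \<i> * (SUM p:S. winding_number (circlepath 0 r) p * residue f p)"
   by (rule Residue_theorem[OF open_UNIV connected_UNIV S]) (insert f sub, auto simp: Compl_eq_Diff_UNIV)
  also have "(SUM p:S. winding_number (circlepath 0 r) p * residue f p) = T"
   unfolding T_def by (intro sum.cong refl) (insert r, simp add: winding_number_circlepath)
  finally have I: "contour_integral (circlepath 0 r) f = 2 * pi * \<i> * T" .
  have "f contour_integrable_on circlepath 0 r"
   by (rule contour_integrable_continuous_circlepath, rule continuous_on_subset[OF holomorphic_on_imp_continuous_on[OF f]])
    (use sub in auto)
  hence hi: "(f has_contour_integral 2 * pi * \<i> * T) (circlepath 0 r)"
   using I has_contour_integral_integral by metis
  have "norm (2 * pi * \<i> * T) <= e / r * (2 * pi * r)"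
  proof (rule has_contour_integral_bound_circlepath[OF hi])
   fix x :: complex assume "norm (x - 0) = r"
   hence "norm x = r" by simp
   moreover have "norm (x * f x) < e" using B r \<open>norm x = r\<close> by auto
   ultimately show "norm (f x) <= e / r" using r by (simp add: norm_mult field_simps)
  qed (use r e in auto)
  thus ?thesis using r by (simp add: norm_mult)
 qed
 hence "norm T <= 0" by (rule field_le_epsilon[of _ 0, simplified])
 thus ?thesis by (simp add: T_def)
qed

section \<open>Principal parts in the logarithmic coordinate\<close>

text \<open>\<open>exp_pole i\<close> is the expansion of \<open>(exp z - 1)\<^sup>-\<^sup>i\<close>.\<close>

definition exp_unit :: "complex fps" where
 "exp_unit = fps_shift 1 (fps_exp 1 - 1)"

definition exp_pole :: "nat => complex fls" where
 "exp_pole i = fls_shift (int i) (fps_to_fls (inverse exp_unit ^ i))"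

definition pole_coeff :: "nat => nat => complex" where
 "pole_coeff i j = fls_nth (exp_pole i) (- int j)"

lemma exp_unit_0: "fps_nth exp_unit 0 = 1"
 by (simp add: exp_unit_def)

lemma pole_coeff_diag: "pole_coeff i i = 1"
 by (simp add: pole_coeff_def exp_pole_def exp_unit_0 fps_nth_power_0)

lemma pole_coeff_upper: "i < j ==> pole_coeff i j = 0"
 by (simp add: pole_coeff_def exp_pole_def)

lemma exp_pole_eq: "exp_pole i = inverse (fps_to_fls (fps_exp 1 - 1)) ^ i"
proof -
 have "fps_exp 1 - 1 = fps_X * exp_unit" 
  by (rule fps_ext) (auto simp: exp_unit_def)
 moreover have "inverse (fps_to_fls exp_unit) = fps_to_fls (inverse exp_unit)"
 proof (rule inverse_unique)
  have "exp_unit * inverse exp_unit = 1" by (rule inverse_mult_eq_1') (simp add: exp_unit_0)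
  hence "fps_to_fls (exp_unit * inverse exp_unit) = 1" by simp
  thus "fps_to_fls exp_unit * fps_to_fls (inverse exp_unit) = 1" by (simp only: fls_times_fps_to_fls)
 qed
 ultimately have "inverse (fps_to_fls (fps_exp 1 - 1)) = fls_X_inv * fps_to_fls (inverse exp_unit)"
  by (simp add: fls_times_fps_to_fls fls_inverse_X)
 hence "inverse (fps_to_fls (fps_exp 1 - 1)) ^ i = fls_X_inv ^ i * fps_to_fls (inverse exp_unit ^ i)"
  by (simp add: power_mult_distrib fps_to_fls_power)
 thus ?thesis unfolding exp_pole_def by (simp add: fls_X_inv_power_times_conv_shift)
qed

lemma exp_pole_laurent: "(%x. 1 / (exp x - 1) ^ i) has_laurent_expansion exp_pole i"
proof -
 have "(%x. exp (1 * x) - 1 :: complex) has_fps_expansion fps_exp 1 - 1"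
  by (intro fps_expansion_intros)
 hence "(%x. exp x - 1 :: complex) has_laurent_expansion fps_to_fls (fps_exp 1 - 1)"
  using has_laurent_expansion_fps by fastforce
 hence "(%x. inverse (exp x - 1 :: complex) ^ i) has_laurent_expansion exp_pole i"
  unfolding exp_pole_eq by (intro laurent_expansion_intros)
 thus ?thesis by (simp add: field_simps power_inverse)
qed

lemma exp_pole_deriv: "fls_deriv (exp_pole i) = - of_nat i * (exp_pole i + exp_pole (Suc i))"
proof -
 let ?T = "fps_to_fls (fps_exp 1 - 1 :: complex fps)"
 have T0: "?T ~= 0"
 proof
  assume "?T = 0"
  hence "fps_nth (fps_exp 1 - 1 :: complex fps) 1 = 0" by simp
  thus False by (simp add: numeral_eq_Suc)
 qed
 have dT: "fls_deriv ?T = ?T + 1" by (simp add: fls_deriv_fps_to_fls)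
 have i: "?T * inverse ?T = 1" using T0 by simp
 have "0 = fls_deriv (?T * inverse ?T) * inverse ?T" unfolding i by simp
 also have "... = (?T * inverse ?T) * fls_deriv (inverse ?T) + (?T * inverse ?T + inverse ?T) * inverse ?T"
  unfolding fls_deriv_mult dT by (simp only: algebra_simps mult_1_left mult_1_right)
 finally have d: "fls_deriv (inverse ?T) = - (1 + inverse ?T) * inverse ?T"
  unfolding i by (simp add: eq_neg_iff_add_eq_0 algebra_simps)
 show ?thesis
 proof (cases i)
  case (Suc n)
  thus ?thesis unfolding exp_pole_eq fls_deriv_power d by (simp add: algebra_simps)
 qed (simp add: exp_pole_eq)
qed

text \<open>A derivative has no residue, so \<open>exp_pole_deriv\<close> forces consecutive
  residues to be opposite.\<close>

lemma pole_coeff_residue: "pole_coeff (Suc i) 1 = (- 1) ^ i"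
proof (induction i)
 case 0
 show ?case using pole_coeff_diag[of 1] by simp
next
 case (Suc i)
 have "fls_residue (fls_deriv (exp_pole (Suc i))) = 0" by (rule fls_residue_deriv)
 hence "of_nat (Suc i) * (pole_coeff (Suc i) 1 + pole_coeff (Suc (Suc i)) 1) = 0"
  unfolding exp_pole_deriv by (simp add: pole_coeff_def fls_mult_of_nat_nth del: of_nat_Suc One_nat_def)
 hence "pole_coeff (Suc i) 1 + pole_coeff (Suc (Suc i)) 1 = 0"
  by (simp only: mult_eq_0_iff of_nat_eq_0_iff) simp
 thus ?case using Suc by (simp add: eq_neg_iff_add_eq_0 add.commute)
qed

lemma fls_principal_decomposition:
 fixes F :: "complex fls"
 assumes "!!n. n < - int m ==> fls_nth F n = 0"
 shows "F = fls_shift (int m) (fps_to_fls (prin_series m (%j. fls_nth F (- int j)))) + fps_to_fls (fls_regpart F)"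
proof (rule fls_eqI)
 fix n
 consider "n < - int m" | "- int m <= n" "n < 0" | "n \<ge> 0" by linarith
 thus "fls_nth F n = fls_nth (fls_shift (int m) (fps_to_fls (prin_series m (%j. fls_nth F (- int j)))) + fps_to_fls (fls_regpart F)) n"
 proof cases
  case 2
  hence "nat (n + int m) < m" "int (m - nat (n + int m)) = - n" by auto
  thus ?thesis using 2 by (simp add: principal_series_nth)
 next
  case 3
  hence "\<not> nat (n + int m) < m" by auto
  thus ?thesis using 3 by (simp add: principal_series_nth)
 qed (use assms in auto)
qed

text \<open>With this normalisation the Laurent coefficients in the logarithmic coordinate do not depend on \<open>b\<close>.\<close>

definition lprin :: "nat => (nat => complex) => complex => complex => complex" where
 "lprin m eps b \<nu> = (SUM i=1..m. eps i / (\<nu> / b - 1) ^ i)"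

definition log_coeff :: "nat => (nat => complex) => nat => complex" where
 "log_coeff m eps j = (SUM i=1..m. eps i * pole_coeff i j)"

definition log_series :: "nat => (nat => complex) => complex fls" where
 "log_series m eps = (SUM i=1..m. fls_const (eps i) * exp_pole i)"

lemma log_principal_laurent:
 "(%x. lprin m eps (exp \<b>) (exp (\<b> + x))) has_laurent_expansion log_series m eps"
proof -
 have "(%x. SUM i=1..m. eps i * (1 / (exp x - 1) ^ i)) has_laurent_expansion log_series m eps"
  unfolding log_series_def by (intro laurent_expansion_intros exp_pole_laurent)
 moreover have "exp (\<b> + x) / exp \<b> = exp x" for x :: complex by (simp add: exp_add)
 ultimately show ?thesis by (simp add: lprin_def)
qed

lemma fls_nth_sum: "fls_nth (sum f A) n = (SUM a:A. fls_nth (f a) n)"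
 by (induction A rule: infinite_finite_induct) auto

lemma log_series_nth: "fls_nth (log_series m eps) (- int j) = log_coeff m eps j"
 by (simp add: log_series_def log_coeff_def fls_nth_sum pole_coeff_def)

lemma log_coeff_zero: "m < j ==> log_coeff m eps j = 0"
 unfolding log_coeff_def by (intro sum.neutral) (auto simp: pole_coeff_upper)

lemma log_coeff_top: "0 < m ==> log_coeff m eps m = eps m"
proof -
 assume m: "0 < m"
 have "log_coeff m eps m = (SUM i=1..m. if i = m then eps i else 0)"
  unfolding log_coeff_def by (intro sum.cong refl) (auto simp: pole_coeff_diag pole_coeff_upper)
 thus ?thesis using m by simp
qed

text \<open>The sum is the value of the principal part at \<open>\<nu> = 0\<close>, where
  \<open>\<nu> / b - 1 = -1\<close>. Because of this, \<open>c\<^sub>1\<close> couples to the lowest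
  coefficient of \<open>h\<close> in the metric.\<close>

lemma log_coeff_1: "log_coeff m eps 1 = - (SUM i=1..m. eps i * (- 1) ^ i)"
proof -
 have "pole_coeff i 1 = - ((- 1) ^ i)" if "i : {1..m}" for i
  using that pole_coeff_residue[of "i - 1"] by (cases i) auto
 thus ?thesis unfolding log_coeff_def sum_negf[symmetric] by (intro sum.cong) auto
qed

lemma log_series_decomposition:
 "log_series m eps = fls_shift (int m) (fps_to_fls (prin_series m (log_coeff m eps))) + fps_to_fls (fls_regpart (log_series m eps))"
proof -
 have "fls_nth (log_series m eps) n = 0" if "n < - int m" for n
 proof -
  have "n = - int (nat (- n))" using that by simp
  hence "fls_nth (log_series m eps) n = log_coeff m eps (nat (- n))" using log_series_nth by metis
  thus ?thesis using that by (simp add: log_coeff_zero)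
 qed
 from fls_principal_decomposition[of m, OF this] show ?thesis by (simp add: log_series_nth)
qed

definition lprin_deriv :: "nat => (nat => complex) => complex => complex => complex" where
 "lprin_deriv m eps b \<nu> = (SUM i=1..m. - of_nat i * eps i / b / (\<nu> / b - 1) ^ Suc i)"

lemma log_principal_has_deriv:
 assumes "b ~= 0" "\<nu> ~= b"
 shows "DERIV (lprin m eps b) (\<nu>) :> lprin_deriv m eps b \<nu>"
proof -
 have "\<nu> / b - 1 ~= 0" using assms by auto
 moreover have "DERIV (%\<nu>. eps i / (\<nu> / b - 1) ^ i) (\<nu>) :> - of_nat i * eps i / b / (\<nu> / b - 1) ^ Suc i"
  if "\<nu> / b - 1 ~= 0" for i
 proof -
  have "DERIV (%\<nu>. \<nu> / b - 1) (\<nu>) :> 1 / b"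
   using assms by (auto intro!: derivative_eq_intros)
  from DERIV_cmult[OF DERIV_power[OF DERIV_inverse'[OF this that], of i], of "eps i"]
  have "DERIV (%\<nu>. eps i * inverse (\<nu> / b - 1) ^ i) (\<nu>) :> eps i * (of_nat i * (- (inverse (\<nu> / b - 1) * (1 / b) * inverse (\<nu> / b - 1)) * inverse (\<nu> / b - 1) ^ (i - Suc 0)))" .
  moreover have "eps i * (of_nat i * (- (x * (1 / b) * x) * x ^ (i - Suc 0))) = - of_nat i * eps i * (1 / b) * x ^ Suc i" for x
   by (cases i) (simp_all add: algebra_simps add_divide_distrib)
  ultimately have "DERIV (%\<nu>. eps i * inverse (\<nu> / b - 1) ^ i) (\<nu>) :> - of_nat i * eps i * (1 / b) * inverse (\<nu> / b - 1) ^ Suc i"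
   by (simp only:)
  moreover have "eps i * inverse (\<nu> / b - 1) ^ i = eps i / (\<nu> / b - 1) ^ i" for \<nu>
   by (simp add: divide_inverse power_inverse)
  moreover have "- of_nat i * eps i * (1 / b) * inverse (\<nu> / b - 1) ^ Suc i = - of_nat i * eps i / b / (\<nu> / b - 1) ^ Suc i"
   unfolding power_inverse by (simp add: divide_inverse)
  ultimately show ?thesis by (simp only:)
 qed
 ultimately show ?thesis unfolding lprin_def[abs_def] lprin_deriv_def by (intro DERIV_sum) auto
qed

text \<open>Derivative of \<open>lprin m eps (exp \<b>) \<nu>\<close> at fixed \<open>\<nu>\<close> in a direction with components \<open>eps'\<close> and \<open>\<b>'\<close>.\<close>

definition lprin_var ::
  "nat => (nat => complex) => (nat => complex) => complex => complex => complex => complex" where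
 "lprin_var m eps eps' \<b>' b \<nu> =
   (SUM i=1..m. eps' i / (\<nu> / b - 1) ^ i + of_nat i * eps i * \<b>' * (\<nu> / b) / (\<nu> / b - 1) ^ Suc i)"

text \<open>With \<open>\<nu> = exp (\<b> + x)\<close> fixed, moving \<open>\<b>\<close> moves
  \<open>x\<close> by the opposite amount; this gives the term with the derivative of the
  series.\<close>

lemma log_principal_variation_laurent:
 "(%x. lprin_var m eps eps' \<b>' (exp \<b>) (exp (\<b> + x))) has_laurent_expansion
   log_series m eps' - fls_const \<b>' * fls_deriv (log_series m eps)"
proof -
 have e: "exp (\<b> + x) / exp \<b> = exp x" for x :: complex by (simp add: exp_add)
 have "(%x. SUM i=1..m. eps' i * (1 / (exp x - 1) ^ i) + of_nat i * eps i * \<b>' * (1 / (exp x - 1) ^ i + 1 / (exp x - 1) ^ Suc i))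
   has_laurent_expansion (SUM i=1..m. fls_const (eps' i) * exp_pole i + fls_const (of_nat i * eps i * \<b>') * (exp_pole i + exp_pole (Suc i)))"
 proof (rule has_laurent_expansion_sum)
  fix i
  show "(%x. eps' i * (1 / (exp x - 1) ^ i) + of_nat i * eps i * \<b>' * (1 / (exp x - 1) ^ i + 1 / (exp x - 1) ^ Suc i))
    has_laurent_expansion fls_const (eps' i) * exp_pole i + fls_const (of_nat i * eps i * \<b>') * (exp_pole i + exp_pole (Suc i))"
   by (rule has_laurent_expansion_add[OF has_laurent_expansion_cmult_left[OF exp_pole_laurent]
      has_laurent_expansion_cmult_left[OF has_laurent_expansion_add[OF exp_pole_laurent exp_pole_laurent]]])
 qed
 moreover have "(SUM i=1..m. fls_const (eps' i) * exp_pole i + fls_const (of_nat i * eps i * \<b>') * (exp_pole i + exp_pole (Suc i)))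
   = log_series m eps' - fls_const \<b>' * fls_deriv (log_series m eps)"
 proof -
  have "fls_deriv (log_series m eps) = (SUM i=1..m. fls_const (eps i) * (- of_nat i * (exp_pole i + exp_pole (Suc i))))"
   unfolding log_series_def fls_deriv_sum by (intro sum.cong refl) (simp add: exp_pole_deriv)
  hence d: "fls_const \<b>' * fls_deriv (log_series m eps) = (SUM i=1..m. fls_const \<b>' * (fls_const (eps i) * (- of_nat i * (exp_pole i + exp_pole (Suc i)))))"
   by (simp only: sum_distrib_left)
  have key: "fls_const (of_nat i * eps i * \<b>') * Z = - (fls_const \<b>' * (fls_const (eps i) * (- of_nat i * Z)))" for i and Z :: "complex fls"
  proof -
   have c: "fls_const (of_nat i * eps i * \<b>') = of_nat i * (fls_const (eps i) * fls_const \<b>')"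
    by (simp only: fls_of_nat fls_const_mult_const mult.assoc)
   show ?thesis unfolding c by (simp only: mult_minus_left mult_minus_right minus_minus ac_simps)
  qed
  show ?thesis unfolding d log_series_def[of m eps'] sum_subtractf[symmetric]
   by (intro sum.cong refl) (simp only: key diff_conv_add_uminus)
 qed
 \<comment> \<open>Near 0, \<open>exp x = 1\<close> only for \<open>x = 0\<close>, since
   \<open>Ln\<close> inverts \<open>exp\<close> on the strip. Elsewhere the numerator
   \<open>exp x\<close> is written as \<open>(exp x - 1) + 1\<close>.\<close>
 moreover have ev: "\<forall>\<^sub>F x in at 0. (SUM i=1..m. eps' i * (1 / (exp x - 1) ^ i) + of_nat i * eps i * \<b>' * (1 / (exp x - 1) ^ i + 1 / (exp x - 1) ^ Suc i))
   = lprin_var m eps eps' \<b>' (exp \<b>) (exp (\<b> + x))"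
 proof -
  have "\<forall>\<^sub>F x in at 0. exp x - 1 ~= (0::complex)"
  proof -
   have "\<forall>\<^sub>F x in at (0::complex). x : ball 0 1 - {0}" by (rule eventually_at_in_open) auto
   thus ?thesis
   proof eventually_elim
    case (elim x)
    have "x = 0" if "exp x = 1"
    proof -
     have "norm (Im x) < 1" using elim abs_Im_le_cmod[of x] by simp
     hence "Ln (exp x) = x" using pi_gt3 by (intro Ln_exp) auto
     thus ?thesis using that by simp
    qed
    thus ?case using elim by auto
   qed
  qed
  thus ?thesis
  proof eventually_elim
   case (elim x)
   have *: "exp x / (exp x - 1) ^ Suc i = 1 / (exp x - 1) ^ i + 1 / (exp x - 1) ^ Suc i" for i
    using elim by (simp add: field_simps)
   show ?case unfolding lprin_var_def e
    by (intro sum.cong refl) (simp only: *[symmetric] times_divide_eq_right mult_1_right)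
  qed
 qed
 ultimately show ?thesis using has_laurent_expansion_cong[OF ev refl] by simp
qed

section \<open>The residue metric of a superpotential\<close>

text \<open>It serves to show that critical sets and zero sets are finite. The equation is required
  only off \<open>S\<close>, because total division gives arbitrary values at poles.\<close>

definition rational_off :: "complex set => (complex => complex) => bool" where
 "rational_off S f \<longleftrightarrow> (EX p q. ALL z. z ~: S --> poly q z ~= 0 & f z * poly q z = poly p z)"

lemma rational_off_const: "rational_off S (%_. c)"
 unfolding rational_off_def by (intro exI[of _ "[:c:]"] exI[of _ 1]) simp

lemma rational_off_id: "rational_off S (%z. z)"
 unfolding rational_off_def by (intro exI[of _ "[:0, 1:]"] exI[of _ 1]) simp

lemma rational_off_add:
 assumes "rational_off S f" "rational_off S g" shows "rational_off S (%z. f z + g z)"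
proof -
 obtain p q where f: "!!z. z ~: S ==> poly q z ~= 0 & f z * poly q z = poly p z"
  using assms(1) unfolding rational_off_def by blast
 obtain p' q' where g: "!!z. z ~: S ==> poly q' z ~= 0 & g z * poly q' z = poly p' z"
  using assms(2) unfolding rational_off_def by blast
 have "poly (q * q') z ~= 0 & (f z + g z) * poly (q * q') z = poly (p * q' + p' * q) z" if "z ~: S" for z
  using f[OF that] g[OF that] by (auto simp: algebra_simps)
 thus ?thesis unfolding rational_off_def by blast
qed

lemma rational_off_mult:
 assumes "rational_off S f" "rational_off S g" shows "rational_off S (%z. f z * g z)"
proof -
 obtain p q where f: "!!z. z ~: S ==> poly q z ~= 0 & f z * poly q z = poly p z"
  using assms(1) unfolding rational_off_def by blast
 obtain p' q' where g: "!!z. z ~: S ==> poly q' z ~= 0 & g z * poly q' z = poly p' z"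
  using assms(2) unfolding rational_off_def by blast
 have "poly (q * q') z ~= 0 & (f z * g z) * poly (q * q') z = poly (p * p') z" if "z ~: S" for z
 proof -
  have e: "poly p z = f z * poly q z" "poly p' z = g z * poly q' z" using f[OF that] g[OF that] by simp_all
  have "poly q z ~= 0" "poly q' z ~= 0" using f[OF that] g[OF that] by simp_all
  thus ?thesis by (simp add: e)
 qed
 thus ?thesis unfolding rational_off_def by blast
qed

lemma rational_off_sum: "(!!a. a : A ==> rational_off S (f a)) ==> rational_off S (%z. SUM a:A. f a z)"
 by (induction A rule: infinite_finite_induct) (auto intro: rational_off_const rational_off_add)

lemma rational_off_power: "rational_off S f ==> rational_off S (%z. f z ^ n)"
 by (induction n) (auto intro: rational_off_const rational_off_mult)

lemma rational_off_inverse_linear: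
 assumes "b : S" "b ~= 0" shows "rational_off S (%z. inverse (z / b - 1))"
 unfolding rational_off_def
proof (rule exI[of _ 1], rule exI[of _ "[:-1, 1/b:]"], intro allI impI)
 fix z assume "z ~: S"
 hence "z / b - 1 ~= 0" using assms by auto
 moreover have "poly [:-1, 1/b:] z = z / b - 1" by simp
 ultimately show "poly [:-1, 1/b:] z ~= 0 & inverse (z / b - 1) * poly [:-1, 1/b:] z = poly 1 z"
  by (simp only: left_inverse poly_1 simp_thms not_False_eq_True)
qed

lemma rational_off_powi:
 assumes "0 : S" shows "rational_off S (%z. z powi n)"
proof -
 have "rational_off S (%z. inverse z)"
  unfolding rational_off_def
 proof (rule exI[of _ 1], rule exI[of _ "[:0, 1:]"], intro allI impI)
  fix z assume "z ~: S"
  hence "z ~= 0" using assms by auto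
  thus "poly [:0, 1:] z ~= 0 & inverse z * poly [:0, 1:] z = poly 1 z" by simp
 qed
 thus ?thesis by (cases "n \<ge> 0") (simp_all add: power_int_def rational_off_power rational_off_id)
qed

lemma rational_off_finite_zeros:
 assumes "rational_off S f" "z0 ~: S" "f z0 ~= 0"
 shows "finite {z. z ~: S & f z = 0}"
proof -
 obtain p q where pq: "!!z. z ~: S ==> poly q z ~= 0 & f z * poly q z = poly p z"
  using assms(1) unfolding rational_off_def by blast
 have "p ~= 0" using pq[OF assms(2)] assms(3) by auto
 hence "finite {z. poly p z = 0}" by (rule poly_roots_finite)
 thus ?thesis by (rule finite_subset[rotated]) (use pq in force)
qed

text \<open>A tangent vector of the Dubrovin--Zhang manifold: the leading coefficient of
  \<open>h\<close> is fixed, so the power \<open>lh + 1\<close> does not occur.\<close>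

definition laurent_poly :: "nat => nat => (int => complex) => complex => complex" where
 "laurent_poly lh kb A \<nu> = (SUM i:dz_ix lh kb. A i * \<nu> powi i)"

definition dz_deriv :: "nat => nat => (int => complex) => complex => complex" where
 "dz_deriv lh kb A \<nu> = of_nat (lh + 1) * \<nu> ^ lh + (SUM i:dz_ix lh kb. A i * (of_int i * \<nu> powi (i - 1)))"

lemma finite_dz_index: "finite (dz_ix lh kb)"
 by (simp add: dz_index_def)

lemma dz_has_deriv:
 assumes "\<nu> ~= 0"
 shows "DERIV (dzs lh kb A) (\<nu>) :> dz_deriv lh kb A \<nu>"
proof -
 have d1: "DERIV (%\<nu>. \<nu> ^ (lh + 1)) (\<nu>) :> of_nat (lh + 1) * \<nu> ^ lh"
  using DERIV_power[OF DERIV_ident, of "lh + 1" \<nu>] by simp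
 have d2: "DERIV (%\<nu>. \<nu> powi i) (\<nu>) :> of_int i * \<nu> powi (i - 1)" for i
  using assms by (auto intro!: derivative_eq_intros)
 show ?thesis unfolding dz_superpotential_def[abs_def] dz_deriv_def
  by (intro DERIV_add DERIV_sum DERIV_cmult d1 d2)
qed

lemma powi_tendsto_infinity:
 "i <= 0 ==> ((%\<nu>::complex. \<nu> powi i) \<longlongrightarrow> (if i = 0 then 1 else 0)) at_infinity"
proof -
 assume i: "i <= 0"
 have "((%\<nu>::complex. inverse \<nu> ^ nat (- i)) \<longlongrightarrow> 0 ^ nat (- i)) at_infinity"
  by (intro tendsto_power tendsto_inverse_0)
 moreover have "0 ^ nat (- i) = (if i = 0 then 1 else 0 :: complex)" using i by auto
 moreover have "inverse \<nu> ^ nat (- i) = \<nu> powi i" for \<nu> :: complex using i by (auto simp: power_int_def)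
 ultimately show ?thesis by simp
qed

lemma powi_tendsto_0:
 "i \<ge> 0 ==> ((%\<nu>::complex. \<nu> powi i) \<longlongrightarrow> (if i = 0 then 1 else 0)) (at 0)"
proof -
 assume i: "i \<ge> 0"
 have "((%\<nu>::complex. \<nu> ^ nat i) \<longlongrightarrow> 0 ^ nat i) (at 0)"
  by (intro tendsto_power tendsto_ident_at)
 moreover have "0 ^ nat i = (if i = 0 then 1 else 0 :: complex)" using i by auto
 moreover have "\<nu> ^ nat i = \<nu> powi i" for \<nu> :: complex using i by (auto simp: power_int_def)
 ultimately show ?thesis by simp
qed

text \<open>Growth is recorded as a power times a factor \<open>u\<close> that has a limit. The
  comparison of integrands at infinity and at 0 then reduces to limits of rational expressions in
  such factors.\<close>

lemma laurent_poly_infinity: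
 "EX u. (u \<longlongrightarrow> A (int lh)) at_infinity & (ALL \<nu>. \<nu> ~= 0 --> laurent_poly lh kb A \<nu> = \<nu> ^ lh * u \<nu>)"
proof (intro exI conjI allI impI)
 let ?u = "%\<nu>. SUM i:dz_ix lh kb. A i * \<nu> powi (i - int lh)"
 have "(?u \<longlongrightarrow> (SUM i:dz_ix lh kb. A i * (if i - int lh = 0 then 1 else 0))) at_infinity"
  by (intro tendsto_sum tendsto_mult tendsto_const powi_tendsto_infinity) (auto simp: dz_index_def)
 also have "(SUM i:dz_ix lh kb. A i * (if i - int lh = 0 then 1 else 0)) = (SUM i:dz_ix lh kb. if i = int lh then A i else 0)"
  by (intro sum.cong) auto
 also have "... = A (int lh)" by (simp add: dz_index_def)
 finally show "(?u \<longlongrightarrow> A (int lh)) at_infinity" .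
 fix \<nu> :: complex assume "\<nu> ~= 0"
 hence e: "\<nu> powi i = \<nu> ^ lh * \<nu> powi (i - int lh)" for i
  by (simp add: power_int_diff)
 have t: "A i * \<nu> powi i = \<nu> ^ lh * (A i * \<nu> powi (i - int lh))" for i
  by (subst e) (rule mult.left_commute)
 show "laurent_poly lh kb A \<nu> = \<nu> ^ lh * ?u \<nu>"
  unfolding laurent_poly_def sum_distrib_left by (intro sum.cong refl t)
qed

lemma laurent_poly_0:
 "EX u. (u \<longlongrightarrow> A (- int kb)) (at 0) & (ALL \<nu>. \<nu> ~= 0 --> laurent_poly lh kb A \<nu> = inverse \<nu> ^ kb * u \<nu>)"
proof (intro exI conjI allI impI)
 let ?u = "%\<nu>. SUM i:dz_ix lh kb. A i * \<nu> powi (i + int kb)"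
 have "(?u \<longlongrightarrow> (SUM i:dz_ix lh kb. A i * (if i + int kb = 0 then 1 else 0))) (at 0)"
  by (intro tendsto_sum tendsto_mult tendsto_const powi_tendsto_0) (auto simp: dz_index_def)
 also have "(SUM i:dz_ix lh kb. A i * (if i + int kb = 0 then 1 else 0)) = (SUM i:dz_ix lh kb. if i = - int kb then A i else 0)"
  by (intro sum.cong) auto
 also have "... = A (- int kb)" by (simp add: dz_index_def)
 finally show "(?u \<longlongrightarrow> A (- int kb)) (at 0)" .
 fix \<nu> :: complex assume "\<nu> ~= 0"
 hence e: "\<nu> powi i = inverse \<nu> ^ kb * \<nu> powi (i + int kb)" for i
  by (simp add: power_int_add power_inverse)
 have t: "A i * \<nu> powi i = inverse \<nu> ^ kb * (A i * \<nu> powi (i + int kb))" for i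
  by (subst e) (rule mult.left_commute)
 show "laurent_poly lh kb A \<nu> = inverse \<nu> ^ kb * ?u \<nu>"
  unfolding laurent_poly_def sum_distrib_left by (intro sum.cong refl t)
qed

lemma dz_deriv_laurent:
 "\<nu> ~= 0 ==> dz_deriv lh kb A \<nu> = of_nat (lh + 1) * \<nu> ^ lh + laurent_poly lh kb (%i. of_int i * A i) \<nu> / \<nu>"
 unfolding dz_deriv_def laurent_poly_def sum_divide_distrib
 by (intro arg_cong2[where f = "(+)"] refl sum.cong) (simp add: power_int_diff)

lemma dz_deriv_infinity:
 "EX u. (u \<longlongrightarrow> of_nat (lh + 1)) at_infinity & (ALL \<nu>. \<nu> ~= 0 --> dz_deriv lh kb A \<nu> = \<nu> ^ lh * u \<nu>)"
proof -
 obtain u where u: "(u \<longlongrightarrow> of_int (int lh) * A (int lh)) at_infinity"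
  "!!\<nu>. \<nu> ~= 0 ==> laurent_poly lh kb (%i. of_int i * A i) \<nu> = \<nu> ^ lh * u \<nu>"
  using laurent_poly_infinity[of "%i. of_int i * A i" lh kb] by blast
 show ?thesis
 proof (intro exI conjI allI impI)
  have "((%\<nu>. of_nat (lh + 1) + u \<nu> * inverse \<nu>) \<longlongrightarrow> of_nat (lh + 1) + of_int (int lh) * A (int lh) * 0) at_infinity"
   by (intro tendsto_intros u tendsto_inverse_0)
  thus "((%\<nu>. of_nat (lh + 1) + u \<nu> * inverse \<nu>) \<longlongrightarrow> of_nat (lh + 1)) at_infinity" by simp
 qed (insert u, simp add: dz_deriv_laurent field_simps)
qed

lemma dz_deriv_0:
 "EX u. (u \<longlongrightarrow> - of_nat kb * A (- int kb)) (at 0) & (ALL \<nu>. \<nu> ~= 0 --> dz_deriv lh kb A \<nu> = inverse \<nu> ^ Suc kb * u \<nu>)"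
proof -
 obtain u where u: "(u \<longlongrightarrow> of_int (- int kb) * A (- int kb)) (at 0)"
  "!!\<nu>. \<nu> ~= 0 ==> laurent_poly lh kb (%i. of_int i * A i) \<nu> = inverse \<nu> ^ kb * u \<nu>"
  using laurent_poly_0[of "%i. of_int i * A i" kb lh] by blast
 show ?thesis
 proof (intro exI conjI allI impI)
  have "((%\<nu>. of_nat (lh + 1) * \<nu> ^ lh * \<nu> ^ Suc kb + u \<nu>) \<longlongrightarrow> of_nat (lh + 1) * 0 ^ lh * 0 ^ Suc kb + of_int (- int kb) * A (- int kb)) (at 0)"
   by (intro tendsto_intros u)
  thus "((%\<nu>. of_nat (lh + 1) * \<nu> ^ lh * \<nu> ^ Suc kb + u \<nu>) \<longlongrightarrow> - of_nat kb * A (- int kb)) (at 0)" by simp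
  fix \<nu> :: complex assume nz: "\<nu> ~= 0"
  have "inverse \<nu> ^ Suc kb * (of_nat (lh + 1) * \<nu> ^ lh * \<nu> ^ Suc kb) = of_nat (lh + 1) * \<nu> ^ lh * (inverse \<nu> ^ Suc kb * \<nu> ^ Suc kb)"
   by (simp only: ac_simps)
  also have "inverse \<nu> ^ Suc kb * \<nu> ^ Suc kb = 1" using nz by (simp add: power_mult_distrib[symmetric] del: power_Suc)
  finally have 1: "inverse \<nu> ^ Suc kb * (of_nat (lh + 1) * \<nu> ^ lh * \<nu> ^ Suc kb) = of_nat (lh + 1) * \<nu> ^ lh" by simp
  have 2: "inverse \<nu> ^ kb * u \<nu> / \<nu> = inverse \<nu> ^ Suc kb * u \<nu>" by (simp add: divide_inverse)
  show "dz_deriv lh kb A \<nu> = inverse \<nu> ^ Suc kb * (of_nat (lh + 1) * \<nu> ^ lh * \<nu> ^ Suc kb + u \<nu>)"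
   unfolding distrib_left 1 dz_deriv_laurent[OF nz] u(2)[OF nz] 2 ..
 qed
qed

section \<open>Asymptotics of the principal parts at infinity and at 0\<close>

lemma inverse_linear_tendsto_0:
 assumes "b ~= (0::complex)" shows "((%\<nu>. inverse (\<nu> / b - 1)) \<longlongrightarrow> 0) at_infinity"
proof -
 have "filterlim (%\<nu>. inverse b * \<nu>) at_infinity at_infinity"
  by (rule tendsto_mult_filterlim_at_infinity[OF tendsto_const]) (insert assms, auto simp: filterlim_ident)
 hence "filterlim (%\<nu>. - 1 + inverse b * \<nu>) at_infinity at_infinity"
  by (rule tendsto_add_filterlim_at_infinity[OF tendsto_const])
 hence "filterlim (%\<nu>. \<nu> / b - 1) at_infinity at_infinity"
  by (simp add: divide_inverse mult.commute)
 thus ?thesis by (rule filterlim_compose[OF tendsto_inverse_0])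
qed

lemma log_principal_variation_infinity:
 assumes "b ~= 0" shows "(lprin_var m eps eps' \<b>' b \<longlongrightarrow> 0) at_infinity"
proof -
 let ?x = "%\<nu>. inverse (\<nu> / b - 1)"
 have "((%\<nu>. SUM i=1..m. eps' i * ?x \<nu> ^ i + of_nat i * eps i * \<b>' * (?x \<nu> ^ i + ?x \<nu> ^ Suc i)) \<longlongrightarrow>
   (SUM i=1..m. eps' i * 0 ^ i + of_nat i * eps i * \<b>' * (0 ^ i + 0 ^ Suc i))) at_infinity"
  by (intro tendsto_intros inverse_linear_tendsto_0 assms)
 also have "(SUM i=1..m. eps' i * 0 ^ i + of_nat i * eps i * \<b>' * (0 ^ i + 0 ^ Suc i)) = 0"
  by (intro sum.neutral) (auto simp: power_0_left)
 finally have *: "((%\<nu>. SUM i=1..m. eps' i * ?x \<nu> ^ i + of_nat i * eps i * \<b>' * (?x \<nu> ^ i + ?x \<nu> ^ Suc i)) \<longlongrightarrow> 0) at_infinity" .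
 have "\<forall>\<^sub>F \<nu> in at_infinity. (SUM i=1..m. eps' i * ?x \<nu> ^ i + of_nat i * eps i * \<b>' * (?x \<nu> ^ i + ?x \<nu> ^ Suc i)) = lprin_var m eps eps' \<b>' b \<nu>"
  using eventually_not_equal_at_infinity[of b]
 proof eventually_elim
  case (elim \<nu>)
  have x0: "\<nu> / b - 1 ~= 0" using elim assms by auto
  have key: "(\<nu> / b) / (\<nu> / b - 1) ^ Suc i = ?x \<nu> ^ i + ?x \<nu> ^ Suc i" for i
  proof -
   have "\<nu> / b = (\<nu> / b - 1) + 1" by simp
   hence "(\<nu> / b) / (\<nu> / b - 1) ^ Suc i = (\<nu> / b - 1) / (\<nu> / b - 1) ^ Suc i + 1 / (\<nu> / b - 1) ^ Suc i"
    by (metis add_divide_distrib)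
   also have "(\<nu> / b - 1) / (\<nu> / b - 1) ^ Suc i = ?x \<nu> ^ i" using x0 by (simp add: inverse_eq_divide power_one_over)
   finally show ?thesis by (simp add: inverse_eq_divide power_one_over)
  qed
  have a: "eps' i / (\<nu> / b - 1) ^ i = eps' i * ?x \<nu> ^ i" for i by (simp add: inverse_eq_divide power_one_over)
  have b: "of_nat i * eps i * \<b>' * (\<nu> / b) / (\<nu> / b - 1) ^ Suc i = of_nat i * eps i * \<b>' * (?x \<nu> ^ i + ?x \<nu> ^ Suc i)" for i
   unfolding key[symmetric] by (rule times_divide_eq_right[symmetric])
  show ?case unfolding lprin_var_def a b ..
 qed
 with * show ?thesis by (rule Lim_transform_eventually)
qed

lemma log_principal_deriv_infinity:
 assumes "b ~= 0" shows "(lprin_deriv m eps b \<longlongrightarrow> 0) at_infinity"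
proof -
 let ?x = "%\<nu>. inverse (\<nu> / b - 1)"
 have "((%\<nu>. SUM i=1..m. - of_nat i * eps i / b * ?x \<nu> ^ Suc i) \<longlongrightarrow> (SUM i=1..m. - of_nat i * eps i / b * 0 ^ Suc i)) at_infinity"
  by (intro tendsto_intros inverse_linear_tendsto_0 assms)
 thus ?thesis unfolding lprin_deriv_def[abs_def] by (simp add: divide_inverse power_inverse)
qed

text \<open>The terms from moving the pole carry a factor \<open>\<nu>\<close> and vanish at 0; the
  remaining value is the sum of \<open>log_coeff_1\<close>.\<close>

lemma log_principal_variation_0:
 assumes "b ~= 0"
 shows "(lprin_var m eps eps' \<b>' b \<longlongrightarrow> - log_coeff m eps' 1) (at 0)"
proof -
 have "isCont (lprin_var m eps eps' \<b>' b) 0"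
  unfolding lprin_var_def[abs_def]
  by (intro continuous_intros) (use assms in auto)
 hence "(lprin_var m eps eps' \<b>' b \<longlongrightarrow> lprin_var m eps eps' \<b>' b 0) (at 0)"
  by (simp add: isCont_def)
 also have "lprin_var m eps eps' \<b>' b 0 = - log_coeff m eps' 1"
  unfolding log_coeff_1 minus_minus lprin_var_def by (intro sum.cong refl) (auto simp: minus_one_power_iff)
 finally show ?thesis .
qed

lemma log_principal_deriv_0:
 assumes "b ~= 0"
 shows "(lprin_deriv m eps b \<longlongrightarrow> lprin_deriv m eps b 0) (at 0)"
proof -
 have "isCont (lprin_deriv m eps b) 0"
  unfolding lprin_deriv_def[abs_def]
  by (intro continuous_intros) (use assms in auto)
 thus ?thesis by (simp add: isCont_def)
qed

text \<open>One superpotential in normal form, with the poles given by their logarithms. For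
  \<open>L = 0\<close> it describes the Dubrovin--Zhang superpotential itself, whose critical set
  and metric are obtained as this special case.\<close>

locale lg_data =
 fixes lh kb L :: nat and m :: "nat => nat" and A :: "int => complex"
  and be :: "nat => complex" and ep :: "nat => nat => complex"
 assumes kb: "1 <= kb" and A0: "A (- int kb) ~= 0"
  and inj: "inj_on (%\<a>. exp (be \<a>)) {1..L}"
  and m: "!!\<a>. \<a> : {1..L} ==> 1 <= m \<a>"
  and ep: "!!\<a>. \<a> : {1..L} ==> ep \<a> (m \<a>) ~= 0"
begin

definition poles :: "complex set" where
 "poles = insert 0 ((%\<a>. exp (be \<a>)) ` {1..L})"

definition Lam :: "complex => complex" where
 "Lam \<nu> = dzs lh kb A \<nu> + (SUM \<a>=1..L. lprin (m \<a>) (ep \<a>) (exp (be \<a>)) \<nu>)"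

definition Lam_deriv :: "complex => complex" where
 "Lam_deriv \<nu> = dz_deriv lh kb A \<nu> + (SUM \<a>=1..L. lprin_deriv (m \<a>) (ep \<a>) (exp (be \<a>)) \<nu>)"

definition variation :: "(int => complex) => (nat => complex) => (nat => nat => complex) => complex => complex" where
 "variation A' be' ep' \<nu> = laurent_poly lh kb A' \<nu> +
   (SUM \<a>=1..L. lprin_var (m \<a>) (ep \<a>) (ep' \<a>) (be' \<a>) (exp (be \<a>)) \<nu>)"

definition integrand :: "(complex => complex) => (complex => complex) => complex => complex" where
 "integrand X Y \<nu> = X \<nu> * Y \<nu> / (\<nu>^2 * Lam_deriv \<nu>)"

definition dz_integrand :: "(int => complex) => (int => complex) => complex => complex" where
 "dz_integrand A' A'' \<nu> = laurent_poly lh kb A' \<nu> * laurent_poly lh kb A'' \<nu> / (\<nu>^2 * dz_deriv lh kb A \<nu>)"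

definition crit :: "complex set" where "crit = {\<nu>. \<nu> ~: poles & Lam_deriv \<nu> = 0}"

definition dz_crit :: "complex set" where "dz_crit = {\<nu>. \<nu> ~= 0 & dz_deriv lh kb A \<nu> = 0}"

lemma finite_poles: "finite poles" by (simp add: poles_def)

lemma closed_poles: "closed poles" by (rule finite_imp_closed[OF finite_poles])

lemma not_pole: "\<nu> ~: poles \<longleftrightarrow> \<nu> ~= 0 & (ALL \<a>:{1..L}. \<nu> ~= exp (be \<a>))"
 by (auto simp: poles_def)

lemma Lam_has_deriv: "\<nu> ~: poles ==> DERIV Lam (\<nu>) :> Lam_deriv \<nu>"
 unfolding Lam_def[abs_def] Lam_deriv_def
 by (intro DERIV_add DERIV_sum dz_has_deriv log_principal_has_deriv) (auto simp: not_pole)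

lemma laurent_poly_holomorphic: "0 ~: S ==> laurent_poly lh kb B holomorphic_on S"
 unfolding laurent_poly_def[abs_def] by (intro holomorphic_intros) auto

lemma dz_deriv_holomorphic: "0 ~: S ==> dz_deriv lh kb B holomorphic_on S"
 unfolding dz_deriv_def[abs_def] by (intro holomorphic_intros) auto

lemma variation_holomorphic: "variation A' be' ep' holomorphic_on - poles"
 unfolding variation_def[abs_def] lprin_var_def[abs_def]
 by (intro holomorphic_intros laurent_poly_holomorphic) (auto simp: not_pole poles_def)

lemma Lam_deriv_holomorphic: "Lam_deriv holomorphic_on - poles"
 unfolding Lam_deriv_def[abs_def] lprin_deriv_def[abs_def]
 by (intro holomorphic_intros dz_deriv_holomorphic) (auto simp: not_pole poles_def)

lemma integrand_holomorphic: "integrand (variation A1 b1 e1) (variation A2 b2 e2) holomorphic_on - (poles \<union> crit)"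
proof -
 have sub: "- (poles \<union> crit) <= - poles" by auto
 show ?thesis unfolding integrand_def[abs_def]
  by (intro holomorphic_intros holomorphic_on_subset[OF variation_holomorphic sub] holomorphic_on_subset[OF Lam_deriv_holomorphic sub])
   (auto simp: crit_def poles_def)
qed

lemma dz_integrand_holomorphic: "dz_integrand A1 A2 holomorphic_on - insert 0 dz_crit"
 unfolding dz_integrand_def[abs_def]
 by (intro holomorphic_intros laurent_poly_holomorphic dz_deriv_holomorphic) (auto simp: dz_crit_def)

lemma Lam_deriv_infinity:
 "EX u v. (u \<longlongrightarrow> of_nat (lh + 1)) at_infinity & (v \<longlongrightarrow> of_nat (lh + 1)) at_infinity &
   (ALL \<nu>. \<nu> ~= 0 --> dz_deriv lh kb A \<nu> = \<nu> ^ lh * u \<nu> & Lam_deriv \<nu> = \<nu> ^ lh * v \<nu>)"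
proof -
 obtain u where u: "(u \<longlongrightarrow> of_nat (lh + 1)) at_infinity" "!!\<nu>. \<nu> ~= 0 ==> dz_deriv lh kb A \<nu> = \<nu> ^ lh * u \<nu>"
  using dz_deriv_infinity by blast
 let ?p = "%\<nu>. SUM \<a>=1..L. lprin_deriv (m \<a>) (ep \<a>) (exp (be \<a>)) \<nu>"
 let ?v = "%\<nu>. u \<nu> + inverse \<nu> ^ lh * ?p \<nu>"
 have "(?p \<longlongrightarrow> (SUM \<a>=1..L. 0)) at_infinity" by (intro tendsto_sum log_principal_deriv_infinity) auto
 hence "(?v \<longlongrightarrow> of_nat (lh + 1) + 0 ^ lh * (SUM \<a>=1..L. 0)) at_infinity"
  by (intro tendsto_add tendsto_mult tendsto_power tendsto_inverse_0 u)
 hence "(?v \<longlongrightarrow> of_nat (lh + 1)) at_infinity" by simp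
 moreover have "Lam_deriv \<nu> = \<nu> ^ lh * ?v \<nu>" if "\<nu> ~= 0" for \<nu>
  using that u(2)[OF that] by (simp add: Lam_deriv_def distrib_left power_inverse)
 ultimately show ?thesis using u by blast
qed

text \<open>\<open>Lam_deriv\<close> is rational with poles in \<open>poles\<close> only, and not
  identically zero, since it grows like \<open>(lh + 1) \<nu>^lh\<close>.\<close>

lemma finite_crit: "finite crit"
proof -
 have "rational_off poles (dz_deriv lh kb A)"
  unfolding dz_deriv_def[abs_def]
  by (intro rational_off_add rational_off_sum rational_off_mult rational_off_const rational_off_power rational_off_id rational_off_powi)
   (auto simp: poles_def)
 moreover have "rational_off poles (lprin_deriv (m \<a>) (ep \<a>) (exp (be \<a>)))" if "\<a> : {1..L}" for \<a>
 proof -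
  have "rational_off poles (%\<nu>. SUM i=1..m \<a>. (- of_nat i * ep \<a> i / exp (be \<a>)) * inverse (\<nu> / exp (be \<a>) - 1) ^ Suc i)"
   by (intro rational_off_sum rational_off_mult rational_off_const rational_off_power rational_off_inverse_linear)
    (insert that, auto simp: poles_def)
  thus ?thesis unfolding lprin_deriv_def[abs_def] by (simp add: divide_inverse power_inverse)
 qed
 ultimately have r: "rational_off poles Lam_deriv"
  unfolding Lam_deriv_def[abs_def] by (intro rational_off_add rational_off_sum) auto
 obtain v where v: "(v \<longlongrightarrow> of_nat (lh + 1)) at_infinity" "!!\<nu>. \<nu> ~= 0 ==> Lam_deriv \<nu> = \<nu> ^ lh * v \<nu>"
  using Lam_deriv_infinity by blast
 have "of_nat (lh + 1) ~= (0::complex)" unfolding of_nat_eq_0_iff by simp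
 hence "\<forall>\<^sub>F \<nu> in at_infinity. v \<nu> ~= 0" by (rule tendsto_imp_eventually_ne[OF v(1)])
 moreover have "\<forall>\<^sub>F \<nu> in at_infinity. \<nu> ~: poles"
 proof -
  have "bounded poles" by (rule finite_imp_bounded[OF finite_poles])
  then obtain B where B: "!!z. z : poles ==> norm z <= B" by (auto simp: bounded_iff)
  show ?thesis unfolding eventually_at_infinity by (rule exI[of _ "B + 1"]) (use B in force)
 qed
 ultimately have "\<forall>\<^sub>F \<nu> in at_infinity. \<nu> ~: poles & Lam_deriv \<nu> ~= 0"
  by eventually_elim (auto simp: v not_pole)
 then obtain z0 where "z0 ~: poles" "Lam_deriv z0 ~= 0"
  using eventually_happens'[OF trivial_limit_at_infinity] by blast
 from rational_off_finite_zeros[OF r this] show ?thesis by (simp add: crit_def)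
qed

lemma finite_dz_crit: "finite dz_crit"
proof -
 interpret h: lg_data lh kb 0 m A be ep
  by unfold_locales (use kb A0 in auto)
 have "h.crit = dz_crit" unfolding h.crit_def dz_crit_def h.poles_def h.Lam_deriv_def by simp
 thus ?thesis using h.finite_crit by simp
qed

text \<open>
  Both integrands agree at infinity up to \<open>O(\<nu>\<^sup>-\<^sup>2)\<close>, and at \<open>0\<close> up to a simple pole which couples the
  constant terms of the principal parts to the lowest coefficient of \<open>h\<close>.
\<close>

lemma integrand_difference_infinity:
 "((%\<nu>. \<nu> * (integrand (variation A1 b1 e1) (variation A2 b2 e2) \<nu> - dz_integrand A1 A2 \<nu>)) \<longlongrightarrow> 0) at_infinity"
proof -
 obtain u1 where u1: "(u1 \<longlongrightarrow> A1 (int lh)) at_infinity" "!!\<nu>. \<nu> ~= 0 ==> laurent_poly lh kb A1 \<nu> = \<nu> ^ lh * u1 \<nu>"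
  using laurent_poly_infinity by blast
 obtain u2 where u2: "(u2 \<longlongrightarrow> A2 (int lh)) at_infinity" "!!\<nu>. \<nu> ~= 0 ==> laurent_poly lh kb A2 \<nu> = \<nu> ^ lh * u2 \<nu>"
  using laurent_poly_infinity by blast
 obtain u v where u: "(u \<longlongrightarrow> of_nat (lh + 1)) at_infinity" "!!\<nu>. \<nu> ~= 0 ==> dz_deriv lh kb A \<nu> = \<nu> ^ lh * u \<nu>"
  and v: "(v \<longlongrightarrow> of_nat (lh + 1)) at_infinity" "!!\<nu>. \<nu> ~= 0 ==> Lam_deriv \<nu> = \<nu> ^ lh * v \<nu>"
  using Lam_deriv_infinity by blast
 define dp where "dp \<nu> = (SUM \<a>=1..L. lprin_deriv (m \<a>) (ep \<a>) (exp (be \<a>)) \<nu>)" for \<nu>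
 define p1 where "p1 \<nu> = (SUM \<a>=1..L. lprin_var (m \<a>) (ep \<a>) (e1 \<a>) (b1 \<a>) (exp (be \<a>)) \<nu>)" for \<nu>
 define p2 where "p2 \<nu> = (SUM \<a>=1..L. lprin_var (m \<a>) (ep \<a>) (e2 \<a>) (b2 \<a>) (exp (be \<a>)) \<nu>)" for \<nu>
 have "(dp \<longlongrightarrow> (SUM \<a>=1..L. 0)) at_infinity" unfolding dp_def by (intro tendsto_sum log_principal_deriv_infinity) auto
 hence dp: "(dp \<longlongrightarrow> 0) at_infinity" by simp
 have "(p1 \<longlongrightarrow> (SUM \<a>=1..L. 0)) at_infinity" unfolding p1_def by (intro tendsto_sum log_principal_variation_infinity) auto
 hence p1: "(p1 \<longlongrightarrow> 0) at_infinity" by simp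
 have "(p2 \<longlongrightarrow> (SUM \<a>=1..L. 0)) at_infinity" unfolding p2_def by (intro tendsto_sum log_principal_variation_infinity) auto
 hence p2: "(p2 \<longlongrightarrow> 0) at_infinity" by simp
 have ne: "of_nat (lh + 1) ~= (0::complex)" unfolding of_nat_eq_0_iff by simp
 let ?n = "of_nat (lh + 1) :: complex"
 \<comment> \<open>The three summands come from the change of the denominator, from products of a
   variation of \<open>h\<close> with one of the principal parts, and from products of two of the
   latter.\<close>
 let ?E = "%\<nu>. inverse \<nu> * (- (u1 \<nu> * u2 \<nu> * dp \<nu>) / (v \<nu> * u \<nu>) + (u1 \<nu> * p2 \<nu> + p1 \<nu> * u2 \<nu>) / v \<nu> + p1 \<nu> * p2 \<nu> * inverse \<nu> ^ lh / v \<nu>)"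
 have "(?E \<longlongrightarrow> 0 * (- (A1 (int lh) * A2 (int lh) * 0) / (?n * ?n) + (A1 (int lh) * 0 + 0 * A2 (int lh)) / ?n + 0 * 0 * 0 ^ lh / ?n)) at_infinity"
  by (intro tendsto_intros tendsto_inverse_0 u1 u2 u v dp p1 p2) (use ne in auto)
 hence E: "(?E \<longlongrightarrow> 0) at_infinity" by simp
 show ?thesis
 proof (rule Lim_transform_eventually[OF E])
  have "\<forall>\<^sub>F \<nu> in at_infinity. u \<nu> ~= 0" "\<forall>\<^sub>F \<nu> in at_infinity. v \<nu> ~= 0"
   using tendsto_imp_eventually_ne[OF u(1) ne] tendsto_imp_eventually_ne[OF v(1) ne] by auto
  with eventually_not_equal_at_infinity[of 0]
  show "\<forall>\<^sub>F \<nu> in at_infinity. ?E \<nu> = \<nu> * (integrand (variation A1 b1 e1) (variation A2 b2 e2) \<nu> - dz_integrand A1 A2 \<nu>)"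
  proof eventually_elim
   case (elim \<nu>)
   define N where "N = \<nu> ^ lh"
   have N: "N ~= 0" using elim by (simp add: N_def)
   have "N * v \<nu> = N * u \<nu> + dp \<nu>" using u(2)[OF elim(1)] v(2)[OF elim(1)] by (simp add: Lam_deriv_def dp_def N_def)
   hence dpe: "dp \<nu> = N * (v \<nu> - u \<nu>)" by (simp add: algebra_simps)
   have iN: "inverse \<nu> ^ lh = 1 / N" by (simp add: N_def inverse_eq_divide power_one_over)
   have R: "integrand (variation A1 b1 e1) (variation A2 b2 e2) \<nu> = (N * u1 \<nu> + p1 \<nu>) * (N * u2 \<nu> + p2 \<nu>) / (\<nu>^2 * (N * v \<nu>))"
    "dz_integrand A1 A2 \<nu> = (N * u1 \<nu>) * (N * u2 \<nu>) / (\<nu>^2 * (N * u \<nu>))"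
    unfolding integrand_def dz_integrand_def variation_def p1_def[symmetric] p2_def[symmetric]
     u1(2)[OF elim(1)] u2(2)[OF elim(1)] u(2)[OF elim(1)] v(2)[OF elim(1)] N_def by simp_all
   have "inverse \<nu> * (- (x * y * (N * (V - U))) / (V * U) + (x * b + a * y) / V + a * b * (1 / N) / V) =
    \<nu> * ((N * x + a) * (N * y + b) / (\<nu>^2 * (N * V)) - (N * x) * (N * y) / (\<nu>^2 * (N * U)))"
    if "U ~= 0" "V ~= 0" for x y a b U V
    using that N elim(1) by (simp add: field_simps power2_eq_square)
   from this[OF elim(2,3)] show ?case unfolding R dpe iN .
  qed
 qed
qed

lemma integrand_difference_0:
 "((%\<nu>. (integrand (variation A1 b1 e1) (variation A2 b2 e2) \<nu> - dz_integrand A1 A2 \<nu>) * (\<nu> - 0)) \<longlongrightarrow>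
   (A1 (- int kb) * (SUM \<a>=1..L. log_coeff (m \<a>) (e2 \<a>) 1) + (SUM \<a>=1..L. log_coeff (m \<a>) (e1 \<a>) 1) * A2 (- int kb)) /
    (of_nat kb * A (- int kb))) (at 0)"
proof -
 obtain u1 where u1: "(u1 \<longlongrightarrow> A1 (- int kb)) (at 0)" "!!\<nu>. \<nu> ~= 0 ==> laurent_poly lh kb A1 \<nu> = inverse \<nu> ^ kb * u1 \<nu>"
  using laurent_poly_0 by blast
 obtain u2 where u2: "(u2 \<longlongrightarrow> A2 (- int kb)) (at 0)" "!!\<nu>. \<nu> ~= 0 ==> laurent_poly lh kb A2 \<nu> = inverse \<nu> ^ kb * u2 \<nu>"
  using laurent_poly_0 by blast
 let ?n = "- of_nat kb * A (- int kb)"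
 obtain u where u: "(u \<longlongrightarrow> ?n) (at 0)" "!!\<nu>. \<nu> ~= 0 ==> dz_deriv lh kb A \<nu> = inverse \<nu> ^ Suc kb * u \<nu>"
  using dz_deriv_0 by blast
 define dp where "dp \<nu> = (SUM \<a>=1..L. lprin_deriv (m \<a>) (ep \<a>) (exp (be \<a>)) \<nu>)" for \<nu>
 define p1 where "p1 \<nu> = (SUM \<a>=1..L. lprin_var (m \<a>) (ep \<a>) (e1 \<a>) (b1 \<a>) (exp (be \<a>)) \<nu>)" for \<nu>
 define p2 where "p2 \<nu> = (SUM \<a>=1..L. lprin_var (m \<a>) (ep \<a>) (e2 \<a>) (b2 \<a>) (exp (be \<a>)) \<nu>)" for \<nu>
 define l where "l \<a> = lprin_deriv (m \<a>) (ep \<a>) (exp (be \<a>)) 0" for \<a>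
 have l: "(lprin_deriv (m \<a>) (ep \<a>) (exp (be \<a>)) \<longlongrightarrow> l \<a>) (at 0)" for \<a>
  unfolding l_def by (intro log_principal_deriv_0) simp
 have dp: "(dp \<longlongrightarrow> (SUM \<a>=1..L. l \<a>)) (at 0)" unfolding dp_def by (intro tendsto_sum l)
 have p1: "(p1 \<longlongrightarrow> (SUM \<a>=1..L. - log_coeff (m \<a>) (e1 \<a>) 1)) (at 0)" unfolding p1_def by (intro tendsto_sum log_principal_variation_0) auto
 have p2: "(p2 \<longlongrightarrow> (SUM \<a>=1..L. - log_coeff (m \<a>) (e2 \<a>) 1)) (at 0)" unfolding p2_def by (intro tendsto_sum log_principal_variation_0) auto
 \<comment> \<open>The principal parts are regular at 0, so the full derivative has the same leading
   behaviour there as the derivative of \<open>h\<close>.\<close>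
 define v where "v \<nu> = u \<nu> + \<nu> ^ Suc kb * dp \<nu>" for \<nu>
 have "(v \<longlongrightarrow> ?n + 0 ^ Suc kb * (SUM \<a>=1..L. l \<a>)) (at 0)" unfolding v_def
  by (intro tendsto_intros u dp)
 hence v: "(v \<longlongrightarrow> ?n) (at 0)" by simp
 have v2: "Lam_deriv \<nu> = inverse \<nu> ^ Suc kb * v \<nu>" if "\<nu> ~= 0" for \<nu>
 proof -
  have "inverse \<nu> ^ Suc kb * (\<nu> ^ Suc kb * dp \<nu>) = dp \<nu>"
   using that by (simp add: mult.assoc[symmetric] power_mult_distrib[symmetric] del: power_Suc)
  thus ?thesis by (simp only: Lam_deriv_def v_def dp_def[symmetric] distrib_left u(2)[OF that])
 qed
 have ne: "?n ~= 0" using A0 kb by auto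
 let ?c1 = "SUM \<a>=1..L. - log_coeff (m \<a>) (e1 \<a>) 1" and ?c2 = "SUM \<a>=1..L. - log_coeff (m \<a>) (e2 \<a>) 1"
 \<comment> \<open>These are the same three contributions as at infinity; now only the mixed one
   survives in the limit.\<close>
 let ?E = "%\<nu>. - (u1 \<nu> * u2 \<nu> * (\<nu> * dp \<nu>)) / (v \<nu> * u \<nu>) + (u1 \<nu> * p2 \<nu> + p1 \<nu> * u2 \<nu>) / v \<nu> + p1 \<nu> * p2 \<nu> * \<nu> ^ kb / v \<nu>"
 have "(?E \<longlongrightarrow> - (A1 (- int kb) * A2 (- int kb) * (0 * (SUM \<a>=1..L. l \<a>))) / (?n * ?n) + (A1 (- int kb) * ?c2 + ?c1 * A2 (- int kb)) / ?n + ?c1 * ?c2 * 0 ^ kb / ?n) (at 0)"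
  by (intro tendsto_intros u1 u2 u v dp p1 p2) (use ne in auto)
 moreover have "- (A1 (- int kb) * A2 (- int kb) * (0 * (SUM \<a>=1..L. l \<a>))) / (?n * ?n) + (A1 (- int kb) * ?c2 + ?c1 * A2 (- int kb)) / ?n + ?c1 * ?c2 * 0 ^ kb / ?n
   = (A1 (- int kb) * (SUM \<a>=1..L. log_coeff (m \<a>) (e2 \<a>) 1) + (SUM \<a>=1..L. log_coeff (m \<a>) (e1 \<a>) 1) * A2 (- int kb)) / (of_nat kb * A (- int kb))"
 proof -
  have "(x * - c + - d * y) / (- k) = (x * c + d * y) / k" for x c d y k :: complex
   by (cases "k = 0") (simp_all add: field_simps)
  moreover have "0 ^ kb = (0::complex)" using kb by simp
  ultimately show ?thesis by (simp add: sum_negf)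
 qed
 ultimately have E: "(?E \<longlongrightarrow> (A1 (- int kb) * (SUM \<a>=1..L. log_coeff (m \<a>) (e2 \<a>) 1) + (SUM \<a>=1..L. log_coeff (m \<a>) (e1 \<a>) 1) * A2 (- int kb)) / (of_nat kb * A (- int kb))) (at 0)"
  by simp
 show ?thesis
 proof (rule Lim_transform_eventually[OF E])
  have "\<forall>\<^sub>F \<nu> in at 0. u \<nu> ~= 0" "\<forall>\<^sub>F \<nu> in at 0. v \<nu> ~= 0"
   using tendsto_imp_eventually_ne[OF u(1) ne] tendsto_imp_eventually_ne[OF v ne] by auto
  moreover have "\<forall>\<^sub>F \<nu> in at 0. \<nu> ~= (0::complex)" by (simp add: eventually_at_filter)
  ultimately show "\<forall>\<^sub>F \<nu> in at 0. ?E \<nu> = (integrand (variation A1 b1 e1) (variation A2 b2 e2) \<nu> - dz_integrand A1 A2 \<nu>) * (\<nu> - 0)"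
  proof eventually_elim
   case (elim \<nu>)
   define M where "M = \<nu> ^ kb"
   have M: "M ~= 0" using elim by (simp add: M_def)
   have iM: "inverse \<nu> ^ kb = 1 / M" "inverse \<nu> ^ Suc kb = 1 / (\<nu> * M)" using elim by (simp_all add: M_def inverse_eq_divide power_one_over)
   have dpe: "dp \<nu> = (v \<nu> - u \<nu>) / (\<nu> * M)" using elim M by (simp add: v_def M_def)
   have R: "integrand (variation A1 b1 e1) (variation A2 b2 e2) \<nu> = (1 / M * u1 \<nu> + p1 \<nu>) * (1 / M * u2 \<nu> + p2 \<nu>) / (\<nu>^2 * (1 / (\<nu> * M) * v \<nu>))"
    "dz_integrand A1 A2 \<nu> = (1 / M * u1 \<nu>) * (1 / M * u2 \<nu>) / (\<nu>^2 * (1 / (\<nu> * M) * u \<nu>))"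
    unfolding integrand_def dz_integrand_def variation_def p1_def[symmetric] p2_def[symmetric]
     u1(2)[OF elim(3)] u2(2)[OF elim(3)] u(2)[OF elim(3)] v2[OF elim(3)] iM by simp_all
   have "- (x * y * (\<nu> * ((V - U) / (\<nu> * M)))) / (V * U) + (x * b + a * y) / V + a * b * M / V =
    ((1 / M * x + a) * (1 / M * y + b) / (\<nu>^2 * (1 / (\<nu> * M) * V)) - (1 / M * x) * (1 / M * y) / (\<nu>^2 * (1 / (\<nu> * M) * U))) * (\<nu> - 0)"
    if "U ~= 0" "V ~= 0" for x y a b U V
    using that M elim(3) by (simp add: field_simps power2_eq_square)
   from this[OF elim(1,2)] show ?case unfolding R dpe M_def[symmetric] .
  qed
 qed
qed

text \<open>The residues of the difference of the two integrands over all finite singularities add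
  up to zero. The difference contributes its simple pole at 0, the full integrand its residues at
  the movable poles, and the integrand of \<open>h\<close> the Dubrovin--Zhang part.\<close>

theorem critical_residues:
 "(SUM q:crit. residue (integrand (variation A1 b1 e1) (variation A2 b2 e2)) q) =
  (SUM q:dz_crit. residue (dz_integrand A1 A2) q)
  - (A1 (- int kb) * (SUM \<a>=1..L. log_coeff (m \<a>) (e2 \<a>) 1) + (SUM \<a>=1..L. log_coeff (m \<a>) (e1 \<a>) 1) * A2 (- int kb)) /
    (of_nat kb * A (- int kb))
  - (SUM \<a>=1..L. residue (integrand (variation A1 b1 e1) (variation A2 b2 e2)) (exp (be \<a>)))"
proof -
 define R where "R = integrand (variation A1 b1 e1) (variation A2 b2 e2)"
 define H where "H = dz_integrand A1 A2"
 define S where "S = poles \<union> crit \<union> dz_crit"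
 have S: "finite S" unfolding S_def using finite_poles finite_crit finite_dz_crit by simp
 have R: "R holomorphic_on - (poles \<union> crit)" unfolding R_def by (rule integrand_holomorphic)
 have H: "H holomorphic_on - insert 0 dz_crit" unfolding H_def by (rule dz_integrand_holomorphic)
 have RS: "R holomorphic_on - S" by (rule holomorphic_on_subset[OF R]) (auto simp: S_def)
 have HS: "H holomorphic_on - S" by (rule holomorphic_on_subset[OF H]) (auto simp: S_def poles_def)
 have near: "EX U. open U & p : U & R holomorphic_on U - {p} & H holomorphic_on U - {p}" for p
 proof (intro exI[of _ "- (S - {p})"] conjI)
  show "open (- (S - {p}))" using S by (intro open_Compl finite_imp_closed) auto
  show "R holomorphic_on - (S - {p}) - {p}" by (rule holomorphic_on_subset[OF RS]) auto
  show "H holomorphic_on - (S - {p}) - {p}" by (rule holomorphic_on_subset[OF HS]) auto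
 qed auto
 have diff: "residue (%\<nu>. R \<nu> - H \<nu>) p = residue R p - residue H p" for p
  using near[of p] residue_diff by blast
 have "(SUM p:S. residue (%\<nu>. R \<nu> - H \<nu>) p) = 0"
 proof (rule total_residue[OF S])
  show "(%\<nu>. R \<nu> - H \<nu>) holomorphic_on - S" by (intro holomorphic_intros RS HS)
  show "((%\<nu>. \<nu> * (R \<nu> - H \<nu>)) \<longlongrightarrow> 0) at_infinity"
   unfolding R_def H_def by (rule integrand_difference_infinity)
 qed
 hence "(SUM p:S. residue R p) = (SUM p:S. residue H p)" by (simp add: diff sum_subtractf)
 moreover have "(SUM p:S. residue R p) = (SUM p:poles \<union> crit. residue R p)"
 proof (rule sum.mono_neutral_right[OF S])
  show "ALL i:S - (poles \<union> crit). residue R i = 0"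
  proof
   fix i assume "i : S - (poles \<union> crit)"
   thus "residue R i = 0"
    by (intro residue_holo[OF _ _ R] open_Compl finite_imp_closed) (use finite_poles finite_crit in auto)
  qed
 qed (auto simp: S_def)
 moreover have "(SUM p:S. residue H p) = (SUM p:insert 0 dz_crit. residue H p)"
 proof (rule sum.mono_neutral_right[OF S])
  show "ALL i:S - insert 0 dz_crit. residue H i = 0"
  proof
   fix i assume "i : S - insert 0 dz_crit"
   thus "residue H i = 0"
    by (intro residue_holo[OF _ _ H] open_Compl finite_imp_closed) (use finite_dz_crit in auto)
  qed
 qed (auto simp: S_def poles_def)
 moreover have "(SUM p:poles \<union> crit. residue R p) = (SUM p:poles. residue R p) + (SUM p:crit. residue R p)"
  by (rule sum.union_disjoint[OF finite_poles finite_crit]) (auto simp: crit_def)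
 moreover have "(SUM p:poles. residue R p) = residue R 0 + (SUM \<a>=1..L. residue R (exp (be \<a>)))"
  unfolding poles_def by (subst sum.insert) (auto simp: sum.reindex[OF inj, unfolded One_nat_def] o_def)
 moreover have "(SUM p:insert 0 dz_crit. residue H p) = residue H 0 + (SUM p:dz_crit. residue H p)"
  by (rule sum.insert[OF finite_dz_crit]) (simp add: dz_crit_def)
 moreover have "residue R 0 - residue H 0 = (A1 (- int kb) * (SUM \<a>=1..L. log_coeff (m \<a>) (e2 \<a>) 1) + (SUM \<a>=1..L. log_coeff (m \<a>) (e1 \<a>) 1) * A2 (- int kb)) /
    (of_nat kb * A (- int kb))"
 proof -
  obtain U where U: "open U" "0 : U" "R holomorphic_on U - {0}" "H holomorphic_on U - {0}" using near by blast
  have "residue (%\<nu>. R \<nu> - H \<nu>) 0 = (A1 (- int kb) * (SUM \<a>=1..L. log_coeff (m \<a>) (e2 \<a>) 1) + (SUM \<a>=1..L. log_coeff (m \<a>) (e1 \<a>) 1) * A2 (- int kb)) /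
    (of_nat kb * A (- int kb))"
   unfolding R_def H_def
   by (rule residue_simple'[OF U(1,2) _ integrand_difference_0])
    (insert U(3,4), auto intro!: holomorphic_intros simp: R_def H_def)
  thus ?thesis by (simp add: diff)
 qed
 ultimately show ?thesis unfolding R_def H_def by (simp add: algebra_simps)
qed

text \<open>In the coordinate \<open>z\<close> with \<open>\<nu> = exp z\<close> the denominator
  becomes the derivative of \<open>Lam (exp z)\<close>, and the variations take the shape required
  by \<open>cluster_residue\<close>.\<close>

lemma residue_at_pole:
 assumes \<a>: "\<a> : {1..L}" and s: "s ^ m \<a> = log_coeff (m \<a>) (ep \<a>) (m \<a>)"
 shows "residue (integrand (variation A1 b1 e1) (variation A2 b2 e2)) (exp (be \<a>)) =
  - b1 \<a> * log_coeff (m \<a>) (e2 \<a>) 1 - b2 \<a> * log_coeff (m \<a>) (e1 \<a>) 1 -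
  of_nat (m \<a>) * (SUM i=1..m \<a> - 1.
   cluster_diff (m \<a>) (log_coeff (m \<a>) (ep \<a>)) s i (prin_series (m \<a>) (log_coeff (m \<a>) (e1 \<a>))) *
   cluster_diff (m \<a>) (log_coeff (m \<a>) (ep \<a>)) s (m \<a> - i) (prin_series (m \<a>) (log_coeff (m \<a>) (e2 \<a>))))"
proof -
 define \<b> where "\<b> = be \<a>"
 define M where "M = m \<a>"
 have M: "0 < M" using m[OF \<a>] by (simp add: M_def)
 define Oth where "Oth = {1..L} - {\<a>}"
 have split: "(SUM \<g>=1..L. f \<g>) = f \<a> + (SUM \<g>:Oth. f \<g>)" for f :: "nat => complex"
  unfolding Oth_def using \<a> by (intro sum.remove) auto
 have ne: "exp \<b> / exp (be \<g>) - 1 ~= 0" if "\<g> : Oth" for \<g>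
 proof
  assume "exp \<b> / exp (be \<g>) - 1 = 0"
  hence "exp (be \<g>) = exp (be \<a>)" by (simp add: \<b>_def)
  thus False using inj_onD[OF inj, of \<g> \<a>] that \<a> by (auto simp: Oth_def)
 qed
 let ?R = "integrand (variation A1 b1 e1) (variation A2 b2 e2)"
 let ?e = "%x. exp (\<b> + x)"
 \<comment> \<open>\<open>h\<close> and the other principal parts are analytic at this pole and
   enter only as a regular part.\<close>
 obtain r2 where r2: "(%x. dzs lh kb A (?e x) + (SUM \<g>:Oth. lprin (m \<g>) (ep \<g>) (exp (be \<g>)) (?e x))) has_fps_expansion r2"
 proof -
  have "(%x. dzs lh kb A (?e x) + (SUM \<g>:Oth. lprin (m \<g>) (ep \<g>) (exp (be \<g>)) (?e x))) analytic_on {0}"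
   unfolding dz_superpotential_def lprin_def
   by (intro analytic_intros) (use ne in auto)
  thus ?thesis using analytic_at_imp_has_fps_expansion_0 that by blast
 qed
 define c where "c = log_coeff M (ep \<a>)"
 define Lf where "Lf = log_series M (ep \<a>) + fps_to_fls r2"
 have Lf: "Lf = fls_shift (int M) (fps_to_fls (prin_series M c)) + fps_to_fls (fls_regpart (log_series M (ep \<a>)) + r2)"
  unfolding Lf_def c_def by (subst log_series_decomposition) simp
 have Lam_exp: "(%x. Lam (?e x)) has_laurent_expansion Lf"
 proof -
  have "(%x. lprin M (ep \<a>) (exp \<b>) (?e x) + (dzs lh kb A (?e x) + (SUM \<g>:Oth. lprin (m \<g>) (ep \<g>) (exp (be \<g>)) (?e x)))) has_laurent_expansion Lf"
   unfolding Lf_def by (intro has_laurent_expansion_add log_principal_laurent has_laurent_expansion_fps r2)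
  thus ?thesis unfolding Lam_def split by (simp add: \<b>_def M_def algebra_simps)
 qed
 have off: "\<forall>\<^sub>F x in at 0. ?e x ~: poles"
 proof -
  have "\<forall>\<^sub>F x in at 0. ?e x ~= exp \<b>"
  proof -
   have "\<forall>\<^sub>F x in at (0::complex). x : ball 0 1 - {0}" by (rule eventually_at_in_open) auto
   thus ?thesis
   proof eventually_elim
    case (elim x)
    have "x = 0" if "?e x = exp \<b>"
    proof -
     have "norm (Im x) < 1" using elim abs_Im_le_cmod[of x] by simp
     hence "Ln (exp x) = x" using pi_gt3 by (intro Ln_exp) auto
     moreover have "exp x = 1" using that by (simp add: exp_add)
     ultimately show ?thesis by simp
    qed
    thus ?case using elim by auto
   qed
  qed
  moreover have "\<forall>\<^sub>F x in at 0. ?e x ~= exp (be \<g>)" if "\<g> : Oth" for \<g>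
  proof (rule tendsto_imp_eventually_ne)
   show "(?e \<longlongrightarrow> exp (\<b> + 0)) (at 0)" by (intro tendsto_intros)
   show "exp (\<b> + 0) ~= exp (be \<g>)" using ne[OF that] by auto
  qed
  hence "\<forall>\<^sub>F x in at 0. ALL \<g>:Oth. ?e x ~= exp (be \<g>)"
   by (intro eventually_ball_finite) (auto simp: Oth_def)
  ultimately show ?thesis
   by eventually_elim (auto simp: not_pole Oth_def \<b>_def)
 qed
 have D_exp: "(%x. ?e x * Lam_deriv (?e x)) has_laurent_expansion fls_deriv Lf"
 proof -
  have "\<forall>\<^sub>F x in at 0. deriv (%x. Lam (?e x)) x = ?e x * Lam_deriv (?e x)"
   using off
  proof eventually_elim
   case (elim x)
   have "DERIV (?e) x :> ?e x" by (auto intro!: derivative_eq_intros)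
   from DERIV_chain2[OF Lam_has_deriv[OF elim] this] show ?case by (simp add: DERIV_imp_deriv mult.commute)
  qed
  from has_laurent_expansion_cong[OF this refl] show ?thesis
   using has_laurent_expansion_deriv[OF Lam_exp] by simp
 qed
 have var: "EX r. (%x. variation A' b' e' (?e x)) has_laurent_expansion
   fls_shift (int M) (fps_to_fls (prin_series M (log_coeff M (e' \<a>)))) - fls_const (b' \<a>) * fls_deriv Lf + fps_to_fls r" for A' b' e'
 proof -
  have "(%x. laurent_poly lh kb A' (?e x) + (SUM \<g>:Oth. lprin_var (m \<g>) (ep \<g>) (e' \<g>) (b' \<g>) (exp (be \<g>)) (?e x))) analytic_on {0}"
   unfolding laurent_poly_def lprin_var_def
   by (intro analytic_intros) (use ne in auto)
  then obtain r where r: "(%x. laurent_poly lh kb A' (?e x) + (SUM \<g>:Oth. lprin_var (m \<g>) (ep \<g>) (e' \<g>) (b' \<g>) (exp (be \<g>)) (?e x))) has_fps_expansion r"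
   using analytic_at_imp_has_fps_expansion_0 by blast
  have "(%x. lprin_var M (ep \<a>) (e' \<a>) (b' \<a>) (exp \<b>) (?e x) + (laurent_poly lh kb A' (?e x) + (SUM \<g>:Oth. lprin_var (m \<g>) (ep \<g>) (e' \<g>) (b' \<g>) (exp (be \<g>)) (?e x))))
    has_laurent_expansion (log_series M (e' \<a>) - fls_const (b' \<a>) * fls_deriv (log_series M (ep \<a>))) + fps_to_fls r"
   by (intro has_laurent_expansion_add log_principal_variation_laurent has_laurent_expansion_fps r)
  moreover have "log_series M (e' \<a>) - fls_const (b' \<a>) * fls_deriv (log_series M (ep \<a>)) + fps_to_fls r =
   fls_shift (int M) (fps_to_fls (prin_series M (log_coeff M (e' \<a>)))) - fls_const (b' \<a>) * fls_deriv Lf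
    + fps_to_fls (fls_regpart (log_series M (e' \<a>)) + fps_const (b' \<a>) * fps_deriv r2 + r)"
  proof -
   have "fls_deriv Lf = fls_deriv (log_series M (ep \<a>)) + fps_to_fls (fps_deriv r2)"
    by (simp add: Lf_def fls_deriv_fps_to_fls)
   hence 1: "fls_const (b' \<a>) * fls_deriv (log_series M (ep \<a>)) = fls_const (b' \<a>) * fls_deriv Lf - fls_const (b' \<a>) * fps_to_fls (fps_deriv r2)"
    by (simp add: algebra_simps)
   show ?thesis unfolding 1 by (subst log_series_decomposition) (simp add: fls_times_fps_to_fls)
  qed
  moreover have "variation A' b' e' (?e x) = lprin_var M (ep \<a>) (e' \<a>) (b' \<a>) (exp \<b>) (?e x) + (laurent_poly lh kb A' (?e x) + (SUM \<g>:Oth. lprin_var (m \<g>) (ep \<g>) (e' \<g>) (b' \<g>) (exp (be \<g>)) (?e x)))" for x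
   unfolding variation_def split \<b>_def M_def by simp
  ultimately show ?thesis
   by (intro exI[of _ "fls_regpart (log_series M (e' \<a>)) + fps_const (b' \<a>) * fps_deriv r2 + r"]) (simp only:)
 qed
 obtain q1 where q1: "(%x. variation A1 b1 e1 (?e x)) has_laurent_expansion
   fls_shift (int M) (fps_to_fls (prin_series M (log_coeff M (e1 \<a>)))) - fls_const (b1 \<a>) * fls_deriv Lf + fps_to_fls q1"
  using var by blast
 obtain q2 where q2: "(%x. variation A2 b2 e2 (?e x)) has_laurent_expansion
   fls_shift (int M) (fps_to_fls (prin_series M (log_coeff M (e2 \<a>)))) - fls_const (b2 \<a>) * fls_deriv Lf + fps_to_fls q2"
  using var by blast
 have mero: "?R meromorphic_on {exp \<b>}"
  unfolding integrand_def[abs_def] variation_def Lam_deriv_def laurent_poly_def dz_deriv_def lprin_var_def lprin_deriv_def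
  by (intro meromorphic_intros)
 have de: "deriv exp z = exp z" for z :: complex by (rule DERIV_imp_deriv[OF DERIV_exp])
 have "residue ?R (exp \<b>) = residue (%z. ?R (exp z) * deriv exp z) \<b>"
  by (rule residue_change_variable[where g = exp, OF mero]) (auto intro!: analytic_intros simp: de)
 \<comment> \<open>One of the two factors \<open>exp z\<close> from the square of
   \<open>d log \<nu>\<close> cancels against the derivative of \<open>exp\<close>; the other
   completes the derivative of \<open>Lam (exp z)\<close>.\<close>
 also have "... = residue (%z. variation A1 b1 e1 (exp z) * variation A2 b2 e2 (exp z) / (exp z * Lam_deriv (exp z))) \<b>"
  by (rule arg_cong2[where f = residue]) (auto simp: integrand_def power2_eq_square de)
 also have "... = fls_residue ((fls_shift (int M) (fps_to_fls (prin_series M (log_coeff M (e1 \<a>)))) - fls_const (b1 \<a>) * fls_deriv Lf + fps_to_fls q1) *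
   (fls_shift (int M) (fps_to_fls (prin_series M (log_coeff M (e2 \<a>)))) - fls_const (b2 \<a>) * fls_deriv Lf + fps_to_fls q2) / fls_deriv Lf)"
  by (rule has_laurent_expansion_residue[OF has_laurent_expansion_divide[OF has_laurent_expansion_mult[OF q1 q2] D_exp]])
 also have "... = - b1 \<a> * fps_nth (prin_series M (log_coeff M (e2 \<a>))) (M - 1) - b2 \<a> * fps_nth (prin_series M (log_coeff M (e1 \<a>))) (M - 1) -
  of_nat M * (SUM i=1..M - 1. cluster_diff M c s i (prin_series M (log_coeff M (e1 \<a>))) * cluster_diff M c s (M - i) (prin_series M (log_coeff M (e2 \<a>))))"
  unfolding Lf
  by (rule cluster_residue[OF M]) (insert s ep[OF \<a>] M, auto simp: c_def M_def log_coeff_top)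
 finally show ?thesis using M unfolding c_def M_def \<b>_def by (simp add: principal_series_nth)
qed

end

section \<open>Collision of simple poles\<close>

lemma lagrange_interpolation:
 fixes P :: "complex poly"
 assumes X: "finite X" and P: "degree P < card X"
 shows "poly P \<mu> = (SUM k:X. poly P k * (PROD i:X - {k}. (\<mu> - i) / (k - i)))"
proof -
 define l where "l k = (PROD i:X - {k}. smult (1 / (k - i)) [:- i, 1:])" for k
 have pl: "poly (l k) x = (PROD i:X - {k}. (x - i) / (k - i))" for k x
  unfolding l_def poly_prod by (intro prod.cong refl) (simp add: diff_divide_distrib)
 have dl: "degree (l k) <= card X - 1" if "k : X" for k
 proof -
  have "degree (l k) <= (SUM i:X - {k}. 1)"
   unfolding l_def using X by (intro order.trans[OF degree_prod_sum_le] sum_mono) auto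
  thus ?thesis using X that by simp
 qed
 have "P = (SUM k:X. smult (poly P k) (l k))"
 proof (rule poly_eqI_degree[where A = X])
  fix x assume x: "x : X"
  have "poly (l k) x = (if k = x then 1 else 0)" if "k : X" for k
   unfolding pl using x X that by (auto intro!: prod_zero)
  thus "poly P x = poly (SUM k:X. smult (poly P k) (l k)) x"
   using X x by (simp add: poly_sum mult_delta_right)
 next
  have "degree (SUM k:X. smult (poly P k) (l k)) <= card X - 1"
   by (intro degree_sum_le X order.trans[OF degree_smult_le] dl)
  thus "degree (SUM k:X. smult (poly P k) (l k)) < card X" using P by simp
 qed (use P in simp)
 hence "poly P \<mu> = poly (SUM k:X. smult (poly P k) (l k)) \<mu>" by simp
 thus ?thesis by (simp add: poly_sum pl)
qed

text \<open>Newton interpolation of \<open>x \<mapsto> 1 / (\<mu> - x)\<close> with remainder. When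
  \<open>x\<close> is one of the nodes the remainder vanishes, which is how it is applied to a
  cluster.\<close>

lemma newton_identity:
 fixes x \<mu> :: complex
 assumes "!!i. i : {1..n} ==> \<mu> ~= p i" "\<mu> ~= x"
 shows "1 / (\<mu> - x) = (SUM k<n. (PROD i=1..k. x - p i) / (PROD i=1..Suc k. \<mu> - p i))
   + (PROD i=1..n. x - p i) / ((PROD i=1..n. \<mu> - p i) * (\<mu> - x))"
 using assms
proof (induction n)
 case (Suc n)
 define A B where "A = (PROD i=1..n. x - p i)" and "B = (PROD i=1..n. \<mu> - p i)"
 have B: "B ~= 0" using Suc.prems by (auto simp: B_def)
 have m: "\<mu> ~= x" "\<mu> ~= p (Suc n)" using Suc.prems by auto
 have "1 / (\<mu> - x) = (SUM k<n. (PROD i=1..k. x - p i) / (PROD i=1..Suc k. \<mu> - p i)) + A / (B * (\<mu> - x))"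
  unfolding A_def B_def by (rule Suc.IH) (use Suc.prems in auto)
 moreover have "A / (B * (\<mu> - x)) = A / (B * (\<mu> - p (Suc n))) + A * (x - p (Suc n)) / (B * (\<mu> - p (Suc n)) * (\<mu> - x))"
  using B m by (simp add: divide_simps) (simp add: algebra_simps)
 moreover have e: "(PROD i=1..Suc n. x - p i) = A * (x - p (Suc n))" "(PROD i=1..Suc n. \<mu> - p i) = B * (\<mu> - p (Suc n))"
  unfolding A_def B_def by (simp_all add: prod.nat_ivl_Suc')
 ultimately show ?case by (simp only: sum.lessThan_Suc e A_def[symmetric] add.assoc)
qed simp

lemma coeff_prod_linear_tendsto:
 fixes u :: "nat => 'j => complex"
 assumes "finite J" "!!j. j : J ==> (%n. u n j) \<longlonglongrightarrow> v j"
 shows "(%n. coeff (PROD j:J. [:- u n j, 1:]) k) \<longlonglongrightarrow> coeff (PROD j:J. [:- v j, 1:]) k"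
 using assms
proof (induction J arbitrary: k rule: finite_induct)
 case (insert j J)
 have e: "coeff ([:- a, 1:] * q) k = (case k of 0 => - a * coeff q 0 | Suc i => - a * coeff q (Suc i) + coeff q i)"
  for a and q :: "complex poly" by (cases k) (simp_all add: coeff_pCons)
 have IH: "(%n. coeff (PROD j:J. [:- u n j, 1:]) i) \<longlonglongrightarrow> coeff (PROD j:J. [:- v j, 1:]) i" for i
  using insert by auto
 have j: "(%n. u n j) \<longlonglongrightarrow> v j" using insert by auto
 show ?case unfolding prod.insert[OF insert.hyps] e
  by (cases k) (auto intro!: tendsto_intros IH j)
qed simp

lemma degree_prod_linear:
 fixes u :: "'j => complex"
 shows "finite J ==> degree (PROD j:J. [:- u j, 1:]) = card J & coeff (PROD j:J. [:- u j, 1:]) (card J) = 1"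
proof (induction J rule: finite_induct)
 case (insert j J)
 let ?q = "PROD j:J. [:- u j, 1:]"
 have q: "?q ~= 0" using insert by auto
 have "degree ([:- u j, 1:] * ?q) = Suc (card J)" using insert q by (subst degree_mult_eq) auto
 moreover have "coeff ([:- u j, 1:] * ?q) (Suc (card J)) = 1"
  using insert by (simp add: coeff_eq_0)
 ultimately show ?case using insert by simp
qed simp

lemma uniform_limit_sum:
 fixes g :: "'k => nat => 'a => complex"
 shows "(!!k. k : A ==> uniform_limit S (g k) (l k) F) ==> uniform_limit S (%n x. SUM k:A. g k n x) (%x. SUM k:A. l k x) F"
 by (induction A rule: infinite_finite_induct) (auto intro: uniform_limit_const uniform_limit_add)

locale collision =
 fixes m :: nat and \<b> :: complex and Oth :: "complex set" and f :: "complex => complex"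
  and al be :: "nat => nat => complex"
 assumes m: "1 <= m" and Oth: "finite Oth" "exp \<b> ~: Oth" and f: "f holomorphic_on - Oth"
  and inj: "!!n. inj_on (%j. exp (be n j)) {1..m}"
  and be: "!!j. j : {1..m} ==> (%n. be n j) \<longlonglongrightarrow> \<b>"
begin

definition lam where "lam n \<mu> = f \<mu> + cluster_function m (al n) (be n) \<mu>"

lemma mean_tendsto: "(%n. cmean m (be n)) \<longlonglongrightarrow> \<b>"
proof -
 have "(%n. (SUM j=1..m. be n j) / of_nat m) \<longlonglongrightarrow> (SUM j=1..m. \<b>) / of_nat m"
  by (intro tendsto_intros be) (use m in auto)
 thus ?thesis using m by (simp add: cluster_mean_def)
qed

lemma pole_tendsto: "j : {1..m} ==> (%n. exp (be n j)) \<longlonglongrightarrow> exp \<b>"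
 by (intro tendsto_intros be)

text \<open>Over the common denominator the cluster has a numerator of degree less than
  \<open>m\<close>. These numerators converge at \<open>m\<close> points, hence everywhere and to a
  polynomial of degree less than \<open>m\<close>, while the denominators tend to
  \<open>(\<mu> - exp \<b>)^m\<close>.\<close>

lemma cluster_limit_rational:
 assumes lim: "!!\<mu>. \<mu> ~: insert (exp \<b>) Oth ==> (%n. lam n \<mu>) \<longlonglongrightarrow> l \<mu>"
 shows "EX q. degree q < m & (ALL \<mu>. \<mu> ~: insert (exp \<b>) Oth --> l \<mu> = f \<mu> + poly q \<mu> / (\<mu> - exp \<b>) ^ m)"
proof -
 let ?S = "insert (exp \<b>) Oth"
 define P where "P n = (SUM j=1..m. smult (al n j * exp (be n j)) (PROD i:{1..m} - {j}. [:- exp (be n i), 1:]))" for n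
 have degP: "degree (P n) < m" for n
 proof -
  have "degree (P n) <= m - 1" unfolding P_def
   by (intro degree_sum_le order.trans[OF degree_smult_le]) (auto simp: degree_prod_linear)
  thus ?thesis using m by simp
 qed
 have P: "poly (P n) \<mu> = cluster_function m (al n) (be n) \<mu> * (PROD j=1..m. \<mu> - exp (be n j))"
  if "!!j. j : {1..m} ==> \<mu> ~= exp (be n j)" for n \<mu>
 proof -
  have "poly (P n) \<mu> = (SUM j=1..m. al n j * exp (be n j) * (PROD i:{1..m} - {j}. \<mu> - exp (be n i)))"
   by (simp add: P_def poly_sum poly_prod)
  also have "... = (SUM j=1..m. al n j * exp (be n j) / (\<mu> - exp (be n j)) * (PROD i=1..m. \<mu> - exp (be n i)))"
  proof (intro sum.cong refl)
   fix j assume j: "j : {1..m}"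
   have "(PROD i=1..m. \<mu> - exp (be n i)) = (\<mu> - exp (be n j)) * (PROD i:{1..m} - {j}. \<mu> - exp (be n i))"
    using j by (intro prod.remove) auto
   thus "al n j * exp (be n j) * (PROD i:{1..m} - {j}. \<mu> - exp (be n i)) =
    al n j * exp (be n j) / (\<mu> - exp (be n j)) * (PROD i=1..m. \<mu> - exp (be n i))"
    using that[OF j] by simp
  qed
  finally show ?thesis by (simp add: cluster_function_def sum_distrib_right)
 qed
 define v where "v \<mu> = (l \<mu> - f \<mu>) * (\<mu> - exp \<b>) ^ m" for \<mu>
 have Pv: "(%n. poly (P n) \<mu>) \<longlonglongrightarrow> v \<mu>" if \<mu>: "\<mu> ~: ?S" for \<mu>
 proof -
  have "(%n. (lam n \<mu> - f \<mu>) * (PROD j=1..m. \<mu> - exp (be n j))) \<longlonglongrightarrow> (l \<mu> - f \<mu>) * (PROD j=1..m. \<mu> - exp \<b>)"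
   by (intro tendsto_mult tendsto_diff tendsto_const tendsto_prod lim[OF \<mu>] pole_tendsto)
  moreover have "\<forall>\<^sub>F n in sequentially. ALL j:{1..m}. exp (be n j) ~= \<mu>"
   by (intro eventually_ball_finite ballI tendsto_imp_eventually_ne[OF pole_tendsto]) (use \<mu> in auto)
  hence "\<forall>\<^sub>F n in sequentially. (lam n \<mu> - f \<mu>) * (PROD j=1..m. \<mu> - exp (be n j)) = poly (P n) \<mu>"
  proof eventually_elim
   case (elim n)
   thus ?case by (subst P) (auto simp: lam_def)
  qed
  ultimately show ?thesis unfolding v_def by (auto intro: Lim_transform_eventually)
 qed
 have "infinite (- ?S)" using Oth by (simp add: infinite_UNIV_char_0 Compl_eq_Diff_UNIV)
 then obtain X where X: "finite X" "card X = m" "X <= - ?S" by (metis infinite_arbitrarily_large)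
 \<comment> \<open>The interpolation polynomial of the limits at the \<open>m\<close> nodes
   \<open>X\<close>, which were chosen off the exceptional set, where convergence is known.\<close>
 define q where "q = (SUM k:X. smult (v k) (PROD i:X - {k}. smult (1 / (k - i)) [:- i, 1:]))"
 have pq: "poly q \<mu> = (SUM k:X. v k * (PROD i:X - {k}. (\<mu> - i) / (k - i)))" for \<mu>
 proof -
  have "1 / (k - i) * poly [:- i, 1:] \<mu> = (\<mu> - i) / (k - i)" for i k by (simp add: diff_divide_distrib)
  thus ?thesis unfolding q_def poly_sum by (simp only: poly_smult poly_prod)
 qed
 have dq: "degree q < m"
 proof -
  have dl: "degree (PROD i:X - {k}. smult (1 / (k - i)) [:- i, 1:]) <= m - 1" if "k : X" for k
  proof -
   have "degree (PROD i:X - {k}. smult (1 / (k - i)) [:- i, 1:]) <= (SUM i:X - {k}. 1)"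
    using X by (intro order.trans[OF degree_prod_sum_le] sum_mono) auto
   thus ?thesis using X that by simp
  qed
  have "degree q <= m - 1" unfolding q_def by (intro degree_sum_le X order.trans[OF degree_smult_le] dl)
  thus ?thesis using m by simp
 qed
 have vq: "v \<mu> = poly q \<mu>" if \<mu>: "\<mu> ~: ?S" for \<mu>
 proof -
  have "(%n. SUM k:X. poly (P n) k * (PROD i:X - {k}. (\<mu> - i) / (k - i))) \<longlonglongrightarrow> (SUM k:X. v k * (PROD i:X - {k}. (\<mu> - i) / (k - i)))"
   by (intro tendsto_sum tendsto_mult tendsto_const Pv) (use X in auto)
  hence "(%n. poly (P n) \<mu>) \<longlonglongrightarrow> poly q \<mu>"
   unfolding pq using lagrange_interpolation[OF X(1), of "P _" \<mu>] degP X(2) by simp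
  with Pv[OF \<mu>] show ?thesis by (rule LIMSEQ_unique)
 qed
 show ?thesis
 proof (intro exI[of _ q] conjI allI impI dq)
  fix \<mu> assume "\<mu> ~: ?S"
  thus "l \<mu> = f \<mu> + poly q \<mu> / (\<mu> - exp \<b>) ^ m"
   using vq[of \<mu>] by (simp add: v_def field_simps)
 qed
qed

text \<open>As a function of \<open>z\<close>, the summand \<open>al_j e^p / (e^z - e^p)\<close> has
  residue \<open>al_j\<close> at \<open>p = be_j\<close>. So
  \<open>(z - mean)^(i-1) lam_n(e^z)\<close>, integrated over a small fixed circle about
  \<open>\<b>\<close>, yields the cluster coefficient. Uniform convergence on the circle passes to
  the limit, whose integral is the Laurent coefficient.\<close>

lemma cluster_coeff_tendsto:
 assumes conv: "cconv (insert (exp \<b>) Oth) lam l"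
  and l: "!!\<mu>. \<mu> ~: insert (exp \<b>) Oth ==> l \<mu> = f \<mu> + poly q \<mu> / (\<mu> - exp \<b>) ^ m"
  and i: "i : {1..m}"
 shows "(%n. ccoef m (al n) (be n) i) \<longlonglongrightarrow> collision_coeff l \<b> i"
proof -
 let ?S = "insert (exp \<b>) Oth"
 have "open (exp -` (- Oth) :: complex set)"
  using Oth by (intro open_vimage open_Compl finite_imp_closed continuous_on_exp continuous_on_id)
 moreover have "\<b> : exp -` (- Oth)" using Oth by auto
 ultimately obtain R1 where R1: "R1 > 0" "ball \<b> R1 <= exp -` (- Oth)" using open_contains_ball by blast
 \<comment> \<open>Two points of a disc of radius at most 1 differ by less than \<open>2\<close>,
   hence by less than \<open>2 \<pi>\<close> in the imaginary part; so \<open>exp\<close> is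
   injective there.\<close>
 define R where "R = min R1 1"
 have R: "R > 0" "R <= 1" "ball \<b> R <= exp -` (- Oth)" using R1 by (auto simp: R_def)
 have expinj: "z = w" if "exp z = exp w" "z : ball \<b> R" "w : ball \<b> R" for z w
 proof (rule exp_complex_eqI[OF _ that(1)])
  have "dist z w < 2" using that R(2) dist_triangle2[of z w \<b>] by (auto simp: dist_commute)
  hence "\<bar>Im (z - w)\<bar> < 2" using abs_Im_le_cmod[of "z - w"] by (simp add: dist_norm)
  thus "\<bar>Im z - Im w\<bar> < 2 * pi" using pi_gt3 by simp
 qed
 define r where "r = R / 2"
 have r: "0 < r" "r < R" using R by (auto simp: r_def)
 have fh: "(%z. f (exp z)) holomorphic_on ball \<b> R"
  using R(3) by (intro holomorphic_on_compose_gen[OF holomorphic_on_exp f, unfolded o_def]) auto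
 have circ: "path_image (circlepath \<b> r) <= ball \<b> R - {\<b>}" using r by auto
 have one_pole: "(g has_contour_integral 2 * pi * \<i> * residue g p) (circlepath \<b> r)"
  if p: "p : ball \<b> r" and holo: "g holomorphic_on ball \<b> R - {p}" for g p
 proof -
  have w: "winding_number (circlepath \<b> r) p = 1"
   using p by (simp add: winding_number_circlepath dist_norm norm_minus_commute)
  have "contour_integral (circlepath \<b> r) g = 2 * pi * \<i> * (SUM x:{p}. winding_number (circlepath \<b> r) x * residue g x)"
  proof (rule Residue_theorem[OF open_ball connected_ball _ holo])
   show "path_image (circlepath \<b> r) <= ball \<b> R - {p}" using p r by auto
   show "ALL z. z ~: ball \<b> R --> winding_number (circlepath \<b> r) z = 0"
   proof (intro allI impI)
    fix z assume "z ~: ball \<b> R"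
    thus "winding_number (circlepath \<b> r) z = 0"
     by (intro winding_number_zero_outside[of _ "cball \<b> r"]) (use r in auto)
   qed
  qed auto
  hence 1: "contour_integral (circlepath \<b> r) g = 2 * pi * \<i> * residue g p" by (simp add: w)
  have "g contour_integrable_on circlepath \<b> r"
   by (intro contour_integrable_continuous_circlepath holomorphic_on_imp_continuous_on holomorphic_on_subset[OF holo])
    (use p r in auto)
  thus ?thesis using 1 has_contour_integral_integral by metis
 qed
 have cint: "((%z. (z - c) ^ k * (a * exp p / (exp z - exp p))) has_contour_integral 2 * pi * \<i> * (a * (p - c) ^ k)) (circlepath \<b> r)"
  if p: "p : ball \<b> r" for p a c k
 proof -
  let ?g = "%z. (z - c) ^ k * (a * exp p / (exp z - exp p))"
  have pB: "p : ball \<b> R" using p r by auto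
  have holo: "?g holomorphic_on ball \<b> R - {p}"
   by (intro holomorphic_intros) (use expinj pB in auto)
  have res: "residue ?g p = a * (p - c) ^ k"
  proof (rule residue_simple'[OF open_ball pB holo])
   have "((%z. (exp z - exp p) / (z - p)) \<longlongrightarrow> exp p) (at p)"
    using DERIV_exp[of p] by (simp add: has_field_derivative_iff)
   hence "((%z. (z - c) ^ k * (a * exp p / ((exp z - exp p) / (z - p)))) \<longlongrightarrow> (p - c) ^ k * (a * exp p / exp p)) (at p)"
    by (intro tendsto_intros) auto
   thus "((%z. ?g z * (z - p)) \<longlongrightarrow> a * (p - c) ^ k) (at p)" by (simp add: ac_simps)
  qed
  from one_pole[OF p holo] show ?thesis unfolding res .
 qed
 define k where "k = i - 1"
 let ?c = "%n. cmean m (be n)"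
 have ev: "\<forall>\<^sub>F n in sequentially. ALL j:{1..m}. be n j : ball \<b> r"
 proof (intro eventually_ball_finite ballI)
  fix j assume "j : {1..m}"
  thus "\<forall>\<^sub>F n in sequentially. be n j : ball \<b> r"
   using tendstoD[OF be r(1)] by (simp add: dist_commute)
 qed auto
 have int: "((%z. (z - ?c n) ^ k * lam n (exp z)) has_contour_integral 2 * pi * \<i> * ccoef m (al n) (be n) i) (circlepath \<b> r)"
  if n: "ALL j:{1..m}. be n j : ball \<b> r" for n
 proof -
  have 1: "((%z. (z - ?c n) ^ k * f (exp z)) has_contour_integral 0) (circlepath \<b> r)"
   by (rule Cauchy_theorem_convex_simple[of _ "ball \<b> R"]) (insert r, auto intro!: holomorphic_intros fh)
  have "((%z. SUM j=1..m. (z - ?c n) ^ k * (al n j * exp (be n j) / (exp z - exp (be n j)))) has_contour_integral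
    (SUM j=1..m. 2 * pi * \<i> * (al n j * (be n j - ?c n) ^ k))) (circlepath \<b> r)"
   by (intro has_contour_integral_sum cint) (use n in auto)
  from has_contour_integral_add[OF 1 this] show ?thesis
   by (simp add: lam_def cluster_function_def cluster_coeff_def k_def distrib_left sum_distrib_left)
 qed
 have lim1: "(%n. contour_integral (circlepath \<b> r) (%z. (z - ?c n) ^ k * lam n (exp z))) \<longlonglongrightarrow>
   contour_integral (circlepath \<b> r) (%z. (z - \<b>) ^ k * l (exp z))"
 proof (rule contour_integral_uniform_limit_circlepath)
  show "\<forall>\<^sub>F n in sequentially. (%z. (z - ?c n) ^ k * lam n (exp z)) contour_integrable_on circlepath \<b> r"
   using ev by eventually_elim (insert int, auto simp: contour_integrable_on_def)
  let ?C = "sphere \<b> r"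
  have expC: "exp z ~: ?S" if "z : ?C" for z
  proof -
   have z: "z : ball \<b> R" "z ~= \<b>" using that r by auto
   have "exp z ~= exp \<b>" using expinj[of z \<b>] z R(1) by auto
   moreover have "exp z ~: Oth" using R(3) z by auto
   ultimately show ?thesis by simp
  qed
  have expS: "exp ` ?C \<inter> ?S = {}" using expC by blast
  have cpt: "compact (exp ` ?C)" by (intro compact_continuous_image continuous_intros) auto
  have ul0: "uniform_limit (exp ` ?C) lam l sequentially"
   using conv cpt expS unfolding compactly_convergent_off_def by blast
  hence ul: "uniform_limit ?C (%n z. lam n (exp z)) (%z. l (exp z)) sequentially"
   by (rule uniform_limit_compose') auto
  have "continuous_on (exp ` ?C) (%\<mu>. f \<mu> + poly q \<mu> / (\<mu> - exp \<b>) ^ m)"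
  proof (intro continuous_intros holomorphic_on_imp_continuous_on)
   show "f holomorphic_on exp ` ?C" by (rule holomorphic_on_subset[OF f]) (use expS in auto)
  qed (use expS in auto)
  hence "compact ((%\<mu>. f \<mu> + poly q \<mu> / (\<mu> - exp \<b>) ^ m) ` exp ` ?C)" by (intro compact_continuous_image cpt)
  moreover have "(%\<mu>. f \<mu> + poly q \<mu> / (\<mu> - exp \<b>) ^ m) ` exp ` ?C = (%z. l (exp z)) ` ?C"
   unfolding image_image by (intro image_cong refl l[symmetric] expC)
  ultimately have bl: "bounded ((%z. l (exp z)) ` ?C)" by (simp add: compact_imp_bounded)
  have lin: "uniform_limit ?C (%n z. z - ?c n) (%z. z - \<b>) sequentially"
   by (intro uniform_limit_intros) (insert mean_tendsto, auto simp: uniform_limit_iff tendsto_iff)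
  have cl: "bounded ((%z. (z - \<b>) ^ e) ` ?C)" for e
   by (intro compact_imp_bounded compact_continuous_image continuous_intros) auto
  have pw: "uniform_limit ?C (%n z. (z - ?c n) ^ e) (%z. (z - \<b>) ^ e) sequentially" for e
  proof (induction e)
   case (Suc e)
   show ?case unfolding power_Suc by (rule uniform_lim_mult[OF lin Suc]) (use cl[of 1] cl in auto)
  qed (simp add: uniform_limit_const)
  show "uniform_limit (sphere \<b> r) (%n z. (z - ?c n) ^ k * lam n (exp z)) (%z. (z - \<b>) ^ k * l (exp z)) sequentially"
   by (rule uniform_lim_mult[OF pw ul cl bl])
 qed (use r in auto)
 \<comment> \<open>The limit \<open>l\<close> is determined only off the exceptional set, so its
   meromorphic expression is used in its place.\<close>
 define G where "G z = f (exp z) + poly q (exp z) / (exp z - exp \<b>) ^ m" for z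
 have G: "l (exp z) = G z" if "z : ball \<b> R - {\<b>}" for z
  unfolding G_def using that R(1,3) expinj[of z \<b>] by (intro l) auto
 have Gh: "G holomorphic_on ball \<b> R - {\<b>}"
  unfolding G_def by (intro holomorphic_intros holomorphic_on_subset[OF fh]) (use expinj[of _ \<b>] R(1) in auto)
 have "G meromorphic_on {\<b>}"
 proof -
  have "(%z. f (exp z)) analytic_on {\<b>}" using fh R(1) analytic_at[of "%z. f (exp z)" \<b>] by (meson centre_in_ball open_ball)
  hence 1: "(%z. f (exp z)) meromorphic_on {\<b>}" by (rule analytic_on_imp_meromorphic_on)
  have hm: "g meromorphic_on {\<b>}" if "g holomorphic_on UNIV" for g
  proof -
   have "g analytic_on UNIV" using that by (simp add: analytic_on_open)
   hence "g analytic_on {\<b>}" by (rule analytic_on_subset) simp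
   thus ?thesis by (rule analytic_on_imp_meromorphic_on)
  qed
  have 2: "(%z. poly q (exp z)) meromorphic_on {\<b>}" by (rule hm) (intro holomorphic_intros)
  have 3: "(%z. exp z - exp \<b>) meromorphic_on {\<b>}" by (rule hm) (intro holomorphic_intros)
  show ?thesis unfolding G_def[abs_def] by (rule meromorphic_on_add[OF 1 meromorphic_on_divide[OF 2 meromorphic_on_power[OF 3]]])
 qed
 then obtain F where F: "(%x. G (\<b> + x)) has_laurent_expansion F" by (auto simp: meromorphic_on_def)
 have "\<forall>\<^sub>F z in at \<b>. z : ball \<b> R - {\<b>}" using eventually_at_in_open[OF open_ball, of \<b> \<b> R] R(1) by simp
 hence evG: "\<forall>\<^sub>F z in at \<b>. l (exp z) = G z" by (rule eventually_mono) (rule G)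
 have "collision_coeff l \<b> i = fls_nth (laurent_expansion G \<b>) (- int i)"
  unfolding collision_coeff_def by (subst laurent_expansion_cong[OF evG refl]) (rule refl)
 also have "laurent_expansion G \<b> = F" by (rule laurent_expansion_eqI[OF F])
 finally have cc: "collision_coeff l \<b> i = fls_nth F (- int i)" .
 have "(%x. G (\<b> + x) * (\<b> + x - \<b>) ^ k) has_laurent_expansion F * fls_X_intpow (int k)"
  using has_laurent_expansion_mult[OF F has_laurent_expansion_fps_X_power[of k]] by (simp only: add_diff_cancel_left')
 hence "residue (%z. G z * (z - \<b>) ^ k) \<b> = fls_residue (F * fls_X_intpow (int k))" by (rule has_laurent_expansion_residue)
 also have "fls_residue (F * fls_X_intpow (int k)) = collision_coeff l \<b> i"
  using i unfolding fls_X_intpow_times_conv_shift(2) by (simp add: cc k_def of_nat_diff)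
 finally have "((%z. G z * (z - \<b>) ^ k) has_contour_integral 2 * pi * \<i> * collision_coeff l \<b> i) (circlepath \<b> r)"
  using one_pole[of \<b> "%z. G z * (z - \<b>) ^ k"] r by (simp add: Gh holomorphic_intros)
 hence "((%z. (z - \<b>) ^ k * l (exp z)) has_contour_integral 2 * pi * \<i> * collision_coeff l \<b> i) (circlepath \<b> r)"
 proof (rule has_contour_integral_eq)
  fix z assume "z : path_image (circlepath \<b> r)"
  hence "z : ball \<b> R - {\<b>}" using circ by blast
  thus "G z * (z - \<b>) ^ k = (z - \<b>) ^ k * l (exp z)" using G by simp
 qed
 from contour_integral_unique[OF this] have lim2: "(%n. contour_integral (circlepath \<b> r) (%z. (z - ?c n) ^ k * lam n (exp z))) \<longlonglongrightarrow> 2 * pi * \<i> * collision_coeff l \<b> i"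
  using lim1 by simp
 have "(%n. 2 * pi * \<i> * ccoef m (al n) (be n) i) \<longlonglongrightarrow> 2 * pi * \<i> * collision_coeff l \<b> i"
 proof (rule Lim_transform_eventually[OF lim2])
  show "\<forall>\<^sub>F n in sequentially. contour_integral (circlepath \<b> r) (%z. (z - ?c n) ^ k * lam n (exp z)) = 2 * pi * \<i> * ccoef m (al n) (be n) i"
   using ev by eventually_elim (use int contour_integral_unique in blast)
 qed
 thus ?thesis by (subst (asm) tendsto_mult_left_iff) auto
qed

text \<open>
  The moments \<open>\<Sum>\<^sub>j al\<^sub>j (be\<^sub>j - mean)\<^sup>i\<close> of order \<open>i \<ge> m\<close> satisfy the linear recurrence given by the polynomial
  with roots \<open>be\<^sub>j - mean\<close>, whose lower coefficients tend to \<open>0\<close>.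
\<close>

lemma moments_tendsto:
 assumes c: "!!i. i : {1..m} ==> (%n. ccoef m (al n) (be n) i) \<longlonglongrightarrow> c i"
 shows "convergent (%n. SUM j=1..m. al n j * exp (of_nat q * (be n j - cmean m (be n))))"
proof -
 define D where "D n j = be n j - cmean m (be n)" for n j
 define C where "C k n = (SUM j=1..m. al n j * D n j ^ k)" for k n
 define V where "V n = (PROD j:{1..m}. [:- D n j, 1:])" for n
 have D: "(%n. D n j) \<longlonglongrightarrow> 0" if "j : {1..m}" for j
  using tendsto_diff[OF be[OF that] mean_tendsto] by (simp add: D_def)
 have V0: "(%n. coeff (V n) k) \<longlonglongrightarrow> 0" if "k < m" for k
 proof -
  have "(%n. coeff (V n) k) \<longlonglongrightarrow> coeff (PROD j:{1..m}. [:- (0::complex), 1:]) k"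
   unfolding V_def by (rule coeff_prod_linear_tendsto) (use D in auto)
  moreover have "(PROD j:{1..m}. [:- (0::complex), 1:]) = monom 1 m"
   by (simp add: monom_altdef)
  ultimately show ?thesis using that by simp
 qed
 have root: "D n j ^ m = - (SUM k<m. coeff (V n) k * D n j ^ k)" if j: "j : {1..m}" for n j
 proof -
  have dg: "degree (V n) = m" "coeff (V n) m = 1" using degree_prod_linear[of "{1..m}" "D n"] by (simp_all add: V_def)
  have "poly (V n) (D n j) = 0" unfolding V_def poly_prod using j by (intro prod_zero) auto
  hence "(SUM k<=m. coeff (V n) k * D n j ^ k) = 0" by (simp add: poly_altdef dg)
  hence "(SUM k<m. coeff (V n) k * D n j ^ k) + D n j ^ m = 0" by (simp add: dg lessThan_Suc_atMost[symmetric])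
  thus ?thesis by (simp add: eq_neg_iff_add_eq_0 add.commute)
 qed
 have rec: "C (i + m) n = - (SUM k<m. coeff (V n) k * C (i + k) n)" for i n
 proof -
  have "C (i + m) n = (SUM j=1..m. al n j * D n j ^ i * (- (SUM k<m. coeff (V n) k * D n j ^ k)))"
   unfolding C_def by (intro sum.cong refl) (simp add: power_add root mult.assoc)
  also have "... = - (SUM j=1..m. SUM k<m. coeff (V n) k * (al n j * D n j ^ (i + k)))"
   by (simp add: sum_negf sum_distrib_left power_add algebra_simps)
  also have "... = - (SUM k<m. coeff (V n) k * C (i + k) n)"
   unfolding C_def sum_distrib_left by (subst sum.swap) simp
  finally show ?thesis .
 qed
 define lc where "lc k = (if k < m then c (Suc k) else 0)" for k
 have Clim: "C k \<longlonglongrightarrow> lc k" for k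
 proof (induction k rule: less_induct)
  case (less k)
  show ?case
  proof (cases "k < m")
   case True
   thus ?thesis using c[of "Suc k"] by (simp add: C_def[abs_def] lc_def D_def cluster_coeff_def)
  next
   case False
   then obtain i where i: "k = i + m" using le_Suc_ex by (metis add.commute not_less)
   have "(%n. - (SUM j<m. coeff (V n) j * C (i + j) n)) \<longlonglongrightarrow> - (SUM j<m. 0 * lc (i + j))"
    by (intro tendsto_minus tendsto_sum tendsto_mult V0 less) (auto simp: i)
   thus ?thesis using False by (simp add: i rec[abs_def] lc_def)
  qed
 qed
 have "EX B. ALL k<m. ALL n. norm (C k n) <= B"
 proof -
  have "ALL k. EX B. ALL n. norm (C k n) <= B"
   using convergent_imp_Bseq[OF convergentI[OF Clim]] by (auto simp: Bseq_def)
  then obtain b where b: "!!k n. norm (C k n) <= b k" by metis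
  have "norm (C k n) <= (SUM k<m. b k)" if "k < m" for k n
  proof -
   have "b k <= (SUM k<m. b k)" using that order.trans[OF norm_ge_zero b] by (intro member_le_sum) auto
   thus ?thesis using b order.trans by blast
  qed
  thus ?thesis by blast
 qed
 then obtain B where B: "!!k n. k < m ==> norm (C k n) <= B" by blast
 have B0: "B \<ge> 0" using B[of 0 0] m order.trans[OF norm_ge_zero] by auto
 have "(%n. SUM k<m. norm (coeff (V n) k)) \<longlonglongrightarrow> (SUM k<m. 0)"
  by (intro tendsto_sum tendsto_norm_zero V0) auto
 hence evV: "\<forall>\<^sub>F n in sequentially. (SUM k<m. norm (coeff (V n) k)) < 1"
  by (intro order_tendstoD(2)[of _ 0]) auto
 \<comment> \<open>Once the lower coefficients of the recurrence have total size below 1, the bound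
   for the first \<open>m\<close> moments propagates to all orders with the same
   \<open>B\<close>.\<close>
 have CB: "norm (C k n) <= B" if "(SUM k<m. norm (coeff (V n) k)) < 1" for n k
 proof (induction k rule: less_induct)
  case (less k)
  show ?case
  proof (cases "k < m")
   case False
   then obtain i where i: "k = i + m" using le_Suc_ex by (metis add.commute not_less)
   have "norm (C k n) <= (SUM j<m. norm (coeff (V n) j * C (i + j) n))"
    unfolding i rec norm_minus_cancel by (rule norm_sum)
   also have "... <= (SUM j<m. norm (coeff (V n) j) * B)"
    unfolding norm_mult by (intro sum_mono mult_left_mono less) (auto simp: i)
   also have "... <= 1 * B" unfolding sum_distrib_right[symmetric] using that B0 by (intro mult_right_mono) auto
   finally show ?thesis by simp
  qed (use B in auto)
 qed
 \<comment> \<open>The exponential is expanded into moments. Their bound uniform in \<open>k\<close>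
   and \<open>n\<close> gives a summable majorant, so Tannery's theorem allows the termwise
   limit.\<close>
 have "((%n. \<Sum>k. of_nat q ^ k / fact k * C k n) \<longlongrightarrow> (\<Sum>k. of_nat q ^ k / fact k * lc k)) sequentially"
 proof -
  have sm: "summable (%k. norm (of_nat q :: complex) ^ k / fact k * B)"
   using summable_exp[of "norm (of_nat q :: complex)"] by (intro summable_mult2) (simp add: divide_inverse mult.commute)
  have bd: "\<forall>\<^sub>F x in at_top \<times>\<^sub>F sequentially. case x of (k, n) => norm (of_nat q ^ k / fact k * C k n) <= norm (of_nat q :: complex) ^ k / fact k * B"
  proof -
   have "\<forall>\<^sub>F x in at_top \<times>\<^sub>F sequentially. (SUM k<m. norm (coeff (V (snd x)) k)) < (1::real)"
    using evV by (rule eventually_compose_filterlim[OF _ filterlim_snd])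
   thus ?thesis
   proof eventually_elim
    case (elim x)
    show ?case
    proof (cases x)
     case (Pair k n)
     have "norm (of_nat q ^ k / fact k * C k n) = norm (of_nat q :: complex) ^ k / fact k * norm (C k n)"
      by (simp add: norm_mult norm_divide norm_power)
     also have "... <= norm (of_nat q :: complex) ^ k / fact k * B"
      using CB elim Pair by (intro mult_left_mono) auto
     finally show ?thesis using Pair by simp
    qed
   qed
  qed
  have lm: "(%n. of_nat q ^ k / fact k * C k n) \<longlonglongrightarrow> of_nat q ^ k / fact k * lc k" for k
   by (intro tendsto_mult tendsto_const Clim)
  show ?thesis
   by (rule tannerys_theorem[OF lm bd sm, THEN conjunct2, THEN conjunct2]) simp
 qed
 moreover have "(\<Sum>k. of_nat q ^ k / fact k * C k n) = (SUM j=1..m. al n j * exp (of_nat q * D n j))" for n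
 proof -
  have "(%k. SUM j=1..m. al n j * ((of_nat q * D n j) ^ k /\<^sub>R fact k)) sums (SUM j=1..m. al n j * exp (of_nat q * D n j))"
   by (intro sums_sum sums_mult exp_converges)
  moreover have "(SUM j=1..m. al n j * ((of_nat q * D n j) ^ k /\<^sub>R fact k)) = of_nat q ^ k / fact k * C k n" for k
   unfolding C_def sum_distrib_left
   by (intro sum.cong refl) (simp add: power_mult_distrib scaleR_conv_of_real divide_inverse)
  ultimately show ?thesis by (simp add: sums_iff)
 qed
 ultimately show ?thesis unfolding D_def convergent_def by auto
qed

text \<open>In Newton form the coefficient is
  \<open>N_k = \<Sum> al_j p_j (p_j - p_1) \<dots> (p_j - p_k)\<close>. It is a combination of the
  sums \<open>\<Sum> al_j p_j^q\<close> with convergent coefficients, and these sums are the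
  exponential moments of \<open>moments_tendsto\<close> times \<open>exp (q * mean)\<close>. The
  products of inverse linear factors converge uniformly away from the collision point.\<close>

lemma cluster_converges:
 assumes c: "!!i. i : {1..m} ==> (%n. ccoef m (al n) (be n) i) \<longlonglongrightarrow> c i"
 obtains e where "cconv (insert (exp \<b>) Oth) lam (%\<mu>. f \<mu> + (SUM i=1..m. e i / (\<mu> - exp \<b>) ^ i))"
proof -
 let ?p = "%n j. exp (be n j)"
 define N where "N k n = (SUM j=1..m. al n j * ?p n j * (PROD i=1..k. ?p n j - ?p n i))" for k n
 have conv: "convergent (%n. SUM j=1..m. al n j * ?p n j ^ q)" for q
 proof -
  obtain l where l: "(%n. SUM j=1..m. al n j * exp (of_nat q * (be n j - cmean m (be n)))) \<longlonglongrightarrow> l"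
   using moments_tendsto[OF c] unfolding convergent_def by blast
  have "(%n. exp (of_nat q * cmean m (be n)) * (SUM j=1..m. al n j * exp (of_nat q * (be n j - cmean m (be n))))) \<longlonglongrightarrow> exp (of_nat q * \<b>) * l"
   by (intro tendsto_intros l mean_tendsto)
  moreover have "exp (of_nat q * cmean m (be n)) * (SUM j=1..m. al n j * exp (of_nat q * (be n j - cmean m (be n)))) = (SUM j=1..m. al n j * ?p n j ^ q)" for n
   unfolding sum_distrib_left
   by (intro sum.cong refl) (simp add: exp_of_nat_mult[symmetric] right_diff_distrib exp_diff)
  ultimately show ?thesis unfolding convergent_def by auto
 qed
 have "convergent (N k)" if "k < m" for k
 proof -
  let ?V = "%n. PROD i:{1..k}. [:- ?p n i, 1:]"
  have "(%n. coeff (?V n) q) \<longlonglongrightarrow> coeff (PROD i:{1..k}. [:- exp \<b>, 1:]) q" for q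
   using that by (intro coeff_prod_linear_tendsto pole_tendsto) auto
  hence cV: "convergent (%n. coeff (?V n) q)" for q unfolding convergent_def by blast
  have "N k n = (SUM q<=k. coeff (?V n) q * (SUM j=1..m. al n j * ?p n j ^ Suc q))" for n
  proof -
   have dV: "degree (?V n) = k" using degree_prod_linear[of "{1..k}" "?p n"] by simp
   have "(PROD i=1..k. x - ?p n i) = (SUM q<=k. coeff (?V n) q * x ^ q)" for x
    using poly_altdef[of "?V n" x] unfolding dV by (simp add: poly_prod)
   hence "N k n = (SUM j=1..m. SUM q<=k. coeff (?V n) q * (al n j * ?p n j ^ Suc q))"
    unfolding N_def by (intro sum.cong refl) (simp add: sum_distrib_left algebra_simps)
   thus ?thesis unfolding sum_distrib_left by (subst sum.swap) simp
  qed
  moreover have "convergent (%n. SUM q<=k. coeff (?V n) q * (SUM j=1..m. al n j * ?p n j ^ Suc q))"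
   by (intro convergent_sum convergent_mult cV conv)
  ultimately show ?thesis by (metis (no_types, lifting) ext)
 qed
 then obtain l where l: "!!k. k < m ==> N k \<longlonglongrightarrow> l k" unfolding convergent_def by metis
 have newton: "cluster_function m (al n) (be n) \<mu> = (SUM k<m. N k n * (PROD i=1..Suc k. inverse (\<mu> - ?p n i)))"
  if "!!j. j : {1..m} ==> \<mu> ~= ?p n j" for n \<mu>
 proof -
  have "al n j * ?p n j / (\<mu> - ?p n j) = (SUM k<m. al n j * ?p n j * (PROD i=1..k. ?p n j - ?p n i) * (PROD i=1..Suc k. inverse (\<mu> - ?p n i)))"
   if j: "j : {1..m}" for j
  proof -
   have z: "(PROD i=1..m. ?p n j - ?p n i) = 0" using j by (intro prod_zero) auto
   have "1 / (\<mu> - ?p n j) = (SUM k<m. (PROD i=1..k. ?p n j - ?p n i) / (PROD i=1..Suc k. \<mu> - ?p n i))"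
    using newton_identity[of m \<mu> "?p n" "?p n j"] \<open>!!j. j : {1..m} ==> \<mu> ~= ?p n j\<close> j unfolding z by simp
   hence "al n j * ?p n j * (1 / (\<mu> - ?p n j)) = (SUM k<m. al n j * ?p n j * ((PROD i=1..k. ?p n j - ?p n i) / (PROD i=1..Suc k. \<mu> - ?p n i)))"
    by (simp only: sum_distrib_left)
   thus ?thesis by (simp add: divide_inverse prod_inversef[symmetric] o_def mult.assoc)
  qed
  hence "cluster_function m (al n) (be n) \<mu> = (SUM j=1..m. SUM k<m. al n j * ?p n j * (PROD i=1..k. ?p n j - ?p n i) * (PROD i=1..Suc k. inverse (\<mu> - ?p n i)))"
   unfolding cluster_function_def by (intro sum.cong refl) auto
  also have "... = (SUM k<m. N k n * (PROD i=1..Suc k. inverse (\<mu> - ?p n i)))"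
   unfolding N_def sum_distrib_right by (rule sum.swap)
  finally show ?thesis .
 qed
 define e where "e i = l (i - 1)" for i
 show ?thesis
 proof (rule that[of e], unfold compactly_convergent_off_def, intro allI impI)
  fix K assume K: "compact K & K \<inter> insert (exp \<b>) Oth = {}"
  obtain d where d: "d > 0" "!!x. x : K ==> d <= dist (exp \<b>) x"
   using separate_point_closed[of K "exp \<b>"] K compact_imp_closed by blast
  have inv: "uniform_limit K (%n \<mu>. inverse (\<mu> - ?p n i)) (%\<mu>. inverse (\<mu> - exp \<b>)) sequentially" if "i : {1..m}" for i
  proof -
   have "uniform_limit K (%n \<mu>. \<mu> - ?p n i) (%\<mu>. \<mu> - exp \<b>) sequentially"
    by (intro uniform_limit_intros) (insert pole_tendsto[OF that], auto simp: uniform_limit_iff tendsto_iff)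
   from uniform_lim_inverse[OF this, of d] show ?thesis
    using d by (simp add: o_def dist_norm norm_minus_commute)
  qed
  have bd: "bounded ((%\<mu>. inverse (\<mu> - exp \<b>) ^ k) ` K)" for k
   by (intro compact_imp_bounded compact_continuous_image continuous_intros) (use K in auto)
  have pr: "uniform_limit K (%n \<mu>. PROD i=1..k. inverse (\<mu> - ?p n i)) (%\<mu>. inverse (\<mu> - exp \<b>) ^ k) sequentially" if "k <= m" for k
   using that
  proof (induction k)
   case (Suc k)
   have "uniform_limit K (%n \<mu>. inverse (\<mu> - ?p n (Suc k)) * (PROD i=1..k. inverse (\<mu> - ?p n i))) (%\<mu>. inverse (\<mu> - exp \<b>) * inverse (\<mu> - exp \<b>) ^ k) sequentially"
    by (rule uniform_lim_mult[OF inv Suc.IH]) (use Suc.prems bd[of 1] bd[of k] in auto)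
   thus ?case by (simp add: prod.nat_ivl_Suc' mult.commute)
  qed (simp add: uniform_limit_const)
  have main: "uniform_limit K (%n \<mu>. SUM k<m. N k n * (PROD i=1..Suc k. inverse (\<mu> - ?p n i))) (%\<mu>. SUM k<m. l k * inverse (\<mu> - exp \<b>) ^ Suc k) sequentially"
  proof (rule uniform_limit_sum)
   fix k assume k: "k : {..<m}"
   have "uniform_limit K (%n \<mu>. N k n) (%\<mu>. l k) sequentially"
    using l[of k] k by (auto simp: uniform_limit_iff tendsto_iff)
   thus "uniform_limit K (%n \<mu>. N k n * (PROD i=1..Suc k. inverse (\<mu> - ?p n i))) (%\<mu>. l k * inverse (\<mu> - exp \<b>) ^ Suc k) sequentially"
    by (rule uniform_lim_mult[OF _ pr]) (insert k bd[of "Suc k"], auto simp: image_constant_conv)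
  qed
  have "uniform_limit K (%n \<mu>. f \<mu> + (SUM k<m. N k n * (PROD i=1..Suc k. inverse (\<mu> - ?p n i)))) (%\<mu>. f \<mu> + (SUM k<m. l k * inverse (\<mu> - exp \<b>) ^ Suc k)) sequentially"
   by (intro uniform_limit_add uniform_limit_const main)
  moreover have ev: "\<forall>\<^sub>F n in sequentially. ALL \<mu>:K. f \<mu> + (SUM k<m. N k n * (PROD i=1..Suc k. inverse (\<mu> - ?p n i))) = lam n \<mu>"
  proof -
   have "\<forall>\<^sub>F n in sequentially. ALL j:{1..m}. dist (?p n j) (exp \<b>) < d"
    by (intro eventually_ball_finite ballI tendstoD[OF pole_tendsto] d) auto
   thus ?thesis
   proof eventually_elim
    case (elim n)
    have "\<mu> ~= ?p n j" if "\<mu> : K" "j : {1..m}" for \<mu> j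
     using elim[rule_format, OF that(2)] d(2)[OF that(1)] by (auto simp: dist_commute)
    thus ?case using newton by (simp add: lam_def)
   qed
  qed
  moreover have eq: "f \<mu> + (SUM k<m. l k * inverse (\<mu> - exp \<b>) ^ Suc k) = f \<mu> + (SUM i=1..m. e i / (\<mu> - exp \<b>) ^ i)" for \<mu>
  proof -
   have "(SUM i=1..m. e i / (\<mu> - exp \<b>) ^ i) = (SUM k<m. e (Suc k) / (\<mu> - exp \<b>) ^ Suc k)"
    by (rule sum.reindex_bij_witness[of _ Suc "%i. i - 1"]) auto
   thus ?thesis by (simp add: e_def divide_inverse power_inverse)
  qed
  ultimately show "uniform_limit K lam (%\<mu>. f \<mu> + (SUM i=1..m. e i / (\<mu> - exp \<b>) ^ i)) sequentially"
   using uniform_limit_cong[OF ev eq] by simp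
 qed
qed

end

lemma well_behaved:
 assumes \<a>: "\<a> : {1..length ms}" and ms: "partition_of p ms"
 shows "well_behaved_collision lh kb ms \<a>"
 unfolding well_behaved_collision_def
proof (intro allI)
 fix A :: "int => complex" and b :: "nat => complex" and d :: "nat => nat => complex"
  and \<b> :: complex and al be :: "nat => nat => complex"
 define m where "m = pole_order ms \<a>"
 define f where "f = fixed_part lh kb ms \<a> A b d"
 define others where "others = b ` other_poles ms \<a>"
 let ?S = "{0, exp \<b>} \<union> others"
 let ?lam = "%n \<mu>. f \<mu> + cluster_function m (al n) (be n) \<mu>"
 have "(ALL lam. cconv ?S ?lam lam -->
       lam meromorphic_on UNIV & - int m <= zorder lam (exp \<b>) &
       (ALL i:{1..m}. (%n. ccoef m (al n) (be n) i) \<longlonglongrightarrow> collision_coeff lam \<b> i)) &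
      (ALL c. (ALL i:{1..m}. (%n. ccoef m (al n) (be n) i) \<longlonglongrightarrow> c i) & c m ~= 0 -->
       (EX e. let lam = (%\<mu>. f \<mu> + (SUM i=1..m. e i / (\<mu> - exp \<b>) ^ i))
          in (ALL i:{1..m}. collision_coeff lam \<b> i = c i) & cconv ?S ?lam lam))"
  if valid: "valid_fixed_part lh kb ms \<a> A b d \<b>" and coll: "colliding m others al be \<b>"
 proof -
  let ?O = "insert 0 others"
  have S: "?S = insert (exp \<b>) ?O" by auto
  have fin: "finite (other_poles ms \<a>)" by (simp add: other_poles_def)
  have bnz: "b \<g> ~= 0" "b \<g> ~= exp \<b>" if "\<g> : other_poles ms \<a>" for \<g>
   using valid that by (auto simp: valid_fixed_part_def)
  have m1: "1 <= m"
  proof -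
   have "ms ! (\<a> - 1) : set ms" using \<a> by (intro nth_mem) auto
   thus ?thesis using ms by (auto simp: m_def pole_order_def partition_of_def Suc_le_eq)
  qed
  have fh: "f holomorphic_on - ?O"
   unfolding f_def fixed_part_def[abs_def] dz_superpotential_def[abs_def]
   by (intro holomorphic_intros) (auto simp: others_def)
  have "exp \<b> ~: ?O"
  proof
   assume "exp \<b> : ?O"
   then obtain \<g> where "\<g> : other_poles ms \<a>" "b \<g> = exp \<b>" by (auto simp: others_def)
   thus False using bnz(2)[of \<g>] by simp
  qed
  then interpret collision m \<b> ?O f al be
   by unfold_locales (insert m1 fin fh coll bnz, auto simp: others_def colliding_def)
  have lam_eq: "?lam = lam" by (intro ext) (simp add: lam_def)
  define R where "R q \<mu> = f \<mu> + poly q \<mu> / (\<mu> - exp \<b>) ^ m" for q \<mu>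
  have merof: "f meromorphic_on UNIV"
   unfolding f_def fixed_part_def[abs_def] dz_superpotential_def[abs_def] by (intro meromorphic_intros)
  have meroR: "R q meromorphic_on UNIV" for q
  proof -
   have "poly q analytic_on UNIV" by (simp add: analytic_on_open holomorphic_intros)
   hence "poly q meromorphic_on UNIV" by (rule analytic_on_imp_meromorphic_on)
   thus ?thesis unfolding R_def[abs_def] by (intro meromorphic_intros merof)
  qed
  have finS: "finite ?S" using fin by (simp add: others_def)
  have offS: "\<forall>\<^sub>F w in at z. w ~: ?S" for z
  proof -
   have "\<forall>\<^sub>F w in at z. w : - (?S - {z}) - {z}"
    using finS by (intro eventually_at_in_open open_Compl finite_imp_closed) auto
   thus ?thesis by eventually_elim auto
  qed
  \<comment> \<open>The order of a function that vanishes identically near the point says nothing.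
    Here the function is rational and large at infinity, so its zeros off the poles are finite in
    number.\<close>
  have nonzero: "\<not> (\<forall>\<^sub>F w in at (exp \<b>). R q w = 0)" if q: "degree q < m" for q
  proof
   assume ev: "\<forall>\<^sub>F w in at (exp \<b>). R q w = 0"
   have inv: "rational_off ?S (%\<mu>. inverse (\<mu> - c))" if c: "c : ?S" for c
   proof (unfold rational_off_def, rule exI[of _ 1], rule exI[of _ "[:- c, 1:]"], intro allI impI)
    fix z assume "z ~: ?S"
    hence "z - c ~= 0" using c by auto
    thus "poly [:- c, 1:] z ~= 0 & inverse (z - c) * poly [:- c, 1:] z = poly 1 z" by simp
   qed
   have pq: "rational_off ?S (poly q)" unfolding rational_off_def by (rule exI[of _ q], rule exI[of _ 1]) simp
   have R': "R q \<mu> = \<mu> ^ (lh + 1) + (SUM i:dz_ix lh kb. A i * \<mu> powi i) +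
     (SUM \<g>:other_poles ms \<a>. SUM i=1..pole_order ms \<g>. d \<g> i * inverse (\<mu> - b \<g>) ^ i) + poly q \<mu> * inverse (\<mu> - exp \<b>) ^ m" for \<mu>
    by (simp add: R_def f_def fixed_part_def dz_superpotential_def divide_inverse power_inverse)
   have rat: "rational_off ?S (R q)"
    unfolding R'[abs_def]
    by (intro rational_off_add rational_off_sum rational_off_mult rational_off_power rational_off_const rational_off_id rational_off_powi inv pq)
     (auto simp: others_def)
   obtain u where u: "(u \<longlongrightarrow> A (int lh)) at_infinity" "!!\<nu>. \<nu> ~= 0 ==> laurent_poly lh kb A \<nu> = \<nu> ^ lh * u \<nu>"
    using laurent_poly_infinity by blast
   have inv0: "((%\<mu>. inverse (\<mu> - c)) \<longlongrightarrow> 0) at_infinity" for c :: complex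
   proof -
    have "filterlim (%\<mu>. - c + \<mu>) at_infinity at_infinity"
     by (rule tendsto_add_filterlim_at_infinity[OF tendsto_const filterlim_ident])
    hence "filterlim (%\<mu>. \<mu> - c) at_infinity at_infinity" by simp
    thus ?thesis by (rule filterlim_compose[OF tendsto_inverse_0])
   qed
   define g where "g \<mu> = (SUM \<g>:other_poles ms \<a>. SUM i=1..pole_order ms \<g>. d \<g> i * inverse (\<mu> - b \<g>) ^ i) + poly q \<mu> / poly ([:- exp \<b>, 1:] ^ m) \<mu>" for \<mu>
   have "(g \<longlongrightarrow> (SUM \<g>:other_poles ms \<a>. SUM i=1..pole_order ms \<g>. d \<g> i * 0 ^ i) + 0) at_infinity"
    unfolding g_def
   proof (intro tendsto_add tendsto_sum tendsto_mult tendsto_const tendsto_power inv0)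
    show "((%\<mu>. poly q \<mu> / poly ([:- exp \<b>, 1:] ^ m) \<mu>) \<longlongrightarrow> 0) at_infinity"
     by (rule poly_divide_tendsto_0_at_infinity) (simp add: degree_power_eq q)
   qed
   moreover have "(SUM \<g>:other_poles ms \<a>. SUM i=1..pole_order ms \<g>. d \<g> i * 0 ^ i) = 0"
    by (intro sum.neutral ballI) (auto simp: power_0_left)
   ultimately have g0: "(g \<longlongrightarrow> 0) at_infinity" by simp
   \<comment> \<open>The part \<open>h\<close> is \<open>\<mu>^lh (u + \<mu>)\<close> with
     \<open>u\<close> convergent, while all principal parts together tend to 0; hence the sum cannot
     vanish far out.\<close>
   have "filterlim (%\<mu>. u \<mu> + \<mu>) at_infinity at_infinity"
    by (rule tendsto_add_filterlim_at_infinity[OF u(1) filterlim_ident])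
   hence big: "\<forall>\<^sub>F \<mu> in at_infinity. 2 <= norm (u \<mu> + \<mu>)"
    by (auto simp: filterlim_at_infinity[of 0])
   have small: "\<forall>\<^sub>F \<mu> in at_infinity. norm (g \<mu>) < 1"
    using tendstoD[OF g0, of 1] by simp
   have "\<forall>\<^sub>F \<mu> in at_infinity. 1 <= norm (\<mu> :: complex)" unfolding eventually_at_infinity by blast
   moreover have "\<forall>\<^sub>F \<mu> in at_infinity. \<mu> ~: ?S"
   proof -
    obtain B where B: "!!z. z : ?S ==> norm z <= B" using finite_imp_bounded[OF finS] unfolding bounded_iff by blast
    show ?thesis unfolding eventually_at_infinity by (rule exI[of _ "B + 1"]) (use B in force)
   qed
   ultimately have "\<forall>\<^sub>F \<mu> in at_infinity. \<mu> ~: ?S & R q \<mu> ~= 0"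
    using big small
   proof eventually_elim
    case (elim \<mu>)
    have \<mu>0: "\<mu> ~= 0" using elim by auto
    have "poly ([:- exp \<b>, 1:] ^ m) \<mu> = (\<mu> - exp \<b>) ^ m" by (simp add: poly_power)
    hence "R q \<mu> = \<mu> ^ lh * (u \<mu> + \<mu>) + g \<mu>"
     using u(2)[OF \<mu>0] unfolding R' g_def laurent_poly_def by (simp add: algebra_simps divide_inverse power_inverse)
    moreover have "1 * 2 <= norm (\<mu> ^ lh) * norm (u \<mu> + \<mu>)"
     using elim by (intro mult_mono) (auto simp: norm_power one_le_power)
    hence "norm (g \<mu>) < norm (\<mu> ^ lh * (u \<mu> + \<mu>))" using elim by (simp add: norm_mult)
    ultimately show ?case using elim(2) by (metis add_eq_0_iff less_irrefl norm_minus_cancel)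
   qed
   then obtain z0 where z0: "z0 ~: ?S" "R q z0 ~= 0"
    using eventually_happens'[OF trivial_limit_at_infinity] by blast
   have "finite {z. z ~: ?S & R q z = 0}" by (rule rational_off_finite_zeros[OF rat z0])
   hence "\<forall>\<^sub>F w in at (exp \<b>). w : - ({z. z ~: ?S & R q z = 0} - {exp \<b>}) - {exp \<b>}"
    by (intro eventually_at_in_open open_Compl finite_imp_closed) auto
   with ev offS[of "exp \<b>"] have "\<forall>\<^sub>F w in at (exp \<b>). False" by eventually_elim auto
   thus False by (simp add: eventually_False)
  qed
  have part1: "l meromorphic_on UNIV & - int m <= zorder l (exp \<b>) &
    (ALL i:{1..m}. (%n. ccoef m (al n) (be n) i) \<longlonglongrightarrow> collision_coeff l \<b> i)"
   if conv: "cconv ?S ?lam l" for l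
  proof -
   have conv': "cconv (insert (exp \<b>) ?O) lam l" using conv unfolding S lam_eq .
   have lim0: "(%n. lam n \<mu>) \<longlonglongrightarrow> l \<mu>" if "\<mu> ~: insert (exp \<b>) ?O" for \<mu>
   proof -
    have "compact {\<mu>}" "{\<mu>} \<inter> insert (exp \<b>) ?O = {}" using that by auto
    hence "uniform_limit {\<mu>} lam l sequentially" using conv' unfolding compactly_convergent_off_def by blast
    thus ?thesis by simp
   qed
   obtain q where q: "degree q < m" "ALL \<mu>. \<mu> ~: insert (exp \<b>) ?O --> l \<mu> = f \<mu> + poly q \<mu> / (\<mu> - exp \<b>) ^ m"
    using cluster_limit_rational[OF lim0] by blast
   have ev: "\<forall>\<^sub>F w in at z. l w = R q w" for z
    using offS[of z] by eventually_elim (insert q(2) S, auto simp: R_def)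
   have "l meromorphic_on UNIV" using meroR[of q] meromorphic_on_cong[OF ev refl] by blast
   moreover have "- int m <= zorder l (exp \<b>)"
   proof -
    have "f analytic_on {exp \<b>}" unfolding analytic_at using fh Oth(2) open_Compl[OF finite_imp_closed[OF Oth(1)]] by blast
    then obtain F where F: "(%x. f (exp \<b> + x)) has_fps_expansion F" using analytic_at_imp_has_fps_expansion by blast
    have "poly q analytic_on {exp \<b>}" by (rule analytic_on_subset[of _ UNIV]) (simp_all add: analytic_on_open holomorphic_intros)
    then obtain Q where Q: "(%x. poly q (exp \<b> + x)) has_fps_expansion Q" using analytic_at_imp_has_fps_expansion by blast
    have "(%x. f (exp \<b> + x) + poly q (exp \<b> + x) / x ^ m) has_laurent_expansion fps_to_fls F + fls_shift (int m) (fps_to_fls Q)"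
     using has_laurent_expansion_add[OF has_laurent_expansion_fps[OF F] has_laurent_expansion_shift[OF has_laurent_expansion_fps[OF Q], of "- int m"]]
     by (simp add: power_int_minus divide_inverse)
    hence L: "(%x. R q (exp \<b> + x)) has_laurent_expansion fps_to_fls F + fls_shift (int m) (fps_to_fls Q)"
     by (simp add: R_def)
    have nz: "fps_to_fls F + fls_shift (int m) (fps_to_fls Q) ~= 0"
    proof
     assume z: "fps_to_fls F + fls_shift (int m) (fps_to_fls Q) = 0"
     have "\<forall>\<^sub>F x in at 0. R q (exp \<b> + x) = 0"
      using L unfolding z has_laurent_expansion_def by (auto elim!: eventually_mono)
     hence "\<forall>\<^sub>F w in at (exp \<b>). R q w = 0" unfolding at_to_0[of "exp \<b>"] eventually_filtermap by (simp add: add.commute)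
     thus False using nonzero[OF q(1)] by blast
    qed
    have "zorder l (exp \<b>) = zorder (R q) (exp \<b>)" by (rule zorder_cong[OF ev refl])
    also have "... = fls_subdegree (fps_to_fls F + fls_shift (int m) (fps_to_fls Q))"
     by (rule has_laurent_expansion_zorder[OF L nz])
    also have "... \<ge> - int m" by (rule fls_subdegree_geI[OF nz]) auto
    finally show ?thesis .
   qed
   moreover have "(%n. ccoef m (al n) (be n) i) \<longlonglongrightarrow> collision_coeff l \<b> i" if "i : {1..m}" for i
    by (rule cluster_coeff_tendsto[OF conv' q(2)[rule_format] that])
   ultimately show ?thesis by blast
  qed
  have part2: "EX e. let lam = (%\<mu>. f \<mu> + (SUM i=1..m. e i / (\<mu> - exp \<b>) ^ i))
          in (ALL i:{1..m}. collision_coeff lam \<b> i = c i) & cconv ?S ?lam lam"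
   if c: "ALL i:{1..m}. (%n. ccoef m (al n) (be n) i) \<longlonglongrightarrow> c i" for c
  proof -
   obtain e where e: "cconv (insert (exp \<b>) ?O) lam (%\<mu>. f \<mu> + (SUM i=1..m. e i / (\<mu> - exp \<b>) ^ i))"
    by (rule cluster_converges[of c]) (use c in auto)
   hence e': "cconv ?S ?lam (%\<mu>. f \<mu> + (SUM i=1..m. e i / (\<mu> - exp \<b>) ^ i))"
    unfolding S lam_eq .
   \<comment> \<open>The coefficients of the limit need no computation: the first direction, applied
     to this limit, says that the cluster coefficients also tend to them.\<close>
   have "collision_coeff (%\<mu>. f \<mu> + (SUM i=1..m. e i / (\<mu> - exp \<b>) ^ i)) \<b> i = c i" if "i : {1..m}" for i
    using part1[OF e'] c that LIMSEQ_unique by blast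
   thus ?thesis using e' unfolding Let_def by blast
  qed
  show ?thesis using part1 part2 by blast
 qed
 thus "let m = pole_order ms \<a>;
      f = fixed_part lh kb ms \<a> A b d;
      others = b ` other_poles ms \<a>;
      S = {0, exp \<b>} \<union> others;
      lam_n = (%n \<mu>. f \<mu> + cluster_function m (al n) (be n) \<mu>)
    in valid_fixed_part lh kb ms \<a> A b d \<b> & colliding m others al be \<b> -->
      (ALL lam. cconv S lam_n lam -->
       lam meromorphic_on UNIV & - int m <= zorder lam (exp \<b>) &
       (ALL i:{1..m}. (%n. ccoef m (al n) (be n) i)
               \<longlonglongrightarrow> collision_coeff lam \<b> i)) &
      (ALL c. (ALL i:{1..m}. (%n. ccoef m (al n) (be n) i) \<longlonglongrightarrow> c i) & c m ~= 0 -->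
       (EX e. let lam = (%\<mu>. f \<mu> + (SUM i=1..m. e i / (\<mu> - exp \<b>) ^ i))
          in (ALL i:{1..m}. collision_coeff lam \<b> i = c i) &
           cconv S lam_n lam))"
  unfolding m_def f_def others_def by (simp only: Let_def) blast
qed

section \<open>Partial fractions depending on parameters\<close>

locale pole_family =
 fixes I :: "'i set" and U :: "('i => complex) set" and K :: "nat set"
  and b :: "nat => ('i => complex) => complex"
 assumes U: "openin (cspace I) U" and K: "finite K"
  and b: "!!\<g>. \<g> : K ==> hol I U (b \<g>)"
  and distinct: "!!w \<g> \<d>. w : U ==> \<g> : K ==> \<d> : K ==> \<g> ~= \<d> ==> b \<g> w ~= b \<d> w"
begin

text \<open>The point is that the coefficients depend holomorphically on the parameters. They are
  produced by algebraic manipulation only, and uniqueness is not part of the notion.\<close>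

definition pfrac :: "nat => (nat => nat) => (('i => complex) => complex => complex) => bool" where
 "pfrac n M F \<longleftrightarrow> (EX A e. (ALL j. hol I U (A j)) & (ALL \<g> i. hol I U (e \<g> i)) &
   (ALL w:U. ALL \<mu>. (ALL \<g>:K. \<mu> ~= b \<g> w) -->
    F w \<mu> = (SUM j<n. A j w * \<mu> ^ j) + (SUM \<g>:K. SUM i=1..M \<g>. e \<g> i w / (\<mu> - b \<g> w) ^ i)))"

lemma pf_add:
 assumes "pfrac n M F" "pfrac n M G"
 shows "pfrac n M (%w \<mu>. F w \<mu> + G w \<mu>)"
proof -
 obtain A e where 1: "ALL j. hol I U (A j)" "ALL \<g> i. hol I U (e \<g> i)"
  "ALL w:U. ALL \<mu>. (ALL \<g>:K. \<mu> ~= b \<g> w) -->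
    F w \<mu> = (SUM j<n. A j w * \<mu> ^ j) + (SUM \<g>:K. SUM i=1..M \<g>. e \<g> i w / (\<mu> - b \<g> w) ^ i)"
  using assms(1) unfolding pfrac_def by blast
 obtain A' e' where 2: "ALL j. hol I U (A' j)" "ALL \<g> i. hol I U (e' \<g> i)"
  "ALL w:U. ALL \<mu>. (ALL \<g>:K. \<mu> ~= b \<g> w) -->
    G w \<mu> = (SUM j<n. A' j w * \<mu> ^ j) + (SUM \<g>:K. SUM i=1..M \<g>. e' \<g> i w / (\<mu> - b \<g> w) ^ i)"
  using assms(2) unfolding pfrac_def by blast
 show ?thesis unfolding pfrac_def
 proof (rule exI[of _ "%j w. A j w + A' j w"], rule exI[of _ "%\<g> i w. e \<g> i w + e' \<g> i w"], intro conjI allI ballI impI)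
  fix w \<mu> assume h: "w : U" "ALL \<g>:K. \<mu> ~= b \<g> w"
  have F: "F w \<mu> = (SUM j<n. A j w * \<mu> ^ j) + (SUM \<g>:K. SUM i=1..M \<g>. e \<g> i w / (\<mu> - b \<g> w) ^ i)"
   using 1(3) h by blast
  have G: "G w \<mu> = (SUM j<n. A' j w * \<mu> ^ j) + (SUM \<g>:K. SUM i=1..M \<g>. e' \<g> i w / (\<mu> - b \<g> w) ^ i)"
   using 2(3) h by blast
  show "F w \<mu> + G w \<mu> = (SUM j<n. (A j w + A' j w) * \<mu> ^ j) +
   (SUM \<g>:K. SUM i=1..M \<g>. (e \<g> i w + e' \<g> i w) / (\<mu> - b \<g> w) ^ i)"
   unfolding F G by (simp add: sum.distrib distrib_right add_divide_distrib)
 qed (insert 1 2, auto intro: hol_add[OF U])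
qed

lemma pf_scale:
 assumes f: "hol I U f" and F: "pfrac n M F"
 shows "pfrac n M (%w \<mu>. f w * F w \<mu>)"
proof -
 obtain A e where 1: "ALL j. hol I U (A j)" "ALL \<g> i. hol I U (e \<g> i)"
  "ALL w:U. ALL \<mu>. (ALL \<g>:K. \<mu> ~= b \<g> w) -->
    F w \<mu> = (SUM j<n. A j w * \<mu> ^ j) + (SUM \<g>:K. SUM i=1..M \<g>. e \<g> i w / (\<mu> - b \<g> w) ^ i)"
  using F unfolding pfrac_def by blast
 show ?thesis unfolding pfrac_def
 proof (rule exI[of _ "%j w. f w * A j w"], rule exI[of _ "%\<g> i w. f w * e \<g> i w"], intro conjI allI ballI impI)
  fix w \<mu> assume "w : U" "ALL \<g>:K. \<mu> ~= b \<g> w"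
  hence F: "F w \<mu> = (SUM j<n. A j w * \<mu> ^ j) + (SUM \<g>:K. SUM i=1..M \<g>. e \<g> i w / (\<mu> - b \<g> w) ^ i)"
   using 1(3) by blast
  show "f w * F w \<mu> = (SUM j<n. f w * A j w * \<mu> ^ j) + (SUM \<g>:K. SUM i=1..M \<g>. f w * e \<g> i w / (\<mu> - b \<g> w) ^ i)"
   unfolding F by (simp add: distrib_left sum_distrib_left mult.assoc)
 qed (insert 1 f, auto intro: hol_mult[OF U])
qed

lemma pf_cong:
 assumes "pfrac n M F" "!!w \<mu>. w : U ==> (!!\<g>. \<g> : K ==> \<mu> ~= b \<g> w) ==> G w \<mu> = F w \<mu>"
 shows "pfrac n M G"
proof -
 obtain A e where 1: "ALL j. hol I U (A j)" "ALL \<g> i. hol I U (e \<g> i)"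
  "ALL w:U. ALL \<mu>. (ALL \<g>:K. \<mu> ~= b \<g> w) -->
    F w \<mu> = (SUM j<n. A j w * \<mu> ^ j) + (SUM \<g>:K. SUM i=1..M \<g>. e \<g> i w / (\<mu> - b \<g> w) ^ i)"
  using assms(1) unfolding pfrac_def by blast
 show ?thesis unfolding pfrac_def
  by (rule exI[of _ A], rule exI[of _ e]) (use 1 assms(2) in simp)
qed

lemma pf_monomial:
 assumes "j < n" shows "pfrac n M (%w \<mu>. \<mu> ^ j)"
 unfolding pfrac_def
 by (rule exI[of _ "%i w. if i = j then 1 else 0"], rule exI[of _ "%\<g> i w. 0"])
  (insert assms, simp add: hol_const[OF U] mult_delta_left)

lemma pf_pole:
 assumes "\<d> : K" "1 <= k" "k <= M \<d>" shows "pfrac n M (%w \<mu>. 1 / (\<mu> - b \<d> w) ^ k)"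
 unfolding pfrac_def
proof (rule exI[of _ "%i w. 0"], rule exI[of _ "%\<g> i w. if \<g> = \<d> & i = k then 1 else 0"], intro conjI allI ballI impI)
 fix w \<mu>
 have "(SUM \<g>:K. SUM i=1..M \<g>. (if \<g> = \<d> & i = k then 1 else 0) / (\<mu> - b \<g> w) ^ i) =
  (SUM \<g>:K. if \<g> = \<d> then SUM i=1..M \<g>. if i = k then 1 / (\<mu> - b \<g> w) ^ i else 0 else 0)"
 proof (intro sum.cong refl)
  fix \<g>
  have e: "(if P then 1 else 0) / z = (if P then 1 / z else 0)" for P and z :: complex by simp
  show "(SUM i=1..M \<g>. (if \<g> = \<d> & i = k then 1 else 0) / (\<mu> - b \<g> w) ^ i) =
   (if \<g> = \<d> then SUM i=1..M \<g>. if i = k then 1 / (\<mu> - b \<g> w) ^ i else 0 else 0)"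
   unfolding e by (cases "\<g> = \<d>") simp_all
 qed
 also have "... = (SUM i=1..M \<d>. if i = k then 1 / (\<mu> - b \<d> w) ^ i else 0)"
  using sum.delta[OF K, of \<d> "%\<g>. SUM i=1..M \<g>. if i = k then 1 / (\<mu> - b \<g> w) ^ i else 0"] assms
  by (simp only: if_True)
 also have "... = 1 / (\<mu> - b \<d> w) ^ k" 
  using sum.delta[of "{1..M \<d>}" k "%i. 1 / (\<mu> - b \<d> w) ^ i"] assms
  by (simp only: finite_atLeastAtMost atLeastAtMost_iff simp_thms if_True)
 finally show "1 / (\<mu> - b \<d> w) ^ k = (SUM j<n. 0 * \<mu> ^ j) +
   (SUM \<g>:K. SUM i=1..M \<g>. (if \<g> = \<d> & i = k then 1 else 0) / (\<mu> - b \<g> w) ^ i)" by simp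
next
 fix \<g> i show "hol I U (%w. if \<g> = \<d> & i = k then 1 else 0)"
  by (cases "\<g> = \<d> & i = k") (simp_all only: simp_thms if_True if_False hol_const[OF U])
qed (rule hol_const[OF U])

lemma pf_zero: "pfrac n M (%w \<mu>. 0)"
 unfolding pfrac_def
 by (rule exI[of _ "%i w. 0"], rule exI[of _ "%\<g> i w. 0"]) (simp add: hol_const[OF U])

lemma pf_sum:
 "(!!a. a : S ==> pfrac n M (F a)) ==> pfrac n M (%w \<mu>. SUM a:S. F a w \<mu>)"
 by (induction S rule: infinite_finite_induct) (simp_all add: pf_add pf_zero)

lemma pf_monomial_divide:
 assumes "\<g> : K" "1 <= M \<g>" "j <= n"
 shows "pfrac n M (%w \<mu>. \<mu> ^ j / (\<mu> - b \<g> w))"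
 using assms(3)
proof (induction j)
 case 0
 show ?case using pf_pole[of \<g> 1 M n] assms by simp
next
 case (Suc j)
 have "pfrac n M (%w \<mu>. \<mu> ^ j + b \<g> w * (\<mu> ^ j / (\<mu> - b \<g> w)))"
  by (intro pf_add pf_scale pf_monomial b Suc.IH) (use Suc assms in auto)
 thus ?case
 proof (rule pf_cong)
  fix w \<mu> assume "!!\<g>. \<g> : K ==> \<mu> ~= b \<g> w"
  hence "\<mu> - b \<g> w ~= 0" using assms by auto
  thus "\<mu> ^ Suc j / (\<mu> - b \<g> w) = \<mu> ^ j + b \<g> w * (\<mu> ^ j / (\<mu> - b \<g> w))"
   by (simp add: field_simps)
 qed
qed

text \<open>For distinct poles \<open>1/(x y) = (1/x - 1/y) / (y - x)\<close> lowers the order step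
  by step. The difference of the poles is invertible on all of \<open>U\<close>, so holomorphy of
  the coefficients is kept.\<close>

lemma pf_pole_divide:
 assumes "\<g> : K" "\<d> : K" "1 <= M \<g>" "i <= M \<d>" "\<g> = \<d> ==> i < M \<d>"
 shows "pfrac n M (%w \<mu>. 1 / (\<mu> - b \<d> w) ^ i / (\<mu> - b \<g> w))"
proof (cases "\<g> = \<d>")
 case True
 thus ?thesis using pf_pole[of \<d> "Suc i" M n] assms by (simp add: mult.commute)
next
 case False
 show ?thesis using assms(4)
 proof (induction i)
  case 0
  show ?case using pf_pole[of \<g> 1 M n] assms by simp
 next
  case (Suc i)
  have "pfrac n M (%w \<mu>. inverse (b \<d> w - b \<g> w) * (1 / (\<mu> - b \<d> w) ^ Suc i + (- 1) * (1 / (\<mu> - b \<d> w) ^ i / (\<mu> - b \<g> w))))"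
   by (intro pf_add pf_scale pf_pole hol_inverse[OF U] hol_diff[OF U] hol_const[OF U] b Suc.IH)
    (use Suc assms False distinct in auto)
  thus ?case
  proof (rule pf_cong)
   fix w \<mu> assume "w : U" "!!\<g>. \<g> : K ==> \<mu> ~= b \<g> w"
   hence nz: "\<mu> - b \<g> w ~= 0" "\<mu> - b \<d> w ~= 0" "b \<d> w - b \<g> w ~= 0"
    using assms False distinct by auto
   have "1 / (x ^ i * x) / y = inverse (y - x) * (1 / (x ^ i * x) + (- 1) * (1 / x ^ i / y))"
    if "x ~= 0" "y ~= 0" "y - x ~= 0" for x y :: complex
    using that by (simp add: divide_simps)
   from this[of "\<mu> - b \<d> w" "\<mu> - b \<g> w"] nz
   show "1 / (\<mu> - b \<d> w) ^ Suc i / (\<mu> - b \<g> w) =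
    inverse (b \<d> w - b \<g> w) * (1 / (\<mu> - b \<d> w) ^ Suc i + (- 1) * (1 / (\<mu> - b \<d> w) ^ i / (\<mu> - b \<g> w)))"
    by (simp add: mult.commute)
  qed
 qed
qed

lemma pf_divide:
 assumes F: "pfrac n M F" and n: "n <= Suc n'" and \<g>: "\<g> : K"
 shows "pfrac n' (M(\<g> := Suc (M \<g>))) (%w \<mu>. F w \<mu> / (\<mu> - b \<g> w))"
proof -
 let ?M = "M(\<g> := Suc (M \<g>))"
 obtain A e where 1: "ALL j. hol I U (A j)" "ALL \<g> i. hol I U (e \<g> i)"
  "ALL w:U. ALL \<mu>. (ALL \<g>:K. \<mu> ~= b \<g> w) -->
    F w \<mu> = (SUM j<n. A j w * \<mu> ^ j) + (SUM \<g>:K. SUM i=1..M \<g>. e \<g> i w / (\<mu> - b \<g> w) ^ i)"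
  using F unfolding pfrac_def by blast
 have "pfrac n' ?M (%w \<mu>. (SUM j<n. A j w * (\<mu> ^ j / (\<mu> - b \<g> w))) +
  (SUM \<d>:K. SUM i=1..M \<d>. e \<d> i w * (1 / (\<mu> - b \<d> w) ^ i / (\<mu> - b \<g> w))))"
  by (intro pf_add pf_sum pf_scale pf_monomial_divide pf_pole_divide 1(1)[rule_format] 1(2)[rule_format])
   (use n \<g> in auto)
 thus ?thesis
 proof (rule pf_cong)
  fix w \<mu> assume "w : U" "!!\<g>. \<g> : K ==> \<mu> ~= b \<g> w"
  hence F: "F w \<mu> = (SUM j<n. A j w * \<mu> ^ j) + (SUM \<g>:K. SUM i=1..M \<g>. e \<g> i w / (\<mu> - b \<g> w) ^ i)"
   using 1(3) by blast
  show "F w \<mu> / (\<mu> - b \<g> w) = (SUM j<n. A j w * (\<mu> ^ j / (\<mu> - b \<g> w))) +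
   (SUM \<d>:K. SUM i=1..M \<d>. e \<d> i w * (1 / (\<mu> - b \<d> w) ^ i / (\<mu> - b \<g> w)))"
   unfolding F by (simp add: add_divide_distrib sum_divide_distrib)
 qed
qed

text \<open>Induction on the total pole order, dividing by one linear factor at a time. The leading
  term is kept apart because in the application it becomes the monomial with coefficient 1 after
  rescaling.\<close>

lemma pf_quotient:
 assumes a: "!!j. hol I U (a j)" and s: "(SUM \<g>:K. M \<g>) + n' = n"
 shows "pfrac n' M (%w \<mu>. (SUM j<=n. a j w * \<mu> ^ j) / (PROD \<g>:K. (\<mu> - b \<g> w) ^ M \<g>) - a n w * \<mu> ^ n')"
 using s
proof (induction "SUM \<g>:K. M \<g>" arbitrary: M n')
 case 0
 hence M: "M \<g> = 0" if "\<g> : K" for \<g> using K that by simp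
 have n: "n' = n" using 0 by simp
 have "pfrac n' M (%w \<mu>. SUM j<n. a j w * \<mu> ^ j)"
  by (intro pf_sum pf_scale pf_monomial a) (simp add: n)
 thus ?case by (rule pf_cong) (simp add: M n lessThan_Suc_atMost[symmetric])
next
 case (Suc s)
 then obtain \<g> where \<g>: "\<g> : K" "M \<g> ~= 0" by (metis nat.simps(3) sum.neutral)
 define M' where "M' = M(\<g> := M \<g> - 1)"
 have M: "M = M'(\<g> := Suc (M' \<g>))" using \<g> by (simp add: M'_def fun_eq_iff)
 have "(SUM \<d>:K. M \<d>) = M \<g> + (SUM \<d>:K-{\<g>}. M \<d>)" "(SUM \<d>:K. M' \<d>) = M' \<g> + (SUM \<d>:K-{\<g>}. M' \<d>)"
  using \<g> K by (simp_all add: sum.remove)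
 moreover have "(SUM \<d>:K-{\<g>}. M' \<d>) = (SUM \<d>:K-{\<g>}. M \<d>)" by (intro sum.cong) (auto simp: M'_def)
 ultimately have s: "(SUM \<d>:K. M' \<d>) = s" using Suc.hyps(2) \<g> by (simp add: M'_def)
 have IH: "pfrac (Suc n') M' (%w \<mu>. (SUM j<=n. a j w * \<mu> ^ j) / (PROD \<g>:K. (\<mu> - b \<g> w) ^ M' \<g>) - a n w * \<mu> ^ Suc n')"
  by (rule Suc.hyps(1)) (use s Suc.hyps(2) Suc.prems in auto)
 \<comment> \<open>The last summand corrects the leading term:
   \<open>\<mu>^(n'+1) / (\<mu> - b)\<close> equals
   \<open>\<mu>^n' + b \<mu>^n' / (\<mu> - b)\<close>.\<close>
 have d: "pfrac n' M (%w \<mu>. ((SUM j<=n. a j w * \<mu> ^ j) / (PROD \<g>:K. (\<mu> - b \<g> w) ^ M' \<g>) - a n w * \<mu> ^ Suc n') / (\<mu> - b \<g> w)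
   + (a n w * b \<g> w) * (\<mu> ^ n' / (\<mu> - b \<g> w)))"
  by (intro pf_add pf_scale hol_mult[OF U] a b \<g> pf_monomial_divide pf_divide[OF IH _ \<g>(1), of n', folded M]) (use \<g> in auto)
 show ?case
 proof (rule pf_cong[OF d])
  fix w \<mu> assume "w : U" "!!\<g>. \<g> : K ==> \<mu> ~= b \<g> w"
  hence nz: "\<mu> - b \<g> w ~= 0" using \<g> by auto
  have "(PROD \<d>:K. (\<mu> - b \<d> w) ^ M \<d>) = (\<mu> - b \<g> w) ^ M \<g> * (PROD \<d>:K-{\<g>}. (\<mu> - b \<d> w) ^ M \<d>)"
   using \<g> K by (simp add: prod.remove)
  also have "(PROD \<d>:K-{\<g>}. (\<mu> - b \<d> w) ^ M \<d>) = (PROD \<d>:K-{\<g>}. (\<mu> - b \<d> w) ^ M' \<d>)"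
   by (intro prod.cong) (auto simp: M'_def)
  also have "(\<mu> - b \<g> w) ^ M \<g> * ... = (\<mu> - b \<g> w) * ((\<mu> - b \<g> w) ^ M' \<g> * ...)"
   using \<g> by (simp add: M'_def flip: power_Suc)
  also have "(\<mu> - b \<g> w) ^ M' \<g> * (PROD \<d>:K-{\<g>}. (\<mu> - b \<d> w) ^ M' \<d>) = (PROD \<d>:K. (\<mu> - b \<d> w) ^ M' \<d>)"
   using \<g> K by (simp add: prod.remove)
  finally have P: "(PROD \<d>:K. (\<mu> - b \<d> w) ^ M \<d>) = (\<mu> - b \<g> w) * (PROD \<d>:K. (\<mu> - b \<d> w) ^ M' \<d>)" .
  have "x / (y * z) - c * q = (x / z - c * (\<mu> * q)) / y + c * b \<g> w * (q / y)" if "y = \<mu> - b \<g> w" "y ~= 0" for x y z c q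
  proof -
   have \<mu>: "\<mu> = y + b \<g> w" using that by simp
   have "c * q = c * (\<mu> * q) / y - c * b \<g> w * (q / y)" using that(2) unfolding \<mu> by (simp add: field_simps)
   thus ?thesis by (simp add: diff_divide_distrib)
  qed
  from this[OF refl nz] show "(SUM j<=n. a j w * \<mu> ^ j) / (PROD \<g>:K. (\<mu> - b \<g> w) ^ M \<g>) - a n w * \<mu> ^ n' =
   ((SUM j<=n. a j w * \<mu> ^ j) / (PROD \<g>:K. (\<mu> - b \<g> w) ^ M' \<g>) - a n w * \<mu> ^ Suc n') / (\<mu> - b \<g> w)
   + (a n w * b \<g> w) * (\<mu> ^ n' / (\<mu> - b \<g> w))"
   unfolding P power_Suc .
 qed
qed

end

section \<open>The numerator of a superpotential\<close>

text \<open>The normal form multiplied by its denominator, written without divisions so that its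
  coefficients are polynomial in the data. It carries the step from the coordinates back to the
  parameters.\<close>

definition numer_poly :: "nat => nat => nat => (nat => nat) => (int => complex) => (nat => complex) =>
  (nat => nat => complex) => complex poly" where
 "numer_poly lh kb L m A b ep =
   (PROD \<a>=1..L. [:- b \<a>, 1:] ^ m \<a>) *
    (monom 1 (lh + 1 + kb) + (SUM i:dz_ix lh kb. monom (A i) (nat (i + int kb)))) +
   monom 1 kb * (SUM \<a>=1..L. (SUM i=1..m \<a>. smult (ep \<a> i * b \<a> ^ i) ([:- b \<a>, 1:] ^ (m \<a> - i))) *
    (PROD \<g>:{1..L}-{\<a>}. [:- b \<g>, 1:] ^ m \<g>))"

lemma numer_poly_eval:
 assumes "\<nu> ~= 0" "!!\<a>. \<a> : {1..L} ==> b \<a> ~= 0 & \<nu> ~= b \<a>"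
 shows "poly (numer_poly lh kb L m A b ep) \<nu> = \<nu> ^ kb * (PROD \<a>=1..L. (\<nu> - b \<a>) ^ m \<a>) *
  (dzs lh kb A \<nu> + (SUM \<a>=1..L. lprin (m \<a>) (ep \<a>) (b \<a>) \<nu>))"
proof -
 let ?P = "PROD \<a>=1..L. (\<nu> - b \<a>) ^ m \<a>"
 have 1: "poly (monom 1 (lh + 1 + kb) + (SUM i:dz_ix lh kb. monom (A i) (nat (i + int kb)))) \<nu> =
  \<nu> ^ kb * dzs lh kb A \<nu>"
 proof -
  have "\<nu> ^ nat (i + int kb) = \<nu> ^ kb * \<nu> powi i" if "i : dz_ix lh kb" for i
  proof -
   have "\<nu> ^ nat (i + int kb) = \<nu> powi (i + int kb)" using that by (simp add: dz_index_def power_int_def)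
   thus ?thesis using assms(1) by (simp add: power_int_add)
  qed
  thus ?thesis
   by (simp add: dz_superpotential_def poly_sum poly_monom distrib_left sum_distrib_left power_add ac_simps)
 qed
 have 2: "(SUM i=1..m \<a>. ep \<a> i * b \<a> ^ i * (\<nu> - b \<a>) ^ (m \<a> - i)) * (PROD \<g>:{1..L}-{\<a>}. (\<nu> - b \<g>) ^ m \<g>) =
   ?P * lprin (m \<a>) (ep \<a>) (b \<a>) \<nu>" if \<a>: "\<a> : {1..L}" for \<a>
 proof -
  have nz: "b \<a> ~= 0" "\<nu> - b \<a> ~= 0" using assms(2)[OF \<a>] by auto
  have "ep \<a> i * b \<a> ^ i * (\<nu> - b \<a>) ^ (m \<a> - i) = (\<nu> - b \<a>) ^ m \<a> * (ep \<a> i / (\<nu> / b \<a> - 1) ^ i)" if "i : {1..m \<a>}" for i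
  proof -
   have "\<nu> / b \<a> - 1 = (\<nu> - b \<a>) / b \<a>" using nz by (simp add: diff_divide_distrib)
   moreover have "(\<nu> - b \<a>) ^ m \<a> = (\<nu> - b \<a>) ^ (m \<a> - i) * (\<nu> - b \<a>) ^ i" using that by (simp flip: power_add)
   ultimately show ?thesis using nz by (simp add: power_divide)
  qed
  hence "(SUM i=1..m \<a>. ep \<a> i * b \<a> ^ i * (\<nu> - b \<a>) ^ (m \<a> - i)) = (\<nu> - b \<a>) ^ m \<a> * lprin (m \<a>) (ep \<a>) (b \<a>) \<nu>"
   by (simp add: lprin_def sum_distrib_left)
  moreover have "?P = (\<nu> - b \<a>) ^ m \<a> * (PROD \<g>:{1..L}-{\<a>}. (\<nu> - b \<g>) ^ m \<g>)"
   using \<a> by (intro prod.remove) auto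
  ultimately show ?thesis by simp
 qed
 have lin: "poly [:- c, 1:] \<nu> = \<nu> - c" for c by simp
 have 3: "(SUM \<a>=1..L. (SUM i=1..m \<a>. ep \<a> i * b \<a> ^ i * (\<nu> - b \<a>) ^ (m \<a> - i)) * (PROD \<g>:{1..L}-{\<a>}. (\<nu> - b \<g>) ^ m \<g>)) =
  ?P * (SUM \<a>=1..L. lprin (m \<a>) (ep \<a>) (b \<a>) \<nu>)"
  unfolding sum_distrib_left by (intro sum.cong refl 2)
 show ?thesis
  unfolding numer_poly_def poly_add[of "_ * _"] poly_mult 1
  unfolding poly_sum poly_mult poly_prod poly_power poly_smult lin 3 poly_monom
  by (simp add: algebra_simps)
qed

lemma numer_poly_0:
 assumes "1 <= kb"
 shows "poly (numer_poly lh kb L m A b ep) 0 = (PROD \<a>=1..L. (- b \<a>) ^ m \<a>) * A (- int kb)"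
proof -
 have "(SUM i:dz_ix lh kb. poly (monom (A i) (nat (i + int kb))) 0) =
  (SUM i:dz_ix lh kb. if i = - int kb then A i else 0)"
  by (intro sum.cong refl) (auto simp: poly_monom power_0_left dz_index_def)
 also have "... = A (- int kb)" by (simp add: finite_dz_index) (simp add: dz_index_def)
 finally show ?thesis using assms
  by (simp add: numer_poly_def poly_sum poly_prod poly_monom power_0_left)
qed

text \<open>Every other summand contains a positive power of the factor that vanishes at this pole.
  Together with the value at 0, this translates nonvanishing of the top coefficients into
  nonvanishing of the numerator at the poles, and back.\<close>

lemma numer_poly_at_pole:
 assumes "\<a> : {1..L}" "1 <= m \<a>"
 shows "poly (numer_poly lh kb L m A b ep) (b \<a>) =
  b \<a> ^ kb * (ep \<a> (m \<a>) * b \<a> ^ m \<a> * (PROD \<g>:{1..L}-{\<a>}. (b \<a> - b \<g>) ^ m \<g>))"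
proof -
 let ?x = "b \<a>"
 have z: "(PROD \<g>:S. (?x - b \<g>) ^ m \<g>) = 0" if "\<a> : S" "finite S" for S
  using that assms(2) by (intro prod_zero) auto
 have t: "(SUM \<g>=1..L. (SUM i=1..m \<g>. ep \<g> i * b \<g> ^ i * (?x - b \<g>) ^ (m \<g> - i)) * (PROD \<d>:{1..L}-{\<g>}. (?x - b \<d>) ^ m \<d>)) =
   (SUM i=1..m \<a>. ep \<a> i * b \<a> ^ i * (?x - b \<a>) ^ (m \<a> - i)) * (PROD \<d>:{1..L}-{\<a>}. (?x - b \<d>) ^ m \<d>)"
 proof (subst sum.remove[OF _ assms(1)])
  have "(PROD \<d>:{1..L}-{\<g>}. (?x - b \<d>) ^ m \<d>) = 0" if "\<g> : {1..L} - {\<a>}" for \<g>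
   by (rule z) (use that assms(1) in auto)
  hence "(SUM \<g>:{1..L}-{\<a>}. (SUM i=1..m \<g>. ep \<g> i * b \<g> ^ i * (?x - b \<g>) ^ (m \<g> - i)) * (PROD \<d>:{1..L}-{\<g>}. (?x - b \<d>) ^ m \<d>)) = 0"
   by (intro sum.neutral ballI) (simp only: mult_zero_right)
  thus "(SUM i=1..m \<a>. ep \<a> i * b \<a> ^ i * (?x - b \<a>) ^ (m \<a> - i)) * (PROD \<d>:{1..L}-{\<a>}. (?x - b \<d>) ^ m \<d>) +
   (SUM \<g>:{1..L}-{\<a>}. (SUM i=1..m \<g>. ep \<g> i * b \<g> ^ i * (?x - b \<g>) ^ (m \<g> - i)) * (PROD \<d>:{1..L}-{\<g>}. (?x - b \<d>) ^ m \<d>)) =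
   (SUM i=1..m \<a>. ep \<a> i * b \<a> ^ i * (?x - b \<a>) ^ (m \<a> - i)) * (PROD \<d>:{1..L}-{\<a>}. (?x - b \<d>) ^ m \<d>)"
   by (simp only: add_0_right)
 qed simp
 have u: "(SUM i=1..m \<a>. ep \<a> i * b \<a> ^ i * (?x - b \<a>) ^ (m \<a> - i)) = ep \<a> (m \<a>) * b \<a> ^ m \<a>"
 proof -
  have "(SUM i=1..m \<a>. ep \<a> i * b \<a> ^ i * (?x - b \<a>) ^ (m \<a> - i)) = (SUM i=1..m \<a>. if i = m \<a> then ep \<a> i * b \<a> ^ i else 0)"
   by (intro sum.cong refl) (auto simp: power_0_left)
  thus ?thesis using assms(2) by simp
 qed
 have lin: "poly [:- c, 1:] x = x - c" for c x :: complex by simp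
 show ?thesis
  unfolding numer_poly_def poly_add[of "_ * _"] poly_mult
  unfolding poly_sum poly_mult poly_prod poly_power poly_smult lin t u poly_monom z[of "{1..L}", OF assms(1) finite_atLeastAtMost]
  by simp
qed

lemma degree_prod_linear_power:
 fixes b :: "nat => complex"
 assumes "finite S"
 shows "degree (PROD \<g>:S. [:- b \<g>, 1:] ^ m \<g>) = (SUM \<g>:S. m \<g>)" "lead_coeff (PROD \<g>:S. [:- b \<g>, 1:] ^ m \<g>) = 1"
 using assms unfolding lead_coeff_prod lead_coeff_power
 by (simp_all add: degree_prod_eq_sum_degree degree_power_eq)

lemma numer_poly_degree:
 fixes lh kb :: nat
 assumes "!!\<a>. \<a> : {1..L} ==> 1 <= m \<a>"
 defines "l \<equiv> lh + kb + (SUM \<a>=1..L. m \<a>)"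
 shows "degree (numer_poly lh kb L m A b ep) = l + 1" "coeff (numer_poly lh kb L m A b ep) (l + 1) = 1"
proof -
 let ?D = "PROD \<a>=1..L. [:- b \<a>, 1:] ^ m \<a>"
 let ?s = "SUM i:dz_ix lh kb. monom (A i) (nat (i + int kb))"
 let ?q = "%\<a>. (SUM i=1..m \<a>. smult (ep \<a> i * b \<a> ^ i) ([:- b \<a>, 1:] ^ (m \<a> - i))) * (PROD \<g>:{1..L}-{\<a>}. [:- b \<g>, 1:] ^ m \<g>)"
 have D: "degree ?D = (SUM \<a>=1..L. m \<a>)" "lead_coeff ?D = 1" using degree_prod_linear_power[of "{1..L}" b m] by simp_all
 have "degree ?s <= lh + kb"
  by (intro degree_sum_le order.trans[OF degree_monom_le]) (auto simp: dz_index_def finite_dz_index)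
 hence s: "degree ?s < degree (monom (1::complex) (lh + 1 + kb))" by (simp add: degree_monom_eq)
 have M: "degree (monom 1 (lh + 1 + kb) + ?s) = lh + 1 + kb" "lead_coeff (monom 1 (lh + 1 + kb) + ?s) = 1"
  using degree_add_eq_left[OF s] lead_coeff_add_le[OF s] s
  by (simp_all add: degree_monom_eq coeff_eq_0)
 have N1: "degree (?D * (monom 1 (lh + 1 + kb) + ?s)) = l + 1" "lead_coeff (?D * (monom 1 (lh + 1 + kb) + ?s)) = 1"
 proof -
  have p0: "p ~= 0" if "lead_coeff p = 1" for p :: "complex poly" using that by auto
  have nz: "?D ~= 0" "monom 1 (lh + 1 + kb) + ?s ~= 0" by (rule p0, rule D, rule p0, rule M)
  show "degree (?D * (monom 1 (lh + 1 + kb) + ?s)) = l + 1"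
   using degree_mult_eq[OF nz] D(1) M(1) by (simp add: l_def)
  show "lead_coeff (?D * (monom 1 (lh + 1 + kb) + ?s)) = 1" unfolding lead_coeff_mult D(2) M(2) by simp
 qed
 have q: "degree (?q \<a>) <= (SUM \<a>=1..L. m \<a>)" if \<a>: "\<a> : {1..L}" for \<a>
 proof -
  have "degree (SUM i=1..m \<a>. smult (ep \<a> i * b \<a> ^ i) ([:- b \<a>, 1:] ^ (m \<a> - i))) <= m \<a>"
   by (intro degree_sum_le order.trans[OF degree_smult_le]) (auto simp: degree_power_eq)
  moreover have "degree (PROD \<g>:{1..L}-{\<a>}. [:- b \<g>, 1:] ^ m \<g>) = (SUM \<g>:{1..L}-{\<a>}. m \<g>)"
   by (rule degree_prod_linear_power) simp
  ultimately have "degree (?q \<a>) <= m \<a> + (SUM \<g>:{1..L}-{\<a>}. m \<g>)"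
   using degree_mult_le[of "SUM i=1..m \<a>. smult (ep \<a> i * b \<a> ^ i) ([:- b \<a>, 1:] ^ (m \<a> - i))" "PROD \<g>:{1..L}-{\<a>}. [:- b \<g>, 1:] ^ m \<g>"] by linarith
  thus ?thesis using sum.remove[OF _ \<a>, of m] by simp
 qed
 have "degree (monom 1 kb * (SUM \<a>=1..L. ?q \<a>)) <= kb + (SUM \<a>=1..L. m \<a>)"
  by (intro order.trans[OF degree_mult_le] add_mono degree_monom_le degree_sum_le q) auto
 hence N2: "degree (monom 1 kb * (SUM \<a>=1..L. ?q \<a>)) < degree (?D * (monom 1 (lh + 1 + kb) + ?s))"
  unfolding N1 l_def by simp
 show deg: "degree (numer_poly lh kb L m A b ep) = l + 1"
  unfolding numer_poly_def degree_add_eq_left[OF N2] by (rule N1)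
 show "coeff (numer_poly lh kb L m A b ep) (l + 1) = 1"
  unfolding numer_poly_def coeff_add using N1 N2 by (simp add: coeff_eq_0)
qed

lemma poly_eqI_off_finite:
 fixes p q :: "complex poly"
 assumes "finite S" "!!x. x ~: S ==> poly p x = poly q x"
 shows "p = q"
proof (rule ccontr)
 assume "p ~= q"
 hence "finite {x. poly (p - q) x = 0}" by (intro poly_roots_finite) simp
 moreover have "- S <= {x. poly (p - q) x = 0}" using assms(2) by auto
 ultimately have "finite (- S)" by (rule finite_subset[rotated])
 thus False using assms(1) infinite_UNIV_char_0 by (metis Compl_partition finite_UnI)
qed

section \<open>Polynomials whose coefficients depend holomorphically on parameters\<close>

definition hol_poly :: "'i set => ('i => complex) set => (('i => complex) => complex poly) => bool" where
 "hol_poly I U p \<longleftrightarrow> (ALL n. hol I U (%w. coeff (p w) n))"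

context
 fixes I :: "'i set" and U :: "('i => complex) set"
 assumes U: "openin (cspace I) U"
begin

lemma hol_poly_const: "hol_poly I U (%_. q)"
 by (simp add: hol_poly_def hol_const[OF U])

lemma hol_poly_add: "hol_poly I U p ==> hol_poly I U q ==> hol_poly I U (%w. p w + q w)"
 by (simp add: hol_poly_def hol_add[OF U])

lemma hol_poly_mult: "hol_poly I U p ==> hol_poly I U q ==> hol_poly I U (%w. p w * q w)"
 unfolding hol_poly_def coeff_mult by (auto intro!: hol_sum[OF U] hol_mult[OF U])

lemma hol_poly_smult: "hol I U f ==> hol_poly I U q ==> hol_poly I U (%w. smult (f w) (q w))"
 by (simp add: hol_poly_def hol_mult[OF U])

lemma hol_poly_sum: "(!!a. a : S ==> hol_poly I U (p a)) ==> hol_poly I U (%w. SUM a:S. p a w)"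
 by (induction S rule: infinite_finite_induct) (simp_all add: hol_poly_const hol_poly_add)

lemma hol_poly_prod: "(!!a. a : S ==> hol_poly I U (p a)) ==> hol_poly I U (%w. PROD a:S. p a w)"
 by (induction S rule: infinite_finite_induct) (simp_all add: hol_poly_const hol_poly_mult)

lemma hol_poly_power: "hol_poly I U p ==> hol_poly I U (%w. p w ^ n)"
 by (induction n) (simp_all add: hol_poly_const hol_poly_mult)

lemma hol_poly_linear:
 assumes "hol I U f" shows "hol_poly I U (%w. [:- f w, 1:])"
 unfolding hol_poly_def
proof
 fix n show "hol I U (%w. coeff [:- f w, 1:] n)"
  by (cases n) (simp_all add: hol_const[OF U] hol_minus[OF U] assms)
qed

lemma hol_poly_monom:
 assumes "hol I U f" shows "hol_poly I U (%w. monom (f w) k)"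
 unfolding hol_poly_def
proof
 fix n show "hol I U (%w. coeff (monom (f w) k) n)"
  by (cases "n = k") (simp_all add: hol_const[OF U] assms)
qed

lemma hol_numer_poly:
 assumes "!!i. i : dz_ix lh kb ==> hol I U (A i)"
  "!!\<a>. \<a> : {1..L} ==> hol I U (b \<a>)"
  "!!\<a> i. \<a> : {1..L} ==> i : {1..m \<a>} ==> hol I U (ep \<a> i)"
 shows "hol_poly I U (%w. numer_poly lh kb L m (%i. A i w) (%\<a>. b \<a> w) (%\<a> i. ep \<a> i w))"
 unfolding numer_poly_def
 by (intro hol_poly_add hol_poly_mult hol_poly_smult hol_poly_sum hol_poly_prod hol_poly_power hol_poly_const
   hol_poly_linear hol_poly_monom hol_mult[OF U] hol_power[OF U] assms) auto

end

section \<open>Normal forms of superpotentials\<close>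

text \<open>Equality is demanded only off the poles, where total division has its intended
  meaning.\<close>

definition normal_form :: "nat => nat => nat list => (int => complex) => complex => (int => complex) =>
  (nat => nat => complex) => bool" where
 "normal_form lh kb ms w a A ep \<longleftrightarrow>
   (ALL \<mu>. \<mu> ~= 0 --> (ALL \<a>:{1..length ms}. \<mu> ~= mpole w a \<a>) -->
    nsp lh kb ms w a \<mu> = dzs lh kb A \<mu> +
     (SUM \<a>=1..length ms. lprin (pole_order ms \<a>) (ep \<a>) (mpole w a \<a>) \<mu>))"

definition Q_coeff :: "nat => (int => complex) => nat => complex" where
 "Q_coeff l w j = (if j = 0 then 1 else if j = l + 1 then (- 1) ^ (l + 1) else (- 1) ^ j * w (int j))"

lemma Q_poly_coeff: "Q_poly l w \<mu> = (SUM j<=l+1. Q_coeff l w j * \<mu> ^ j)"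
proof -
 have "(SUM j<=l. g j) = g 0 + (SUM j=1..l. g j)" for g :: "nat => complex"
  by (simp add: atMost_atLeast0 sum.atLeast_Suc_atMost)
 hence "(SUM j<=l+1. Q_coeff l w j * \<mu> ^ j) = Q_coeff l w 0 * \<mu> ^ 0 + (SUM j=1..l. Q_coeff l w j * \<mu> ^ j) + Q_coeff l w (l + 1) * \<mu> ^ (l + 1)"
  by simp
 also have "(SUM j=1..l. Q_coeff l w j * \<mu> ^ j) = (SUM j=1..l. (- 1) ^ j * w (int j) * \<mu> ^ j)"
  by (intro sum.cong) (auto simp: Q_coeff_def)
 finally show ?thesis by (simp add: Q_poly_def Q_coeff_def)
qed

lemma dz_superpotential_split:
 assumes "\<mu> ~= 0"
 shows "dzs lh kb A \<mu> =
  \<mu> ^ (lh + 1) + (SUM j<lh + 1. A (int j) * \<mu> ^ j) + (SUM i=1..kb. A (- int i) / \<mu> ^ i)"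
proof -
 have "dz_ix lh kb = int ` {..<lh + 1} \<union> (%i. - int i) ` {1..kb}"
 proof (intro set_eqI iffI)
  fix i assume i: "i : dz_ix lh kb"
  show "i : int ` {..<lh + 1} \<union> (%i. - int i) ` {1..kb}"
  proof (cases "i \<ge> 0")
   case True
   hence "i = int (nat i)" "nat i : {..<lh + 1}" using i by (auto simp: dz_index_def)
   thus ?thesis by blast
  next
   case False
   hence "i = - int (nat (- i))" "nat (- i) : {1..kb}" using i by (auto simp: dz_index_def)
   thus ?thesis by blast
  qed
 qed (auto simp: dz_index_def)
 hence "(SUM i:dz_ix lh kb. A i * \<mu> powi i) = (SUM i:int ` {..<lh + 1}. A i * \<mu> powi i) + (SUM i:(%i. - int i) ` {1..kb}. A i * \<mu> powi i)"
  by (simp only:, intro sum.union_disjoint) auto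
 also have "(SUM i:int ` {..<lh + 1}. A i * \<mu> powi i) = (SUM j<lh + 1. A (int j) * \<mu> ^ j)"
  by (subst sum.reindex) (auto simp: inj_on_def)
 also have "(SUM i:(%i. - int i) ` {1..kb}. A i * \<mu> powi i) = (SUM i=1..kb. A (- int i) / \<mu> ^ i)"
  by (subst sum.reindex) (auto simp: inj_on_def power_int_minus divide_inverse)
 finally show ?thesis by (simp add: dz_superpotential_def)
qed

section \<open>Superpotentials with given pole orders: normal form and its inversion\<close>

locale model =
 fixes lh kb p :: nat and ms :: "nat list"
 assumes kb: "1 <= kb" and ms: "partition_of p ms"
begin

abbreviation "L \<equiv> length ms"
abbreviation "m \<equiv> pole_order ms"
abbreviation "l \<equiv> total_degree lh kb ms"
abbreviation "I \<equiv> par_ix lh kb ms"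
abbreviation "W \<equiv> parameters lh kb ms"

lemma m1: "\<a> : {1..L} ==> 1 <= m \<a>"
proof -
 assume "\<a> : {1..L}"
 hence "ms ! (\<a> - 1) : set ms" by (intro nth_mem) auto
 thus "1 <= m \<a>" using ms by (auto simp: pole_order_def partition_of_def Suc_le_eq)
qed

lemma sum_m: "(SUM \<a>=1..L. m \<a>) = p"
proof -
 have "(SUM \<a>:{Suc 0..<Suc L}. m \<a>) = (SUM i=0..<L. ms ! i)"
  unfolding sum.atLeast_Suc_lessThan_Suc_shift by (simp add: pole_order_def)
 thus ?thesis using ms by (simp add: partition_of_def sum_list_sum_nth atLeastLessThanSuc_atLeastAtMost)
qed

lemma l_eq: "l = lh + kb + p"
 using ms by (simp add: total_degree_def partition_of_def)

lemma finI: "finite I" by (simp add: parameter_index_def)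

text \<open>All conditions on the parameters amount to the nonvanishing of one product of
  holomorphic functions.\<close>

lemma open_parameters: "openin (cspace I) W"
proof -
 let ?g = "%w. w 0 * (PROD \<a>=1..L. w (- int \<a>) * Q_poly l w (w (- int \<a>))) *
   (PROD \<a>=1..L. PROD \<g>:{1..L}-{\<a>}. w (- int \<a>) - w (- int \<g>))"
 have U: "openin (cspace I) (extensional I)" by (simp add: cspace_eq)
 have "hol I (extensional I) ?g"
  unfolding Q_poly_def by (intro hol_intros[OF U])
 hence "openin (cspace I) {w : extensional I. ?g w : - {0}}"
  by (intro openin_cspace_vimage U hol_continuous[OF U]) auto
 also have "{w : extensional I. ?g w : - {0}} = W"
 proof -
  have "inj_on (%\<a>. w (- int \<a>)) {1..L} \<longleftrightarrow> (ALL \<a>:{1..L}. ALL \<g>:{1..L}-{\<a>}. w (- int \<a>) - w (- int \<g>) ~= 0)" for w :: "int => complex"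
   by (auto simp: inj_on_def)
  thus ?thesis by (simp add: parameters_def conj_commute conj_left_commute)
 qed
 finally show ?thesis .
qed

lemma leading_coeff_nonzero: "w : W ==> lcoef lh kb ms w ~= 0"
 by (simp add: leading_coeff_def parameters_def)

lemma scale_nonzero: "w : W ==> a ^ (lh + 1) = lcoef lh kb ms w ==> a ~= 0"
 using leading_coeff_nonzero by force

lemma movable_pole_distinct:
 assumes "w : W" "a ~= 0" "\<a> : {1..L}" "\<g> : {1..L}" "\<a> ~= \<g>"
 shows "mpole w a \<a> ~= mpole w a \<g>"
 using assms inj_onD[of "%\<a>. w (- int \<a>)" "{1..L}" \<a> \<g>] by (auto simp: movable_pole_def parameters_def)

lemma movable_pole_nonzero: "w : W ==> a ~= 0 ==> \<a> : {1..L} ==> mpole w a \<a> ~= 0"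
 by (auto simp: movable_pole_def parameters_def)

lemma scaled_denominator:
 assumes "a ~= 0"
 shows "\<mu> ^ kb * (PROD \<a>=1..L. (\<mu> - mpole w a \<a>) ^ m \<a>) =
  a ^ (kb + p) * ((\<mu> / a) ^ kb * (PROD \<a>=1..L. (\<mu> / a - w (- int \<a>)) ^ m \<a>))"
proof -
 have "(\<mu> - mpole w a \<a>) ^ m \<a> = a ^ m \<a> * (\<mu> / a - w (- int \<a>)) ^ m \<a>" for \<a>
 proof -
  have "\<mu> - mpole w a \<a> = a * (\<mu> / a - w (- int \<a>))" using assms by (simp add: movable_pole_def algebra_simps)
  thus ?thesis by (simp add: power_mult_distrib)
 qed
 hence P: "(PROD \<a>=1..L. (\<mu> - mpole w a \<a>) ^ m \<a>) = a ^ (SUM \<a>=1..L. m \<a>) * (PROD \<a>=1..L. (\<mu> / a - w (- int \<a>)) ^ m \<a>)"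
  by (simp add: prod.distrib power_sum)
 show ?thesis unfolding P sum_m using assms by (simp add: power_add power_divide)
qed

lemma normalised_superpotential_eq:
 assumes "a ~= 0" "\<mu> ~= 0" "!!\<a>. \<a> : {1..L} ==> \<mu> ~= mpole w a \<a>"
 shows "\<mu> ^ kb * (PROD \<a>=1..L. (\<mu> - mpole w a \<a>) ^ m \<a>) * nsp lh kb ms w a \<mu> =
  a ^ (kb + p) * (w 0 * Q_poly l w (\<mu> / a))"
proof -
 have "\<mu> / a - w (- int \<a>) ~= 0" if "\<a> : {1..L}" for \<a>
  using assms(1) assms(3)[OF that] by (simp add: movable_pole_def divide_eq_eq mult.commute)
 hence D: "(\<mu> / a) ^ kb * (PROD \<a>=1..L. (\<mu> / a - w (- int \<a>)) ^ m \<a>) ~= 0"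
  using assms by auto
 have "c * y * (x / y) = c * x" if "y ~= 0" for c x y :: complex using that by simp
 from this[OF D] show ?thesis
  unfolding scaled_denominator[OF assms(1)] normalised_superpotential_def superpotential_def .
qed

lemma finite_poles_set: "finite (insert 0 (mpole w a ` {1..L}))" by simp

lemma numer_poly_normal_form:
 assumes w: "w : W" and a: "a ~= 0" and nf: "normal_form lh kb ms w a A ep"
 shows "numer_poly lh kb L m A (mpole w a) ep =
  (SUM j<=l+1. monom (a ^ (kb + p) * w 0 * Q_coeff l w j / a ^ j) j)"
proof (rule poly_eqI_off_finite[OF finite_poles_set[of w a]])
 fix x assume x: "x ~: insert 0 (mpole w a ` {1..L})"
 hence x': "x ~= 0" "!!\<a>. \<a> : {1..L} ==> x ~= mpole w a \<a>" by auto
 have "poly (numer_poly lh kb L m A (mpole w a) ep) x = x ^ kb * (PROD \<a>=1..L. (x - mpole w a \<a>) ^ m \<a>) *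
  nsp lh kb ms w a x"
  using nf x' movable_pole_nonzero[OF w a] by (subst numer_poly_eval) (auto simp: normal_form_def)
 also have "... = a ^ (kb + p) * (w 0 * Q_poly l w (x / a))" by (rule normalised_superpotential_eq[OF a x'])
 also have "... = poly (SUM j<=l+1. monom (a ^ (kb + p) * w 0 * Q_coeff l w j / a ^ j) j) x"
  unfolding Q_poly_coeff poly_sum sum_distrib_left by (intro sum.cong refl) (simp add: poly_monom power_divide)
 finally show "poly (numer_poly lh kb L m A (mpole w a) ep) x = ..." .
qed

lemma numer_poly_normal_form_eval:
 assumes "w : W" "a ~= 0" "normal_form lh kb ms w a A ep"
 shows "poly (numer_poly lh kb L m A (mpole w a) ep) x = a ^ (kb + p) * (w 0 * Q_poly l w (x / a))"
 unfolding numer_poly_normal_form[OF assms] Q_poly_coeff poly_sum sum_distrib_left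
 by (intro sum.cong refl) (simp add: poly_monom power_divide)

lemma normal_form_nonzero:
 assumes w: "w : W" and a: "a ~= 0" and nf: "normal_form lh kb ms w a A ep"
 shows "A (- int kb) ~= 0" "\<a> : {1..L} ==> ep \<a> (m \<a>) ~= 0"
proof -
 have "poly (numer_poly lh kb L m A (mpole w a) ep) 0 ~= 0"
  unfolding numer_poly_normal_form_eval[OF assms] using w a by (simp add: parameters_def Q_poly_def power_0_left)
 thus "A (- int kb) ~= 0" unfolding numer_poly_0[OF kb] by simp
next
 assume \<a>: "\<a> : {1..L}"
 have "poly (numer_poly lh kb L m A (mpole w a) ep) (mpole w a \<a>) ~= 0"
  unfolding numer_poly_normal_form_eval[OF assms] using w a \<a> by (simp add: parameters_def movable_pole_def)
 thus "ep \<a> (m \<a>) ~= 0" unfolding numer_poly_at_pole[where m = m and b = "mpole w a", OF \<a> m1[OF \<a>]] by auto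
qed

lemma normal_form_at_pole:
 assumes w: "w : W" and a: "a ~= 0" and nf: "normal_form lh kb ms w a A ep" and \<a>: "\<a> : {1..L}"
 obtains g where "g analytic_on {mpole w a \<a>}"
  "\<forall>\<^sub>F \<mu> in at (mpole w a \<a>). nsp lh kb ms w a \<mu> =
    g \<mu> + lprin (m \<a>) (ep \<a>) (mpole w a \<a>) \<mu>"
proof
 let ?b = "mpole w a"
 define g where "g \<mu> = dzs lh kb A \<mu> + (SUM \<g>:{1..L}-{\<a>}. lprin (m \<g>) (ep \<g>) (?b \<g>) \<mu>)" for \<mu>
 let ?S = "insert 0 (?b ` ({1..L} - {\<a>}))"
 have o: "open (- ?S)" by (intro open_Compl finite_imp_closed) simp
 have "?b \<a> ~= ?b \<g>" if "\<g> : {1..L} - {\<a>}" for \<g> using movable_pole_distinct[OF w a \<a>, of \<g>] that by auto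
 hence in_S: "?b \<a> : - ?S" using movable_pole_nonzero[OF w a \<a>] by blast
 have "g holomorphic_on - ?S"
  unfolding g_def[abs_def] dz_superpotential_def lprin_def
  by (intro holomorphic_intros) (auto simp: movable_pole_nonzero[OF w a])
 thus "g analytic_on {?b \<a>}" using o in_S analytic_at by blast
 have "\<forall>\<^sub>F \<mu> in at (?b \<a>). \<mu> : - ?S - {?b \<a>}" by (rule eventually_at_in_open[OF o in_S])
 thus "\<forall>\<^sub>F \<mu> in at (?b \<a>). nsp lh kb ms w a \<mu> = g \<mu> + lprin (m \<a>) (ep \<a>) (?b \<a>) \<mu>"
 proof eventually_elim
  case (elim \<mu>)
  hence "nsp lh kb ms w a \<mu> = dzs lh kb A \<mu> + (SUM \<g>=1..L. lprin (m \<g>) (ep \<g>) (?b \<g>) \<mu>)"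
   using nf by (auto simp: normal_form_def)
  also have "(SUM \<g>=1..L. lprin (m \<g>) (ep \<g>) (?b \<g>) \<mu>) = lprin (m \<a>) (ep \<a>) (?b \<a>) \<mu> + (SUM \<g>:{1..L}-{\<a>}. lprin (m \<g>) (ep \<g>) (?b \<g>) \<mu>)"
   using \<a> by (intro sum.remove) auto
  finally show ?case by (simp add: g_def)
 qed
qed

lemma fls_analytic_coeff:
 assumes "g analytic_on {b}"
 obtains F where "(%x. g (b + x)) has_laurent_expansion F" "!!i. i < 0 ==> fls_nth F i = 0"
proof -
 obtain G where "(%x. g (b + x)) has_fps_expansion G" using analytic_at_imp_has_fps_expansion[OF assms] by blast
 hence "(%x. g (b + x)) has_laurent_expansion fps_to_fls G" by (rule has_laurent_expansion_fps)
 thus ?thesis using that by simp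
qed

text \<open>The rest of the superpotential is analytic at this pole. What remains is a linear
  function of \<open>ep \<a>\<close> with constant coefficients, independent of the position of the
  pole and of the branch \<open>\<b>\<close>.\<close>

lemma normal_form_collision_coeff:
 assumes w: "w : W" and a: "a ~= 0" and nf: "normal_form lh kb ms w a A ep" and \<a>: "\<a> : {1..L}"
  and \<b>: "exp \<b> = mpole w a \<a>" and i: "1 <= i"
 shows "collision_coeff (nsp lh kb ms w a) \<b> i = log_coeff (m \<a>) (ep \<a>) i"
proof -
 obtain g where g: "g analytic_on {mpole w a \<a>}"
  and ev: "\<forall>\<^sub>F \<mu> in at (mpole w a \<a>). nsp lh kb ms w a \<mu> =
    g \<mu> + lprin (m \<a>) (ep \<a>) (mpole w a \<a>) \<mu>"
  using normal_form_at_pole[OF w a nf \<a>] by blast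
 have "(g \<circ> exp) analytic_on {\<b>}"
 proof (rule analytic_on_compose)
  show "exp analytic_on {\<b>}"
   by (rule analytic_on_subset[of _ UNIV]) (simp_all add: analytic_on_open holomorphic_on_exp)
 qed (simp add: \<b> g)
 then obtain F where F: "(%x. (g \<circ> exp) (\<b> + x)) has_laurent_expansion F" "!!i. i < 0 ==> fls_nth F i = 0"
  using fls_analytic_coeff by blast
 have "exp z ~= exp \<b>" if "z : ball \<b> 1 - {\<b>}" for z
 proof
  assume e: "exp z = exp \<b>"
  have "\<bar>Im (z - \<b>)\<bar> < 1" using that abs_Im_le_cmod[of "z - \<b>"] by (simp add: dist_norm norm_minus_commute)
  hence "\<bar>Im z - Im \<b>\<bar> < 2 * pi" using pi_gt3 by simp
  hence "z = \<b>" by (rule exp_complex_eqI[OF _ e])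
  thus False using that by simp
 qed
 moreover have "\<forall>\<^sub>F z in at \<b>. z : ball \<b> 1 - {\<b>}" by (rule eventually_at_in_open) auto
 ultimately have "\<forall>\<^sub>F z in at \<b>. exp z ~= exp \<b>" by (auto elim!: eventually_mono)
 hence "filterlim exp (at (exp \<b>)) (at \<b>)"
  by (intro filterlim_atI tendsto_exp tendsto_ident_at)
 hence "\<forall>\<^sub>F z in at \<b>. nsp lh kb ms w a (exp z) = g (exp z) + lprin (m \<a>) (ep \<a>) (exp \<b>) (exp z)"
  using ev unfolding \<b>[symmetric] by (auto simp: filterlim_iff)
 moreover have "(%x. (g \<circ> exp) (\<b> + x) + lprin (m \<a>) (ep \<a>) (exp \<b>) (exp (\<b> + x))) has_laurent_expansion F + log_series (m \<a>) (ep \<a>)"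
  by (intro has_laurent_expansion_add F log_principal_laurent)
 hence "laurent_expansion (%z. g (exp z) + lprin (m \<a>) (ep \<a>) (exp \<b>) (exp z)) \<b> = F + log_series (m \<a>) (ep \<a>)"
  by (intro laurent_expansion_eqI) (simp add: o_def)
 ultimately have "laurent_expansion (%z. nsp lh kb ms w a (exp z)) \<b> = F + log_series (m \<a>) (ep \<a>)"
  by (simp cong: laurent_expansion_cong)
 thus ?thesis using F(2)[of "- int i"] i by (simp add: collision_coeff_def log_series_nth)
qed

lemma normal_form_principal_part:
 assumes w: "w : W" and a: "a ~= 0" and nf: "normal_form lh kb ms w a A ep" and \<a>: "\<a> : {1..L}"
 shows "principal_part (nsp lh kb ms w a) (mpole w a \<a>) (m \<a>) \<mu> =
  lprin (m \<a>) (ep \<a>) (mpole w a \<a>) \<mu>"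
proof -
 let ?b = "mpole w a \<a>"
 have b: "?b ~= 0" by (rule movable_pole_nonzero[OF w a \<a>])
 obtain g where g: "g analytic_on {?b}"
  and ev: "\<forall>\<^sub>F \<mu> in at ?b. nsp lh kb ms w a \<mu> = g \<mu> + lprin (m \<a>) (ep \<a>) ?b \<mu>"
  using normal_form_at_pole[OF w a nf \<a>] by blast
 obtain F where F: "(%x. g (?b + x)) has_laurent_expansion F" "!!i. i < 0 ==> fls_nth F i = 0"
  using fls_analytic_coeff[OF g] by blast
 have lp: "lprin (m \<a>) (ep \<a>) ?b x = (SUM i=1..m \<a>. ep \<a> i * ?b ^ i * (x - ?b) powi (- int i))" for x
  unfolding lprin_def
 proof (intro sum.cong refl)
  fix i
  have "x / ?b - 1 = (x - ?b) / ?b" using b by (simp add: diff_divide_distrib)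
  thus "ep \<a> i / (x / ?b - 1) ^ i = ep \<a> i * ?b ^ i * (x - ?b) powi (- int i)"
   by (simp only: power_divide power_int_minus power_int_of_nat) (simp add: divide_inverse mult.assoc mult.commute)
 qed
 define E where "E = (SUM i=1..m \<a>. fls_const (ep \<a> i * ?b ^ i) * fls_X_intpow (- int i))"
 have "(%x. g (?b + x) + (SUM i=1..m \<a>. ep \<a> i * ?b ^ i * x powi (- int i))) has_laurent_expansion F + E"
  unfolding E_def by (intro has_laurent_expansion_add has_laurent_expansion_sum has_laurent_expansion_mult
   has_laurent_expansion_const has_laurent_expansion_fps_X_power_int F)
 hence "laurent_expansion (%\<mu>. g \<mu> + lprin (m \<a>) (ep \<a>) ?b \<mu>) ?b = F + E"
  by (intro laurent_expansion_eqI) (simp add: lp)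
 hence le: "laurent_expansion (nsp lh kb ms w a) ?b = F + E"
  using laurent_expansion_cong[OF ev refl] by simp
 have E: "fls_nth E (- int i) = ep \<a> i * ?b ^ i" if i: "i : {1..m \<a>}" for i
 proof -
  have "fls_nth E (- int i) = (SUM k=1..m \<a>. if k = i then ep \<a> k * ?b ^ k else 0)"
   unfolding E_def fls_nth_sum by (intro sum.cong refl) auto
  thus ?thesis using i by simp
 qed
 show ?thesis
  unfolding principal_part_def le lp
 proof (intro sum.cong refl)
  fix i assume i: "i : {1..m \<a>}"
  thus "fls_nth (F + E) (- int i) / (\<mu> - ?b) ^ i = ep \<a> i * ?b ^ i * (\<mu> - ?b) powi (- int i)"
   using E[OF i] F(2)[of "- int i"] by (simp add: power_int_minus divide_inverse)
 qed
qed

lemma normal_form_h_coeffs: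
 assumes w: "w : W" and a: "a ~= 0" and nf: "normal_form lh kb ms w a A ep"
 shows "h_coeffs lh kb ms w a = restrict A (dz_ix lh kb)"
proof -
 have o: "open (- (mpole w a ` {1..L}))" by (intro open_Compl finite_imp_closed) simp
 have "\<forall>\<^sub>F \<mu> in at 0. \<mu> : - (mpole w a ` {1..L}) - {0}"
  by (rule eventually_at_in_open[OF o]) (use movable_pole_nonzero[OF w a] in force)
 hence ev: "\<forall>\<^sub>F \<mu> in at 0. h_part lh kb ms w a \<mu> = dzs lh kb A \<mu>"
 proof eventually_elim
  case (elim \<mu>)
  hence "nsp lh kb ms w a \<mu> = dzs lh kb A \<mu> +
     (SUM \<a>=1..L. lprin (m \<a>) (ep \<a>) (mpole w a \<a>) \<mu>)"
   using nf by (auto simp: normal_form_def)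
  thus ?case by (simp add: h_part_def normal_form_principal_part[OF w a nf])
 qed
 define E where "E = fls_X_intpow (int (lh + 1)) + (SUM i:dz_ix lh kb. fls_const (A i) * fls_X_intpow i)"
 have "(%x. x ^ (lh + 1) + (SUM i:dz_ix lh kb. A i * x powi i)) has_laurent_expansion E"
  unfolding E_def by (intro has_laurent_expansion_add has_laurent_expansion_sum has_laurent_expansion_mult
   has_laurent_expansion_const has_laurent_expansion_fps_X_power_int has_laurent_expansion_fps_X_power)
 hence "laurent_expansion (dzs lh kb A) 0 = E"
  by (intro laurent_expansion_eqI) (simp add: dz_superpotential_def[abs_def])
 hence le: "laurent_expansion (h_part lh kb ms w a) 0 = E"
  using laurent_expansion_cong[OF ev refl] by simp
 have E: "fls_nth E i = A i" if i: "i : dz_ix lh kb" for i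
 proof -
  have "fls_nth E i = (if i = int (lh + 1) then 1 else 0) + (SUM k:dz_ix lh kb. A k * (if i = k then 1 else 0))"
   unfolding E_def fls_plus_nth fls_nth_sum by simp
  thus ?thesis using i by (simp add: finite_dz_index mult_delta_right) (auto simp: dz_index_def)
 qed
 show ?thesis unfolding h_coeffs_def le by (rule restrict_ext) (rule E)
qed

text \<open>The partial fractions are taken in the original coordinate, where they are holomorphic
  in \<open>w\<close> and involve no root. Rescaling by \<open>a\<close> multiplies the coefficient
  of index \<open>i\<close> by \<open>a^(-i)\<close> and leaves the \<open>ep\<close> unchanged,
  because their normalisation by the pole position is invariant under scaling.\<close>

lemma normal_form_exists:
 obtains A e where "!!i. hol I W (A i)" "!!\<a> i. hol I W (e \<a> i)"
  "!!w a. w : W ==> a ^ (lh + 1) = lcoef lh kb ms w ==>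
    normal_form lh kb ms w a (%i. A i w * a powi (- i)) (%\<a> i. e \<a> i w)"
proof -
 \<comment> \<open>The origin is treated as pole number 0, of order \<open>kb\<close>.\<close>
 define b where "b \<g> w = (if \<g> = 0 then 0 else w (- int \<g>))" for \<g> :: nat and w :: "int => complex"
 define M where "M \<g> = (if \<g> = 0 then kb else m \<g>)" for \<g>
 have hb: "hol I W (b \<g>)" for \<g>
  unfolding b_def[abs_def] by (cases "\<g> = 0") (simp_all add: hol_const[OF open_parameters] hol_coord[OF open_parameters])
 have db: "b \<g> w ~= b \<d> w" if "w : W" "\<g> : {0..L}" "\<d> : {0..L}" "\<g> ~= \<d>" for w \<g> \<d>
  using movable_pole_distinct[OF that(1), of 1 \<g> \<d>] movable_pole_nonzero[OF that(1), of 1 \<g>]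
   movable_pole_nonzero[OF that(1), of 1 \<d>] that(2-)
  by (cases "\<g> = 0"; cases "\<d> = 0") (auto simp: b_def movable_pole_def)
 interpret pole_family I W "{0..L}" b
  by unfold_locales (use open_parameters hb db in auto)
 have split: "(SUM \<g>=0..L. f \<g>) = f 0 + (SUM \<g>=1..L. f \<g>)" for f :: "nat => 'x::comm_monoid_add"
  by (simp add: sum.atLeast_Suc_atMost)
 have M: "(SUM \<g>=0..L. M \<g>) + (lh + 1) = l + 1"
  unfolding split using sum_m by (simp add: M_def l_eq)
 have hq: "hol I W (%w. w 0 * Q_coeff l w j)" for j
 proof -
  define c :: complex where "c = (if j = 0 then 1 else if j = l + 1 then (- 1) ^ (l + 1) else 0)"
  define d :: complex where "d = (if j = 0 \<or> j = l + 1 then 0 else (- 1) ^ j)"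
  have "Q_coeff l w j = c + d * w (int j)" for w by (simp add: Q_coeff_def c_def d_def)
  thus ?thesis by (simp only:) (intro hol_mult hol_add hol_const hol_coord open_parameters)
 qed
 have "pfrac (lh + 1) M (%w \<mu>. (SUM j<=l+1. w 0 * Q_coeff l w j * \<mu> ^ j) / (PROD \<g>=0..L. (\<mu> - b \<g> w) ^ M \<g>) - w 0 * Q_coeff l w (l + 1) * \<mu> ^ (lh + 1))"
  by (rule pf_quotient[OF hq M])
 then obtain A e where A: "!!j. hol I W (A j)" and e: "!!\<g> i. hol I W (e \<g> i)"
  and eq: "!!w \<mu>. w : W ==> (ALL \<g>:{0..L}. \<mu> ~= b \<g> w) ==>
    (SUM j<=l+1. w 0 * Q_coeff l w j * \<mu> ^ j) / (PROD \<g>=0..L. (\<mu> - b \<g> w) ^ M \<g>) - w 0 * Q_coeff l w (l + 1) * \<mu> ^ (lh + 1) =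
    (SUM j<lh+1. A j w * \<mu> ^ j) + (SUM \<g>=0..L. SUM i=1..M \<g>. e \<g> i w / (\<mu> - b \<g> w) ^ i)"
  unfolding pfrac_def by blast
 have sp: "spot lh kb ms w \<mu> = lcoef lh kb ms w * \<mu> ^ (lh + 1) + (SUM j<lh+1. A j w * \<mu> ^ j) +
   (SUM i=1..kb. e 0 i w / \<mu> ^ i) + (SUM \<a>=1..L. SUM i=1..m \<a>. e \<a> i w / (\<mu> - w (- int \<a>)) ^ i)"
  if w: "w : W" and \<mu>: "\<mu> ~= 0" "ALL \<a>:{1..L}. \<mu> ~= w (- int \<a>)" for w \<mu>
 proof -
  have off: "ALL \<g>:{0..L}. \<mu> ~= b \<g> w" using \<mu> by (auto simp: b_def)
  have den: "(PROD \<g>=0..L. (\<mu> - b \<g> w) ^ M \<g>) = \<mu> ^ kb * (PROD \<a>=1..L. (\<mu> - w (- int \<a>)) ^ m \<a>)"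
   by (simp add: prod.atLeast_Suc_atMost b_def M_def)
  have num: "(SUM j<=l+1. w 0 * Q_coeff l w j * \<mu> ^ j) = w 0 * Q_poly l w \<mu>"
   by (simp only: Q_poly_coeff sum_distrib_left mult.assoc)
  have pp: "(SUM \<g>=0..L. SUM i=1..M \<g>. e \<g> i w / (\<mu> - b \<g> w) ^ i) = (SUM i=1..kb. e 0 i w / \<mu> ^ i) + (SUM \<a>=1..L. SUM i=1..m \<a>. e \<a> i w / (\<mu> - w (- int \<a>)) ^ i)"
   unfolding split by (simp add: b_def M_def)
  have lc: "w 0 * Q_coeff l w (l + 1) = lcoef lh kb ms w"
   by (simp add: Q_coeff_def leading_coeff_def)
  show ?thesis using eq[OF w off] unfolding den num pp lc superpotential_def by (simp add: algebra_simps)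
 qed
 define A' where "A' i w = (if 0 <= i then A (nat i) w else e 0 (nat (- i)) w)" for i w
 define e' where "e' \<a> i w = e \<a> i w / w (- int \<a>) ^ i" for \<a> i and w :: "int => complex"
 show ?thesis
 \<comment> \<open>The default value 0 makes holomorphy hold for every index, also where there is no
   movable pole to divide by.\<close>
 proof (rule that[of A' "%\<a> i w. if \<a> : {1..L} then e' \<a> i w else 0"])
  fix i show "hol I W (A' i)" unfolding A'_def[abs_def] by (cases "0 <= i") (simp_all add: A e)
 next
  fix \<a> i
  show "hol I W (%w. if \<a> : {1..L} then e' \<a> i w else 0)"
  proof (cases "\<a> : {1..L}")
   case True
   have "hol I W (e' \<a> i)" unfolding e'_def[abs_def]
    by (intro hol_divide hol_power hol_coord e open_parameters) (insert True, auto simp: parameters_def)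
   thus ?thesis using True by simp
  qed (simp only: if_False hol_const[OF open_parameters])
 next
  fix w a assume w: "w : W" and a: "a ^ (lh + 1) = lcoef lh kb ms w"
  have a0: "a ~= 0" by (rule scale_nonzero[OF w a])
  show "normal_form lh kb ms w a (%i. A' i w * a powi (- i)) (%\<a> i. if \<a> : {1..L} then e' \<a> i w else 0)"
   unfolding normal_form_def
  proof (intro allI impI)
   fix \<mu> assume \<mu>: "\<mu> ~= 0" "ALL \<a>:{1..L}. \<mu> ~= mpole w a \<a>"
   have \<mu>': "\<mu> / a ~= 0" "ALL \<a>:{1..L}. \<mu> / a ~= w (- int \<a>)" using \<mu> a0 by (auto simp: movable_pole_def divide_eq_eq mult.commute)
   have 1: "lcoef lh kb ms w * (\<mu> / a) ^ (lh + 1) = \<mu> ^ (lh + 1)"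
    using a0 unfolding a[symmetric] by (simp add: power_divide)
   have 2: "(SUM j<lh+1. A j w * (\<mu> / a) ^ j) = (SUM j<lh + 1. A' (int j) w * a powi (- int j) * \<mu> ^ j)"
    by (intro sum.cong refl) (simp add: A'_def, simp only: power_divide power_int_minus power_int_of_nat, simp add: divide_inverse ac_simps)
   have 3: "(SUM i=1..kb. e 0 i w / (\<mu> / a) ^ i) = (SUM i=1..kb. A' (- int i) w * a powi (- (- int i)) / \<mu> ^ i)"
    by (intro sum.cong refl) (auto simp: A'_def power_divide)
   have 4: "(SUM \<a>=1..L. SUM i=1..m \<a>. e \<a> i w / (\<mu> / a - w (- int \<a>)) ^ i) =
    (SUM \<a>=1..L. lprin (m \<a>) (%i. if \<a> : {1..L} then e' \<a> i w else 0) (mpole w a \<a>) \<mu>)"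
    unfolding lprin_def
   proof (intro sum.cong refl)
    fix \<a> i assume \<a>: "\<a> : {1..L}"
    have "w (- int \<a>) ~= 0" using w \<a> by (auto simp: parameters_def)
    hence "\<mu> / mpole w a \<a> - 1 = (\<mu> / a - w (- int \<a>)) / w (- int \<a>)"
     using a0 by (simp add: movable_pole_def field_simps)
    thus "e \<a> i w / (\<mu> / a - w (- int \<a>)) ^ i =
     (if \<a> : {1..L} then e' \<a> i w else 0) / (\<mu> / mpole w a \<a> - 1) ^ i"
     using \<a> \<open>w (- int \<a>) ~= 0\<close> by (simp add: e'_def power_divide)
   qed
   show "nsp lh kb ms w a \<mu> = dzs lh kb (%i. A' i w * a powi (- i)) \<mu> +
     (SUM \<a>=1..L. lprin (m \<a>) (%i. if \<a> : {1..L} then e' \<a> i w else 0) (mpole w a \<a>) \<mu>)"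
    unfolding normalised_superpotential_def sp[OF w \<mu>'] 1 2 3 4 dz_superpotential_split[OF \<mu>(1)] ..
  qed
 qed
qed

text \<open>The numerator is \<open>a^(kb + p) w_0 Q(\<mu> / a)\<close>. Comparing coefficients of
  \<open>\<mu>^0\<close> and of \<open>\<mu>^j\<close> gives \<open>w_0\<close> and
  \<open>w_j\<close>.\<close>

definition parameter_of :: "complex poly => (nat => complex) => complex => int => complex" where
 "parameter_of N b a i = (if i < 0 then b (nat (- i)) / a else if i = 0 then coeff N 0 / a ^ (kb + p)
   else (- 1) ^ nat i * coeff N (nat i) * a ^ nat i / coeff N 0)"

text \<open>The rebuilt numerator is monic of degree \<open>l + 1\<close>, whereas the leading
  coefficient of \<open>Q\<close> is a sign. Together with the constant term this forces the
  equation for \<open>a^(l+1)\<close>, so that the inverse direction needs an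
  \<open>(l+1)\<close>-st root.\<close>

lemma normal_form_parameter_of:
 fixes A :: "int => complex" and ep :: "nat => nat => complex" and b :: "nat => complex" and a :: complex
 defines "N \<equiv> numer_poly lh kb L m A b ep"
 defines "w \<equiv> restrict (parameter_of N b a) I"
 assumes a: "a ^ (l + 1) = (- 1) ^ (l + 1) * coeff N 0"
  and b: "inj_on b {1..L}" "!!\<a>. \<a> : {1..L} ==> b \<a> ~= 0"
  and A: "A (- int kb) ~= 0" and ep: "ALL \<a>:{1..L}. ep \<a> (m \<a>) ~= 0"
 shows "a ~= 0" "w : W" "a ^ (lh + 1) = lcoef lh kb ms w" "normal_form lh kb ms w a A ep"
  "!!\<a>. \<a> : {1..L} ==> mpole w a \<a> = b \<a>"
proof -
 have N0: "coeff N 0 ~= 0"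
  unfolding poly_0_coeff_0[symmetric] N_def numer_poly_0[OF kb] using A b by auto
 show a0: "a ~= 0"
 proof
  assume "a = 0"
  with a have "(- 1) ^ (l + 1) * coeff N 0 = 0" by simp
  thus False using N0 by simp
 qed
 have wn: "w (- int \<a>) = b \<a> / a" if "\<a> : {1..L}" for \<a>
  using that by (auto simp: w_def parameter_of_def parameter_index_def)
 show pole: "mpole w a \<a> = b \<a>" if "\<a> : {1..L}" for \<a>
  using wn[OF that] a0 by (simp add: movable_pole_def)
 have w0: "w 0 = coeff N 0 / a ^ (kb + p)" by (simp add: w_def parameter_of_def parameter_index_def)
 have deg: "degree N = l + 1" "coeff N (l + 1) = 1"
  using numer_poly_degree[where L = L and m = m and lh = lh and kb = kb and A = A and b = b and ep = ep, OF m1]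
  unfolding sum_m N_def l_eq by simp_all
 have q: "w 0 * Q_coeff l w j = coeff N j * a ^ j / a ^ (kb + p)" if "j <= l + 1" for j
 proof (cases "j = 0 \<or> j = l + 1")
  case True
  thus ?thesis
  proof
   assume j: "j = l + 1"
   have qq: "Q_coeff l w (l + 1) = (- 1) ^ (l + 1)" by (simp add: Q_coeff_def)
   show ?thesis unfolding j w0 deg(2) a qq by simp
  qed (simp add: w0 Q_coeff_def)
 next
  case False
  hence j: "int j : I" using that by (auto simp: parameter_index_def)
  have "w (int j) = (- 1) ^ j * coeff N j * a ^ j / coeff N 0" using False j by (simp add: w_def parameter_of_def)
  moreover have "(- 1) ^ j * (- 1) ^ j = (1 :: complex)" by (simp flip: power_mult_distrib)
  ultimately show ?thesis using False N0 unfolding w0 by (simp add: Q_coeff_def mult.assoc[symmetric])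
 qed
 have Q: "w 0 * Q_poly l w \<mu> = poly N (a * \<mu>) / a ^ (kb + p)" for \<mu>
 proof -
  have "w 0 * Q_poly l w \<mu> = (SUM j<=l+1. w 0 * Q_coeff l w j * \<mu> ^ j)"
   by (simp only: Q_poly_coeff sum_distrib_left mult.assoc)
  also have "... = (SUM j<=l+1. coeff N j * (a * \<mu>) ^ j / a ^ (kb + p))"
   by (intro sum.cong refl) (simp add: q power_mult_distrib)
  also have "... = poly N (a * \<mu>) / a ^ (kb + p)"
   unfolding poly_altdef deg(1) sum_divide_distrib ..
  finally show ?thesis .
 qed
 have NP: "poly N (b \<a>) ~= 0" if \<a>: "\<a> : {1..L}" for \<a>
 proof -
  have "b \<a> - b \<g> ~= 0" if "\<g> : {1..L} - {\<a>}" for \<g> using b(1) \<a> that by (auto dest: inj_onD)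
  thus ?thesis unfolding N_def numer_poly_at_pole[where m = m and b = b, OF \<a> m1[OF \<a>]]
   using b(2)[OF \<a>] ep[rule_format, OF \<a>] by simp
 qed
 show w: "w : W"
  unfolding parameters_def
 proof (intro CollectI conjI ballI)
  show "w : extensional I" by (simp add: w_def)
  show "w 0 ~= 0" using N0 a0 by (simp add: w0)
  show "inj_on (%\<a>. w (- int \<a>)) {1..L}"
   using b(1) a0 by (auto simp: inj_on_def wn)
 next
  fix \<a> assume \<a>: "\<a> : {1..L}"
  show "w (- int \<a>) ~= 0" using b(2)[OF \<a>] a0 by (simp add: wn[OF \<a>])
  have "w 0 * Q_poly l w (w (- int \<a>)) ~= 0" using NP[OF \<a>] a0 unfolding Q wn[OF \<a>] by simp
  thus "Q_poly l w (w (- int \<a>)) ~= 0" by simp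
 qed
 have "l + 1 = (lh + 1) + (kb + p)" by (simp add: l_eq)
 hence "a ^ (lh + 1) * a ^ (kb + p) = (- 1) ^ (l + 1) * coeff N 0" using a by (simp only: power_add[symmetric])
 thus "a ^ (lh + 1) = lcoef lh kb ms w"
  unfolding leading_coeff_def w0 using a0 by (simp add: field_simps)
 show "normal_form lh kb ms w a A ep"
  unfolding normal_form_def
 proof (intro allI impI)
  fix \<mu> assume \<mu>: "\<mu> ~= 0" "ALL \<a>:{1..L}. \<mu> ~= mpole w a \<a>"
  let ?D = "\<mu> ^ kb * (PROD \<a>=1..L. (\<mu> - b \<a>) ^ m \<a>)"
  have D: "?D ~= 0" using \<mu> pole by auto
  have P: "(PROD \<a>=1..L. (\<mu> - mpole w a \<a>) ^ m \<a>) = (PROD \<a>=1..L. (\<mu> - b \<a>) ^ m \<a>)"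
   by (intro prod.cong refl) (simp only: pole)
  have S: "(SUM \<a>=1..L. lprin (m \<a>) (ep \<a>) (mpole w a \<a>) \<mu>) = (SUM \<a>=1..L. lprin (m \<a>) (ep \<a>) (b \<a>) \<mu>)"
   by (intro sum.cong refl) (simp only: pole)
  have "?D * nsp lh kb ms w a \<mu> = a ^ (kb + p) * (w 0 * Q_poly l w (\<mu> / a))"
   using normalised_superpotential_eq[OF a0 \<mu>(1), of w] \<mu>(2) unfolding P by blast
  also have "... = poly N \<mu>" unfolding Q using a0 by simp
  also have "... = ?D * (dzs lh kb A \<mu> + (SUM \<a>=1..L. lprin (m \<a>) (ep \<a>) (b \<a>) \<mu>))"
   unfolding N_def by (rule numer_poly_eval) (use \<mu> pole b in auto)
  finally have "?D * nsp lh kb ms w a \<mu> = ..." .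
  with D show "nsp lh kb ms w a \<mu> = dzs lh kb A \<mu> +
    (SUM \<a>=1..L. lprin (m \<a>) (ep \<a>) (mpole w a \<a>) \<mu>)"
   unfolding S mult_left_cancel[OF D] by blast
 qed
qed

lemma parameter_of_normal_form:
 assumes w: "w : W" and a: "a ~= 0" and nf: "normal_form lh kb ms w a A ep"
 shows "restrict (parameter_of (numer_poly lh kb L m A (mpole w a) ep) (mpole w a) a) I = w"
  "coeff (numer_poly lh kb L m A (mpole w a) ep) 0 = a ^ (kb + p) * w 0"
proof -
 let ?N = "numer_poly lh kb L m A (mpole w a) ep"
 have w0: "w 0 ~= 0" using w by (simp add: parameters_def)
 have c: "coeff ?N j = a ^ (kb + p) * w 0 * Q_coeff l w j / a ^ j" if "j <= l + 1" for j
  unfolding numer_poly_normal_form[OF assms] using that by (simp add: coeff_sum del: sum.atMost_Suc)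
 show c0: "coeff ?N 0 = a ^ (kb + p) * w 0" using c[of 0] by (simp add: Q_coeff_def)
 show "restrict (parameter_of ?N (mpole w a) a) I = w"
 proof (rule extensionalityI[of _ I])
  show "w : extensional I" using w by (simp add: parameters_def)
  fix i assume i: "i : I"
  consider "i < 0" | "i = 0" | "i > 0" by linarith
  hence "parameter_of ?N (mpole w a) a i = w i"
  proof cases
   case 1
   thus ?thesis using a by (simp add: parameter_of_def movable_pole_def)
  next
   case 2
   thus ?thesis using a by (simp add: parameter_of_def c0)
  next
   case 3
   hence j: "nat i <= l" "nat i ~= 0" "int (nat i) = i" using i by (auto simp: parameter_index_def)
   have "(- 1) ^ nat i * (- 1) ^ nat i = (1 :: complex)" by (simp flip: power_mult_distrib)
   thus ?thesis using 3 a w0 j c[of "nat i"]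
    by (simp add: parameter_of_def c0 Q_coeff_def mult.assoc[symmetric])
  qed
  thus "restrict (parameter_of ?N (mpole w a) a) I i = w i" using i by simp
 qed simp
qed

end

section \<open>Collision coordinates\<close>

text \<open>Back substitution, from the highest order down, in the system
  \<open>log_coeff m e j = c j\<close>; it is triangular with diagonal 1 by
  \<open>pole_coeff_diag\<close> and \<open>pole_coeff_upper\<close>.\<close>

primrec log_solve :: "nat => (nat => complex) => nat => nat => complex" where
 "log_solve m c 0 = (%_. 0)"
| "log_solve m c (Suc n) = (let e = log_solve m c n in e(m - n := c (m - n) - log_coeff m e (m - n)))"

lemma log_solve_zero: "i <= m - n ==> n <= m ==> log_solve m c n i = 0"
 by (induction n arbitrary: i) (auto simp: Let_def)

lemma log_coeff_upd:
 assumes "k : {1..m}"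
 shows "log_coeff m (e(k := x)) j = log_coeff m e j + (x - e k) * pole_coeff k j"
proof -
 have "(SUM i:{1..m}-{k}. (e(k := x)) i * pole_coeff i j) = (SUM i:{1..m}-{k}. e i * pole_coeff i j)"
  by (intro sum.cong) auto
 moreover have s: "log_coeff m f j = f k * pole_coeff k j + (SUM i:{1..m}-{k}. f i * pole_coeff i j)" for f
  unfolding log_coeff_def by (rule sum.remove) (use assms in auto)
 ultimately show ?thesis unfolding s[of "e(k := x)"] s[of e] by (simp add: algebra_simps)
qed

lemma log_solve_partial:
 "n <= m ==> m - n < j ==> j <= m ==> log_coeff m (log_solve m c n) j = c j"
proof (induction n arbitrary: j)
 case (Suc n)
 define e where "e = log_solve m c n"
 have k: "m - n : {1..m}" using Suc.prems by auto
 have ek: "e (m - n) = 0" unfolding e_def using Suc.prems by (intro log_solve_zero) auto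
 have eq: "log_coeff m (log_solve m c (Suc n)) j = log_coeff m e j + (c (m - n) - log_coeff m e (m - n)) * pole_coeff (m - n) j"
  using log_coeff_upd[OF k, of e] by (simp add: Let_def e_def[symmetric] ek)
 show ?case
 proof (cases "j = m - n")
  case True
  thus ?thesis unfolding eq by (simp add: pole_coeff_diag)
 next
  case False
  hence "m - n < j" using Suc.prems by auto
  thus ?thesis unfolding eq using Suc.IH[of j] Suc.prems by (simp add: pole_coeff_upper e_def)
 qed
qed simp

lemma log_solve_correct: "j : {1..m} ==> log_coeff m (log_solve m c m) j = c j"
 by (rule log_solve_partial) auto

lemma log_coeff_inject:
 assumes "!!j. j : {1..m} ==> log_coeff m e j = log_coeff m e' j" "i : {1..m}"
 shows "e i = e' i"
 using assms(2)
proof (induction "m - i" arbitrary: i rule: less_induct)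
 case less
 have s: "log_coeff m f i = f i + (SUM k:{1..m}-{i}. f k * pole_coeff k i)" for f
  using less.prems sum.remove[of "{1..m}" i "%k. f k * pole_coeff k i"]
  by (simp only: log_coeff_def pole_coeff_diag mult_1_right finite_atLeastAtMost simp_thms)
 have "(SUM k:{1..m}-{i}. e k * pole_coeff k i) = (SUM k:{1..m}-{i}. e' k * pole_coeff k i)"
 proof (intro sum.cong refl)
  fix k assume k: "k : {1..m} - {i}"
  show "e k * pole_coeff k i = e' k * pole_coeff k i"
  proof (cases "k < i")
   case False
   hence "e k = e' k" using k less.prems by (intro less.hyps) auto
   thus ?thesis by simp
  qed (simp add: pole_coeff_upper)
 qed
 thus ?case using assms(1)[OF less.prems] unfolding s by simp
qed

lemma hol_log_coeff:
 assumes U: "openin (cspace I) U" and e: "!!i. i : {1..m} ==> hol I U (e i)"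
 shows "hol I U (%w. log_coeff m (%i. e i w) j)"
 unfolding log_coeff_def by (intro hol_sum[OF U] hol_mult[OF U] hol_const[OF U] e)

lemma hol_log_solve:
 assumes U: "openin (cspace I) U" and c: "!!i. i : {1..m} ==> hol I U (c i)"
 shows "n <= m ==> hol I U (%w. log_solve m (%i. c i w) n i)"
proof (induction n arbitrary: i)
 case (Suc n)
 have IH: "hol I U (%w. log_solve m (%i. c i w) n i)" for i using Suc by simp
 have "hol I U (%w. c (m - n) w - log_coeff m (%i. log_solve m (%i. c i w) n i) (m - n))"
  using Suc.prems by (intro hol_diff[OF U] c hol_log_coeff[OF U] IH) auto
 thus ?case using IH[of i] by (cases "i = m - n") (simp_all add: Let_def)
qed (simp add: hol_const[OF U])

lemma numer_poly_cong:
 assumes "!!i. i : dz_ix lh kb ==> A i = A' i" "!!\<a>. \<a> : {1..L} ==> b \<a> = b' \<a>"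
  "!!\<a> i. \<a> : {1..L} ==> i : {1..m \<a>} ==> ep \<a> i = ep' \<a> i"
 shows "numer_poly lh kb L m A b ep = numer_poly lh kb L m A' b' ep'"
proof -
 have 1: "(PROD \<a>:S. [:- b \<a>, 1:] ^ m \<a>) = (PROD \<a>:S. [:- b' \<a>, 1:] ^ m \<a>)" if "S <= {1..L}" for S
  using that assms(2) by (intro prod.cong refl) (simp add: subset_iff)
 have 2: "(SUM i=1..m \<a>. smult (ep \<a> i * b \<a> ^ i) ([:- b \<a>, 1:] ^ (m \<a> - i))) * (PROD \<g>:{1..L}-{\<a>}. [:- b \<g>, 1:] ^ m \<g>) =
  (SUM i=1..m \<a>. smult (ep' \<a> i * b' \<a> ^ i) ([:- b' \<a>, 1:] ^ (m \<a> - i))) * (PROD \<g>:{1..L}-{\<a>}. [:- b' \<g>, 1:] ^ m \<g>)"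
  if \<a>: "\<a> : {1..L}" for \<a>
 proof -
  have "(SUM i=1..m \<a>. smult (ep \<a> i * b \<a> ^ i) ([:- b \<a>, 1:] ^ (m \<a> - i))) =
   (SUM i=1..m \<a>. smult (ep' \<a> i * b' \<a> ^ i) ([:- b' \<a>, 1:] ^ (m \<a> - i)))"
   using assms(2)[OF \<a>] assms(3)[OF \<a>] by (intro sum.cong refl) simp
  thus ?thesis using 1[of "{1..L}-{\<a>}"] by auto
 qed
 have 3: "(SUM i:dz_ix lh kb. monom (A i) (nat (i + int kb))) = (SUM i:dz_ix lh kb. monom (A' i) (nat (i + int kb)))"
  using assms(1) by (intro sum.cong refl) simp
 show ?thesis
  unfolding numer_poly_def 1[OF order.refl] 3
  by (rule arg_cong2[where f = "(+)", OF refl arg_cong2[where f = "(*)", OF refl sum.cong[OF refl 2]]])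
qed

lemma openin_cspace_vimage_ball:
 assumes U: "openin (cspace I) U" and K: "finite K"
  and f: "!!k. k : K ==> continuous_on U (f k)" and S: "open S"
 shows "openin (cspace I) {w : U. ALL k:K. f k w : S}"
 using K f
proof (induction K rule: finite_induct)
 case (insert k K)
 have "{w : U. ALL k:insert k K. f k w : S} = {w : U. ALL k:K. f k w : S} \<inter> {w : U. f k w : S}" by auto
 thus ?case using insert by (simp add: openin_Int openin_cspace_vimage[OF U _ S])
qed (simp add: U)

lemma open_slit: "open (- nonpos_Reals :: complex set)"
 by (simp add: open_Compl)

lemma open_strip: "open {z :: complex. \<bar>Im z\<bar> < r}"
 by (intro open_Collect_less continuous_intros)

lemma of_nat_Suc_nz: "of_nat (n + 1) ~= (0 :: complex)"
 unfolding of_nat_eq_0_iff by simp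

lemma exp_root: "exp (x / of_nat (n + 1)) ^ (n + 1) = exp (x :: complex)"
 by (simp only: exp_of_nat_mult[symmetric] times_divide_eq_right nonzero_mult_div_cancel_left[OF of_nat_Suc_nz])

lemma abs_Im_Ln: "z ~: nonpos_Reals ==> \<bar>Im (Ln z)\<bar> < pi"
proof -
 assume z: "z ~: nonpos_Reals"
 hence "z ~= 0" by auto
 thus ?thesis using mpi_less_Im_Ln[of z] Im_Ln_less_pi[OF z] by linarith
qed

lemma Ln_exp_strip: "\<bar>Im z\<bar> < pi ==> Ln (exp z) = z"
 by (intro Ln_exp) auto

locale chart = model +
 fixes Ah :: "int => (int => complex) => complex" and eh :: "nat => nat => (int => complex) => complex"
  and V :: "(int => complex) set" and t :: "nat => (int => complex) => complex"
  and w0 :: "int => complex" and a0 :: complex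
 assumes Ah: "!!i. hol I W (Ah i)" and eh: "!!\<a> i. hol I W (eh \<a> i)"
  and nf: "!!w a. w : W ==> a ^ (lh + 1) = lcoef lh kb ms w ==>
    normal_form lh kb ms w a (%i. Ah i w * a powi (- i)) (%\<a> i. eh \<a> i w)"
  and t: "csys (dz_ix lh kb) V {1..lh + kb + 1} t"
  and V: "V <= dz_par lh kb"
  and w0: "w0 : W" and a0: "a0 ^ (lh + 1) = lcoef lh kb ms w0"
  and h0: "h_coeffs lh kb ms w0 a0 : V"
begin

section \<open>Branches near the base point and the coordinates in terms of them\<close>

abbreviation "D \<equiv> dz_ix lh kb"
abbreviation "T \<equiv> {1..lh + kb + 1}"
abbreviation "J \<equiv> coord_labels lh kb ms"
abbreviation "lc \<equiv> lcoef lh kb ms"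

text \<open>The branch of the \<open>(lh+1)\<close>-st root that takes the prescribed value
  \<open>a0\<close> at the base point; the quotient by \<open>lc w0\<close> puts the cut away from
  \<open>w0\<close>.\<close>

definition aa where "aa w = a0 * exp (Ln (lc w / lc w0) / of_nat (lh + 1))"
definition AA where "AA i w = Ah i w * aa w powi (- i)"
definition bb where "bb \<a> w = mpole w (aa w) \<a>"
definition \<b> where "\<b> \<a> w = Ln (bb \<a> w0) + Ln (bb \<a> w / bb \<a> w0)"
definition cc where "cc \<a> i w = log_coeff (m \<a>) (%i. eh \<a> i w) i"

text \<open>The inverse chart takes the logarithm of a quantity whose logarithm is
  \<open>(l+1)/(lh+1)\<close> times the present one. The narrower strip keeps that multiple inside
  the range of \<open>Ln\<close>.\<close>

definition W1 where "W1 = {w : {w : W. lc w / lc w0 : - nonpos_Reals}.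
 Ln (lc w / lc w0) : {z. \<bar>Im z\<bar> < pi * (of_nat (lh + 1) / of_nat (l + 1))}}"
definition W2 where "W2 = {w : {w : {w : W1. ALL \<a>:{1..L}. bb \<a> w / bb \<a> w0 : - nonpos_Reals}.
  ALL \<a>:{1..L}. cc \<a> (m \<a>) w / cc \<a> (m \<a>) w0 : - nonpos_Reals}. cmap D AA w : V}"

lemma lc0: "lc w0 ~= 0" by (rule leading_coeff_nonzero[OF w0])
lemma a0_nz: "a0 ~= 0" by (rule scale_nonzero[OF w0 a0])
lemma finD: "finite D" by (rule finite_dz_index)

lemma finJ: "finite J"
proof -
 have "{Cc \<a> i |\<a> i. \<a> : {1..L} & i : {1..m \<a>}} = (%(\<a>, i). Cc \<a> i) ` (SIGMA \<a>:{1..L}. {1..m \<a>})" by auto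
 thus ?thesis by (simp add: coord_labels_def)
qed

lemma J_cases:
 assumes "j : J"
 obtains i where "i : T" "j = Tc i" | \<a> where "\<a> : {1..L}" "j = Bc \<a>"
  | \<a> i where "\<a> : {1..L}" "i : {1..m \<a>}" "j = Cc \<a> i"
 using assms by (auto simp: coord_labels_def)

lemma J_intros: "i : T ==> Tc i : J" "\<a> : {1..L} ==> Bc \<a> : J" "\<a> : {1..L} ==> i : {1..m \<a>} ==> Cc \<a> i : J"
 by (auto simp: coord_labels_def)

lemma hol_lc: "openin (cspace I) U ==> hol I U (%w. lc w / lc w0)"
 unfolding leading_coeff_def by (simp only: divide_inverse) (intro hol_mult hol_const hol_coord)

lemma open_W1: "openin (cspace I) W1"
proof -
 have 1: "openin (cspace I) {w : W. lc w / lc w0 : - nonpos_Reals}" (is "openin _ ?U")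
  by (intro openin_cspace_vimage open_parameters hol_continuous[OF open_parameters] hol_lc open_slit)
 have "hol I ?U (%w. Ln (lc w / lc w0))" by (rule hol_Ln[OF 1 hol_lc[OF 1]]) simp
 thus ?thesis unfolding W1_def
  by (intro openin_cspace_vimage 1 hol_continuous[OF 1] open_strip)
qed

lemma W1D: "w : W1 ==> w : W" "w : W1 ==> lc w / lc w0 ~: nonpos_Reals"
 "w : W1 ==> \<bar>Im (Ln (lc w / lc w0))\<bar> < pi * (of_nat (lh + 1) / of_nat (l + 1))"
 by (auto simp: W1_def)

lemma hol_aa: "hol I W1 aa"
 unfolding aa_def[abs_def] divide_inverse[of "Ln _"]
 by (intro hol_mult hol_exp hol_Ln hol_const hol_lc open_W1) (use W1D in blast)

lemma aa_power: "w : W1 ==> aa w ^ (lh + 1) = lc w"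
proof -
 assume w: "w : W1"
 have nz: "lc w / lc w0 ~= 0" using leading_coeff_nonzero[OF W1D(1)[OF w]] lc0 by simp
 have "exp (Ln (lc w / lc w0) / of_nat (lh + 1)) ^ (lh + 1) = lc w / lc w0"
  by (simp only: exp_root exp_Ln[OF nz])
 thus ?thesis unfolding aa_def power_mult_distrib a0 using lc0 by simp
qed

lemma aa_nz: "aa w ~= 0" using a0_nz by (simp add: aa_def)

lemma aa_w0: "aa w0 = a0" using lc0 by (simp add: aa_def)

lemma hol_AA: "hol I W1 (AA i)"
 unfolding AA_def[abs_def]
 by (intro hol_mult hol_power_int holomorphic_fun_subset[OF Ah] hol_aa open_W1) (use W1D(1) aa_nz in auto)

lemma hol_bb: "hol I W1 (bb \<a>)"
 unfolding bb_def[abs_def] movable_pole_def by (intro hol_mult hol_coord hol_aa open_W1)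

lemma hol_cc: "U <= W1 ==> openin (cspace I) U ==> hol I U (cc \<a> i)"
 unfolding cc_def[abs_def] by (intro hol_log_coeff holomorphic_fun_subset[OF eh]) (use W1D(1) in auto)

lemma bb_nz: "w : W1 ==> \<a> : {1..L} ==> bb \<a> w ~= 0"
 unfolding bb_def by (intro movable_pole_nonzero aa_nz W1D)

lemma nf1: "w : W1 ==> normal_form lh kb ms w (aa w) (%i. AA i w) (%\<a> i. eh \<a> i w)"
 unfolding AA_def by (intro nf W1D aa_power)

lemma h_coeffs_AA: "w : W1 ==> h_coeffs lh kb ms w (aa w) = cmap D AA w"
 unfolding chart_map_def by (rule normal_form_h_coeffs[OF _ aa_nz nf1]) (auto intro: W1D)

lemma cc_top: "w : W1 ==> \<a> : {1..L} ==> cc \<a> (m \<a>) w ~= 0"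
 using m1[of \<a>] normal_form_nonzero(2)[OF W1D(1) aa_nz nf1, of w \<a>] by (simp add: cc_def log_coeff_top)

lemma open_W2: "openin (cspace I) W2" and W2_W1: "W2 <= W1"
proof -
 show sub: "W2 <= W1" by (auto simp: W2_def)
 have 1: "openin (cspace I) {w : W1. ALL \<a>:{1..L}. bb \<a> w / bb \<a> w0 : - nonpos_Reals}" (is "openin _ ?U")
  unfolding divide_inverse
  by (intro openin_cspace_vimage_ball open_W1 hol_continuous[OF open_W1] hol_mult hol_bb hol_const open_slit) simp
 have 2: "openin (cspace I) {w : ?U. ALL \<a>:{1..L}. cc \<a> (m \<a>) w / cc \<a> (m \<a>) w0 : - nonpos_Reals}" (is "openin _ ?U2")
  unfolding divide_inverse[of "cc _ _ _"]
  by (intro openin_cspace_vimage_ball 1 hol_continuous[OF 1] hol_mult hol_cc hol_const open_slit) auto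
 show "openin (cspace I) W2" unfolding W2_def
  by (rule chart_map_vimage_open[OF 2 _ chart_inverse(1)[OF finD t]])
   (rule holomorphic_fun_subset[OF hol_AA], auto)
qed

lemma W2D: "w : W2 ==> w : W1" "w : W2 ==> \<a> : {1..L} ==> bb \<a> w / bb \<a> w0 ~: nonpos_Reals"
 "w : W2 ==> \<a> : {1..L} ==> cc \<a> (m \<a>) w / cc \<a> (m \<a>) w0 ~: nonpos_Reals" "w : W2 ==> cmap D AA w : V"
 by (auto simp: W2_def)

lemma w0_W1: "w0 : W1"
 using w0 lc0 by (simp add: W1_def)

lemma w0_W2: "w0 : W2"
 using w0_W1 bb_nz[OF w0_W1] cc_top[OF w0_W1] h0 h_coeffs_AA[OF w0_W1]
 by (simp add: W2_def aa_w0)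

lemma hol_\<b>: "\<a> : {1..L} ==> hol I W2 (\<b> \<a>)"
proof -
 assume \<a>: "\<a> : {1..L}"
 have h: "hol I W2 (%w. bb \<a> w / bb \<a> w0)" unfolding divide_inverse
  by (intro hol_mult hol_const open_W2 holomorphic_fun_subset[OF hol_bb W2_W1])
 show ?thesis unfolding \<b>_def[abs_def]
  by (rule hol_add[OF open_W2 hol_const[OF open_W2] hol_Ln[OF open_W2 h]]) (rule W2D(2)[OF _ \<a>])
qed

lemma exp_\<b>: "w : W1 ==> \<a> : {1..L} ==> exp (\<b> \<a> w) = bb \<a> w"
 using bb_nz[of w \<a>] bb_nz[OF w0_W1, of \<a>] by (simp add: \<b>_def exp_add)

lemma \<b>_w0: "\<a> : {1..L} ==> \<b> \<a> w0 = Ln (bb \<a> w0)"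
 using bb_nz[OF w0_W1, of \<a>] by (simp add: \<b>_def)

definition y where "y = joint_coords (lift_t lh kb ms t aa) \<b> (c_coord lh kb ms aa \<b>)"

lemma y_simps:
 "w : W1 ==> y (Tc i) w = t i (cmap D AA w)" "y (Bc \<a>) w = \<b> \<a> w"
 "w : W1 ==> \<a> : {1..L} ==> 1 <= i ==> y (Cc \<a> i) w = cc \<a> i w"
proof -
 show "w : W1 ==> y (Tc i) w = t i (cmap D AA w)" by (simp add: y_def lift_t_def h_coeffs_AA)
 show "y (Bc \<a>) w = \<b> \<a> w" by (simp add: y_def)
 assume w: "w : W1" and \<a>: "\<a> : {1..L}" and i: "1 <= i"
 show "y (Cc \<a> i) w = cc \<a> i w"
  unfolding y_def joint_coords.simps c_coord_def cc_def
  by (rule normal_form_collision_coeff[OF W1D(1)[OF w] aa_nz nf1[OF w] \<a> _ i]) (simp add: exp_\<b>[OF w \<a>] bb_def)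
qed

lemma hol_y:
 assumes "j : J" shows "hol I W2 (y j)"
proof -
 note cong = holomorphic_fun_cong[OF finI open_W2, THEN iffD1]
 show ?thesis using assms
 proof (cases rule: J_cases)
  case (1 i)
  have "hol I W2 (%w. t i (cmap D AA w))"
   using 1 by (intro hol_compose[OF finI finD open_W2 chart_inverse(1)[OF finD t]]
    holomorphic_fun_subset[OF hol_AA W2_W1] chart_inverse(3)[OF finD t] W2D) auto
  thus ?thesis by (rule cong[rotated]) (use 1 y_simps(1) W2_W1 in auto)
 next
  case (2 \<a>)
  hence "y j = \<b> \<a>" using y_simps(2) by (simp add: fun_eq_iff)
  thus ?thesis using hol_\<b>[OF 2(1)] by simp
 next
  case (3 \<a> i)
  show ?thesis by (rule cong[OF _ hol_cc[OF W2_W1 open_W2, of \<a> i]]) (use 3 y_simps(3) W2_W1 in auto)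
 qed
qed

section \<open>The inverse chart\<close>

definition TV where "TV = cmap T t ` V"
definition Av where "Av i v = inv_into V (cmap T t) (cmap T (%i v. v (Tc i)) v) i"
definition ev where "ev \<a> i v = log_solve (m \<a>) (%i. v (Cc \<a> i)) (m \<a>) i"
definition Nv where "Nv v = numer_poly lh kb L m (%i. Av i v) (%\<a>. exp (v (Bc \<a>))) (%\<a> i. ev \<a> i v)"
definition n0 where "n0 = a0 ^ (kb + p) * w0 0"
text \<open>Here \<open>n0\<close> is the constant term of the numerator at the base point, so this
  branch of the \<open>(l+1)\<close>-st root equals \<open>a0\<close> there.\<close>

definition av where "av v = a0 * exp (Ln (coeff (Nv v) 0 / n0) / of_nat (l + 1))"
definition G where "G i v = parameter_of (Nv v) (%\<a>. exp (v (Bc \<a>))) (av v) i"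

definition V1 :: "(coord_label => complex) set" where
 "V1 = {v : {v : {v : {v : extensional J. cmap T (%i v. v (Tc i)) v : TV}.
   ALL \<a>:{1..L}. v (Bc \<a>) - \<b> \<a> w0 : {z. \<bar>Im z\<bar> < pi}}.
   ALL \<a>:{1..L}. v (Cc \<a> (m \<a>)) / cc \<a> (m \<a>) w0 : - nonpos_Reals}.
   (PROD \<a>=1..L. PROD \<g>:{1..L}-{\<a>}. exp (v (Bc \<a>)) - exp (v (Bc \<g>))) : - {0}}"
definition V2 where "V2 = {v : V1. coeff (Nv v) 0 / n0 : - nonpos_Reals}"

lemma n0_nz: "n0 ~= 0" using a0_nz w0 by (simp add: n0_def parameters_def)

lemma open_V1: "openin (cspace J) V1"
proof -
 have E: "openin (cspace J) (extensional J)" by (simp add: cspace_eq)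
 have 1: "openin (cspace J) {v : extensional J. cmap T (%i v. v (Tc i)) v : TV}" (is "openin _ ?U1")
  unfolding TV_def
  by (rule chart_map_vimage_open[OF E hol_coord[OF E] chart_inverse(2)[OF finD t]])
 have 2: "openin (cspace J) {v : ?U1. ALL \<a>:{1..L}. v (Bc \<a>) - \<b> \<a> w0 : {z. \<bar>Im z\<bar> < pi}}" (is "openin _ ?U2")
  by (intro openin_cspace_vimage_ball 1 hol_continuous[OF 1] hol_diff hol_coord hol_const open_strip) simp
 have 3: "openin (cspace J) {v : ?U2. ALL \<a>:{1..L}. v (Cc \<a> (m \<a>)) / cc \<a> (m \<a>) w0 : - nonpos_Reals}" (is "openin _ ?U3")
  unfolding divide_inverse
  by (intro openin_cspace_vimage_ball 2 hol_continuous[OF 2] hol_mult hol_coord hol_const open_slit) simp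
 show ?thesis unfolding V1_def
  by (intro openin_cspace_vimage 3 hol_continuous[OF 3] hol_prod hol_diff hol_exp hol_coord) auto
qed

lemma V1D:
 assumes "v : V1"
 shows "v : extensional J" "cmap T (%i v. v (Tc i)) v : TV" "\<a> : {1..L} ==> \<bar>Im (v (Bc \<a>) - \<b> \<a> w0)\<bar> < pi"
  "\<a> : {1..L} ==> v (Cc \<a> (m \<a>)) ~= 0" "inj_on (%\<a>. exp (v (Bc \<a>))) {1..L}"
proof -
 have "(PROD \<a>=1..L. PROD \<g>:{1..L}-{\<a>}. exp (v (Bc \<a>)) - exp (v (Bc \<g>))) ~= 0"
  using assms by (simp add: V1_def)
 thus "inj_on (%\<a>. exp (v (Bc \<a>))) {1..L}" by (auto simp: inj_on_def)
 show "v (Cc \<a> (m \<a>)) ~= 0" if "\<a> : {1..L}"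
 proof
  assume "v (Cc \<a> (m \<a>)) = 0"
  moreover have "v (Cc \<a> (m \<a>)) / cc \<a> (m \<a>) w0 ~: nonpos_Reals" using assms that by (simp add: V1_def)
  ultimately show False by simp
 qed
qed (insert assms, auto simp: V1_def)

lemma hol_Av: "i : D ==> hol J V1 (Av i)"
 unfolding Av_def[abs_def]
 by (intro hol_compose[OF finJ _ open_V1 chart_inverse(2)[OF finD t]] hol_coord[OF open_V1]
   chart_inverse(4)[OF finD t] V1D(2)[unfolded TV_def]) auto

lemma hol_ev: "hol J V1 (ev \<a> i)"
 unfolding ev_def[abs_def] by (intro hol_log_solve open_V1 hol_coord) auto

lemma hol_Nv: "hol J V1 (%v. coeff (Nv v) n)"
proof -
 have "hol_poly J V1 Nv" unfolding Nv_def[abs_def]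
  by (intro hol_numer_poly[OF open_V1] hol_Av hol_ev hol_exp hol_coord open_V1)
 thus ?thesis by (simp add: hol_poly_def)
qed

lemma hol_Nv0: "hol J V1 (%v. coeff (Nv v) 0 / n0)"
 unfolding divide_inverse by (intro hol_mult hol_Nv hol_const open_V1)

lemma open_V2: "openin (cspace J) V2"
 unfolding V2_def by (intro openin_cspace_vimage open_V1 hol_continuous[OF open_V1] hol_Nv0 open_slit)

lemma V2_V1: "V2 <= V1" by (auto simp: V2_def)

lemma hol_av: "hol J V2 av"
 unfolding av_def[abs_def] divide_inverse[of "Ln _"]
 by (intro hol_mult hol_exp hol_Ln hol_const open_V2 holomorphic_fun_subset[OF hol_Nv0 V2_V1]) (simp add: V2_def)

lemma Nv0_nz: "v : V2 ==> coeff (Nv v) 0 ~= 0"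
 by (auto simp: V2_def)

lemma av_nz: "av v ~= 0" using a0_nz by (simp add: av_def)

lemma hol_G: "hol J V2 (G i)"
proof -
 have N: "hol J V2 (%v. coeff (Nv v) n)" for n by (rule holomorphic_fun_subset[OF hol_Nv V2_V1])
 consider "i < 0" | "i = 0" | "i > 0" by linarith
 thus ?thesis
 proof cases
  case 1
  thus ?thesis unfolding G_def[abs_def] parameter_of_def
   by (simp, intro hol_divide hol_exp hol_coord hol_av open_V2 av_nz)
 next
  case 2
  thus ?thesis unfolding G_def[abs_def] parameter_of_def
   by (simp, intro hol_divide hol_power hol_av open_V2 N) (simp add: av_nz)
 next
  case 3
  thus ?thesis unfolding G_def[abs_def] parameter_of_def
   by (simp, intro hol_divide hol_mult hol_power hol_av hol_const open_V2 N) (simp add: Nv0_nz)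
 qed
qed

lemma a0_power: "a0 ^ (l + 1) = (- 1) ^ (l + 1) * n0"
proof -
 have "a0 ^ (l + 1) = a0 ^ (lh + 1) * a0 ^ (kb + p)" by (simp add: l_eq power_add)
 thus ?thesis unfolding a0 by (simp add: leading_coeff_def n0_def)
qed

lemma Nv_chart:
 assumes w: "w : W2"
 shows "i : D ==> Av i (cmap J y w) = AA i w"
  "Nv (cmap J y w) = numer_poly lh kb L m (%i. AA i w) (mpole w (aa w)) (%\<a> i. eh \<a> i w)"
proof -
 have w1: "w : W1" using w W2_W1 by auto
 have v: "cmap J y w (Tc i) = t i (cmap D AA w)" if "i : T" for i
  using that y_simps(1)[OF w1] by (simp only: chart_map_apply[OF J_intros(1)])
 have b: "cmap J y w (Bc \<a>) = \<b> \<a> w" if "\<a> : {1..L}" for \<a>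
  using that y_simps(2) by (simp only: chart_map_apply[OF J_intros(2)])
 have c: "cmap J y w (Cc \<a> i) = cc \<a> i w" if "\<a> : {1..L}" "i : {1..m \<a>}" for \<a> i
  using that y_simps(3)[OF w1] by (simp add: chart_map_apply J_intros)
 have "cmap T (%i v. v (Tc i)) (cmap J y w) = cmap T t (cmap D AA w)"
  unfolding chart_map_def[of T] by (rule restrict_ext) (rule v)
 hence tv: "Av i (cmap J y w) = inv_into V (cmap T t) (cmap T t (cmap D AA w)) i" for i
  by (simp only: Av_def)
 show A: "Av i (cmap J y w) = AA i w" if i: "i : D" for i
  using fun_cong[OF chart_inverse(7)[OF finD t W2D(4)[OF w]], of i]
  by (simp only: tv chart_map_apply[OF i])
 have e: "ev \<a> i (cmap J y w) = eh \<a> i w" if "\<a> : {1..L}" "i : {1..m \<a>}" for \<a> i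
  unfolding ev_def
 proof (rule log_coeff_inject[OF _ that(2)])
  fix j assume j: "j : {1..m \<a>}"
  show "log_coeff (m \<a>) (log_solve (m \<a>) (%i. cmap J y w (Cc \<a> i)) (m \<a>)) j = log_coeff (m \<a>) (%i. eh \<a> i w) j"
   unfolding log_solve_correct[OF j] c[OF that(1) j] cc_def ..
 qed
 show "Nv (cmap J y w) = numer_poly lh kb L m (%i. AA i w) (mpole w (aa w)) (%\<a> i. eh \<a> i w)"
  unfolding Nv_def by (intro numer_poly_cong A e) (simp_all only: b exp_\<b>[OF w1] bb_def)
qed

lemma G_chart:
 assumes w: "w : W2"
 shows "coeff (Nv (cmap J y w)) 0 = aa w ^ (kb + p) * w 0" "cmap I G (cmap J y w) = w"
proof -
 have w1: "w : W1" using w W2_W1 by auto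
 note P = parameter_of_normal_form[OF W1D(1)[OF w1] aa_nz nf1[OF w1]]
 show c0: "coeff (Nv (cmap J y w)) 0 = aa w ^ (kb + p) * w 0" unfolding Nv_chart(2)[OF w] by (rule P)
 define X where "X = Ln (lc w / lc w0)"
 define r :: real where "r = of_nat (l + 1) / of_nat (lh + 1)"
 have r: "r > 0" by (simp add: r_def)
 have aa: "aa w = a0 * exp (X / of_nat (lh + 1))" by (simp add: aa_def X_def)
 have "lc w / lc w0 = w 0 / w0 0" by (simp add: leading_coeff_def)
 moreover have "exp X = lc w / lc w0" unfolding X_def using leading_coeff_nonzero[OF W1D(1)[OF w1]] lc0 by simp
 ultimately have X: "exp X = w 0 / w0 0" by simp
 have "coeff (Nv (cmap J y w)) 0 / n0 = exp (X / of_nat (lh + 1)) ^ (kb + p) * exp X"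
  unfolding c0 n0_def aa X using a0_nz by (simp add: power_mult_distrib)
 also have "... = exp (of_nat (kb + p) * (X / of_nat (lh + 1)) + X)" by (simp only: exp_add exp_of_nat_mult)
 also have "of_nat (kb + p) * (X / of_nat (lh + 1)) + X = of_real r * X"
 proof -
  have e: "l + 1 = (kb + p) + (lh + 1)" by (simp add: l_eq)
  have er: "of_real r = (of_nat (kb + p) + of_nat (lh + 1)) / (of_nat (lh + 1) :: complex)"
   unfolding r_def of_real_divide of_real_of_nat_eq e by (simp only: of_nat_add)
  have "a * (X / b) + X = (a + b) / b * X" if "b ~= 0" for a b X :: complex
   using that by (simp add: add_divide_distrib distrib_right)
  from this[OF of_nat_Suc_nz] show ?thesis unfolding er .
 qed
 finally have e: "coeff (Nv (cmap J y w)) 0 / n0 = exp (of_real r * X)" .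
 \<comment> \<open>This is what the strip in \<open>W1\<close> was made for: \<open>Ln\<close>
   recovers \<open>r * X\<close>, so the root in \<open>av\<close> is the same number as the root in
   \<open>aa\<close>.\<close>
 have "\<bar>Im X\<bar> < pi * (1 / r)" using W1D(3)[OF w1] by (simp only: X_def r_def divide_divide_eq_right mult_1)
 hence "\<bar>Im (of_real r * X)\<bar> < pi" using r by (simp add: abs_mult field_simps)
 hence "Ln (coeff (Nv (cmap J y w)) 0 / n0) = of_real r * X" unfolding e by (rule Ln_exp_strip)
 moreover have "of_real r * X / of_nat (l + 1) = X / of_nat (lh + 1)"
  using of_nat_Suc_nz[of l] unfolding r_def by (simp only: of_real_divide of_real_of_nat_eq) (simp add: divide_simps del: of_nat_Suc of_nat_add)
 ultimately have av: "av (cmap J y w) = aa w" by (simp only: av_def aa)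
 have "parameter_of (Nv (cmap J y w)) (%\<a>. exp (cmap J y w (Bc \<a>))) (aa w) i =
  parameter_of (Nv (cmap J y w)) (mpole w (aa w)) (aa w) i" if "i : I" for i
 proof (cases "i < 0")
  case True
  hence "nat (- i) : {1..L}" using that by (auto simp: parameter_index_def)
  thus ?thesis using y_simps(2) exp_\<b>[OF w1] by (simp add: parameter_of_def chart_map_apply J_intros bb_def)
 qed (simp add: parameter_of_def)
 hence "cmap I G (cmap J y w) = restrict (parameter_of (Nv (cmap J y w)) (mpole w (aa w)) (aa w)) I"
  unfolding chart_map_def[of I] G_def av by (rule restrict_ext)
 also have "... = w" unfolding Nv_chart(2)[OF w] by (rule P)
 finally show "cmap I G (cmap J y w) = w" .
qed

lemma chart_G:
 assumes v: "v : V2" and w: "cmap I G v : W2"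
 shows "cmap J y (cmap I G v) = v"
proof -
 define w where "w = cmap I G v"
 have w1: "w : W1" using w W2_W1 by (auto simp: w_def)
 have v1: "v : V1" using v V2_V1 by auto
 have weq: "w = restrict (parameter_of (Nv v) (%\<a>. exp (v (Bc \<a>))) (av v)) I"
  by (simp add: w_def chart_map_def G_def restrict_def)
 define Y where "Y = Ln (coeff (Nv v) 0 / n0)"
 have expY: "exp Y = coeff (Nv v) 0 / n0" unfolding Y_def using Nv0_nz[OF v] n0_nz by simp
 have av: "av v = a0 * exp (Y / of_nat (l + 1))" by (simp add: av_def Y_def)
 have avp: "av v ^ (l + 1) = (- 1) ^ (l + 1) * coeff (Nv v) 0"
  unfolding av power_mult_distrib exp_root expY a0_power using n0_nz by simp
 have inV: "cmap D Av v : V" unfolding Av_def[abs_def]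
  using chart_inverse(6)[OF finD t V1D(2)[OF v1, unfolded TV_def]] by (simp add: chart_map_def)
 have tA: "t i (cmap D Av v) = v (Tc i)" if "i : T" for i
 proof -
  have "cmap T t (cmap D Av v) = cmap T (%i v. v (Tc i)) v"
   unfolding Av_def[abs_def]
   using chart_inverse(8)[OF finD t V1D(2)[OF v1, unfolded TV_def]] by (simp add: chart_map_def)
  thus ?thesis using that by (metis chart_map_apply)
 qed
 have D0: "- int kb : D" by (simp add: dz_index_def)
 have A0: "Av (- int kb) v ~= 0" using inV V chart_map_apply[OF D0, of Av v] by (auto simp: dz_parameters_def)
 have e0: "ALL \<a>:{1..L}. ev \<a> (m \<a>) v ~= 0"
 proof
  fix \<a> assume that: "\<a> : {1..L}"
  have "m \<a> : {1..m \<a>}" using m1[OF that] by simp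
  hence "log_coeff (m \<a>) (%i. ev \<a> i v) (m \<a>) = v (Cc \<a> (m \<a>))"
   unfolding ev_def using log_solve_correct by auto
  thus "ev \<a> (m \<a>) v ~= 0" using V1D(4)[OF v1 that] m1[OF that] by (simp add: log_coeff_top)
 qed
 note P = normal_form_parameter_of[of "av v" "%i. Av i v" "%\<a>. exp (v (Bc \<a>))" "%\<a> i. ev \<a> i v", folded Nv_def,
   OF avp V1D(5)[OF v1] exp_not_eq_zero A0 e0, folded weq]
 have wW: "w : W" by (rule P)
 have aav: "aa w = av v"
 proof -
  \<comment> \<open>In this direction the logarithm is multiplied by a factor at most 1, so the
    principal strip is preserved and the branches agree again.\<close>
  define r :: real where "r = of_nat (lh + 1) / of_nat (l + 1)"
  have r: "r > 0" "r <= 1" by (simp_all add: r_def l_eq)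
  have "lc w / lc w0 = exp (Y / of_nat (l + 1)) ^ (lh + 1)"
   using P(3) a0 a0_nz lc0 by (simp only: av power_mult_distrib) (simp add: field_simps)
  also have "... = exp (of_nat (lh + 1) * (Y / of_nat (l + 1)))" by (simp only: exp_of_nat_mult)
  also have "of_nat (lh + 1) * (Y / of_nat (l + 1)) = of_real r * Y" unfolding r_def by simp
  finally have e: "lc w / lc w0 = exp (of_real r * Y)" .
  have "coeff (Nv v) 0 / n0 ~: nonpos_Reals" using v by (simp add: V2_def)
  hence "\<bar>Im Y\<bar> < pi" unfolding Y_def by (rule abs_Im_Ln)
  moreover have "r * \<bar>Im Y\<bar> <= 1 * \<bar>Im Y\<bar>" using r by (intro mult_right_mono) auto
  ultimately have "\<bar>Im (of_real r * Y)\<bar> < pi" using r by (simp add: abs_mult)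
  hence "Ln (lc w / lc w0) = of_real r * Y" unfolding e by (rule Ln_exp_strip)
  moreover have "of_real r * Y / of_nat (lh + 1) = Y / of_nat (l + 1)"
   using of_nat_Suc_nz[of lh] unfolding r_def by (simp only: of_real_divide of_real_of_nat_eq) (simp add: divide_simps del: of_nat_Suc of_nat_add)
  ultimately show ?thesis by (simp only: aa_def av)
 qed
 have nfw: "normal_form lh kb ms w (aa w) (%i. Av i v) (%\<a> i. ev \<a> i v)" unfolding aav by (rule P)
 have AAv: "cmap D AA w = cmap D Av v"
  using normal_form_h_coeffs[OF wW aa_nz nfw] h_coeffs_AA[OF w1] by (simp add: chart_map_def)
 have bv: "bb \<a> w = exp (v (Bc \<a>))" if "\<a> : {1..L}" for \<a> unfolding bb_def aav by (rule P(5)[OF that])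
 show ?thesis unfolding w_def[symmetric]
 proof (rule extensionalityI[OF chart_map_extensional V1D(1)[OF v1]])
  fix j assume j: "j : J"
  have "y j w = v j" using j
  proof (cases rule: J_cases)
   case (1 i)
   thus ?thesis using y_simps(1)[OF w1] AAv tA by simp
  next
   case (2 \<a>)
   have "bb \<a> w / bb \<a> w0 = exp (v (Bc \<a>) - \<b> \<a> w0)"
    using 2 exp_\<b>[OF w0_W1] by (simp add: bv exp_diff)
   hence "Ln (bb \<a> w / bb \<a> w0) = v (Bc \<a>) - \<b> \<a> w0" using V1D(3)[OF v1] 2 by (simp only: Ln_exp_strip)
   thus ?thesis using 2 \<b>_w0 by (simp add: y_simps(2) \<b>_def[of \<a> w])
  next
   case (3 \<a> i)
   have "y (Cc \<a> i) w = log_coeff (m \<a>) (%i. ev \<a> i v) i"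
    unfolding y_def joint_coords.simps c_coord_def
    by (rule normal_form_collision_coeff[OF wW aa_nz nfw 3(1)]) (insert 3 exp_\<b>[OF w1], auto simp: bb_def)
   also have "... = v (Cc \<a> i)" unfolding ev_def by (rule log_solve_correct[OF 3(2)])
   finally show ?thesis using 3 by simp
  qed
  thus "cmap J y w j = v j" by (simp only: chart_map_apply[OF j])
 qed
qed

section \<open>The domain of the collision coordinates\<close>

definition U where "U = {w : W2. cmap J y w : V2}"

lemma chart_y: "csys I U J y"
 unfolding U_def by (rule coordinate_system_local[OF finI finJ open_W2 open_V2 hol_y hol_G G_chart(2) chart_G])

lemma U_W2: "U <= W2" by (auto simp: U_def)

lemma w0_U: "w0 : U"
proof -
 let ?v = "cmap J y w0"
 have c: "?v (Bc \<a>) = \<b> \<a> w0" "?v (Cc \<a> (m \<a>)) = cc \<a> (m \<a>) w0" if "\<a> : {1..L}" for \<a>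
  using that m1[OF that] y_simps(2,3) w0_W1 by (simp_all add: chart_map_apply J_intros)
 have "cmap T (%i v. v (Tc i)) ?v = cmap T t (cmap D AA w0)"
  unfolding chart_map_def[of T] using y_simps(1)[OF w0_W1]
  by (intro restrict_ext) (simp add: chart_map_apply J_intros)
 hence TV: "cmap T (%i v. v (Tc i)) ?v : TV" using W2D(4)[OF w0_W2] by (auto simp: TV_def)
 have "inj_on (%\<a>. bb \<a> w0) {1..L}" unfolding bb_def
  using movable_pole_distinct[OF w0 aa_nz] by (meson inj_onI)
 hence "(PROD \<a>=1..L. PROD \<g>:{1..L}-{\<a>}. exp (?v (Bc \<a>)) - exp (?v (Bc \<g>))) ~= 0"
  using c(1) exp_\<b>[OF w0_W1] by (auto simp: inj_on_def)
 hence "?v : V1" unfolding V1_def using TV c cc_top[OF w0_W1] chart_map_extensional[of J y w0] by auto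
 moreover have "coeff (Nv ?v) 0 / n0 = 1" using G_chart(1)[OF w0_W2] n0_nz by (simp add: n0_def aa_w0)
 ultimately show ?thesis using w0_W2 by (simp add: U_def V2_def)
qed

lemma collision_coordinates_subset:
 assumes "U' <= U" "openin (cspace I) U'"
 shows "collision_coordinates lh kb ms V t U' aa \<b>"
proof -
 have sub: "U' <= W1" using assms(1) U_W2 W2_W1 by blast
 show ?thesis unfolding collision_coordinates_def
 proof (intro conjI ballI)
  show "U' <= W" using sub W1D(1) by blast
  show "hol I U' aa" by (rule holomorphic_fun_subset[OF hol_aa sub])
  show "csys I U' J (joint_coords (lift_t lh kb ms t aa) \<b> (c_coord lh kb ms aa \<b>))"
   using coordinate_system_restrict[OF finI finJ chart_y assms(2,1)] by (simp add: y_def)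
 next
  fix w assume w: "w : U'"
  hence w1: "w : W1" and w2: "w : W2" using sub assms(1) U_W2 by auto
  show "aa w ^ (lh + 1) = lc w" by (rule aa_power[OF w1])
  show "h_coeffs lh kb ms w (aa w) : V" unfolding h_coeffs_AA[OF w1] by (rule W2D(4)[OF w2])
  show "exp (\<b> \<a> w) = mpole w (aa w) \<a>" if "\<a> : {1..L}" for \<a>
   using exp_\<b>[OF w1 that] by (simp add: bb_def)
 qed
qed

end

section \<open>Flat coordinates of the clusters\<close>

lemma coordinate_system_cong:
 assumes I: "finite I" and J: "finite J" and c: "csys I U J y"
  and eq: "!!j w. j : J ==> w : U ==> y' j w = y j w"
 shows "csys I U J y'"
proof -
 note inv = chart_inverse[OF I c]
 have ch: "cmap J y' w = cmap J y w" if "w : U" for w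
  unfolding chart_map_def by (rule restrict_ext) (rule eq[OF _ that])
 show ?thesis
 proof (rule coordinate_systemI(1)[OF inv(1) J inv(2) _ inv(4)])
  show "hol I U (y' j)" if "j : J" for j
   by (subst holomorphic_fun_cong[OF I inv(1), of _ "y j"]) (use eq inv(3) that in auto)
  show "cmap J y' w : cmap J y ` U" if "w : U" for w
   unfolding ch[OF that] by (rule inv(5)[OF that])
  show "cmap I (%i v. inv_into U (cmap J y) v i) v : U" if "v : cmap J y ` U" for v
   by (rule inv(6)[OF that])
  show "cmap I (%i v. inv_into U (cmap J y) v i) (cmap J y' w) = w" if "w : U" for w
   unfolding ch[OF that] by (rule inv(7)[OF that])
  show "cmap J y' (cmap I (%i v. inv_into U (cmap J y) v i) v) = v" if "v : cmap J y ` U" for v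
   unfolding ch[OF inv(6)[OF that]] by (rule inv(8)[OF that])
 qed
qed

lemma cluster_flat_cong:
 assumes "0 < k" "k < m" "!!i. i : {1..m} ==> c i = c' i"
 shows "cluster_flat (cluster_poly m k) m k s c = cluster_flat (cluster_poly m k) m k s c'"
proof -
 have "cluster_poly m k (%i. c i / c m) = cluster_poly m k (%i. c' i / c' m)"
  by (rule cluster_poly_cong) (use assms in auto)
 thus ?thesis by (simp add: cluster_flat_def)
qed

lemma exp_strip_slit: "\<bar>Im z\<bar> < pi ==> exp z ~: nonpos_Reals"
proof
 assume z: "\<bar>Im z\<bar> < pi" and e: "exp z : nonpos_Reals"
 have "Re (exp z) ~= 0 \<or> Im (exp z) ~= 0" using exp_not_eq_zero[of z] unfolding complex_eq_iff by simp
 hence "Im (Ln (exp z)) = pi"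
  using e by (subst Im_Ln_eq_pi) (auto simp: complex_nonpos_Reals_iff less_le simp del: Re_exp Im_exp)
 thus False using z by (simp add: Ln_exp_strip)
qed

context chart
begin

definition s0 where "s0 \<a> = exp (Ln (cc \<a> (m \<a>) w0) / of_nat (m \<a>))"
definition root where "root \<a> x = s0 \<a> * exp (Ln (x / cc \<a> (m \<a>) w0) / of_nat (m \<a>))"

text \<open>For \<open>m \<a> = 1\<close> the labels 1 and \<open>m \<a>\<close> coincide.
  \<open>z\<close> tests the former first and \<open>z'\<close> the latter; both then give
  \<open>c\<^sub>1\<close>, which is its own first root.\<close>

primrec z :: "coord_label => (coord_label => complex) => complex" where
 "z (Tc i) v = v (Tc i)"
| "z (Bc \<a>) v = v (Bc \<a>)"
| "z (Cc \<a> k) v = (if k = 1 then v (Cc \<a> 1) else if k = m \<a> then root \<a> (v (Cc \<a> (m \<a>)))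
   else cluster_flat (cluster_poly (m \<a>) k) (m \<a>) k (root \<a> (v (Cc \<a> (m \<a>)))) (%i. v (Cc \<a> i)))"

primrec z' :: "coord_label => (coord_label => complex) => complex" where
 "z' (Tc i) u = u (Tc i)"
| "z' (Bc \<a>) u = u (Bc \<a>)"
| "z' (Cc \<a> k) u = (if k = m \<a> then u (Cc \<a> (m \<a>)) ^ m \<a> else if k = 1 then u (Cc \<a> 1)
   else u (Cc \<a> (m \<a>)) ^ m \<a> * cluster_solve (m \<a>) (%k. u (Cc \<a> k) / u (Cc \<a> (m \<a>)) ^ k) (m \<a> - 2) k)"

definition Z1 :: "(coord_label => complex) set" where
 "Z1 = {v : extensional J. ALL \<a>:{1..L}. v (Cc \<a> (m \<a>)) / cc \<a> (m \<a>) w0 : - nonpos_Reals}"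
text \<open>The image of \<open>Z1\<close>: a root is admissible if its \<open>m\<close>-th power
  stays in the slit plane and \<open>Ln\<close> of that power is \<open>m\<close> times
  \<open>Ln\<close> of the root.\<close>

definition Z2 :: "(coord_label => complex) set" where
 "Z2 = {u : {u : extensional J. ALL \<a>:{1..L}. u (Cc \<a> (m \<a>)) / s0 \<a> : - nonpos_Reals}.
   ALL \<a>:{1..L}. of_nat (m \<a>) * Ln (u (Cc \<a> (m \<a>)) / s0 \<a>) : {z. \<bar>Im z\<bar> < pi}}"

lemma m_nz: "\<a> : {1..L} ==> of_nat (m \<a>) ~= (0 :: complex)"
 using m1[of \<a>] unfolding of_nat_eq_0_iff by simp

lemma exp_root_m: "\<a> : {1..L} ==> exp (x / of_nat (m \<a>)) ^ m \<a> = exp (x :: complex)"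
 by (simp only: exp_of_nat_mult[symmetric] times_divide_eq_right nonzero_mult_div_cancel_left[OF m_nz])

lemma s0_power: "\<a> : {1..L} ==> s0 \<a> ^ m \<a> = cc \<a> (m \<a>) w0"
 using cc_top[OF w0_W1] by (simp add: s0_def exp_root_m)

lemma s0_nz: "s0 \<a> ~= 0" by (simp add: s0_def)

lemma root_nz: "root \<a> x ~= 0" by (simp add: root_def s0_nz)

lemma root_power: "\<a> : {1..L} ==> x ~= 0 ==> root \<a> x ^ m \<a> = x"
 using cc_top[OF w0_W1] by (simp add: root_def power_mult_distrib s0_power exp_root_m)

lemma root_unique:
 assumes \<a>: "\<a> : {1..L}" and x: "x / s0 \<a> ~: nonpos_Reals" "\<bar>Im (of_nat (m \<a>) * Ln (x / s0 \<a>))\<bar> < pi"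
 shows "root \<a> (x ^ m \<a>) = x" "x ^ m \<a> / cc \<a> (m \<a>) w0 ~: nonpos_Reals"
proof -
 have nz: "x / s0 \<a> ~= 0" using x(1) by auto
 have "x ^ m \<a> / cc \<a> (m \<a>) w0 = (x / s0 \<a>) ^ m \<a>" by (simp add: power_divide s0_power[OF \<a>])
 also have "... = exp (of_nat (m \<a>) * Ln (x / s0 \<a>))" using nz by (simp only: exp_of_nat_mult exp_Ln[OF nz])
 finally have e: "x ^ m \<a> / cc \<a> (m \<a>) w0 = exp (of_nat (m \<a>) * Ln (x / s0 \<a>))" .
 show "x ^ m \<a> / cc \<a> (m \<a>) w0 ~: nonpos_Reals" unfolding e by (rule exp_strip_slit[OF x(2)])
 show "root \<a> (x ^ m \<a>) = x"
  unfolding root_def e Ln_exp_strip[OF x(2)] nonzero_mult_div_cancel_left[OF m_nz[OF \<a>]] exp_Ln[OF nz] using s0_nz by simp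
qed

lemma root_range:
 assumes \<a>: "\<a> : {1..L}" and x: "x / cc \<a> (m \<a>) w0 ~: nonpos_Reals"
 shows "root \<a> x / s0 \<a> ~: nonpos_Reals" "\<bar>Im (of_nat (m \<a>) * Ln (root \<a> x / s0 \<a>))\<bar> < pi"
proof -
 let ?X = "Ln (x / cc \<a> (m \<a>) w0)"
 have X: "\<bar>Im ?X\<bar> < pi" by (rule abs_Im_Ln[OF x])
 have "\<bar>Im (?X / of_nat (m \<a>))\<bar> = \<bar>Im ?X\<bar> / of_nat (m \<a>)" by (simp add: Im_divide_of_nat)
 also have "... <= \<bar>Im ?X\<bar>" using m1[OF \<a>] by (simp add: divide_le_eq mult_le_cancel_left1)
 finally have X': "\<bar>Im (?X / of_nat (m \<a>))\<bar> < pi" using X by simp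
 have e: "root \<a> x / s0 \<a> = exp (?X / of_nat (m \<a>))" using s0_nz by (simp add: root_def)
 show "root \<a> x / s0 \<a> ~: nonpos_Reals" unfolding e by (rule exp_strip_slit[OF X'])
 show "\<bar>Im (of_nat (m \<a>) * Ln (root \<a> x / s0 \<a>))\<bar> < pi"
  unfolding e Ln_exp_strip[OF X'] times_divide_eq_right nonzero_mult_div_cancel_left[OF m_nz[OF \<a>]] by (rule X)
qed

lemma open_Z1: "openin (cspace J) Z1" and open_Z2: "openin (cspace J) Z2"
proof -
 have E: "openin (cspace J) (extensional J)" by (simp add: cspace_eq)
 show "openin (cspace J) Z1" unfolding Z1_def divide_inverse
  by (intro openin_cspace_vimage_ball E hol_continuous[OF E] hol_mult hol_coord hol_const open_slit) simp
 have 1: "openin (cspace J) {u : extensional J. ALL \<a>:{1..L}. u (Cc \<a> (m \<a>)) / s0 \<a> : - nonpos_Reals}" (is "openin _ ?U")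
  unfolding divide_inverse
  by (intro openin_cspace_vimage_ball E hol_continuous[OF E] hol_mult hol_coord hol_const open_slit) simp
 have "hol J ?U (%u. u (Cc \<a> (m \<a>)) / s0 \<a>)" for \<a>
  by (rule hol_divide[OF 1 hol_coord[OF 1] hol_const[OF 1] s0_nz])
 hence h: "hol J ?U (%u. of_nat (m \<a>) * Ln (u (Cc \<a> (m \<a>)) / s0 \<a>))" if "\<a> : {1..L}" for \<a>
  by (intro hol_mult hol_const hol_Ln 1) (use that in auto)
 show "openin (cspace J) Z2" unfolding Z2_def
  by (rule openin_cspace_vimage_ball[OF 1 finite_atLeastAtMost hol_continuous[OF 1] open_strip]) (rule h)
qed

lemma Z1D:
 assumes "v : Z1"
 shows "v : extensional J" "\<a> : {1..L} ==> v (Cc \<a> (m \<a>)) / cc \<a> (m \<a>) w0 ~: nonpos_Reals"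
  "\<a> : {1..L} ==> v (Cc \<a> (m \<a>)) ~= 0"
proof -
 show 1: "v (Cc \<a> (m \<a>)) / cc \<a> (m \<a>) w0 ~: nonpos_Reals" if "\<a> : {1..L}" for \<a> using assms that by (simp add: Z1_def)
 show "v (Cc \<a> (m \<a>)) ~= 0" if "\<a> : {1..L}" using 1[OF that] by auto
qed (insert assms, simp add: Z1_def)

lemma Z2D:
 assumes "u : Z2"
 shows "u : extensional J" "\<a> : {1..L} ==> u (Cc \<a> (m \<a>)) / s0 \<a> ~: nonpos_Reals"
  "\<a> : {1..L} ==> \<bar>Im (of_nat (m \<a>) * Ln (u (Cc \<a> (m \<a>)) / s0 \<a>))\<bar> < pi" "\<a> : {1..L} ==> u (Cc \<a> (m \<a>)) ~= 0"
proof -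
 show 1: "u (Cc \<a> (m \<a>)) / s0 \<a> ~: nonpos_Reals" if "\<a> : {1..L}" for \<a> using assms that by (simp add: Z2_def)
 show "u (Cc \<a> (m \<a>)) ~= 0" if "\<a> : {1..L}" using 1[OF that] by auto
 show "\<bar>Im (of_nat (m \<a>) * Ln (u (Cc \<a> (m \<a>)) / s0 \<a>))\<bar> < pi" if "\<a> : {1..L}"
  using assms that unfolding Z2_def by blast
qed (insert assms, simp add: Z2_def)

lemma hol_root: "\<a> : {1..L} ==> hol J Z1 (%v. root \<a> (v (Cc \<a> (m \<a>))))"
proof -
 assume \<a>: "\<a> : {1..L}"
 have h: "hol J Z1 (%v. v (Cc \<a> (m \<a>)) / cc \<a> (m \<a>) w0)"
  by (rule hol_divide[OF open_Z1 hol_coord[OF open_Z1] hol_const[OF open_Z1] cc_top[OF w0_W1 \<a>]])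
 show ?thesis unfolding root_def divide_inverse[of "Ln _"]
  by (rule hol_mult[OF open_Z1 hol_const[OF open_Z1] hol_exp[OF open_Z1 hol_mult[OF open_Z1 hol_Ln[OF open_Z1 h] hol_const[OF open_Z1]]]])
   (rule Z1D(2)[OF _ \<a>])
qed

text \<open>Given the root \<open>s\<close>, division of the other coordinates by powers of
  \<open>s\<close> leaves a system for the ratios \<open>c\<^sub>i / c\<^sub>m\<close>, which
  \<open>cluster_solve\<close> inverts.\<close>

lemma coordinate_system_z: "csys J Z1 J z"
proof (rule coordinate_systemI(1)[OF open_Z1 finJ open_Z2])
 show "hol J Z1 (z j)" if "j : J" for j
  using that
 proof (cases rule: J_cases)
  case (3 \<a> k)
  consider "k = 1" | "k ~= 1" "k = m \<a>" | "k ~= 1" "k ~= m \<a>" by blast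
  thus ?thesis
  proof cases
   case 1
   hence "z j = (%v. v (Cc \<a> 1))" using 3 by (simp add: fun_eq_iff)
   thus ?thesis by (simp add: hol_coord[OF open_Z1])
  next
   case 2
   hence "z j = (%v. root \<a> (v (Cc \<a> (m \<a>))))" using 3 by (simp add: fun_eq_iff)
   thus ?thesis by (simp add: hol_root[OF 3(1)])
  next
   case c: 3
   hence zj: "z j = (%v. root \<a> (v (Cc \<a> (m \<a>))) ^ k * cluster_poly (m \<a>) k (%i. v (Cc \<a> i) / v (Cc \<a> (m \<a>))))"
    using 3 by (simp add: fun_eq_iff cluster_flat_def)
   show ?thesis unfolding zj
    by (intro hol_mult hol_power hol_root[OF 3(1)] hol_polynomial[OF open_Z1 polynomial_in_cluster_poly] hol_divide hol_coord open_Z1 Z1D(3)[OF _ 3(1)])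
  qed
 qed (simp_all add: z.simps[abs_def] hol_coord[OF open_Z1])
 show "hol J Z2 (z' j)" if "j : J" for j
  using that
 proof (cases rule: J_cases)
  case (3 \<a> k)
  note o = open_Z2
  consider "k = m \<a>" | "k ~= m \<a>" "k = 1" | "k ~= 1" "k ~= m \<a>" by blast
  thus ?thesis
  proof cases
   case 1
   hence "z' j = (%v. v (Cc \<a> (m \<a>)) ^ m \<a>)" using 3 by (simp add: fun_eq_iff)
   thus ?thesis by (simp add: hol_power[OF o] hol_coord[OF o])
  next
   case 2
   hence "z' j = (%v. v (Cc \<a> 1))" using 3 by (simp add: fun_eq_iff)
   thus ?thesis by (simp add: hol_coord[OF o])
  next
   case c: 3
   hence zj: "z' j = (%u. u (Cc \<a> (m \<a>)) ^ m \<a> * cluster_solve (m \<a>) (%k. u (Cc \<a> k) / u (Cc \<a> (m \<a>)) ^ k) (m \<a> - 2) k)"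
    using 3 by (simp add: fun_eq_iff)
   have "u (Cc \<a> (m \<a>)) ^ n ~= 0" if "u : Z2" for u n using Z2D(4)[OF that 3(1)] by simp
   thus ?thesis unfolding zj
    by (intro hol_mult[OF o] hol_power[OF o] hol_cluster_solve[OF o] hol_divide[OF o] hol_coord[OF o]) auto
  qed
 qed (simp_all add: z'.simps[abs_def] hol_coord[OF open_Z2])
next
 fix v assume v: "v : Z1"
 have zm: "z (Cc \<a> (m \<a>)) v = root \<a> (v (Cc \<a> (m \<a>)))" if \<a>: "\<a> : {1..L}" for \<a>
 proof (cases "m \<a> = 1")
  case True
  thus ?thesis using root_power[OF \<a> Z1D(3)[OF v \<a>]] by simp
 qed simp
 have cz: "cmap J z v (Cc \<a> k) = z (Cc \<a> k) v" if "\<a> : {1..L}" "k : {1..m \<a>}" for \<a> k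
  by (rule chart_map_apply[OF J_intros(3)[OF that]])
 have mm: "m \<a> : {1..m \<a>}" if "\<a> : {1..L}" for \<a> using m1[OF that] by simp
 have czm: "cmap J z v (Cc \<a> (m \<a>)) = root \<a> (v (Cc \<a> (m \<a>)))" if "\<a> : {1..L}" for \<a>
  using cz[OF that mm[OF that]] zm[OF that] by simp
 show "cmap J z v : Z2"
  unfolding Z2_def using root_range[OF _ Z1D(2)[OF v]] czm by (auto simp: chart_map_extensional)
 show "cmap J z' (cmap J z v) = v"
 proof (rule extensionalityI[OF chart_map_extensional Z1D(1)[OF v]])
  fix j assume j: "j : J"
  have "z' j (cmap J z v) = v j" using j
  proof (cases rule: J_cases)
   case (3 \<a> k)
   note pw = root_power[OF 3(1) Z1D(3)[OF v 3(1)]]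
   consider "k = m \<a>" | "k ~= m \<a>" "k = 1" | "2 <= k" "k < m \<a>" using 3(2) by fastforce
   thus ?thesis
   proof cases
    case 1
    thus ?thesis using 3 by (simp add: czm pw)
   next
    case 2
    thus ?thesis using 3 cz[of \<a> 1] by simp
   next
    case c: 3
    have "cluster_solve (m \<a>) (%k. cmap J z v (Cc \<a> k) / cmap J z v (Cc \<a> (m \<a>)) ^ k) (m \<a> - 2) k = v (Cc \<a> k) / v (Cc \<a> (m \<a>))"
    proof (rule cluster_solve_unique[OF _ c])
     fix i assume i: "2 <= i" "i < m \<a>"
     show "cluster_poly (m \<a>) i (%k. v (Cc \<a> k) / v (Cc \<a> (m \<a>))) = cmap J z v (Cc \<a> i) / cmap J z v (Cc \<a> (m \<a>)) ^ i"
      using cz[OF 3(1), of i] i root_nz by (simp add: czm[OF 3(1)] cluster_flat_def)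
    qed
    thus ?thesis using 3 c Z1D(3)[OF v 3(1)] by (simp add: czm pw)
   qed
  qed (simp_all add: chart_map_apply J_intros)
  thus "cmap J z' (cmap J z v) j = v j" by (simp only: chart_map_apply[OF j])
 qed
next
 fix u assume u: "u : Z2"
 have mm: "m \<a> : {1..m \<a>}" if "\<a> : {1..L}" for \<a> using m1[OF that] by simp
 have cz: "cmap J z' u (Cc \<a> k) = z' (Cc \<a> k) u" if "\<a> : {1..L}" "k : {1..m \<a>}" for \<a> k
  by (rule chart_map_apply[OF J_intros(3)[OF that]])
 have czm: "cmap J z' u (Cc \<a> (m \<a>)) = u (Cc \<a> (m \<a>)) ^ m \<a>" if "\<a> : {1..L}" for \<a>
  using cz[OF that mm[OF that]] by simp
 note root = root_unique[OF _ Z2D(2)[OF u] Z2D(3)[OF u]]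
 show "cmap J z' u : Z1"
  unfolding Z1_def using root(2) czm by (auto simp: chart_map_extensional)
 show "cmap J z (cmap J z' u) = u"
 proof (rule extensionalityI[OF chart_map_extensional Z2D(1)[OF u]])
  fix j assume j: "j : J"
  have "z j (cmap J z' u) = u j" using j
  proof (cases rule: J_cases)
   case (3 \<a> k)
   consider "k = 1" "m \<a> = 1" | "k = 1" "m \<a> ~= 1" | "k ~= 1" "k = m \<a>" | "2 <= k" "k < m \<a>" using 3(2) by fastforce
   thus ?thesis
   proof cases
    case 1
    thus ?thesis using 3 czm[OF 3(1)] by simp
   next
    case 2
    thus ?thesis using 3 cz[of \<a> 1] by simp
   next
    case c: 3
    thus ?thesis using 3 root(1)[OF 3(1) 3(1) 3(1)] by (simp add: czm[OF 3(1)])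
   next
    case c: 4
    have nz: "u (Cc \<a> (m \<a>)) ~= 0" by (rule Z2D(4)[OF u 3(1)])
    have "cluster_poly (m \<a>) k (%i. cmap J z' u (Cc \<a> i) / cmap J z' u (Cc \<a> (m \<a>))) =
     cluster_poly (m \<a>) k (cluster_solve (m \<a>) (%k. u (Cc \<a> k) / u (Cc \<a> (m \<a>)) ^ k) (m \<a> - 2))"
    proof (rule cluster_poly_cong)
     fix i assume "m \<a> - k < i" "i < m \<a>"
     hence i: "i : {1..m \<a>}" "i ~= 1" "i ~= m \<a>" using c by auto
     thus "cmap J z' u (Cc \<a> i) / cmap J z' u (Cc \<a> (m \<a>)) =
      cluster_solve (m \<a>) (%k. u (Cc \<a> k) / u (Cc \<a> (m \<a>)) ^ k) (m \<a> - 2) i"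
      using nz by (simp add: cz[OF 3(1) i(1)] czm[OF 3(1)])
    qed (use c in auto)
    also have "... = u (Cc \<a> k) / u (Cc \<a> (m \<a>)) ^ k" by (rule cluster_solve_correct[OF c])
    finally show ?thesis using 3 c nz root(1)[OF 3(1) 3(1) 3(1)] by (simp add: czm[OF 3(1)] cluster_flat_def)
   qed
  qed (simp_all add: chart_map_apply J_intros)
  thus "cmap J z (cmap J z' u) j = u j" by (simp only: chart_map_apply[OF j])
 qed
qed

definition \<tau> where "\<tau> \<a> k w = z (Cc \<a> k) (cmap J y w)"

definition y' where "y' = joint_coords (lift_t lh kb ms t aa) \<b> \<tau>"

lemma chart_y': "csys I U J y'"
proof (rule coordinate_system_cong[OF finI finJ coordinate_system_compose[OF finI finJ finJ chart_y coordinate_system_z]])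
 show "cmap J y ` U <= Z1"
  using V2_V1 by (auto simp: U_def Z1_def V1_def)
 show "y' j w = z j (cmap J y w)" if "j : J" "w : U" for j w
  using that(1) by (cases rule: J_cases) (simp_all add: y'_def y_def \<tau>_def chart_map_apply J_intros)
qed

definition sr where "sr \<a> w = root \<a> (cc \<a> (m \<a>) w)"

lemma \<tau>_eq:
 assumes w: "w : W1" and \<a>: "\<a> : {1..L}"
 shows "\<tau> \<a> 1 w = cc \<a> 1 w" "\<tau> \<a> (m \<a>) w = sr \<a> w"
  "k : {2..<m \<a>} ==> \<tau> \<a> k w = cluster_flat (cluster_poly (m \<a>) k) (m \<a>) k (sr \<a> w) (%i. cc \<a> i w)"
proof -
 have c: "cmap J y w (Cc \<a> i) = cc \<a> i w" if "i : {1..m \<a>}" for i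
  using that y_simps(3)[OF w \<a>] by (simp add: chart_map_apply[OF J_intros(3)[OF \<a> that]])
 have mm: "m \<a> : {1..m \<a>}" "1 : {1..m \<a>}" using m1[OF \<a>] by auto
 show 1: "\<tau> \<a> 1 w = cc \<a> 1 w" by (simp add: \<tau>_def c[OF mm(2)] del: One_nat_def)
 show "\<tau> \<a> (m \<a>) w = sr \<a> w"
 proof (cases "m \<a> = 1")
  case True
  thus ?thesis using 1 root_power[OF \<a> cc_top[OF w \<a>]] by (simp add: sr_def)
 qed (simp add: \<tau>_def c[OF mm(1)] sr_def)
 show "\<tau> \<a> k w = cluster_flat (cluster_poly (m \<a>) k) (m \<a>) k (sr \<a> w) (%i. cc \<a> i w)" if k: "k : {2..<m \<a>}"
 proof -
  have "\<tau> \<a> k w = cluster_flat (cluster_poly (m \<a>) k) (m \<a>) k (sr \<a> w) (%i. cmap J y w (Cc \<a> i))"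
   using k by (simp add: \<tau>_def c[OF mm(1)] sr_def)
  also have "... = cluster_flat (cluster_poly (m \<a>) k) (m \<a>) k (sr \<a> w) (%i. cc \<a> i w)"
   by (rule cluster_flat_cong) (use k c in auto)
  finally show ?thesis .
 qed
qed

lemma cluster_relation_\<tau>:
 assumes w: "w : W1" and \<a>: "\<a> : {1..L}"
 shows "cluster_relation cluster_poly (m \<a>) (%i. c_coord lh kb ms aa \<b> \<a> i w) (%k. \<tau> \<a> k w)"
proof -
 have c: "c_coord lh kb ms aa \<b> \<a> i w = cc \<a> i w" if "1 <= i" for i
  using y_simps(3)[OF w \<a> that] by (simp add: y_def)
 show ?thesis
  unfolding cluster_relation_def
 proof (intro conjI ballI)
  show "\<tau> \<a> 1 w = c_coord lh kb ms aa \<b> \<a> 1 w" by (simp only: \<tau>_eq(1)[OF w \<a>] c)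
  show "\<tau> \<a> (m \<a>) w ^ m \<a> = c_coord lh kb ms aa \<b> \<a> (m \<a>) w"
   by (simp only: \<tau>_eq(2)[OF w \<a>] c[OF m1[OF \<a>]] sr_def root_power[OF \<a> cc_top[OF w \<a>]])
  fix k assume k: "k : {2..<m \<a>}"
  show "\<tau> \<a> k w = cluster_flat (cluster_poly (m \<a>) k) (m \<a>) k (\<tau> \<a> (m \<a>) w) (%i. c_coord lh kb ms aa \<b> \<a> i w)"
   unfolding \<tau>_eq(2)[OF w \<a>] \<tau>_eq(3)[OF w \<a> k] by (rule cluster_flat_cong) (use k c in auto)
 qed
qed

end

section \<open>The metric of the Dubrovin--Zhang manifold\<close>

lemma residue_sum_linear:
 assumes "open s" "z : s" "!!k. k : K ==> f k holomorphic_on s - {z}"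
 shows "residue (%w. SUM k:K. c k * f k w) z = (SUM k:K. c k * residue (f k) z)"
 using assms(3)
proof (induction K rule: infinite_finite_induct)
 case (insert k K)
 have h: "(%w. c k * f k w) holomorphic_on s - {z}" "(%w. SUM k:K. c k * f k w) holomorphic_on s - {z}"
  using insert.prems by (auto intro!: holomorphic_intros)
 show ?case
  using residue_add[OF assms(1,2) h] residue_lmul[OF assms(1,2), of "f k" "c k"] insert by simp
qed (simp_all add: residue_const)

definition dz_pairing :: "nat => nat => (int => complex) => int => int => complex => complex" where
 "dz_pairing lh kb A i j \<nu> = \<nu> powi i * \<nu> powi j / (\<nu>^2 * dz_deriv lh kb A \<nu>)"

text \<open>Adding a constant to \<open>h\<close> changes neither its derivative nor its variations;
  so \<open>\<partial>/\<partial>A_0\<close> preserves the metric.\<close>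

lemma dz_deriv_invariant: "dz_deriv lh kb (A(0 := x)) = dz_deriv lh kb A"
 unfolding dz_deriv_def by (intro ext arg_cong2[where f = "(+)"] refl sum.cong) auto

lemma pderiv_dz_superpotential:
 assumes "i : dz_ix lh kb"
 shows "pd i (%A. dzs lh kb A \<mu>) A = \<mu> powi i"
proof -
 have e: "dzs lh kb (A(i := x)) \<mu> =
  (\<mu> ^ (lh + 1) + (SUM k:dz_ix lh kb - {i}. A k * \<mu> powi k)) + x * \<mu> powi i" for x
  using sum.remove[OF finite_dz_index assms, of "%k. (A(i := x)) k * \<mu> powi k"]
  by (simp add: dz_superpotential_def)
 show ?thesis unfolding pderiv_at_def e by (rule DERIV_imp_deriv) (auto intro!: derivative_eq_intros)
qed

context lg_data
begin

lemma dz_crit_open: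
 assumes "q : dz_crit"
 shows "open (- (insert 0 dz_crit - {q}))" "q : - (insert 0 dz_crit - {q})"
  "- (insert 0 dz_crit - {q}) - {q} <= - insert 0 dz_crit"
proof -
 show "open (- (insert 0 dz_crit - {q}))" by (rule open_Compl, rule finite_imp_closed) (simp add: finite_dz_crit)
qed (use assms in auto)

lemma dz_pairing_holomorphic: "dz_pairing lh kb A i j holomorphic_on - insert 0 dz_crit"
proof -
 have p: "(%\<nu>. \<nu> powi i) holomorphic_on - insert 0 dz_crit" for i by (intro holomorphic_intros) auto
 have q: "(%\<nu>. \<nu>^2) holomorphic_on - insert 0 dz_crit" by (intro holomorphic_intros)
 have d: "dz_deriv lh kb A holomorphic_on - insert 0 dz_crit" by (rule dz_deriv_holomorphic) simp
 have nz: "\<nu>^2 * dz_deriv lh kb A \<nu> ~= 0" if "\<nu> : - insert 0 dz_crit" for \<nu> using that by (auto simp: dz_crit_def)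
 show ?thesis unfolding dz_pairing_def[abs_def]
  by (rule holomorphic_on_divide[OF holomorphic_on_mult[OF p p] holomorphic_on_mult[OF q d] nz])
qed

lemma dz_integrand_residues:
 "(SUM q:dz_crit. residue (dz_integrand A1 A2) q) =
  (SUM i:dz_ix lh kb. SUM j:dz_ix lh kb. A1 i * A2 j * (SUM q:dz_crit. residue (dz_pairing lh kb A i j) q))"
proof -
 let ?D = "dz_ix lh kb"
 have e: "dz_integrand A1 A2 = (%\<nu>. SUM k:?D \<times> ?D. (A1 (fst k) * A2 (snd k)) * dz_pairing lh kb A (fst k) (snd k) \<nu>)"
 proof
  fix \<nu>
  have "laurent_poly lh kb A1 \<nu> * laurent_poly lh kb A2 \<nu> = (SUM k:?D \<times> ?D. (A1 (fst k) * \<nu> powi fst k) * (A2 (snd k) * \<nu> powi snd k))"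
   unfolding laurent_poly_def sum_product sum.cartesian_product by (simp add: case_prod_unfold)
  moreover have "(a * x) * (b * y) / d = (a * b) * (x * y / d)" for a b x y d :: complex by simp
  ultimately show "dz_integrand A1 A2 \<nu> = (SUM k:?D \<times> ?D. (A1 (fst k) * A2 (snd k)) * dz_pairing lh kb A (fst k) (snd k) \<nu>)"
   unfolding dz_integrand_def dz_pairing_def by (simp only: sum_divide_distrib)
 qed
 have "residue (dz_integrand A1 A2) q = (SUM k:?D \<times> ?D. (A1 (fst k) * A2 (snd k)) * residue (dz_pairing lh kb A (fst k) (snd k)) q)"
  if "q : dz_crit" for q
  unfolding e by (rule residue_sum_linear[OF dz_crit_open(1,2)[OF that]])
   (rule holomorphic_on_subset[OF dz_pairing_holomorphic dz_crit_open(3)[OF that]])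
 hence "(SUM q:dz_crit. residue (dz_integrand A1 A2) q) =
  (SUM k:?D \<times> ?D. SUM q:dz_crit. (A1 (fst k) * A2 (snd k)) * residue (dz_pairing lh kb A (fst k) (snd k)) q)"
  by (subst sum.swap) simp
 moreover have r: "(SUM i:?D. SUM j:?D. A1 i * A2 j * (SUM q:dz_crit. residue (dz_pairing lh kb A i j) q)) =
  (SUM k:?D \<times> ?D. A1 (fst k) * A2 (snd k) * (SUM q:dz_crit. residue (dz_pairing lh kb A (fst k) (snd k)) q))"
  by (simp only: sum.cartesian_product case_prod_unfold)
 ultimately show ?thesis unfolding r by (simp only: sum_distrib_left)
qed

lemma critical_points_dz: "critical_points (dzs lh kb A) = dz_crit"
proof -
 have an: "dzs lh kb A analytic_on {\<nu>}" if "\<nu> ~= 0" for \<nu>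
 proof -
  have "dzs lh kb A holomorphic_on - {0}"
   unfolding dz_superpotential_def[abs_def] by (intro holomorphic_intros) auto
  thus ?thesis using that unfolding analytic_at by (intro exI[of _ "- {0}"] conjI) auto
 qed
 have d: "deriv (dzs lh kb A) \<nu> = dz_deriv lh kb A \<nu>" if "\<nu> ~= 0" for \<nu>
  using dz_has_deriv[OF that] by (rule DERIV_imp_deriv)
 \<comment> \<open>The total function has some value at 0, so analyticity must be excluded:
   \<open>\<nu>^kb h\<close> tends to the nonzero lowest coefficient.\<close>
 have n0: "\<not> dzs lh kb A analytic_on {0}"
 proof
  assume "dzs lh kb A analytic_on {0}"
  hence "isCont (dzs lh kb A) 0" by (rule analytic_at_imp_isCont)
  hence "(dzs lh kb A \<longlongrightarrow> dzs lh kb A 0) (at 0)" by (simp add: isCont_def)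
  hence "((%\<nu>. \<nu> ^ kb * dzs lh kb A \<nu>) \<longlongrightarrow> 0 ^ kb * dzs lh kb A 0) (at 0)"
   by (intro tendsto_intros)
  hence 1: "((%\<nu>. \<nu> ^ kb * dzs lh kb A \<nu>) \<longlongrightarrow> 0) (at 0)" using kb by (simp add: power_0_left)
  obtain u where u: "(u \<longlongrightarrow> A (- int kb)) (at 0)" "!!\<nu>. \<nu> ~= 0 ==> laurent_poly lh kb A \<nu> = inverse \<nu> ^ kb * u \<nu>"
   using laurent_poly_0 by blast
  have "((%\<nu>. \<nu> ^ kb * \<nu> ^ (lh + 1) + u \<nu>) \<longlongrightarrow> 0 ^ kb * 0 ^ (lh + 1) + A (- int kb)) (at 0)"
   by (intro tendsto_intros u)
  moreover have "\<forall>\<^sub>F \<nu> in at (0::complex). \<nu> ~= 0" by (simp add: eventually_at_filter)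
  hence "\<forall>\<^sub>F \<nu> in at 0. \<nu> ^ kb * \<nu> ^ (lh + 1) + u \<nu> = \<nu> ^ kb * dzs lh kb A \<nu>"
  proof eventually_elim
   case (elim \<nu>)
   hence "\<nu> ^ kb * inverse \<nu> ^ kb = 1" by (simp flip: power_mult_distrib)
   thus ?case using u(2)[OF elim] unfolding dz_superpotential_def laurent_poly_def[symmetric]
    by (simp only: distrib_left mult.assoc[symmetric] mult_1)
  qed
  ultimately have "((%\<nu>. \<nu> ^ kb * dzs lh kb A \<nu>) \<longlongrightarrow> 0 ^ kb * 0 ^ (lh + 1) + A (- int kb)) (at 0)"
   by (rule Lim_transform_eventually)
  hence "A (- int kb) = 0" using tendsto_unique[OF _ 1] by simp
  thus False using A0 by simp
 qed
 have "x : critical_points (dzs lh kb A) \<longleftrightarrow> x : dz_crit" for x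
  by (cases "x = 0") (simp_all add: critical_points_def dz_crit_def n0 an d)
 thus ?thesis by blast
qed

lemma dz_metric_eq:
 assumes "i : dz_ix lh kb" "j : dz_ix lh kb"
 shows "lg_metric (dzs lh kb) dlog A i j = (SUM q:dz_crit. residue (dz_pairing lh kb A i j) q)"
 unfolding lg_metric_def critical_points_dz
proof (intro sum.cong refl residue_cong)
 fix q assume q: "q : dz_crit"
 have "\<forall>\<^sub>F \<mu> in at q. \<mu> : - {0} - {q}" by (rule eventually_at_in_open) (insert q, auto simp: dz_crit_def)
 thus "\<forall>\<^sub>F \<mu> in at q. pd i (%w. dzs lh kb w \<mu>) A * pd j (%w. dzs lh kb w \<mu>) A *
   (dlog \<mu>)^2 / deriv (dzs lh kb A) \<mu> = dz_pairing lh kb A i j \<mu>"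
 proof eventually_elim
  case (elim \<mu>)
  hence "deriv (dzs lh kb A) \<mu> = dz_deriv lh kb A \<mu>"
   by (intro DERIV_imp_deriv dz_has_deriv) simp
  thus ?case
   by (simp add: pderiv_dz_superpotential assms dz_pairing_def dlog_def power_divide)
 qed
qed

text \<open>The variation in direction \<open>A_0\<close> is the constant 1, so the integrand is
  \<open>\<nu>^(b-2) / h'\<close>. As \<open>b \<le> lh\<close>, infinity does not contribute; at 0
  there is a pole only for \<open>b = - kb\<close>, a simple one.\<close>

lemma dz_metric_0:
 assumes b: "b : dz_ix lh kb"
 shows "lg_metric (dzs lh kb) dlog A 0 b = (if b = - int kb then 1 / (of_nat kb * A (- int kb)) else 0)"
proof -
 let ?f = "dz_pairing lh kb A 0 b"
 have b': "- int kb <= b" "b <= int lh" using b by (auto simp: dz_index_def)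
 have z: "0 : dz_ix lh kb" by (simp add: dz_index_def)
 obtain u where u: "(u \<longlongrightarrow> of_nat (lh + 1)) at_infinity" "!!\<nu>. \<nu> ~= 0 ==> dz_deriv lh kb A \<nu> = \<nu> ^ lh * u \<nu>"
  using dz_deriv_infinity by blast
 have n1: "of_nat (lh + 1) ~= (0::complex)" by (rule of_nat_Suc_nz)
 have "((%\<nu>. \<nu> powi (b - 1 - int lh) / u \<nu>) \<longlongrightarrow> (if b - 1 - int lh = 0 then 1 else 0) / of_nat (lh + 1)) at_infinity"
  by (intro tendsto_divide powi_tendsto_infinity u n1) (use b' in auto)
 moreover have "\<forall>\<^sub>F \<nu> in at_infinity. 1 <= norm (\<nu> :: complex)" unfolding eventually_at_infinity by blast
 hence "\<forall>\<^sub>F \<nu> in at_infinity. \<nu> powi (b - 1 - int lh) / u \<nu> = \<nu> * ?f \<nu>"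
 proof eventually_elim
  case (elim \<nu>)
  hence nz: "\<nu> ~= 0" by auto
  have "\<nu> powi (b - 1 - int lh) = \<nu> powi b / \<nu> / \<nu> ^ lh" using nz by (simp add: power_int_diff)
  thus ?case using nz u(2)[OF nz] by (simp add: dz_pairing_def power2_eq_square)
 qed
 ultimately have "((%\<nu>. \<nu> * ?f \<nu>) \<longlongrightarrow> (if b - 1 - int lh = 0 then 1 else 0) / of_nat (lh + 1)) at_infinity"
  by (rule Lim_transform_eventually)
 hence lim: "((%\<nu>. \<nu> * ?f \<nu>) \<longlongrightarrow> 0) at_infinity" using b' by simp
 have tot: "(SUM q:insert 0 dz_crit. residue ?f q) = 0"
  by (rule total_residue[OF _ dz_pairing_holomorphic lim]) (simp add: finite_dz_crit)
 obtain v where v: "(v \<longlongrightarrow> - of_nat kb * A (- int kb)) (at 0)" "!!\<nu>. \<nu> ~= 0 ==> dz_deriv lh kb A \<nu> = inverse \<nu> ^ Suc kb * v \<nu>"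
  using dz_deriv_0 by blast
 have v0: "- of_nat kb * A (- int kb) ~= 0" using kb A0 by simp
 have "((%\<nu>. \<nu> powi (b + int kb) / v \<nu>) \<longlongrightarrow> (if b + int kb = 0 then 1 else 0) / (- of_nat kb * A (- int kb))) (at 0)"
  by (intro tendsto_divide powi_tendsto_0 v v0) (use b' in auto)
 moreover have "\<forall>\<^sub>F \<nu> in at (0::complex). \<nu> ~= 0" by (simp add: eventually_at_filter)
 hence "\<forall>\<^sub>F \<nu> in at 0. \<nu> powi (b + int kb) / v \<nu> = ?f \<nu> * (\<nu> - 0)"
 proof eventually_elim
  case (elim \<nu>)
  have "\<nu> powi (b + int kb) = \<nu> powi b * \<nu> ^ kb" using elim by (simp add: power_int_add)
  moreover have "x / (\<nu>^2 * (inverse \<nu> ^ Suc kb * c)) * \<nu> = x * \<nu> ^ kb / c" for x c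
   using elim by (simp add: power_inverse power2_eq_square field_simps)
  ultimately show ?case unfolding dz_pairing_def v(2)[OF elim] by (simp only: power_int_0_right mult_1 diff_zero)
 qed
 ultimately have l0: "((%\<nu>. ?f \<nu> * (\<nu> - 0)) \<longlongrightarrow> (if b + int kb = 0 then 1 else 0) / (- of_nat kb * A (- int kb))) (at 0)"
  by (rule Lim_transform_eventually)
 have o: "open (- dz_crit)" "0 : - dz_crit" using finite_dz_crit by (auto intro!: open_Compl finite_imp_closed simp: dz_crit_def)
 have "residue ?f 0 = (if b + int kb = 0 then 1 else 0) / (- of_nat kb * A (- int kb))"
  by (rule residue_simple'[OF o _ l0]) (rule holomorphic_on_subset[OF dz_pairing_holomorphic], auto)
 moreover have "(SUM q:insert 0 dz_crit. residue ?f q) = residue ?f 0 + (SUM q:dz_crit. residue ?f q)"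
  by (rule sum.insert) (insert finite_dz_crit, auto simp: dz_crit_def)
 ultimately have "(SUM q:dz_crit. residue ?f q) = - ((if b + int kb = 0 then 1 else 0) / (- of_nat kb * A (- int kb)))"
  using tot by (metis add_eq_0_iff)
 thus ?thesis unfolding dz_metric_eq[OF z b] by (auto simp: add_eq_0_iff)
qed

end

lemma dz_lg_data:
 assumes "1 <= kb" "A : dz_par lh kb"
 shows "lg_data kb 0 (%_. 0) A (%_. 0) (%_ _. 0)"
 by unfold_locales (insert assms, auto simp: dz_parameters_def)

text \<open>
  The 1-form \<open>g(\<partial>/\<partial>A\<^sub>0, \<cdot>)\<close> is \<open>d log A\<close> of the leading coefficient at \<open>0\<close> up to a constant, so it is closed, and
  \<open>g\<close> does not depend on \<open>A\<^sub>0\<close>: hence this 1-form has constant coefficients in flat coordinates.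
\<close>

lemma dz_one_form:
 assumes kb: "1 <= kb" and flat: "dz_flat_coordinates lh kb V t" and A0: "A0 : V"
 obtains d E where "d > 0" "polydisc (dz_ix lh kb) A0 d <= V"
  "!!A b. A : polydisc (dz_ix lh kb) A0 d ==> b : dz_ix lh kb ==>
    (if b = - int kb then 1 / (of_nat kb * A (- int kb)) else 0) = (SUM j=1..lh+kb+1. E j * pd b (t j) A)"
proof -
 let ?D = "dz_ix lh kb" and ?g = "lg_metric (dzs lh kb) dlog"
 have V: "V <= dz_par lh kb" and c: "csys ?D V {1..lh+kb+1} t"
  using flat by (auto simp: dz_flat_coordinates_def flat_coordinates_def)
 obtain G where G: "ALL w:V. ALL a:?D. ALL b:?D. ?g w a b = (SUM i:{1..lh+kb+1}. SUM j:{1..lh+kb+1}. G i j * pd a (t i) w * pd b (t j) w)"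
  using flat unfolding dz_flat_coordinates_def flat_coordinates_def by blast
 have lg: "lg_data kb 0 (%_. 0) A (%_. 0) (%_ _. 0)" if "A : V" for A
  using dz_lg_data[OF kb] V that by blast
 have geq: "?g A i j = (SUM q:{\<nu>. \<nu> ~= 0 & dz_deriv lh kb A \<nu> = 0}. residue (dz_pairing lh kb A i j) q)"
  if "A : V" "i : ?D" "j : ?D" for A i j
  using lg_data.dz_metric_eq[OF lg[OF that(1)] that(2,3)] unfolding lg_data.dz_crit_def[OF lg[OF that(1)]] .
 have g0: "?g A 0 b = (if b = - int kb then 1 / (of_nat kb * A (- int kb)) else 0)" if "A : V" "b : ?D" for A b
  by (rule lg_data.dz_metric_0[OF lg[OF that(1)] that(2)])
 have finD: "finite ?D" by (rule finite_dz_index)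
 have oV: "openin (cspace ?D) V" by (rule chart_inverse(1)[OF finD c])
 \<comment> \<open>The only nonzero component depends on the lowest coefficient alone, so every
   derivative except the diagonal one vanishes; this is closedness.\<close>
 have p0: "pd a (%w. ?g w 0 b) A = 0" if "A : V" "a : ?D" "b : ?D" "a ~= - int kb \<or> b ~= - int kb" for A a b
 proof -
  have "pd a (%w. ?g w 0 b) A = pd a (%A. if b = - int kb then 1 / (of_nat kb * A (- int kb)) else 0) A"
   by (rule pderiv_at_cong[OF finD oV that(2,1)]) (rule g0[OF _ that(3)])
  also have "... = 0" by (cases "b = - int kb") (insert that(4), simp_all add: pderiv_at_def)
  finally show ?thesis .
 qed
 obtain d E where d: "d > 0" "polydisc ?D A0 d <= V"
  and E: "!!w b. w : polydisc ?D A0 d ==> b : ?D ==> ?g w 0 b = (SUM j:{1..lh+kb+1}. E j * pd b (t j) w)"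
 proof (rule flat_one_form[OF finD _ c, of 0 ?g G A0])
  show "0 : ?D" by (simp add: dz_index_def)
  show "?g w a b = (SUM i:{1..lh+kb+1}. SUM j:{1..lh+kb+1}. G i j * pd a (t i) w * pd b (t j) w)"
   if "w : V" "a : ?D" "b : ?D" for w a b using G that by blast
  show "?g w a b = ?g w b a" if "w : V" "a : ?D" "b : ?D" for w a b
   unfolding lg_metric_def by (simp add: mult.commute)
  show "?g (w(0 := x)) a b = ?g w a b" if "w : V" "w(0 := x) : V" "a : ?D" "b : ?D" for w x a b
   unfolding geq[OF that(2-4)] geq[OF that(1,3,4)] dz_pairing_def dz_deriv_invariant ..
  show "pd a (%w. ?g w 0 b) w = pd b (%w. ?g w 0 a) w" if "w : V" "a : ?D" "b : ?D" for w a b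
  proof (cases "a = - int kb & b = - int kb")
   case False
   thus ?thesis using p0[OF that(1-3)] p0[OF that(1,3,2)] by auto
  qed simp
 qed (use A0 in auto)
 show ?thesis
 proof (rule that[OF d])
  fix A b assume Ab: "A : polydisc ?D A0 d" "b : ?D"
  hence "A : V" using d(2) by blast
  from g0[OF this Ab(2)] E[OF Ab]
  show "(if b = - int kb then 1 / (of_nat kb * A (- int kb)) else 0) = (SUM j=1..lh+kb+1. E j * pd b (t j) A)"
   by (simp only:)
 qed
qed

section \<open>Forms with constant coefficients\<close>

definition constant_form :: "'i set => ('i => complex) set => 'j set => ('j => ('i => complex) => complex) =>
  (('i => complex) => 'i => 'i => complex) => bool" where
 "constant_form I U J y g \<longleftrightarrow> (EX G. ALL w:U. ALL a:I. ALL b:I.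
   g w a b = (SUM i:J. SUM j:J. G i j * pd a (y i) w * pd b (y j) w))"

abbreviation "cform \<equiv> constant_form"

lemma constant_form_add:
 assumes "cform I U J y g" "cform I U J y h"
 shows "cform I U J y (%w a b. g w a b + h w a b)"
proof -
 obtain G H where G: "ALL w:U. ALL a:I. ALL b:I. g w a b = (SUM i:J. SUM j:J. G i j * pd a (y i) w * pd b (y j) w)"
  and H: "ALL w:U. ALL a:I. ALL b:I. h w a b = (SUM i:J. SUM j:J. H i j * pd a (y i) w * pd b (y j) w)"
  using assms unfolding constant_form_def by blast
 show ?thesis unfolding constant_form_def
  by (rule exI[of _ "%i j. G i j + H i j"]) (insert G H, simp add: distrib_right sum.distrib)
qed

lemma constant_form_cmult:
 assumes "cform I U J y g" shows "cform I U J y (%w a b. c * g w a b)"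
proof -
 obtain G where G: "ALL w:U. ALL a:I. ALL b:I. g w a b = (SUM i:J. SUM j:J. G i j * pd a (y i) w * pd b (y j) w)"
  using assms unfolding constant_form_def by blast
 show ?thesis unfolding constant_form_def
  by (rule exI[of _ "%i j. c * G i j"]) (insert G, simp add: sum_distrib_left mult.assoc)
qed

lemma constant_form_sum:
 "(!!s. s : S ==> cform I U J y (g s)) ==> cform I U J y (%w a b. SUM s:S. g s w a b)"
proof (induction S rule: infinite_finite_induct)
 case (insert s S)
 thus ?case using constant_form_add[of I U J y "g s" "%w a b. SUM s:S. g s w a b"] by simp
qed (auto simp: constant_form_def intro!: exI[of _ "%_ _. 0"])

lemma constant_form_prod:
 assumes "finite J" "j : J" "k : J"
 shows "cform I U J y (%w a b. pd a (y j) w * pd b (y k) w)"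
proof -
 have "(SUM i:J. SUM i':J. of_bool (i = j & i' = k) * pd a (y i) w * pd b (y i') w) =
  pd a (y j) w * pd b (y k) w" for w a b
 proof -
  have "(SUM i:J. SUM i':J. of_bool (i = j & i' = k) * pd a (y i) w * pd b (y i') w) =
   (SUM i:J. of_bool (i = j) * (pd a (y i) w * (SUM i':J. of_bool (i' = k) * pd b (y i') w)))"
   unfolding sum_distrib_left by (intro sum.cong refl) (simp add: of_bool_conj)
  thus ?thesis using assms by simp
 qed
 thus ?thesis unfolding constant_form_def by (intro exI[of _ "%i i'. of_bool (i = j & i' = k)"]) simp
qed

lemma constant_form_cong:
 assumes "cform I U J y g" "!!w a b. w : U ==> a : I ==> b : I ==> h w a b = g w a b"
 shows "cform I U J y h"
 using assms unfolding constant_form_def by simp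

section \<open>Derivatives along curves\<close>

text \<open>At a fixed point of the original coordinate, the normalised point
  \<open>f x = a \<mu>\<close> moves with the parameters; this adds the term with
  \<open>lprin_deriv\<close>.\<close>

lemma lprin_curve:
 assumes f: "DERIV f x0 :> f'" and be: "DERIV be x0 :> \<b>'"
  and e: "!!i. i : {1..m} ==> DERIV (%x. e x i) x0 :> e' i" and nz: "f x0 ~= exp (be x0)"
 shows "DERIV (%x. lprin m (e x) (exp (be x)) (f x)) x0 :> lprin_var m (e x0) e' \<b>' (exp (be x0)) (f x0) + f' * lprin_deriv m (e x0) (exp (be x0)) (f x0)"
proof -
 let ?b = "exp (be x0)" and ?u = "f x0 / exp (be x0) - 1"
 have u0: "?u ~= 0" using nz by simp
 have u: "DERIV (%x. f x / exp (be x) - 1) x0 :> (f' / ?b - \<b>' * (f x0 / ?b))"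
  by (rule DERIV_cong[OF DERIV_diff[OF DERIV_divide[OF f DERIV_fun_exp[OF be] exp_not_eq_zero] DERIV_const[of 1]]])
   (simp add: field_simps)
 have "DERIV (%x. e x i / (f x / exp (be x) - 1) ^ i) x0 :> (e' i / ?u ^ i - of_nat i * e x0 i * (f' / ?b - \<b>' * (f x0 / ?b)) / ?u ^ Suc i)" if i: "i : {1..m}" for i
 proof -
  have p: "DERIV (%x. (f x / exp (be x) - 1) ^ i) x0 :> of_nat i * (f' / ?b - \<b>' * (f x0 / ?b)) * ?u ^ (i - 1)"
   using DERIV_power[OF u, of i] by (simp add: ac_simps)
  have "DERIV (%x. e x i / (f x / exp (be x) - 1) ^ i) x0 :> (e' i * ?u ^ i - e x0 i * (of_nat i * (f' / ?b - \<b>' * (f x0 / ?b)) * ?u ^ (i - 1))) / (?u ^ i * ?u ^ i)"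
   by (rule DERIV_divide[OF e[OF i] p]) (use u0 in simp)
  moreover have "(c * U ^ i - d * (n * g * U ^ (i - 1))) / (U ^ i * U ^ i) = c / U ^ i - n * d * g / U ^ Suc i" if "U ~= 0" for c d g n U :: complex
  proof -
   have "U ^ i = U * U ^ (i - 1)" using i by (cases i) auto
   hence "d * (n * g * U ^ (i - 1)) / (U ^ i * U ^ i) = n * d * g / U ^ Suc i" using that by (simp add: field_simps)
   thus ?thesis using that by (simp add: diff_divide_distrib)
  qed
  ultimately show ?thesis using u0 by simp
 qed
 hence "DERIV (%x. lprin m (e x) (exp (be x)) (f x)) x0 :> (SUM i=1..m. e' i / ?u ^ i - of_nat i * e x0 i * (f' / ?b - \<b>' * (f x0 / ?b)) / ?u ^ Suc i)"
  unfolding lprin_def by (rule DERIV_sum)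
 also have "(SUM i=1..m. e' i / ?u ^ i - of_nat i * e x0 i * (f' / ?b - \<b>' * (f x0 / ?b)) / ?u ^ Suc i) =
  lprin_var m (e x0) e' \<b>' ?b (f x0) + f' * lprin_deriv m (e x0) ?b (f x0)"
  unfolding lprin_var_def lprin_deriv_def sum_distrib_left sum.distrib[symmetric]
  by (intro sum.cong refl) (simp add: algebra_simps diff_divide_distrib add_divide_distrib)
 finally show ?thesis .
qed

lemma dz_superpotential_curve:
 assumes f: "DERIV f x0 :> f'" and A: "!!i. DERIV (%x. A x i) x0 :> A' i" and nz: "f x0 ~= 0"
 shows "DERIV (%x. dzs lh kb (A x) (f x)) x0 :> laurent_poly lh kb A' (f x0) + f' * dz_deriv lh kb (A x0) (f x0)"
proof -
 have p: "DERIV (%x. f x powi i) x0 :> of_int i * f x0 powi (i - 1) * f'" for i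
  by (rule DERIV_power_int[OF f]) (simp add: nz)
 have "DERIV (%x. f x ^ (lh + 1) + (SUM i:dz_ix lh kb. A x i * f x powi i)) x0 :> of_nat (lh + 1) * f x0 ^ lh * f' + (SUM i:dz_ix lh kb. A' i * f x0 powi i + (of_int i * f x0 powi (i - 1) * f') * A x0 i)"
  using DERIV_power[OF f, of "lh + 1"] by (intro DERIV_add DERIV_sum DERIV_mult A p) (simp add: ac_simps)
 also have "of_nat (lh + 1) * f x0 ^ lh * f' + (SUM i:dz_ix lh kb. A' i * f x0 powi i + (of_int i * f x0 powi (i - 1) * f') * A x0 i) =
  laurent_poly lh kb A' (f x0) + f' * dz_deriv lh kb (A x0) (f x0)"
  unfolding laurent_poly_def dz_deriv_def distrib_left sum_distrib_left sum.distrib by (simp add: ac_simps)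
 finally show ?thesis by (simp add: dz_superpotential_def)
qed

section \<open>The metric of a superpotential with movable poles\<close>

context chart
begin

lemma lg_data_chart:
 assumes w: "w : W1" shows "lg_data kb L m (%i. AA i w) (%\<a>. \<b> \<a> w) (%\<a> i. eh \<a> i w)"
proof
 note N = normal_form_nonzero[OF W1D(1)[OF w] aa_nz nf1[OF w]]
 show "AA (- int kb) w ~= 0" by (rule N)
 show "inj_on (%\<a>. exp (\<b> \<a> w)) {1..L}"
 proof (rule inj_onI, rule ccontr)
  fix \<a> \<g> assume "\<a> : {1..L}" "\<g> : {1..L}" "exp (\<b> \<a> w) = exp (\<b> \<g> w)" "\<a> ~= \<g>"
  thus False using movable_pole_distinct[OF W1D(1)[OF w] aa_nz] by (simp add: exp_\<b>[OF w] bb_def)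
 qed
 show "eh \<a> (m \<a>) w ~= 0" if "\<a> : {1..L}" for \<a> by (rule N(2)[OF that])
qed (use kb m1 in auto)

lemma superpotential_eq:
 assumes w: "w : W1" and \<mu>: "\<mu> ~= 0" "ALL \<a>:{1..L}. \<mu> ~= w (- int \<a>)"
 shows "spot lh kb ms w \<mu> = dzs lh kb (%i. AA i w) (aa w * \<mu>) +
  (SUM \<a>=1..L. lprin (m \<a>) (%i. eh \<a> i w) (exp (\<b> \<a> w)) (aa w * \<mu>))"
proof -
 have "aa w * \<mu> ~= 0" "ALL \<a>:{1..L}. aa w * \<mu> ~= mpole w (aa w) \<a>" using \<mu> aa_nz[of w] by (auto simp: movable_pole_def)
 hence "nsp lh kb ms w (aa w) (aa w * \<mu>) = dzs lh kb (%i. AA i w) (aa w * \<mu>) +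
  (SUM \<a>=1..L. lprin (m \<a>) (%i. eh \<a> i w) (mpole w (aa w) \<a>) (aa w * \<mu>))"
  using nf1[OF w] unfolding normal_form_def by blast
 also have "(SUM \<a>=1..L. lprin (m \<a>) (%i. eh \<a> i w) (mpole w (aa w) \<a>) (aa w * \<mu>)) =
  (SUM \<a>=1..L. lprin (m \<a>) (%i. eh \<a> i w) (exp (\<b> \<a> w)) (aa w * \<mu>))"
  by (intro sum.cong refl) (simp add: exp_\<b>[OF w] bb_def)
 finally show ?thesis using aa_nz[of w] by (simp add: normalised_superpotential_def)
qed

definition sg where "sg \<a> i v = sr \<a> v ^ i * cluster_poly (m \<a>) i (%j. cc \<a> j v / cc \<a> (m \<a>) v)"
text \<open>The first residue coordinate is the root \<open>s\<close> itself, since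
  \<open>cluster_poly_1\<close>; but label 1 is occupied by \<open>c\<^sub>1\<close>, and
  \<open>s\<close> is stored under label \<open>m \<a>\<close>.\<close>

definition \<sigma> where "\<sigma> \<a> i = (if i = 1 then m \<a> else i)"

lemma sg_\<tau>: "v : W1 ==> \<a> : {1..L} ==> i : {1..m \<a> - 1} ==> sg \<a> i v = \<tau> \<a> (\<sigma> \<a> i) v"
 using \<tau>_eq(2)[of v \<a>] \<tau>_eq(3)[of v \<a> i]
 by (cases "i = 1") (auto simp: sg_def \<sigma>_def cluster_flat_def cluster_poly_1[unfolded One_nat_def])

lemma hol_sr:
 assumes \<a>: "\<a> : {1..L}" shows "hol I W2 (sr \<a>)"
proof -
 have h: "hol I W2 (%w. cc \<a> (m \<a>) w / cc \<a> (m \<a>) w0)"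
  by (rule hol_divide[OF open_W2 hol_cc[OF W2_W1 open_W2] hol_const[OF open_W2] cc_top[OF w0_W1 \<a>]])
 show ?thesis unfolding sr_def[abs_def] root_def divide_inverse[of "Ln _"]
  by (rule hol_mult[OF open_W2 hol_const[OF open_W2] hol_exp[OF open_W2 hol_mult[OF open_W2 hol_Ln[OF open_W2 h] hol_const[OF open_W2]]]])
   (rule W2D(3)[OF _ \<a>])
qed

lemma sr_power: "v : W1 ==> \<a> : {1..L} ==> sr \<a> v ^ m \<a> = cc \<a> (m \<a>) v"
 unfolding sr_def by (rule root_power[OF _ cc_top])

end

locale chart_point = chart +
 fixes w :: "int => complex"
 assumes w2: "w : W2"
begin

lemma w1: "w : W1" using w2 W2_W1 by blast

end

sublocale chart_point < lg: lg_data lh kb L m "%i. AA i w" "%\<a>. \<b> \<a> w" "%\<a> i. eh \<a> i w"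
 by (rule lg_data_chart[OF w1])

context chart_point
begin

section \<open>The residue sum in the original coordinate\<close>

abbreviation "sp \<equiv> spot lh kb ms"

definition off where "off \<mu> \<longleftrightarrow> \<mu> ~= 0 & (ALL \<a>:{1..L}. \<mu> ~= w (- int \<a>))"

lemma off_iff: "off \<mu> \<longleftrightarrow> aa w * \<mu> ~: lg.poles"
 using aa_nz[of w] by (simp add: off_def lg.not_pole exp_\<b>[OF w1] bb_def movable_pole_def)

lemma open_off: "open {\<mu>. off \<mu>}"
proof -
 have "{\<mu>. off \<mu>} = - insert 0 ((%\<a>. w (- int \<a>)) ` {1..L})" by (auto simp: off_def)
 thus ?thesis by (simp only:) (intro open_Compl finite_imp_closed, simp)
qed

lemma sp_Lam: "off \<mu> ==> sp w \<mu> = lg.Lam (aa w * \<mu>)"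
 unfolding lg.Lam_def off_def by (intro superpotential_eq w1) auto

lemma sp_deriv:
 assumes "off \<mu>" shows "DERIV (sp w) (\<mu>) :> aa w * lg.Lam_deriv (aa w * \<mu>)"
proof -
 have "DERIV (%\<mu>. lg.Lam (aa w * \<mu>)) (\<mu>) :> lg.Lam_deriv (aa w * \<mu>) * aa w"
  by (rule DERIV_chain2[OF lg.Lam_has_deriv DERIV_cmult_Id]) (use assms off_iff in simp)
 hence "DERIV (%\<mu>. lg.Lam (aa w * \<mu>)) (\<mu>) :> aa w * lg.Lam_deriv (aa w * \<mu>)"
  by (simp add: mult.commute)
 thus ?thesis
  by (rule has_field_derivative_transform_within_open[OF _ open_off]) (use assms sp_Lam in auto)
qed

text \<open>Total division gives the superpotential values at its poles. If it were continuous
  there, its product with the denominator would tend to 0; but that product is the numerator, which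
  is nonzero at 0 and at the movable poles.\<close>

lemma sp_analytic_iff: "sp w analytic_on {\<mu>} \<longleftrightarrow> off \<mu>"
proof
 assume "off \<mu>"
 have "sp w holomorphic_on {\<mu>. off \<mu>}"
  unfolding holomorphic_on_open[OF open_off] using sp_deriv by blast
 thus "sp w analytic_on {\<mu>}" unfolding analytic_at using open_off \<open>off \<mu>\<close> by blast
next
 assume an: "sp w analytic_on {\<mu>}"
 show "off \<mu>"
 proof (rule ccontr)
  assume no: "\<not> off \<mu>"
  let ?D = "%x. x ^ kb * (PROD \<a>=1..L. (x - w (- int \<a>)) ^ m \<a>)"
  have wW: "w : W" by (rule W1D(1)[OF w1])
  have D0: "?D \<mu> = 0"
  proof (cases "\<mu> = 0")
   case False
   then obtain \<a> where \<a>: "\<a> : {1..L}" "\<mu> = w (- int \<a>)" using no by (auto simp: off_def)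
   hence "(PROD \<a>=1..L. (\<mu> - w (- int \<a>)) ^ m \<a>) = 0"
    using m1[OF \<a>(1)] by (intro prod_zero) auto
   thus ?thesis by simp
  qed (insert kb, simp add: power_0_left)
  have Q: "w 0 * Q_poly l w \<mu> ~= 0"
  proof (cases "\<mu> = 0")
   case True
   thus ?thesis using wW by (simp add: parameters_def Q_poly_def power_0_left)
  next
   case False
   then obtain \<a> where "\<a> : {1..L}" "\<mu> = w (- int \<a>)" using no by (auto simp: off_def)
   thus ?thesis using wW by (simp add: parameters_def)
  qed
  have "isCont (sp w) \<mu>" by (rule analytic_at_imp_isCont[OF an])
  hence "((%x. ?D x * sp w x) \<longlongrightarrow> ?D \<mu> * sp w \<mu>) (at \<mu>)"
   unfolding isCont_def by (intro tendsto_intros)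
  hence 1: "((%x. ?D x * sp w x) \<longlongrightarrow> 0) (at \<mu>)" unfolding D0 by simp
  have "finite ({x. \<not> off x} - {\<mu>})"
  proof (rule finite_subset)
   show "{x. \<not> off x} - {\<mu>} <= insert 0 ((%\<a>. w (- int \<a>)) ` {1..L})" by (auto simp: off_def)
  qed simp
  hence "\<forall>\<^sub>F x in at \<mu>. x : - ({x. \<not> off x} - {\<mu>}) - {\<mu>}"
   by (intro eventually_at_in_open open_Compl finite_imp_closed) auto
  hence e: "\<forall>\<^sub>F x in at \<mu>. ?D x * sp w x = w 0 * Q_poly l w x"
  proof eventually_elim
   case (elim x)
   hence "?D x ~= 0" by (auto simp: off_def)
   thus ?case by (simp add: superpotential_def)
  qed
  have "((%x. w 0 * Q_poly l w x) \<longlongrightarrow> 0) (at \<mu>)" by (rule tendsto_cong[OF e, THEN iffD1, OF 1])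
  moreover have "((%x. w 0 * Q_poly l w x) \<longlongrightarrow> w 0 * Q_poly l w \<mu>) (at \<mu>)"
   unfolding Q_poly_def by (intro tendsto_intros)
  ultimately show False using Q tendsto_unique[OF trivial_limit_at] by blast
 qed
qed

lemma critical_points_sp: "critical_points (sp w) = {q. aa w * q : lg.crit}"
proof -
 have "q : critical_points (sp w) \<longleftrightarrow> aa w * q : lg.crit" for q
 proof (cases "off q")
  case True
  hence "deriv (sp w) q = aa w * lg.Lam_deriv (aa w * q)" by (intro DERIV_imp_deriv sp_deriv)
  thus ?thesis using True aa_nz[of w] by (simp add: critical_points_def sp_analytic_iff lg.crit_def off_iff)
 qed (simp add: critical_points_def sp_analytic_iff lg.crit_def off_iff)
 thus ?thesis by blast
qed

definition "var a = lg.variation (%i. pd a (AA i) w) (%\<a>. pd a (\<b> \<a>) w) (%\<a> i. pd a (eh \<a> i) w)"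

lemma pderiv_sp:
 assumes a: "a : I" and \<mu>: "off \<mu>"
 shows "pd a (%w. sp w \<mu>) w = var a (aa w * \<mu>) + pd a aa w * \<mu> * lg.Lam_deriv (aa w * \<mu>)"
proof -
 let ?S = "{v : W2. ALL \<a>:{1..L}. v (- int \<a>) : - {\<mu>}}"
 let ?v = "%x. w(a := x)"
 have oS: "openin (cspace I) ?S"
  by (intro openin_cspace_vimage_ball open_W2 hol_continuous[OF open_W2] hol_coord) auto
 have "w : ?S" using w2 \<mu> by (auto simp: off_def)
 hence "\<forall>\<^sub>F x in nhds (w a). ?v x : ?S" by (rule slice_eventually[OF finI oS a])
 hence ev: "\<forall>\<^sub>F x in nhds (w a). sp (?v x) \<mu> = dzs lh kb (%i. AA i (?v x)) (aa (?v x) * \<mu>) +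
  (SUM \<a>=1..L. lprin (m \<a>) (%i. eh \<a> i (?v x)) (exp (\<b> \<a> (?v x))) (aa (?v x) * \<mu>))"
 proof eventually_elim
  case (elim x)
  thus ?case by (intro superpotential_eq) (insert \<mu> W2_W1, auto simp: off_def)
 qed
 have hA: "DERIV (%x. AA i (?v x)) ((w a)) :> pd a (AA i) w" for i
  by (rule hol_has_pd[OF hol_AA a w1])
 have h\<b>: "DERIV (%x. \<b> \<a> (?v x)) ((w a)) :> pd a (\<b> \<a>) w" if "\<a> : {1..L}" for \<a>
  by (rule hol_has_pd[OF hol_\<b>[OF that] a w2])
 have he: "DERIV (%x. eh \<a> i (?v x)) ((w a)) :> pd a (eh \<a> i) w" for \<a> i
  by (rule hol_has_pd[OF eh a W1D(1)[OF w1]])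
 have hf: "DERIV (%x. aa (?v x) * \<mu>) ((w a)) :> pd a aa w * \<mu>"
  by (rule DERIV_cmult_right[OF hol_has_pd[OF hol_aa a w1]])
 have np: "aa (?v (w a)) * \<mu> ~= exp (\<b> \<a> (?v (w a)))" "aa (?v (w a)) * \<mu> ~= 0" if "\<a> : {1..L}" for \<a>
  using \<mu> that unfolding off_iff lg.not_pole by auto
 have nz: "aa (?v (w a)) * \<mu> ~= 0" using \<mu> unfolding off_iff lg.not_pole by auto
 have "DERIV (%x. dzs lh kb (%i. AA i (?v x)) (aa (?v x) * \<mu>) +
  (SUM \<a>=1..L. lprin (m \<a>) (%i. eh \<a> i (?v x)) (exp (\<b> \<a> (?v x))) (aa (?v x) * \<mu>))) ((w a)) :> (laurent_poly lh kb (%i. pd a (AA i) w) (aa (?v (w a)) * \<mu>) + pd a aa w * \<mu> * dz_deriv lh kb (%i. AA i (?v (w a))) (aa (?v (w a)) * \<mu>)) +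
  (SUM \<a>=1..L. lprin_var (m \<a>) (%i. eh \<a> i (?v (w a))) (%i. pd a (eh \<a> i) w) (pd a (\<b> \<a>) w) (exp (\<b> \<a> (?v (w a)))) (aa (?v (w a)) * \<mu>)
    + pd a aa w * \<mu> * lprin_deriv (m \<a>) (%i. eh \<a> i (?v (w a))) (exp (\<b> \<a> (?v (w a)))) (aa (?v (w a)) * \<mu>))"
  by (intro DERIV_add DERIV_sum dz_superpotential_curve lprin_curve hA h\<b> he hf np nz)
 from DERIV_imp_deriv[OF this] have "pd a (%w. sp w \<mu>) w = laurent_poly lh kb (%i. pd a (AA i) w) (aa w * \<mu>) +
  pd a aa w * \<mu> * dz_deriv lh kb (%i. AA i w) (aa w * \<mu>) +
  (SUM \<a>=1..L. lprin_var (m \<a>) (%i. eh \<a> i w) (%i. pd a (eh \<a> i) w) (pd a (\<b> \<a>) w) (exp (\<b> \<a> w)) (aa w * \<mu>)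
    + pd a aa w * \<mu> * lprin_deriv (m \<a>) (%i. eh \<a> i w) (exp (\<b> \<a> w)) (aa w * \<mu>))"
  unfolding pderiv_at_def[of a "%w. sp w \<mu>"] deriv_cong_ev[OF ev refl] fun_upd_triv .
 thus ?thesis
  unfolding var_def lg.variation_def lg.Lam_deriv_def sum.distrib sum_distrib_left distrib_left by simp
qed

lemma integrand_meromorphic:
 assumes "\<nu> ~: lg.poles" shows "lg.integrand (var a) (var b) meromorphic_on {\<nu>}"
proof -
 have mero: "f meromorphic_on {\<nu>}" if "f holomorphic_on - lg.poles" for f
 proof -
  have "f analytic_on {\<nu>}" unfolding analytic_at using that assms open_Compl[OF lg.closed_poles] by blast
  thus ?thesis by (rule analytic_on_imp_meromorphic_on)
 qed
 have v: "var a meromorphic_on {\<nu>}" for a unfolding var_def by (rule mero[OF lg.variation_holomorphic])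
 have 2: "(%\<nu>. \<nu>^2) meromorphic_on {\<nu>}" by (rule mero) (intro holomorphic_intros)
 show ?thesis unfolding lg.integrand_def[abs_def]
  by (rule meromorphic_on_divide[OF meromorphic_on_mult[OF v v] meromorphic_on_mult[OF 2 mero[OF lg.Lam_deriv_holomorphic]]])
qed

text \<open>By \<open>pderiv_sp\<close>, rescaling adds to each variation a multiple of the
  derivative of the superpotential. After division by this derivative all extra terms are
  holomorphic at the critical point, so the metric can be computed in the normalised
  coordinate.\<close>

lemma metric_critical:
 assumes a: "a : I" and b: "b : I"
 shows "lg_metric sp dlog w a b = (SUM \<nu>:lg.crit. residue (lg.integrand (var a) (var b)) \<nu>)"
proof -
 let ?i = "lg.integrand (var a) (var b)"
 let ?A = "pd a aa w" and ?B = "pd b aa w"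
 have res: "residue (%\<mu>. pd a (%w. sp w \<mu>) w * pd b (%w. sp w \<mu>) w * (dlog \<mu>)^2 / deriv (sp w) \<mu>) q = residue ?i (aa w * q)"
  if q: "aa w * q : lg.crit" for q
 proof -
  define S where "S = {\<mu>. off \<mu>} - ((%\<nu>. \<nu> / aa w) ` lg.crit - {q})"
  have oS: "open S" unfolding S_def
   by (rule open_Diff[OF open_off finite_imp_closed]) (simp add: lg.finite_crit)
  have offq: "off q" using q by (simp add: off_iff lg.crit_def)
  have qS: "q : S" using offq by (simp add: S_def)
  have SD: "off \<mu>" "lg.Lam_deriv (aa w * \<mu>) ~= 0" "aa w * \<mu> ~: lg.poles \<union> lg.crit" if \<mu>: "\<mu> : S - {q}" for \<mu>
  proof -
   show o: "off \<mu>" using \<mu> by (simp add: S_def)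
   have "aa w * \<mu> ~: lg.crit"
   proof
    assume "aa w * \<mu> : lg.crit"
    hence "aa w * \<mu> / aa w : (%\<nu>. \<nu> / aa w) ` lg.crit" by blast
    thus False using \<mu> aa_nz[of w] by (simp add: S_def)
   qed
   thus "lg.Lam_deriv (aa w * \<mu>) ~= 0" "aa w * \<mu> ~: lg.poles \<union> lg.crit"
    using o by (simp_all add: lg.crit_def off_iff)
  qed
  \<comment> \<open>The extra terms, in which the derivative has already cancelled from the
    denominator.\<close>
  define h where "h \<mu> = (var a (aa w * \<mu>) * (?B * \<mu>) + var b (aa w * \<mu>) * (?A * \<mu>) + ?A * ?B * \<mu>^2 * lg.Lam_deriv (aa w * \<mu>)) / (\<mu>^2 * aa w)" for \<mu>
  have comp: "(%\<mu>. f (aa w * \<mu>)) holomorphic_on S" if "f holomorphic_on - lg.poles" for f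
  proof -
   have "f \<circ> (%\<mu>. aa w * \<mu>) holomorphic_on S"
    by (rule holomorphic_on_compose_gen[OF _ that]) (auto intro!: holomorphic_intros simp: S_def off_iff)
   thus ?thesis by (simp add: o_def)
  qed
  have vh: "(%\<mu>. var a (aa w * \<mu>)) holomorphic_on S" for a unfolding var_def by (rule comp[OF lg.variation_holomorphic])
  have hh: "h holomorphic_on S" unfolding h_def[abs_def]
   by (intro holomorphic_intros vh comp[OF lg.Lam_deriv_holomorphic]) (insert aa_nz, auto simp: S_def off_def)
  have "?i \<circ> (%\<mu>. aa w * \<mu>) holomorphic_on S - {q}"
   unfolding var_def
   by (rule holomorphic_on_compose_gen[OF _ lg.integrand_holomorphic])
    (insert SD(3), auto intro!: holomorphic_intros)
  hence ih: "(%\<mu>. ?i (aa w * \<mu>) * aa w) holomorphic_on S - {q}" by (auto simp: o_def intro!: holomorphic_intros)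
  have "\<forall>\<^sub>F \<mu> in at q. \<mu> : S - {q}" by (rule eventually_at_in_open[OF oS qS])
  hence ev: "\<forall>\<^sub>F \<mu> in at q. pd a (%w. sp w \<mu>) w * pd b (%w. sp w \<mu>) w * (dlog \<mu>)^2 / deriv (sp w) \<mu> =
   ?i (aa w * \<mu>) * aa w + h \<mu>"
  proof eventually_elim
   case (elim \<mu>)
   have "\<mu> ~= 0" using SD(1)[OF elim] by (simp add: off_def)
   moreover have "(X + A * \<mu> * P) * (Y + B * \<mu> * P) * (1 / \<mu>)^2 / (c * P) =
    X * Y / ((c * \<mu>)^2 * P) * c + (X * (B * \<mu>) + Y * (A * \<mu>) + A * B * \<mu>^2 * P) / (\<mu>^2 * c)"
    if "c ~= 0" "P ~= 0" "\<mu> ~= 0" for X Y A B P c :: complex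
    using that by (simp add: field_simps power2_eq_square)
   ultimately show ?case
    using SD(2)[OF elim] aa_nz[of w]
    unfolding pderiv_sp[OF a SD(1)[OF elim]] pderiv_sp[OF b SD(1)[OF elim]] dlog_def
     DERIV_imp_deriv[OF sp_deriv[OF SD(1)[OF elim]]] lg.integrand_def h_def by blast
  qed
  have "residue (%\<mu>. pd a (%w. sp w \<mu>) w * pd b (%w. sp w \<mu>) w * (dlog \<mu>)^2 / deriv (sp w) \<mu>) q =
   residue (%\<mu>. ?i (aa w * \<mu>) * aa w + h \<mu>) q"
   by (rule residue_cong[OF ev refl])
  also have "... = residue (%\<mu>. ?i (aa w * \<mu>) * aa w) q + residue h q"
   by (rule residue_add[OF oS qS ih]) (rule holomorphic_on_subset[OF hh], auto)
  also have "residue h q = 0" by (rule residue_holo[OF oS qS hh])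
  also have "residue (%\<mu>. ?i (aa w * \<mu>) * aa w) q = residue ?i (aa w * q)"
  proof -
   have d: "deriv (%\<mu>. aa w * \<mu>) z = aa w" for z by (rule DERIV_imp_deriv[OF DERIV_cmult_Id])
   have "(%\<mu>. aa w * \<mu>) analytic_on {q}"
    by (rule analytic_on_subset[of _ UNIV]) (simp_all add: analytic_on_open holomorphic_intros)
   from residue_change_variable[where g = "%\<mu>. aa w * \<mu>", OF integrand_meromorphic this]
   show ?thesis using q aa_nz[of w] by (simp add: d lg.crit_def)
  qed
  finally show ?thesis by simp
 qed
 have "lg_metric sp dlog w a b = (SUM q:{q. aa w * q : lg.crit}. residue ?i (aa w * q))"
  unfolding lg_metric_def critical_points_sp by (intro sum.cong refl) (rule res, simp)
 also have "... = (SUM \<nu>:lg.crit. residue ?i \<nu>)"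
  by (rule sum.reindex_bij_witness[of _ "%\<nu>. \<nu> / aa w" "%q. aa w * q"]) (use aa_nz in auto)
 finally show ?thesis .
qed

lemma pderiv_cc:
 assumes a: "a : I" shows "pd a (cc \<a> i) w = log_coeff (m \<a>) (%i. pd a (eh \<a> i) w) i"
 unfolding pderiv_at_def[of a "cc \<a> i"] cc_def log_coeff_def
 by (intro DERIV_imp_deriv DERIV_sum DERIV_cmult_right hol_has_pd[OF eh a W1D(1)[OF w1]])

lemma pderiv_sg:
 assumes a: "a : I" and \<a>: "\<a> : {1..L}" and k: "0 < k"
 shows "pd a (sg \<a> k) w = cluster_diff (m \<a>) (log_coeff (m \<a>) (%i. eh \<a> i w)) (sr \<a> w) k
  (prin_series (m \<a>) (log_coeff (m \<a>) (%i. pd a (eh \<a> i) w)))"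
proof -
 let ?v = "%x. w(a := x)"
 have hc: "DERIV (%x. cc \<a> i (?v x)) ((w a)) :> log_coeff (m \<a>) (%i. pd a (eh \<a> i) w) i" for i
  using hol_has_pd[OF hol_cc[OF order.refl open_W1] a w1, of \<a> i] unfolding pderiv_cc[OF a] .
 have hs: "DERIV (%x. sr \<a> (?v x)) ((w a)) :> pd a (sr \<a>) w"
  by (rule hol_has_pd[OF hol_sr[OF \<a>] a w2])
 have p: "DERIV (%x. sr \<a> (?v x) ^ m \<a>) ((w a)) :> of_nat (m \<a>) * sr \<a> w ^ (m \<a> - 1) * pd a (sr \<a>) w"
  using DERIV_power[OF hs, of "m \<a>"] by (simp add: ac_simps)
 have "\<forall>\<^sub>F x in nhds (w a). ?v x : W2" by (rule slice_eventually[OF finI open_W2 a w2])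
 hence "\<forall>\<^sub>F x in nhds (w a). sr \<a> (?v x) ^ m \<a> = cc \<a> (m \<a>) (?v x)"
  by eventually_elim (use sr_power[OF _ \<a>] W2_W1 in blast)
 hence "DERIV (%x. sr \<a> (?v x) ^ m \<a>) ((w a)) :> log_coeff (m \<a>) (%i. pd a (eh \<a> i) w) (m \<a>)"
  using hc[of "m \<a>"] by (subst DERIV_cong_ev[OF refl _ refl])
 from DERIV_unique[OF p this] have s': "of_nat (m \<a>) * sr \<a> w ^ (m \<a> - 1) * pd a (sr \<a>) w = log_coeff (m \<a>) (%i. pd a (eh \<a> i) w) (m \<a>)" .
 have c: "(%i. cc \<a> i w) = log_coeff (m \<a>) (%i. eh \<a> i w)" by (simp add: cc_def fun_eq_iff)
 have "DERIV (%x. sr \<a> (?v x) ^ k * cluster_poly (m \<a>) k (%i. cc \<a> i (?v x) / cc \<a> (m \<a>) (?v x))) ((w a)) :> cluster_diff (m \<a>) (%i. cc \<a> i (?v (w a))) (sr \<a> (?v (w a))) k (prin_series (m \<a>) (log_coeff (m \<a>) (%i. pd a (eh \<a> i) w)))"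
  by (rule cluster_poly_deriv[OF _ k hc hs])
   (use m1[OF \<a>] sr_power[OF w1 \<a>] cc_top[OF w1 \<a>] s' in simp_all)
 from DERIV_imp_deriv[OF this] show ?thesis unfolding pderiv_at_def[of a "sg \<a> k"] sg_def fun_upd_triv c .
qed

definition "At = cmap D AA w"

lemma At_V: "At : V" unfolding At_def by (rule W2D(4)[OF w2])

lemma dz_deriv_At: "dz_deriv lh kb At = dz_deriv lh kb (%i. AA i w)"
 unfolding dz_deriv_def At_def by (intro ext arg_cong2[where f = "(+)"] refl sum.cong) (simp add: chart_map_apply)

lemma dz_metric_At:
 assumes "i : D" "j : D"
 shows "lg_metric (dzs lh kb) dlog At i j = (SUM q:lg.dz_crit. residue (dz_pairing lh kb (%i. AA i w) i j) q)"
proof -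
 have d: "lg_data kb 0 (%_. 0) At (%_. 0) (%_ _. 0)"
  by (rule dz_lg_data[OF kb subsetD[OF V At_V]])
 have "dz_pairing lh kb At i j = dz_pairing lh kb (%i. AA i w) i j"
  by (simp add: dz_pairing_def fun_eq_iff dz_deriv_At)
 thus ?thesis
  using lg_data.dz_metric_eq[OF d assms] unfolding lg_data.dz_crit_def[OF d] lg.dz_crit_def dz_deriv_At by simp
qed

text \<open>The residue formulas know a variation only through its components. By
  \<open>pderiv_cc\<close> and \<open>pderiv_sg\<close> the linear forms in them are differentials
  of functions on the parameter space.\<close>

lemma metric_formula:
 assumes a: "a : I" and b: "b : I"
 shows "lg_metric sp dlog w a b =
  (SUM i:D. SUM j:D. pd a (AA i) w * pd b (AA j) w * lg_metric (dzs lh kb) dlog At i j)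
  - (pd a (AA (- int kb)) w * (SUM \<a>=1..L. pd b (cc \<a> 1) w) + (SUM \<a>=1..L. pd a (cc \<a> 1) w) * pd b (AA (- int kb)) w) /
    (of_nat kb * At (- int kb))
  + (SUM \<a>=1..L. pd a (\<b> \<a>) w * pd b (cc \<a> 1) w + pd b (\<b> \<a>) w * pd a (cc \<a> 1) w
    + of_nat (m \<a>) * (SUM i=1..m \<a> - 1. pd a (sg \<a> i) w * pd b (sg \<a> (m \<a> - i)) w))"
proof -
 have rp: "residue (lg.integrand (var a) (var b)) (exp (\<b> \<a> w)) =
  - (pd a (\<b> \<a>) w * pd b (cc \<a> 1) w + pd b (\<b> \<a>) w * pd a (cc \<a> 1) w
    + of_nat (m \<a>) * (SUM i=1..m \<a> - 1. pd a (sg \<a> i) w * pd b (sg \<a> (m \<a> - i)) w))" if \<a>: "\<a> : {1..L}" for \<a>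
 proof -
  have s: "sr \<a> w ^ m \<a> = log_coeff (m \<a>) (%i. eh \<a> i w) (m \<a>)" using sr_power[OF w1 \<a>] by (simp add: cc_def)
  have "(SUM i=1..m \<a> - 1. pd a (sg \<a> i) w * pd b (sg \<a> (m \<a> - i)) w) =
   (SUM i=1..m \<a> - 1. cluster_diff (m \<a>) (log_coeff (m \<a>) (%i. eh \<a> i w)) (sr \<a> w) i (prin_series (m \<a>) (log_coeff (m \<a>) (%i. pd a (eh \<a> i) w))) *
    cluster_diff (m \<a>) (log_coeff (m \<a>) (%i. eh \<a> i w)) (sr \<a> w) (m \<a> - i) (prin_series (m \<a>) (log_coeff (m \<a>) (%i. pd b (eh \<a> i) w))))"
   by (intro sum.cong refl arg_cong2[where f = "(*)"] pderiv_sg a b \<a>) auto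
  thus ?thesis
   unfolding var_def lg.residue_at_pole[OF \<a> s] pderiv_cc[OF a] pderiv_cc[OF b] by simp
 qed
 have Ak: "At (- int kb) = AA (- int kb) w" unfolding At_def by (rule chart_map_apply) (simp add: dz_index_def)
 have dz: "(SUM q:lg.dz_crit. residue (lg.dz_integrand (%i. pd a (AA i) w) (%i. pd b (AA i) w)) q) =
  (SUM i:D. SUM j:D. pd a (AA i) w * pd b (AA j) w * lg_metric (dzs lh kb) dlog At i j)"
  unfolding lg.dz_integrand_residues by (intro sum.cong refl) (simp add: dz_metric_At)
 have r: "(SUM \<a>=1..L. residue (lg.integrand (var a) (var b)) (exp (\<b> \<a> w))) =
  - (SUM \<a>=1..L. pd a (\<b> \<a>) w * pd b (cc \<a> 1) w + pd b (\<b> \<a>) w * pd a (cc \<a> 1) w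
    + of_nat (m \<a>) * (SUM i=1..m \<a> - 1. pd a (sg \<a> i) w * pd b (sg \<a> (m \<a> - i)) w))"
  unfolding sum_negf[symmetric] by (intro sum.cong refl rp)
 have cr: "(SUM q:lg.crit. residue (lg.integrand (var a) (var b)) q) =
  (SUM q:lg.dz_crit. residue (lg.dz_integrand (%i. pd a (AA i) w) (%i. pd b (AA i) w)) q)
  - (pd a (AA (- int kb)) w * (SUM \<a>=1..L. pd b (cc \<a> 1) w) + (SUM \<a>=1..L. pd a (cc \<a> 1) w) * pd b (AA (- int kb)) w) /
    (of_nat kb * AA (- int kb) w)
  - (SUM \<a>=1..L. residue (lg.integrand (var a) (var b)) (exp (\<b> \<a> w)))"
  unfolding var_def pderiv_cc[OF a] pderiv_cc[OF b] by (rule lg.critical_residues)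
 show ?thesis unfolding metric_critical[OF a b] cr dz r Ak by simp
qed

end

section \<open>Flatness\<close>

locale flat_chart = chart +
 fixes G' :: "nat => nat => complex" and E :: "nat => complex"
 assumes G': "!!A a b. A : V ==> a : D ==> b : D ==> lg_metric (dzs lh kb) dlog A a b =
   (SUM i:T. SUM j:T. G' i j * pd a (t i) A * pd b (t j) A)"
  and E: "!!A b. A : V ==> b : D ==>
    (if b = - int kb then 1 / (of_nat kb * A (- int kb)) else 0) = (SUM j:T. E j * pd b (t j) A)"
begin

lemma metric_flat:
 assumes wU: "w : U" and a: "a : I" and b: "b : I"
 defines "P \<equiv> %a j. pd a (y' j) w"
 shows "lg_metric (spot lh kb ms) dlog w a b =
  (SUM q:T. SUM r:T. G' q r * (P a (Tc q) * P b (Tc r)))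
  + ((SUM q:T. SUM \<a>=1..L. - E q * (P a (Tc q) * P b (Cc \<a> 1) + P a (Cc \<a> 1) * P b (Tc q)))
  + (SUM \<a>=1..L. (P a (Bc \<a>) * P b (Cc \<a> 1) + P a (Cc \<a> 1) * P b (Bc \<a>))
    + of_nat (m \<a>) * (SUM i=1..m \<a> - 1. P a (Cc \<a> (\<sigma> \<a> i)) * P b (Cc \<a> (\<sigma> \<a> (m \<a> - i))))))"
proof -
 have w2: "w : W2" using wU U_W2 by blast
 interpret chart_point lh kb p ms Ah eh V t w0 a0 w by unfold_locales (rule w2)
 note cong = pderiv_at_cong[OF finI open_W2 _ w2]
 have PT: "P a (Tc q) = (SUM i:D. pd i (t q) At * pd a (AA i) w)" if "q : T" "a : I" for q a
 proof -
  have "P a (Tc q) = pd a (%w. t q (cmap D AA w)) w" unfolding P_def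
   by (rule cong[OF that(2)]) (insert W2_W1, auto simp: y'_def lift_t_def h_coeffs_AA)
  also have "... = (SUM i:D. pd i (t q) At * pd a (AA i) w)" unfolding At_def
   by (rule pderiv_compose[OF finI finD open_W2 chart_inverse(1)[OF finD t] holomorphic_fun_subset[OF hol_AA W2_W1]
    chart_inverse(3)[OF finD t that(1)] w2 W2D(4)[OF w2] that(2)])
  finally show ?thesis .
 qed
 have PB: "P a (Bc \<a>) = pd a (\<b> \<a>) w" for a \<a> by (simp add: P_def y'_def)
 have P1: "P a (Cc \<a> 1) = pd a (cc \<a> 1) w" if "\<a> : {1..L}" "a : I" for a \<a>
  unfolding P_def by (rule cong[OF that(2)]) (insert W2_W1 \<tau>_eq(1) that, auto simp: y'_def simp del: One_nat_def)
 have PS: "P a (Cc \<a> (\<sigma> \<a> i)) = pd a (sg \<a> i) w" if "\<a> : {1..L}" "a : I" "i : {1..m \<a> - 1}" for a \<a> i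
  unfolding P_def by (rule cong[OF that(2)]) (insert W2_W1 sg_\<tau> that, auto simp: y'_def)
 have dz: "(SUM i:D. SUM j:D. pd a (AA i) w * pd b (AA j) w * lg_metric (dzs lh kb) dlog At i j) =
  (SUM q:T. SUM r:T. G' q r * (P a (Tc q) * P b (Tc r)))"
 proof -
  have "(SUM i:D. SUM j:D. pd a (AA i) w * pd b (AA j) w * lg_metric (dzs lh kb) dlog At i j) =
   (SUM i:D. SUM j:D. SUM q:T. SUM r:T. G' q r * ((pd i (t q) At * pd a (AA i) w) * (pd j (t r) At * pd b (AA j) w)))"
  proof (intro sum.cong refl)
   fix i j assume ij: "i : D" "j : D"
   have "x * y * (SUM q:T. SUM r:T. G' q r * f q * g r) = (SUM q:T. SUM r:T. G' q r * ((f q * x) * (g r * y)))" for x y f g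
    unfolding sum_distrib_left by (intro sum.cong refl) (simp only: ac_simps)
   thus "pd a (AA i) w * pd b (AA j) w * lg_metric (dzs lh kb) dlog At i j =
    (SUM q:T. SUM r:T. G' q r * ((pd i (t q) At * pd a (AA i) w) * (pd j (t r) At * pd b (AA j) w)))"
    unfolding G'[OF At_V ij] .
  qed
  also have "... = (SUM q:T. SUM r:T. SUM i:D. SUM j:D. G' q r * ((pd i (t q) At * pd a (AA i) w) * (pd j (t r) At * pd b (AA j) w)))"
   unfolding sum.swap[of _ T D] ..
  also have "... = (SUM q:T. SUM r:T. G' q r * (P a (Tc q) * P b (Tc r)))"
  proof (intro sum.cong refl)
   fix q r assume "q : T" "r : T"
   have "(SUM i:D. SUM j:D. c * (f i * g j)) = c * ((SUM i:D. f i) * (SUM j:D. g j))" for c and f g :: "int => complex"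
    unfolding sum_product unfolding sum_distrib_left ..
   thus "(SUM i:D. SUM j:D. G' q r * ((pd i (t q) At * pd a (AA i) w) * (pd j (t r) At * pd b (AA j) w))) =
    G' q r * (P a (Tc q) * P b (Tc r))"
    unfolding PT[OF \<open>q : T\<close> a] PT[OF \<open>r : T\<close> b] .
  qed
  finally show ?thesis .
 qed
 have k: "- int kb : D" by (simp add: dz_index_def)
 \<comment> \<open>The pullback of the closed Killing form: the logarithmic differential of the
   lowest coefficient becomes a combination of the \<open>dt\<close> with constant
   coefficients.\<close>
 have one: "pd a (AA (- int kb)) w / (of_nat kb * At (- int kb)) = (SUM q:T. E q * P a (Tc q))" if a: "a : I" for a
 proof -
  have "pd a (AA (- int kb)) w / (of_nat kb * At (- int kb)) =
   (SUM i:D. (if i = - int kb then 1 / (of_nat kb * At (- int kb)) else 0) * pd a (AA i) w)"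
   using k finD by (simp add: mult_delta_left)
  also have "... = (SUM i:D. SUM q:T. E q * (pd i (t q) At * pd a (AA i) w))"
   by (intro sum.cong refl) (simp only: E[OF At_V] sum_distrib_right mult.assoc)
  also have "... = (SUM q:T. E q * P a (Tc q))"
   unfolding sum.swap[of _ T D] by (intro sum.cong refl) (simp only: PT a sum_distrib_left)
  finally show ?thesis .
 qed
 have C: "(SUM \<a>=1..L. pd a (cc \<a> 1) w) = (SUM \<a>=1..L. P a (Cc \<a> 1))" if "a : I" for a
  by (intro sum.cong refl) (simp only: P1 that)
 have mixed: "(pd a (AA (- int kb)) w * (SUM \<a>=1..L. pd b (cc \<a> 1) w) + (SUM \<a>=1..L. pd a (cc \<a> 1) w) * pd b (AA (- int kb)) w) /
    (of_nat kb * At (- int kb)) = - (SUM q:T. SUM \<a>=1..L. - E q * (P a (Tc q) * P b (Cc \<a> 1) + P a (Cc \<a> 1) * P b (Tc q)))"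
 proof -
  have "(x * s + s' * x') / c = x / c * s + s' * (x' / c)" for x s s' x' c :: complex by (simp add: add_divide_distrib)
  hence "(pd a (AA (- int kb)) w * (SUM \<a>=1..L. pd b (cc \<a> 1) w) + (SUM \<a>=1..L. pd a (cc \<a> 1) w) * pd b (AA (- int kb)) w) /
    (of_nat kb * At (- int kb)) = (SUM q:T. E q * P a (Tc q)) * (SUM \<a>=1..L. P b (Cc \<a> 1)) + (SUM \<a>=1..L. P a (Cc \<a> 1)) * (SUM q:T. E q * P b (Tc q))"
   by (simp only: one a b C)
  also have "(SUM \<a>=1..L. P a (Cc \<a> 1)) * (SUM q:T. E q * P b (Tc q)) = (SUM q:T. E q * P b (Tc q)) * (SUM \<a>=1..L. P a (Cc \<a> 1))"
   by (rule mult.commute)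
  also have "(SUM q:T. E q * P a (Tc q)) * (SUM \<a>=1..L. P b (Cc \<a> 1)) + (SUM q:T. E q * P b (Tc q)) * (SUM \<a>=1..L. P a (Cc \<a> 1)) =
   (SUM q:T. SUM \<a>=1..L. E q * (P a (Tc q) * P b (Cc \<a> 1) + P a (Cc \<a> 1) * P b (Tc q)))"
   unfolding sum_product sum.distrib[symmetric] by (intro sum.cong refl) (simp add: distrib_left ac_simps)
  finally show ?thesis by (simp only: mult_minus_left sum_negf minus_minus)
 qed
 have cl: "(SUM \<a>=1..L. pd a (\<b> \<a>) w * pd b (cc \<a> 1) w + pd b (\<b> \<a>) w * pd a (cc \<a> 1) w
    + of_nat (m \<a>) * (SUM i=1..m \<a> - 1. pd a (sg \<a> i) w * pd b (sg \<a> (m \<a> - i)) w)) =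
  (SUM \<a>=1..L. (P a (Bc \<a>) * P b (Cc \<a> 1) + P a (Cc \<a> 1) * P b (Bc \<a>))
    + of_nat (m \<a>) * (SUM i=1..m \<a> - 1. P a (Cc \<a> (\<sigma> \<a> i)) * P b (Cc \<a> (\<sigma> \<a> (m \<a> - i)))))"
 proof (intro sum.cong refl)
  fix \<a> assume \<a>: "\<a> : {1..L}"
  have "(SUM i=1..m \<a> - 1. pd a (sg \<a> i) w * pd b (sg \<a> (m \<a> - i)) w) =
   (SUM i=1..m \<a> - 1. P a (Cc \<a> (\<sigma> \<a> i)) * P b (Cc \<a> (\<sigma> \<a> (m \<a> - i))))"
  proof (intro sum.cong refl)
   fix i assume i: "i : {1..m \<a> - 1}"
   hence i': "m \<a> - i : {1..m \<a> - 1}" by auto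
   show "pd a (sg \<a> i) w * pd b (sg \<a> (m \<a> - i)) w = P a (Cc \<a> (\<sigma> \<a> i)) * P b (Cc \<a> (\<sigma> \<a> (m \<a> - i)))"
    by (simp only: PS[OF \<a> a i] PS[OF \<a> b i'])
  qed
  thus "pd a (\<b> \<a>) w * pd b (cc \<a> 1) w + pd b (\<b> \<a>) w * pd a (cc \<a> 1) w
    + of_nat (m \<a>) * (SUM i=1..m \<a> - 1. pd a (sg \<a> i) w * pd b (sg \<a> (m \<a> - i)) w) =
   (P a (Bc \<a>) * P b (Cc \<a> 1) + P a (Cc \<a> 1) * P b (Bc \<a>))
    + of_nat (m \<a>) * (SUM i=1..m \<a> - 1. P a (Cc \<a> (\<sigma> \<a> i)) * P b (Cc \<a> (\<sigma> \<a> (m \<a> - i))))"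
   by (simp only: PB P1[OF \<a> a] P1[OF \<a> b] mult.commute)
 qed
 show ?thesis unfolding metric_formula[OF a b] dz mixed cl by simp
qed

theorem flat_y': "model_flat_coordinates lh kb ms U y'"
proof -
 let ?g = "%j k w a b. pd a (y' j) w * pd b (y' k) w"
 have p: "cform I U J y' (?g j k)" if "j : J" "k : J" for j k
  by (rule constant_form_prod[OF finJ that])
 have \<sigma>J: "Cc \<a> (\<sigma> \<a> i) : J" if "\<a> : {1..L}" "i : {1..m \<a> - 1}" for \<a> i
  using that by (intro J_intros) (auto simp: \<sigma>_def)
 have C1: "Cc \<a> 1 : J" if "\<a> : {1..L}" for \<a> using that m1[OF that] by (intro J_intros) auto
 have "cform I U J y' (%w a b.
  (SUM q:T. SUM r:T. G' q r * ?g (Tc q) (Tc r) w a b)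
  + ((SUM q:T. SUM \<a>=1..L. - E q * (?g (Tc q) (Cc \<a> 1) w a b + ?g (Cc \<a> 1) (Tc q) w a b))
  + (SUM \<a>=1..L. (?g (Bc \<a>) (Cc \<a> 1) w a b + ?g (Cc \<a> 1) (Bc \<a>) w a b)
    + of_nat (m \<a>) * (SUM i=1..m \<a> - 1. ?g (Cc \<a> (\<sigma> \<a> i)) (Cc \<a> (\<sigma> \<a> (m \<a> - i))) w a b))))"
  by (intro constant_form_add constant_form_sum constant_form_cmult p J_intros(1,2) C1 \<sigma>J) auto
 hence "cform I U J y' (lg_metric (spot lh kb ms) dlog)"
  by (rule constant_form_cong) (rule metric_flat)
 thus ?thesis using chart_y' by (simp add: model_flat_coordinates_def flat_coordinates_def constant_form_def)
qed

end

declare One_nat_def [simp del]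

text \<open>The constants \<open>E\<close> of \<open>dz_one_form\<close> are available on a polydisc
  about the given \<open>h\<close>, so \<open>V\<close> is shrunk to this polydisc
  \<open>V'\<close>.\<close>

lemma flat_chart_exists:
 assumes kb: "1 <= kb" and ms: "partition_of p ms" and flat: "dz_flat_coordinates lh kb V t"
  and w0: "w0 : parameters lh kb ms" and a0: "a0 ^ (lh + 1) = lcoef lh kb ms w0"
  and h0: "h_coeffs lh kb ms w0 a0 : V"
 obtains V' Ah eh G' E where "V' <= V" "flat_chart lh kb p ms Ah eh V' t w0 a0 G' E"
proof -
 let ?D = "dz_ix lh kb"
 interpret model lh kb p ms by unfold_locales (rule kb, rule ms)
 obtain Ah eh where Ah: "!!i. hol I W (Ah i)" and eh: "!!\<a> i. hol I W (eh \<a> i)"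
  and nf: "!!w a. w : W ==> a ^ (lh + 1) = lcoef lh kb ms w ==>
    normal_form lh kb ms w a (%i. Ah i w * a powi (- i)) (%\<a> i. eh \<a> i w)"
  using normal_form_exists by blast
 obtain d E where d: "d > 0" "polydisc ?D (h_coeffs lh kb ms w0 a0) d <= V"
  and E: "!!A b. A : polydisc ?D (h_coeffs lh kb ms w0 a0) d ==> b : ?D ==>
    (if b = - int kb then 1 / (of_nat kb * A (- int kb)) else 0) = (SUM j=1..lh+kb+1. E j * pd b (t j) A)"
  using dz_one_form[OF kb flat h0] by blast
 let ?V = "polydisc ?D (h_coeffs lh kb ms w0 a0) d"
 have V: "V <= dz_par lh kb" and c: "csys ?D V {1..lh+kb+1} t"
  using flat by (auto simp: dz_flat_coordinates_def flat_coordinates_def)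
 obtain G where G: "ALL w:V. ALL a:?D. ALL b:?D. lg_metric (dzs lh kb) dlog w a b =
   (SUM i:{1..lh+kb+1}. SUM j:{1..lh+kb+1}. G i j * pd a (t i) w * pd b (t j) w)"
  using flat unfolding dz_flat_coordinates_def flat_coordinates_def by blast
 show ?thesis
 proof (rule that[OF d(2)])
  show "flat_chart lh kb p ms Ah eh ?V t w0 a0 G E"
  proof unfold_locales
   show "csys ?D ?V {1..lh + kb + 1} t"
    by (rule coordinate_system_restrict[OF finite_dz_index finite_atLeastAtMost c openin_polydisc[OF finite_dz_index] d(2)])
   show "?V <= dz_par lh kb" using d(2) V by blast
   show "h_coeffs lh kb ms w0 a0 : ?V" by (rule polydisc_center[OF _ d(1)]) (simp add: h_coeffs_def)
  qed (insert Ah eh nf w0 a0 E G d(2), blast+)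
 qed
qed

context flat_chart
begin

text \<open>\<open>V\<close> enters \<open>collision_coordinates\<close> only as the set that has to
  contain \<open>h\<close>; so the shrinking can be undone.\<close>

lemma collision_coordinates_y: "V <= V' ==> collision_coordinates lh kb ms V' t U aa \<b>"
 using collision_coordinates_subset[OF order.refl] chart_inverse(1)[OF finI chart_y]
 unfolding collision_coordinates_def by blast

text \<open>
  For a single double pole, the only term of the metric that is not constant in \<open>(t, \<b>, c)\<close> is
  \<open>2 d\<tau>\<^sub>2\<^sup>2 = dc\<^sub>2\<^sup>2 / (2 c\<^sub>2)\<close>.
\<close>

lemma curved_y:
 assumes ms2: "ms = [2]"
 shows "\<not> model_flat_coordinates lh kb ms U y"
proof
 assume "model_flat_coordinates lh kb ms U y"
 hence flat: "cform I U J y (lg_metric (spot lh kb ms) dlog)"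
  by (simp add: model_flat_coordinates_def flat_coordinates_def constant_form_def)
 have L: "L = 1" and m2: "m 1 = 2" by (simp_all add: ms2 pole_order_def)
 have cJ: "Cc 1 1 : J" "Cc 1 2 : J" "Bc 1 : J" by (simp_all add: J_intros L m2)
 have oU: "openin (cspace I) U" by (rule chart_inverse(1)[OF finI chart_y])
 let ?g = "%j k w a b. pd a (y j) w * pd b (y k) w"
 let ?c = "cc 1 2"
 have p: "cform I U J y (?g j k)" if "j : J" "k : J" for j k
  by (rule constant_form_prod[OF finJ that])
 let ?rest = "%w a b. (SUM q:T. SUM r:T. G' q r * ?g (Tc q) (Tc r) w a b)
  + ((SUM q:T. - E q * (?g (Tc q) (Cc 1 1) w a b + ?g (Cc 1 1) (Tc q) w a b))
  + (?g (Bc 1) (Cc 1 1) w a b + ?g (Cc 1 1) (Bc 1) w a b))"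
 have rest: "cform I U J y ?rest"
  by (intro constant_form_add constant_form_sum constant_form_cmult p J_intros(1) cJ) auto
 have "cform I U J y (%w a b. lg_metric (spot lh kb ms) dlog w a b + (- 1) * ?rest w a b)"
  by (intro constant_form_add[OF flat] constant_form_cmult rest)
 hence "cform I U J y (%w a b. 1 / (2 * ?c w) * ?g (Cc 1 2) (Cc 1 2) w a b)"
 proof (rule constant_form_cong)
  fix w a b assume w: "w : U" and a: "a : I" and b: "b : I"
  have w2: "w : W2" using w U_W2 by blast
  have w1: "w : W1" using w2 W2_W1 by blast
  have one: "1 : {1..L}" by (simp add: L)
  have yy: "pd a (y' j) w = pd a (y j) w" if "j : {Tc q, Bc 1, Cc 1 1}" "a : I" for j a q
   by (rule pderiv_at_cong[OF finI oU that(2) w])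
    (insert that(1) U_W2 W2_W1 \<tau>_eq(1)[OF _ one] y_simps(3)[OF _ one, of _ 1], auto simp: y_def y'_def simp del: One_nat_def)
  have dc: "pd a (y (Cc 1 2)) w = pd a ?c w" if "a : I" for a
   by (rule pderiv_at_cong[OF finI oU that w]) (use U_W2 W2_W1 y_simps(3)[OF _ one, of _ 2] in auto)
  have ds: "pd a ?c w = 2 * sr 1 w * pd a (y' (Cc 1 2)) w" if a: "a : I" for a
  proof -
   have hs: "DERIV (%x. sr 1 (w(a := x))) ((w a)) :> pd a (sr 1) w"
    by (rule hol_has_pd[OF hol_sr[OF one] a w2])
   have "pd a ?c w = pd a (%w. (sr 1 w)^2) w"
    by (rule pderiv_at_cong[OF finI open_W2 a w2]) (use sr_power[OF _ one] W2_W1 m2 in auto)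
   also have "... = 2 * sr 1 w * pd a (sr 1) w"
    unfolding pderiv_at_def[of a "%w. (sr 1 w)^2"] using DERIV_power[OF hs, of 2] by (intro DERIV_imp_deriv) (simp add: ac_simps)
   also have "pd a (sr 1) w = pd a (y' (Cc 1 2)) w"
    by (rule pderiv_at_cong[OF finI oU a w]) (insert \<tau>_eq(2)[OF _ one] U_W2 W2_W1 m2, auto simp: y'_def)
   finally show ?thesis .
  qed
  have s2: "(sr 1 w)^2 = ?c w" using sr_power[OF w1 one] m2 by simp
  have s0: "sr 1 w ~= 0" by (simp add: sr_def root_nz)
  have "1 / (2 * s^2) * ((2 * s * x) * (2 * s * y)) = 2 * (x * y)" if "s ~= 0" for s x y :: complex
   using that by (simp add: power2_eq_square)
  hence q: "1 / (2 * ?c w) * ?g (Cc 1 2) (Cc 1 2) w a b = 2 * (pd a (y' (Cc 1 2)) w * pd b (y' (Cc 1 2)) w)"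
   unfolding dc[OF a] dc[OF b] ds[OF a] ds[OF b] s2[symmetric] using s0 by blast
  have \<sigma>1: "\<sigma> 1 1 = 2" using m2 by (simp add: \<sigma>_def)
  have L1: "{1..L} = {1}" by (simp add: L)
  have M: "{1..m 1 - 1} = {1}" "m 1 - 1 = 1" "of_nat (m 1) = (2 :: complex)" by (simp_all add: m2)
  show "1 / (2 * ?c w) * ?g (Cc 1 2) (Cc 1 2) w a b =
   lg_metric (spot lh kb ms) dlog w a b + (- 1) * ?rest w a b"
   unfolding metric_flat[OF w a b] q L1 using a b
   by (simp add: yy[of "Tc _"] yy[of "Bc 1"] yy[of "Cc 1 1"] M \<sigma>1)
 qed
 then obtain K where K: "!!w a b. w : U ==> a : I ==> b : I ==> 1 / (2 * ?c w) * ?g (Cc 1 2) (Cc 1 2) w a b =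
   (SUM i:J. SUM j:J. K i j * pd a (y i) w * pd b (y j) w)"
  unfolding constant_form_def by blast
 \<comment> \<open>Coefficients with respect to products of coordinate differentials are unique, by
   \<open>coordinate_system_jacobian\<close> once in each index. Hence \<open>c\<^sub>2\<close>
   would be constant on \<open>U\<close>, although it is a coordinate.\<close>
 have Kc: "K (Cc 1 2) (Cc 1 2) = 1 / (2 * ?c w)" if w: "w : U" for w
 proof -
  note jac = coordinate_system_jacobian[OF finI finJ chart_y w]
  define k where "k = 1 / (2 * ?c w)"
  define d where "d i j = of_bool (i = Cc 1 2 & j = Cc 1 2) * k" for i j
  have "(SUM j:J. (K (Cc 1 2) j - d (Cc 1 2) j) * pd b (y j) w) = 0" if b: "b : I" for b
  proof (rule jac[OF _ cJ(2)])
   fix a assume a: "a : I"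
   have "(SUM i:J. SUM j:J. d i j * pd a (y i) w * pd b (y j) w) = k * ?g (Cc 1 2) (Cc 1 2) w a b"
   proof -
    have "(SUM i:J. SUM j:J. d i j * pd a (y i) w * pd b (y j) w) =
     (SUM i:J. of_bool (i = Cc 1 2) * (SUM j:J. of_bool (j = Cc 1 2) * (k * (pd a (y i) w * pd b (y j) w))))"
     unfolding sum_distrib_left by (intro sum.cong refl) (simp add: d_def of_bool_conj)
    thus ?thesis using cJ(2) finJ by simp
   qed
   hence "(SUM i:J. SUM j:J. (K i j - d i j) * pd a (y i) w * pd b (y j) w) = 0"
    using K[OF w a b] by (simp add: left_diff_distrib sum_subtractf k_def)
   thus "(SUM i:J. (SUM j:J. (K i j - d i j) * pd b (y j) w) * pd a (y i) w) = 0"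
    by (simp add: sum_distrib_right sum_distrib_left mult.assoc mult.commute[of "pd a _ w"])
  qed
  from jac[OF this cJ(2)] show ?thesis by (simp add: d_def k_def)
 qed
 have cn: "?c w ~= 0" if "w : U" for w using cc_top[of w 1] that U_W2 W2_W1 m2 L by auto
 have const: "?c w = ?c w0" if "w : U" for w
 proof -
  have "1 / (2 * ?c w) = 1 / (2 * ?c w0)" using Kc[OF that] Kc[OF w0_U] by simp
  thus ?thesis using cn[OF that] cn[OF w0_U] by (simp add: frac_eq_eq)
 qed
 have "of_bool (Cc 1 2 = Cc 1 2) = (0::complex)"
 proof (rule coordinate_system_jacobian[OF finI finJ chart_y w0_U _ cJ(2), of "%j. of_bool (j = Cc 1 2)"])
  fix b assume b: "b : I"
  have "pd b (y (Cc 1 2)) w0 = pd b (%_. ?c w0) w0"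
   by (rule pderiv_at_cong[OF finI oU b w0_U]) (use const U_W2 W2_W1 y_simps(3)[of _ 1 2] L in auto)
  also have "... = 0" by (simp add: pderiv_at_def)
  finally show "(SUM j:J. of_bool (j = Cc 1 2) * pd b (y j) w0) = 0" using finJ cJ(2) by simp
 qed
 thus False by simp
qed

end

section \<open>The Dubrovin--Zhang manifold with \<open>lh = 0\<close> and \<open>kb = 1\<close>\<close>

definition V01 :: "(int => complex) set" where
 "V01 = {A : extensional (dz_ix 0 1). A (- 1) : - nonpos_Reals}"

text \<open>For \<open>\<mu> + A_0 + A_(-1) / \<mu>\<close> the metric is
  \<open>2 dA_0 d log A_(-1)\<close>, so \<open>A_0\<close> and \<open>log A_(-1)\<close> are
  flat.\<close>

definition t01 :: "nat => (int => complex) => complex" where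
 "t01 i A = (if i = 1 then A 0 else Ln (A (- 1)))"

lemma dz_index_01: "dz_ix 0 1 = {- 1, 0}"
 by (auto simp: dz_index_def)

lemma dz_flat_01: "dz_flat_coordinates 0 1 V01 t01"
proof -
 let ?D = "dz_ix 0 1"
 have fin: "finite ?D" by (rule finite_dz_index)
 have E: "openin (cspace ?D) (extensional ?D)" "openin (cspace {1..2::nat}) (extensional {1..2})" by (simp_all add: cspace_eq)
 have oV: "openin (cspace ?D) V01" unfolding V01_def
  by (intro openin_cspace_vimage E hol_continuous[OF E(1)] hol_coord open_slit)
 have oV': "openin (cspace {1..2}) {v : extensional {1..2::nat}. v 2 : {z. \<bar>Im z\<bar> < pi}}"
  by (intro openin_cspace_vimage E hol_continuous[OF E(2)] hol_coord open_strip)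
 have T: "{1..2::nat} = {1, 2}" by auto
 let ?s = "%(i::int) (v::nat => complex). if i = 0 then v 1 else exp (v 2)"
 have hL: "hol ?D V01 (%A. Ln (A (- 1)))"
  by (rule hol_Ln[OF oV hol_coord[OF oV]]) (simp add: V01_def)
 have cs: "csys ?D V01 {1..2} t01"
 proof (rule coordinate_systemI(1)[OF oV finite_atLeastAtMost oV', of t01 ?s])
  show "hol ?D V01 (t01 j)" for j
   unfolding t01_def[abs_def] by (cases "j = 1") (simp_all add: hol_coord[OF oV] hL)
  show "hol {1..2} {v : extensional {1..2::nat}. v 2 : {z. \<bar>Im z\<bar> < pi}} (?s i)" for i
   by (cases "i = 0") (simp_all only: if_True if_False simp_thms hol_coord[OF oV'] hol_exp[OF oV' hol_coord[OF oV']])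
  show "cmap {1..2} t01 A : {v : extensional {1..2}. v 2 : {z. \<bar>Im z\<bar> < pi}}" if "A : V01" for A
   using that abs_Im_Ln[of "A (- 1)"] by (simp add: chart_map_extensional chart_map_apply t01_def V01_def)
  show "cmap ?D ?s v : V01" if "v : {v : extensional {1..2::nat}. v 2 : {z. \<bar>Im z\<bar> < pi}}" for v
   using that exp_strip_slit[of "v 2"] by (simp add: V01_def chart_map_extensional chart_map_apply dz_index_01)
  show "cmap ?D ?s (cmap {1..2} t01 A) = A" if "A : V01" for A
  proof (rule extensionalityI[OF chart_map_extensional])
   have "A (- 1) ~= 0" using that by (auto simp: V01_def)
   thus "cmap ?D ?s (cmap {1..2} t01 A) i = A i" if "i : ?D" for i
    using that by (auto simp: chart_map_apply dz_index_01 t01_def)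
  qed (insert that, simp add: V01_def)
  show "cmap {1..2} t01 (cmap ?D ?s v) = v" if "v : {v : extensional {1..2::nat}. v 2 : {z. \<bar>Im z\<bar> < pi}}" for v
  proof (rule extensionalityI[OF chart_map_extensional])
   show "cmap {1..2} t01 (cmap ?D ?s v) i = v i" if "i : {1..2}" for i
    using that \<open>v : _\<close> by (auto simp: T chart_map_apply dz_index_01 t01_def Ln_exp_strip)
  qed (use that in simp)
 qed
 have V: "V01 <= dz_par 0 1" by (auto simp: V01_def dz_parameters_def)
 let ?g = "lg_metric (dzs 0 1) dlog"
 have g: "?g A 0 0 = 0" "?g A 0 (- 1) = 1 / A (- 1)" "?g A (- 1) 0 = 1 / A (- 1)" "?g A (- 1) (- 1) = 0" if A: "A : V01" for A
 proof -
  interpret lg_data 0 1 0 "%_. 0" A "%_. 0" "%_ _. 0"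
   by (rule dz_lg_data) (use V A in auto)
  have A0: "A (- 1) ~= 0" using A by (auto simp: V01_def)
  show "?g A 0 0 = 0" "?g A 0 (- 1) = 1 / A (- 1)"
   using dz_metric_0[of 0] dz_metric_0[of "- 1"] by (simp_all add: dz_index_01[simplified])
  thus "?g A (- 1) 0 = 1 / A (- 1)" by (simp add: lg_metric_def mult.commute)
  \<comment> \<open>The remaining diagonal component also comes from the residue at 0. There
    \<open>?f\<close> is an even function, holomorphic at 0, divided by \<open>\<nu>^2\<close>; the
    residue is the derivative of an even function at 0, hence zero.\<close>
  let ?f = "dz_pairing 0 1 A (- 1) (- 1)"
  have dd: "dz_deriv 0 1 A \<nu> = 1 - A (- 1) / \<nu>^2" if "\<nu> ~= 0" for \<nu>
   using that unfolding dz_deriv_def dz_index_01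
   by (simp add: power_int_minus divide_inverse)
  have f: "?f \<nu> = 1 / (\<nu>^2 - A (- 1)) / (\<nu> - 0) ^ Suc 1" if "\<nu> ~= 0" for \<nu>
  proof -
   have "\<nu>^2 * dz_deriv 0 1 A \<nu> = \<nu>^2 - A (- 1)" using that by (simp add: dd right_diff_distrib)
   thus ?thesis using that by (simp add: dz_pairing_def power_int_minus divide_inverse power2_eq_square)
  qed
  have nz: "\<forall>\<^sub>F \<nu> in at_infinity. (\<nu>::complex) ~= 0"
   unfolding eventually_at_infinity by (rule exI[of _ 1]) auto
  have i0: "((%\<nu>::complex. 1 / \<nu>) \<longlongrightarrow> 0) at_infinity" using tendsto_inverse_0 by (simp add: divide_inverse)
  have "((%\<nu>. (1 / \<nu>) * (1 / \<nu>) * (1 / \<nu>) / (1 - A (- 1) * ((1 / \<nu>) * (1 / \<nu>)))) \<longlongrightarrow> 0 * 0 * 0 / (1 - A (- 1) * (0 * 0))) at_infinity"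
   by (intro tendsto_intros i0) simp
  moreover have "\<forall>\<^sub>F \<nu> in at_infinity. (1 / \<nu>) * (1 / \<nu>) * (1 / \<nu>) / (1 - A (- 1) * ((1 / \<nu>) * (1 / \<nu>))) = \<nu> * ?f \<nu>"
   using nz
  proof eventually_elim
   case (elim \<nu>)
   have "1 - A (- 1) * ((1 / \<nu>) * (1 / \<nu>)) = (\<nu>^2 - A (- 1)) / \<nu>^2"
    using elim by (simp add: diff_divide_distrib power2_eq_square)
   thus ?case using elim by (simp add: f power2_eq_square)
  qed
  ultimately have lim: "((%\<nu>. \<nu> * ?f \<nu>) \<longlongrightarrow> 0) at_infinity" by (auto dest: Lim_transform_eventually)
  have tot: "(SUM q:insert 0 dz_crit. residue ?f q) = 0"
   by (rule total_residue[OF _ dz_pairing_holomorphic lim]) (simp add: finite_dz_crit)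
  have S: "open {\<nu>. \<nu>^2 - A (- 1) ~= 0}" by (intro open_Collect_neq continuous_intros)
  have "residue ?f 0 = residue (%\<nu>. 1 / (\<nu>^2 - A (- 1)) / (\<nu> - 0) ^ Suc 1) 0"
   by (rule residue_cong) (insert f, auto simp: eventually_at_filter)
  also have "... = (deriv ^^ 1) (%\<nu>. 1 / (\<nu>^2 - A (- 1))) 0 / fact 1"
   by (rule residue_holomorphic_over_power[OF S]) (insert A0, auto intro!: holomorphic_intros)
  also have "... = deriv (%\<nu>. 1 / (\<nu>^2 - A (- 1))) 0" by (simp add: One_nat_def)
  also have "... = 0" by (rule DERIV_imp_deriv) (insert A0, auto intro!: derivative_eq_intros)
  finally have "residue ?f 0 = 0" .
  moreover have "(SUM q:insert 0 dz_crit. residue ?f q) = residue ?f 0 + (SUM q:dz_crit. residue ?f q)"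
   by (rule sum.insert) (insert finite_dz_crit, auto simp: dz_crit_def)
  ultimately show "?g A (- 1) (- 1) = 0" using tot dz_metric_eq[of "- 1" "- 1"] by (simp add: dz_index_01[simplified])
 qed
 have d1: "pd a (t01 1) A = of_bool (a = 0)" for a A by (auto simp: pderiv_at_def t01_def)
 have d2: "pd a (t01 2) A = of_bool (a = - 1) / A (- 1)" if "A : V01" for a A
 proof (cases "a = - 1")
  case True
  have "DERIV (%x. Ln x) ((A (- 1))) :> inverse (A (- 1))"
   by (rule has_field_derivative_Ln) (insert that, simp add: V01_def)
  thus ?thesis using True by (simp add: pderiv_at_def t01_def DERIV_imp_deriv divide_inverse)
 qed (simp add: pderiv_at_def t01_def)
 have "EX G. ALL A:V01. ALL a:?D. ALL b:?D. ?g A a b = (SUM i:{1..2}. SUM j:{1..2}. G i j * pd a (t01 i) A * pd b (t01 j) A)"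
 proof (rule exI[of _ "%i j. of_bool (i ~= j)"], intro ballI)
  fix A a b assume "A : V01" "a : ?D" "b : ?D"
  thus "?g A a b = (SUM i:{1..2::nat}. SUM j:{1..2::nat}. of_bool (i ~= j) * pd a (t01 i) A * pd b (t01 j) A)"
   using g d1 d2 by (auto simp: dz_index_01[simplified] T simp del: One_nat_def)
 qed
 thus ?thesis using V cs by (simp add: dz_flat_coordinates_def flat_coordinates_def numeral_2_eq_2)
qed

lemma curved_example:
 obtains U a \<b> where "collision_coordinates 0 1 [2] V01 t01 U a \<b>"
  "\<not> model_flat_coordinates 0 1 [2] U (joint_coords (lift_t 0 1 [2] t01 a) \<b> (c_coord 0 1 [2] a \<b>))"
proof -
 interpret M: model 0 1 2 "[2]" by unfold_locales (simp_all add: partition_of_def)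
 \<comment> \<open>The base point is \<open>\<mu> + 1/\<mu> + 1/(\<mu> - 1)^2\<close>, with movable
   pole 1 and \<open>a = 1\<close>; its numerator has constant term 1, as the equation for
   \<open>a\<close> requires.\<close>
 let ?A = "%i::int. if i = - 1 then 1 else 0 :: complex" and ?ep = "%(\<a>::nat) i. if i = (2::nat) then 1 else 0 :: complex"
 let ?N = "numer_poly 0 1 (length [2::nat]) (pole_order [2]) ?A (%_. 1) ?ep"
 let ?w = "restrict (M.parameter_of ?N (%_. 1) 1) (par_ix 0 1 [2])"
 have N0: "coeff ?N 0 = 1"
  unfolding poly_0_coeff_0[symmetric] numer_poly_0[OF order.refl] by (simp add: pole_order_def)
 have c1: "1 ^ (M.l + 1) = (- 1) ^ (M.l + 1) * coeff ?N 0" unfolding N0 by (simp add: total_degree_def)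
 have c2: "inj_on (%_::nat. 1::complex) {1..M.L}" by (simp add: inj_on_def)
 have c3: "?A (- int 1) ~= 0" by simp
 have c4: "ALL \<a>:{1..M.L}. ?ep \<a> (M.m \<a>) ~= 0" by (simp add: pole_order_def)
 note P = M.normal_form_parameter_of[where a = 1 and A = ?A and b = "%_. 1" and ep = ?ep, OF c1 c2 one_neq_zero c3 c4]
 have lc: "1 ^ (0 + 1) = lcoef 0 1 [2] ?w" by (rule P(3))
 have "h_coeffs 0 1 [2] ?w 1 = restrict ?A (dz_ix 0 1)"
  by (rule M.normal_form_h_coeffs[OF P(2,1,4)])
 hence h: "h_coeffs 0 1 [2] ?w 1 : V01" by (simp add: V01_def dz_index_01[simplified])
 obtain V' Ah eh G' E where V': "V' <= V01" and fc: "flat_chart 0 1 2 [2] Ah eh V' t01 ?w 1 G' E"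
  using flat_chart_exists[OF order.refl M.ms dz_flat_01 P(2) lc h] by blast
 interpret flat_chart 0 1 2 "[2]" Ah eh V' t01 ?w 1 G' E by (rule fc)
 show ?thesis
  by (rule that[OF collision_coordinates_y[OF V'] curved_y[unfolded y_def]]) simp
qed

theorem proposition1p1:
  shows
  "(\<exists>P :: nat \<Rightarrow> nat \<Rightarrow> (nat \<Rightarrow> complex) \<Rightarrow> complex.
      (\<forall>m. \<forall>k\<in>{2..<m}. polynomial_in (m - 1) (P m k)) \<and>
      (\<forall>m s c. c m \<noteq> 0 \<and> s ^ m = c m \<longrightarrow>
         (\<forall>r\<in>{2..<m}. \<forall>j\<in>{2..<m}. j < r \<longrightarrow> cluster_jacobian P m s c r j = 0)) \<and>
      (\<forall>lhat kbar p ms. 1 \<le> kbar \<and> partition_of p ms \<longrightarrow>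
         (\<forall>\<alpha>\<in>{1..length ms}. well_behaved_collision lhat kbar ms \<alpha>) \<and>
         (\<forall>V t w0 a0.
            dz_flat_coordinates lhat kbar V t \<and>
            w0 \<in> parameters lhat kbar ms \<and>
            a0 ^ (lhat + 1) = leading_coeff lhat kbar ms w0 \<and>
            h_coeffs lhat kbar ms w0 a0 \<in> V \<longrightarrow>
            (\<exists>U a \<beta>.
               w0 \<in> U \<and> a w0 = a0 \<and>
               collision_coordinates lhat kbar ms V t U a \<beta> \<and>
               (\<exists>\<tau>. model_flat_coordinates lhat kbar ms U
                      (joint_coords (lift_t lhat kbar ms t a) \<beta> \<tau>) \<and>
                    (\<forall>w\<in>U. \<forall>\<alpha>\<in>{1..length ms}.
                       cluster_relation P (pole_order ms \<alpha>)
                         (\<lambda>i. c_coord lhat kbar ms a \<beta> \<alpha> i w) (\<lambda>k. \<tau> \<alpha> k w))))))) \<and>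
   (\<exists>lhat kbar p ms V t U a \<beta>.
      1 \<le> kbar \<and> partition_of p ms \<and> dz_flat_coordinates lhat kbar V t \<and>
      collision_coordinates lhat kbar ms V t U a \<beta> \<and>
      \<not> model_flat_coordinates lhat kbar ms U
           (joint_coords (lift_t lhat kbar ms t a) \<beta> (c_coord lhat kbar ms a \<beta>)))"
proof (intro conjI)
 show "EX P :: nat => nat => (nat => complex) => complex.
   (ALL m. ALL k:{2..<m}. polynomial_in (m - 1) (P m k)) &
   (ALL m s c. c m ~= 0 & s ^ m = c m -->
     (ALL r:{2..<m}. ALL j:{2..<m}. j < r --> cluster_jacobian P m s c r j = 0)) &
   (ALL lh kb p ms. 1 <= kb & partition_of p ms -->
     (ALL \<a>:{1..length ms}. well_behaved_collision lh kb ms \<a>) &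
     (ALL V t w0 a0.
      dz_flat_coordinates lh kb V t &
      w0 : parameters lh kb ms &
      a0 ^ (lh + 1) = lcoef lh kb ms w0 &
      h_coeffs lh kb ms w0 a0 : V -->
      (EX U a \<b>.
        w0 : U & a w0 = a0 &
        collision_coordinates lh kb ms V t U a \<b> &
        (EX \<tau>. model_flat_coordinates lh kb ms U
           (joint_coords (lift_t lh kb ms t a) \<b> \<tau>) &
          (ALL w:U. ALL \<a>:{1..length ms}.
            cluster_relation P (pole_order ms \<a>)
             (%i. c_coord lh kb ms a \<b> \<a> i w) (%k. \<tau> \<a> k w))))))"
 proof (rule exI[of _ cluster_poly], intro conjI allI ballI impI; (elim conjE)?)
  fix lh kb p :: nat and ms V t w0 a0
  assume "1 <= kb" "partition_of p ms" "dz_flat_coordinates lh kb V t" "w0 : parameters lh kb ms"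
   "a0 ^ (lh + 1) = lcoef lh kb ms w0" "h_coeffs lh kb ms w0 a0 : V"
  from flat_chart_exists[OF this] obtain V' Ah eh G' E
   where V': "V' <= V" and fc: "flat_chart lh kb p ms Ah eh V' t w0 a0 G' E" by blast
  interpret flat_chart lh kb p ms Ah eh V' t w0 a0 G' E by (rule fc)
  show "EX U a \<b>. w0 : U & a w0 = a0 & collision_coordinates lh kb ms V t U a \<b> &
   (EX \<tau>. model_flat_coordinates lh kb ms U (joint_coords (lift_t lh kb ms t a) \<b> \<tau>) &
    (ALL w:U. ALL \<a>:{1..length ms}. cluster_relation cluster_poly (pole_order ms \<a>)
      (%i. c_coord lh kb ms a \<b> \<a> i w) (%k. \<tau> \<a> k w)))"
  proof (rule exI[of _ U], rule exI[of _ aa], rule exI[of _ \<b>], intro conjI w0_U aa_w0 collision_coordinates_y V')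
   show "EX \<tau>. model_flat_coordinates lh kb ms U (joint_coords (lift_t lh kb ms t aa) \<b> \<tau>) &
    (ALL w:U. ALL \<a>:{1..length ms}. cluster_relation cluster_poly (pole_order ms \<a>)
      (%i. c_coord lh kb ms aa \<b> \<a> i w) (%k. \<tau> \<a> k w))"
    using flat_y'[unfolded y'_def] cluster_relation_\<tau> U_W2 W2_W1 by blast
  qed
 qed (blast intro: polynomial_in_cluster_poly cluster_jacobian_triangular well_behaved)+
next
 have "partition_of 2 [2]" by (simp add: partition_of_def)
 thus "EX lh kb p ms V t U a \<b>.
   1 <= kb & partition_of p ms & dz_flat_coordinates lh kb V t &
   collision_coordinates lh kb ms V t U a \<b> &
   \<not> model_flat_coordinates lh kb ms U
      (joint_coords (lift_t lh kb ms t a) \<b> (c_coord lh kb ms a \<b>))"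
  using curved_example dz_flat_01 order.refl[of "1::nat"] by metis
qed

end
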